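(* Let $\mathcal{E}$ be a category with finite limits. The tensor product of polynomials extends to a functor $\otimes\colon\mathbf{Poly}_{\mathcal{E}}\times\mathbf{Poly}_{\mathcal{E}}\to\mathbf{Poly}_{\mathcal{E}}$ such that $(\mathbf{Poly}_{\mathcal{E}},y,\otimes)$ forms a monoidal category. Furthermore, $(\mathbf{Poly}_{\mathcal{E}},y,\otimes,y,\triangleleft)$ forms a normal duoidal category.
   Context: For $f\colon B\to A$ in $\mathcal{E}$, $\Delta_f\colon\mathcal{E}/A\to\mathcal{E}/B$ denotes pullback along $f$; $f$ is exponentiable if $\Delta_f$ has a right adjoint $\Pi_f$. A polynomial in $\mathcal{E}$ is an exponentiable morphism $p\colon P_*\to P$. A morphism of polynomials $\phi\colon p\to q$ is a pair $\phi_1\colon P\to Q$, $\phi^\sharp\colon P\times_Q Q_*\to P_*$ with $p\circ\phi^\sharp$ the projection to $P$, up to isomorphism of the choice of pullback. Composition is $(\psi\circ\phi)_1=\psi_1\circ\phi_1$, $(\psi\circ\phi)^\sharp=\phi^\sharp\circ(P\times_Q\psi^\sharp)$ (using $P\times_R R_*\cong P\times_Q(Q\times_R R_* )$). This gives the category $\mathbf{Poly}_{\mathcal{E}}$. The polynomial $y$ is $\mathrm{id}_1\colon1\to1$. Composition monoidal structure $(y,\triangleleft)$: $p\triangleleft q$ is the composite of projections $(\Pi_p(Q\times P_* )\times_P P_* )\times_Q Q_*\to\Pi_p(Q\times P_* )\times_P P_*\to\Pi_p(Q\times P_* )$, where $\Pi_p(Q\times P_* )\times_P P_*\to Q$ is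 the counit of $\Delta_p\dashv\Pi_p$ followed by projection. In terms of generalized elements, positions are pairs $(x\colon X\to P,\ f\colon X\times_PP_*\to Q)$ and a direction at $(x,f)$ is a pair $(y,z)$ with $y$ in $P_*$ over $x$ and $z$ in $Q_*$ over $f(y)$. On morphisms, $\phi\triangleleft\psi$ sends $(x,f)$ to $(\phi_1x,\psi_1\circ f\circ\phi^\sharp(x,-))$ and a direction $(y',z')$ there to $(\phi^\sharp(x,y'),\psi^\sharp(f(\phi^\sharp(x,y')),z'))$; associators and unitors are canonical. Tensor product: $p\otimes q$ is the product morphism $p\times q\colon P_*\times Q_*\to P\times Q$ (which is exponentiable). On morphisms, $\otimes$ is given by taking products in $\mathcal{E}$ of the components: $(\phi\otimes\psi)_1=\phi_1\times\psi_1$ and $(\phi\otimes\psi)^\sharp=\phi^\sharp\times\psi^\sharp$ under the isomorphism commuting products with pullbacks. A duoidal category $(\mathcal{C},I,\otimes,J,\triangleleft)$ is a category with two monoidal structures $(I,\otimes)$ and $(J,\triangleleft)$ such that the functors $\otimes\colon\mathcal{C}\times\mathcal{C}\to\mathcal{C}$ and $I\colon1\to\mathcal{C}$ are equipped with colax monoidal structures with respect to $(J,\triangleleft)$, and the associator and unitors of $\otimes$ are monoidal natural transformations. In particular there are natural interchange maps $(p_1\triangleleft p_2)\otimes(q_1\triangleleft q_2)\to(p_1\otimes q_1)\triangleleft(p_2\otimes q_2)$. It is normal if the structure map $I\to J$ between the units is an isomorphism. *)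

theory Defs
  imports Main
begin

section \<open>Categories, functors, adjunctions, finite limits\<close>

record ('o, 'a) category =
  Obj :: "'o set"
  Arr :: "'a set"
  Dom :: "'a \<Rightarrow> 'o"
  Cod :: "'a \<Rightarrow> 'o"
  Ident :: "'o \<Rightarrow> 'a"
  Comp :: "'a \<Rightarrow> 'a \<Rightarrow> 'a"

abbreviation comp_in :: "'a \<Rightarrow> ('o, 'a) category \<Rightarrow> 'a \<Rightarrow> 'a"
    ("(_ \<cdot>\<^bsub>_\<^esub> _)" [71, 0, 70] 70) where
  "g \<cdot>\<^bsub>C\<^esub> f \<equiv> Comp C g f"

definition hom :: "('o, 'a) category \<Rightarrow> 'o \<Rightarrow> 'o \<Rightarrow> 'a set" where
  "hom C x y = {f \<in> Arr C. Dom C f = x \<and> Cod C f = y}"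

definition is_category :: "('o, 'a) category \<Rightarrow> bool" where
  "is_category C \<longleftrightarrow>
     (\<forall>f \<in> Arr C. Dom C f \<in> Obj C \<and> Cod C f \<in> Obj C) \<and>
     (\<forall>x \<in> Obj C. Ident C x \<in> hom C x x) \<and>
     (\<forall>f \<in> Arr C. \<forall>g \<in> Arr C. Cod C f = Dom C g \<longrightarrow>
        g \<cdot>\<^bsub>C\<^esub> f \<in> hom C (Dom C f) (Cod C g)) \<and>
     (\<forall>f \<in> Arr C. f \<cdot>\<^bsub>C\<^esub> Ident C (Dom C f) = f \<and> Ident C (Cod C f) \<cdot>\<^bsub>C\<^esub> f = f) \<and>
     (\<forall>f \<in> Arr C. \<forall>g \<in> Arr C. \<forall>h \<in> Arr C. Cod C f = Dom C g \<longrightarrow> Cod C g = Dom C h \<longrightarrow>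
        h \<cdot>\<^bsub>C\<^esub> (g \<cdot>\<^bsub>C\<^esub> f) = (h \<cdot>\<^bsub>C\<^esub> g) \<cdot>\<^bsub>C\<^esub> f)"

definition is_iso :: "('o, 'a) category \<Rightarrow> 'a \<Rightarrow> bool" where
  "is_iso C f \<longleftrightarrow> f \<in> Arr C \<and>
     (\<exists>g \<in> hom C (Cod C f) (Dom C f).
        g \<cdot>\<^bsub>C\<^esub> f = Ident C (Dom C f) \<and> f \<cdot>\<^bsub>C\<^esub> g = Ident C (Cod C f))"

record ('c, 'f, 'd, 'g) functr =
  fobj :: "'c \<Rightarrow> 'd"
  farr :: "'f \<Rightarrow> 'g"

definition is_functor ::
    "('c, 'f) category \<Rightarrow> ('d, 'g) category \<Rightarrow> ('c, 'f, 'd, 'g, 'z) functr_scheme \<Rightarrow> bool" where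
  "is_functor C D F \<longleftrightarrow>
     (\<forall>x \<in> Obj C. fobj F x \<in> Obj D \<and> farr F (Ident C x) = Ident D (fobj F x)) \<and>
     (\<forall>f \<in> Arr C. farr F f \<in> hom D (fobj F (Dom C f)) (fobj F (Cod C f))) \<and>
     (\<forall>f \<in> Arr C. \<forall>g \<in> Arr C. Cod C f = Dom C g \<longrightarrow>
        farr F (g \<cdot>\<^bsub>C\<^esub> f) = farr F g \<cdot>\<^bsub>D\<^esub> farr F f)"

definition is_nat_trans ::
    "('c, 'f) category \<Rightarrow> ('d, 'g) category \<Rightarrow> ('c, 'f, 'd, 'g, 'y) functr_scheme \<Rightarrow>
     ('c, 'f, 'd, 'g, 'z) functr_scheme \<Rightarrow> ('c \<Rightarrow> 'g) \<Rightarrow> bool" where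
  "is_nat_trans C D F G \<tau> \<longleftrightarrow>
     (\<forall>x \<in> Obj C. \<tau> x \<in> hom D (fobj F x) (fobj G x)) \<and>
     (\<forall>f \<in> Arr C. \<tau> (Cod C f) \<cdot>\<^bsub>D\<^esub> farr F f = farr G f \<cdot>\<^bsub>D\<^esub> \<tau> (Dom C f))"

definition id_functor :: "('c, 'f, 'c, 'f) functr" where
  "id_functor = \<lparr>fobj = \<lambda>x. x, farr = \<lambda>f. f\<rparr>"

definition comp_functor ::
    "('d, 'g, 'e, 'h) functr \<Rightarrow> ('c, 'f, 'd, 'g) functr \<Rightarrow> ('c, 'f, 'e, 'h) functr" where
  "comp_functor G F = \<lparr>fobj = \<lambda>x. fobj G (fobj F x), farr = \<lambda>f. farr G (farr F f)\<rparr>"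

text \<open>\<open>F\<close> is left adjoint to \<open>G\<close>, with unit \<open>\<eta>\<close> and counit \<open>\<epsilon>\<close>.\<close>

definition is_adjunction ::
    "('c, 'f) category \<Rightarrow> ('d, 'g) category \<Rightarrow> ('c, 'f, 'd, 'g) functr \<Rightarrow>
     ('d, 'g, 'c, 'f) functr \<Rightarrow> ('c \<Rightarrow> 'f) \<Rightarrow> ('d \<Rightarrow> 'g) \<Rightarrow> bool" where
  "is_adjunction C D F G \<eta> \<epsilon> \<longleftrightarrow>
     is_functor C D F \<and> is_functor D C G \<and>
     is_nat_trans C C id_functor (comp_functor G F) \<eta> \<and>
     is_nat_trans D D (comp_functor F G) id_functor \<epsilon> \<and>
     (\<forall>x \<in> Obj C. \<epsilon> (fobj F x) \<cdot>\<^bsub>D\<^esub> farr F (\<eta> x) = Ident D (fobj F x)) \<and>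
     (\<forall>y \<in> Obj D. farr G (\<epsilon> y) \<cdot>\<^bsub>C\<^esub> \<eta> (fobj G y) = Ident C (fobj G y))"

definition is_cone ::
    "('j, 'k) category \<Rightarrow> ('o, 'a) category \<Rightarrow> ('j, 'k, 'o, 'a) functr \<Rightarrow>
     'o \<Rightarrow> ('j \<Rightarrow> 'a) \<Rightarrow> bool" where
  "is_cone J C F X l \<longleftrightarrow> X \<in> Obj C \<and>
     (\<forall>j \<in> Obj J. l j \<in> hom C X (fobj F j)) \<and>
     (\<forall>u \<in> Arr J. farr F u \<cdot>\<^bsub>C\<^esub> l (Dom J u) = l (Cod J u))"

definition is_limit ::
    "('j, 'k) category \<Rightarrow> ('o, 'a) category \<Rightarrow> ('j, 'k, 'o, 'a) functr \<Rightarrow>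
     'o \<Rightarrow> ('j \<Rightarrow> 'a) \<Rightarrow> bool" where
  "is_limit J C F X l \<longleftrightarrow> is_cone J C F X l \<and>
     (\<forall>Y m. is_cone J C F Y m \<longrightarrow>
        (\<exists>!h. h \<in> hom C Y X \<and> (\<forall>j \<in> Obj J. l j \<cdot>\<^bsub>C\<^esub> h = m j)))"

text \<open>Every finite category is isomorphic to one whose objects and arrows are natural numbers,
  so it is enough to let the shape \<open>J\<close> range over the latter.\<close>

definition has_finite_limits :: "('o, 'a) category \<Rightarrow> bool" where
  "has_finite_limits C \<longleftrightarrow>
     (\<forall>(J :: (nat, nat) category) F.
        is_category J \<and> finite (Obj J) \<and> finite (Arr J) \<and> is_functor J C F \<longrightarrow>
        (\<exists>X l. is_limit J C F X l))"

text \<open>An arrow from \<open>f\<close> to \<open>g\<close> in the slice category is a triple \<open>(f, g, h)\<close> with \<open>g h = f\<close>.\<close>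

definition slice :: "('o, 'a) category \<Rightarrow> 'o \<Rightarrow> ('a, 'a \<times> 'a \<times> 'a) category" where
  "slice C A = \<lparr>
     Obj = {f \<in> Arr C. Cod C f = A},
     Arr = {(f, g, h). f \<in> Arr C \<and> Cod C f = A \<and> g \<in> Arr C \<and> Cod C g = A \<and>
              h \<in> hom C (Dom C f) (Dom C g) \<and> g \<cdot>\<^bsub>C\<^esub> h = f},
     Dom = (\<lambda>(f, g, h). f),
     Cod = (\<lambda>(f, g, h). g),
     Ident = (\<lambda>f. (f, f, Ident C (Dom C f))),
     Comp = (\<lambda>(g', k, h') (f, g, h). (f, k, h' \<cdot>\<^bsub>C\<^esub> h))\<rparr>"

definition prod_cat ::
    "('c, 'f) category \<Rightarrow> ('d, 'g) category \<Rightarrow> ('c \<times> 'd, 'f \<times> 'g) category" where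
  "prod_cat C D = \<lparr>
     Obj = Obj C \<times> Obj D,
     Arr = Arr C \<times> Arr D,
     Dom = (\<lambda>(f, g). (Dom C f, Dom D g)),
     Cod = (\<lambda>(f, g). (Cod C f, Cod D g)),
     Ident = (\<lambda>(x, y). (Ident C x, Ident D y)),
     Comp = (\<lambda>(f', g') (f, g). (f' \<cdot>\<^bsub>C\<^esub> f, g' \<cdot>\<^bsub>D\<^esub> g))\<rparr>"

definition one_cat :: "(unit, unit) category" where
  "one_cat = \<lparr>Obj = {()}, Arr = {()}, Dom = \<lambda>_. (), Cod = \<lambda>_. (), Ident = \<lambda>_. (),
     Comp = \<lambda>_ _. ()\<rparr>"


section \<open>Monoidal and duoidal categories\<close>

record ('o, 'a) monoidal =
  munit :: 'o
  mtensor :: "('o \<times> 'o, 'a \<times> 'a, 'o, 'a) functr"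
  massoc :: "'o \<Rightarrow> 'o \<Rightarrow> 'o \<Rightarrow> 'a"
  mlunit :: "'o \<Rightarrow> 'a"
  mrunit :: "'o \<Rightarrow> 'a"

abbreviation tens_obj :: "'o \<Rightarrow> ('o, 'a) monoidal \<Rightarrow> 'o \<Rightarrow> 'o"
    ("(_ \<otimes>\<^bsub>_\<^esub> _)" [76, 0, 75] 75) where
  "x \<otimes>\<^bsub>M\<^esub> y \<equiv> fobj (mtensor M) (x, y)"

abbreviation tens_arr :: "'a \<Rightarrow> ('o, 'a) monoidal \<Rightarrow> 'a \<Rightarrow> 'a"
    ("(_ \<odot>\<^bsub>_\<^esub> _)" [76, 0, 75] 75) where
  "f \<odot>\<^bsub>M\<^esub> g \<equiv> farr (mtensor M) (f, g)"

definition is_monoidal_category :: "('o, 'a) category \<Rightarrow> ('o, 'a) monoidal \<Rightarrow> bool" where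
  "is_monoidal_category C M \<longleftrightarrow>
     is_category C \<and>
     munit M \<in> Obj C \<and>
     is_functor (prod_cat C C) C (mtensor M) \<and>
     (\<forall>x \<in> Obj C. \<forall>y \<in> Obj C. \<forall>z \<in> Obj C.
        massoc M x y z \<in> hom C ((x \<otimes>\<^bsub>M\<^esub> y) \<otimes>\<^bsub>M\<^esub> z) (x \<otimes>\<^bsub>M\<^esub> (y \<otimes>\<^bsub>M\<^esub> z)) \<and>
        is_iso C (massoc M x y z)) \<and>
     (\<forall>x \<in> Obj C. mlunit M x \<in> hom C (munit M \<otimes>\<^bsub>M\<^esub> x) x \<and> is_iso C (mlunit M x)) \<and>
     (\<forall>x \<in> Obj C. mrunit M x \<in> hom C (x \<otimes>\<^bsub>M\<^esub> munit M) x \<and> is_iso C (mrunit M x)) \<and>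
     (\<forall>f \<in> Arr C. \<forall>g \<in> Arr C. \<forall>h \<in> Arr C.
        massoc M (Cod C f) (Cod C g) (Cod C h) \<cdot>\<^bsub>C\<^esub> ((f \<odot>\<^bsub>M\<^esub> g) \<odot>\<^bsub>M\<^esub> h) =
        (f \<odot>\<^bsub>M\<^esub> (g \<odot>\<^bsub>M\<^esub> h)) \<cdot>\<^bsub>C\<^esub> massoc M (Dom C f) (Dom C g) (Dom C h)) \<and>
     (\<forall>f \<in> Arr C.
        mlunit M (Cod C f) \<cdot>\<^bsub>C\<^esub> (Ident C (munit M) \<odot>\<^bsub>M\<^esub> f) = f \<cdot>\<^bsub>C\<^esub> mlunit M (Dom C f) \<and>
        mrunit M (Cod C f) \<cdot>\<^bsub>C\<^esub> (f \<odot>\<^bsub>M\<^esub> Ident C (munit M)) = f \<cdot>\<^bsub>C\<^esub> mrunit M (Dom C f)) \<and>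
     (\<forall>w \<in> Obj C. \<forall>x \<in> Obj C. \<forall>y \<in> Obj C. \<forall>z \<in> Obj C.
        massoc M w x (y \<otimes>\<^bsub>M\<^esub> z) \<cdot>\<^bsub>C\<^esub> massoc M (w \<otimes>\<^bsub>M\<^esub> x) y z =
        (Ident C w \<odot>\<^bsub>M\<^esub> massoc M x y z) \<cdot>\<^bsub>C\<^esub>
          (massoc M w (x \<otimes>\<^bsub>M\<^esub> y) z \<cdot>\<^bsub>C\<^esub> (massoc M w x y \<odot>\<^bsub>M\<^esub> Ident C z))) \<and>
     (\<forall>x \<in> Obj C. \<forall>y \<in> Obj C.
        (Ident C x \<odot>\<^bsub>M\<^esub> mlunit M y) \<cdot>\<^bsub>C\<^esub> massoc M x (munit M) y =
        mrunit M x \<odot>\<^bsub>M\<^esub> Ident C y)"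

definition prod_monoidal ::
    "('c, 'f) monoidal \<Rightarrow> ('d, 'g) monoidal \<Rightarrow> ('c \<times> 'd, 'f \<times> 'g) monoidal" where
  "prod_monoidal M N = \<lparr>
     munit = (munit M, munit N),
     mtensor = \<lparr>
       fobj = (\<lambda>((x, x'), (y, y')). (x \<otimes>\<^bsub>M\<^esub> y, x' \<otimes>\<^bsub>N\<^esub> y')),
       farr = (\<lambda>((f, f'), (g, g')). (f \<odot>\<^bsub>M\<^esub> g, f' \<odot>\<^bsub>N\<^esub> g'))\<rparr>,
     massoc = (\<lambda>(x, x') (y, y') (z, z'). (massoc M x y z, massoc N x' y' z')),
     mlunit = (\<lambda>(x, x'). (mlunit M x, mlunit N x')),
     mrunit = (\<lambda>(x, x'). (mrunit M x, mrunit N x'))\<rparr>"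

definition one_monoidal :: "(unit, unit) monoidal" where
  "one_monoidal = \<lparr>munit = (), mtensor = \<lparr>fobj = \<lambda>_. (), farr = \<lambda>_. ()\<rparr>,
     massoc = \<lambda>_ _ _. (), mlunit = \<lambda>_. (), mrunit = \<lambda>_. ()\<rparr>"

text \<open>A functor with candidate colax structure maps
  \<open>F (x \<otimes> y) \<rightarrow> F x \<otimes> F y\<close> and \<open>F I \<rightarrow> I\<close>.\<close>

record ('c, 'f, 'd, 'g) colax = "('c, 'f, 'd, 'g) functr" +
  comult :: "'c \<Rightarrow> 'c \<Rightarrow> 'g"
  counit :: 'g

definition is_colax_monoidal ::
    "('c, 'f) category \<Rightarrow> ('c, 'f) monoidal \<Rightarrow> ('d, 'g) category \<Rightarrow> ('d, 'g) monoidal \<Rightarrow>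
     ('c, 'f, 'd, 'g) colax \<Rightarrow> bool" where
  "is_colax_monoidal C M D N F \<longleftrightarrow>
     is_functor C D F \<and>
     (\<forall>x \<in> Obj C. \<forall>y \<in> Obj C.
        comult F x y \<in> hom D (fobj F (x \<otimes>\<^bsub>M\<^esub> y)) (fobj F x \<otimes>\<^bsub>N\<^esub> fobj F y)) \<and>
     (\<forall>f \<in> Arr C. \<forall>g \<in> Arr C.
        comult F (Cod C f) (Cod C g) \<cdot>\<^bsub>D\<^esub> farr F (f \<odot>\<^bsub>M\<^esub> g) =
        (farr F f \<odot>\<^bsub>N\<^esub> farr F g) \<cdot>\<^bsub>D\<^esub> comult F (Dom C f) (Dom C g)) \<and>
     counit F \<in> hom D (fobj F (munit M)) (munit N) \<and>
     (\<forall>x \<in> Obj C. \<forall>y \<in> Obj C. \<forall>z \<in> Obj C.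
        massoc N (fobj F x) (fobj F y) (fobj F z) \<cdot>\<^bsub>D\<^esub>
          ((comult F x y \<odot>\<^bsub>N\<^esub> Ident D (fobj F z)) \<cdot>\<^bsub>D\<^esub> comult F (x \<otimes>\<^bsub>M\<^esub> y) z) =
        (Ident D (fobj F x) \<odot>\<^bsub>N\<^esub> comult F y z) \<cdot>\<^bsub>D\<^esub>
          (comult F x (y \<otimes>\<^bsub>M\<^esub> z) \<cdot>\<^bsub>D\<^esub> farr F (massoc M x y z))) \<and>
     (\<forall>x \<in> Obj C.
        mlunit N (fobj F x) \<cdot>\<^bsub>D\<^esub>
          ((counit F \<odot>\<^bsub>N\<^esub> Ident D (fobj F x)) \<cdot>\<^bsub>D\<^esub> comult F (munit M) x) =
        farr F (mlunit M x)) \<and>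
     (\<forall>x \<in> Obj C.
        mrunit N (fobj F x) \<cdot>\<^bsub>D\<^esub>
          ((Ident D (fobj F x) \<odot>\<^bsub>N\<^esub> counit F) \<cdot>\<^bsub>D\<^esub> comult F x (munit M)) =
        farr F (mrunit M x))"

definition is_monoidal_nat_trans ::
    "('c, 'f) category \<Rightarrow> ('c, 'f) monoidal \<Rightarrow> ('d, 'g) category \<Rightarrow> ('d, 'g) monoidal \<Rightarrow>
     ('c, 'f, 'd, 'g) colax \<Rightarrow> ('c, 'f, 'd, 'g) colax \<Rightarrow> ('c \<Rightarrow> 'g) \<Rightarrow> bool" where
  "is_monoidal_nat_trans C M D N F G \<tau> \<longleftrightarrow>
     is_nat_trans C D F G \<tau> \<and>
     (\<forall>x \<in> Obj C. \<forall>y \<in> Obj C.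
        (\<tau> x \<odot>\<^bsub>N\<^esub> \<tau> y) \<cdot>\<^bsub>D\<^esub> comult F x y = comult G x y \<cdot>\<^bsub>D\<^esub> \<tau> (x \<otimes>\<^bsub>M\<^esub> y)) \<and>
     counit G \<cdot>\<^bsub>D\<^esub> \<tau> (munit M) = counit F"

text \<open>Composites and pairings of colax monoidal functors (the category argument of
  \<open>colax_comp\<close> is the codomain of \<open>G\<close>), and the strict ones: identity, projections and
  the functor to the terminal category.\<close>

definition colax_comp ::
    "('e, 'h) category \<Rightarrow> ('d, 'g, 'e, 'h) colax \<Rightarrow> ('c, 'f, 'd, 'g) colax \<Rightarrow>
     ('c, 'f, 'e, 'h) colax" where
  "colax_comp E G F = \<lparr>
     fobj = (\<lambda>x. fobj G (fobj F x)),
     farr = (\<lambda>f. farr G (farr F f)),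
     comult = (\<lambda>x y. comult G (fobj F x) (fobj F y) \<cdot>\<^bsub>E\<^esub> farr G (comult F x y)),
     counit = counit G \<cdot>\<^bsub>E\<^esub> farr G (counit F)\<rparr>"

definition colax_pair ::
    "('c, 'f, 'd, 'g) colax \<Rightarrow> ('c, 'f, 'e, 'h) colax \<Rightarrow>
     ('c, 'f, 'd \<times> 'e, 'g \<times> 'h) colax" where
  "colax_pair F G = \<lparr>
     fobj = (\<lambda>x. (fobj F x, fobj G x)),
     farr = (\<lambda>f. (farr F f, farr G f)),
     comult = (\<lambda>x y. (comult F x y, comult G x y)),
     counit = (counit F, counit G)\<rparr>"

definition colax_id :: "('c, 'f) category \<Rightarrow> ('c, 'f) monoidal \<Rightarrow> ('c, 'f, 'c, 'f) colax" where
  "colax_id C M = \<lparr>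
     fobj = (\<lambda>x. x),
     farr = (\<lambda>f. f),
     comult = (\<lambda>x y. Ident C (x \<otimes>\<^bsub>M\<^esub> y)),
     counit = Ident C (munit M)\<rparr>"

definition colax_fst ::
    "('c, 'f) category \<Rightarrow> ('c, 'f) monoidal \<Rightarrow> ('c \<times> 'd, 'f \<times> 'g, 'c, 'f) colax" where
  "colax_fst C M = \<lparr>
     fobj = fst,
     farr = fst,
     comult = (\<lambda>x y. Ident C (fst x \<otimes>\<^bsub>M\<^esub> fst y)),
     counit = Ident C (munit M)\<rparr>"

definition colax_snd ::
    "('d, 'g) category \<Rightarrow> ('d, 'g) monoidal \<Rightarrow> ('c \<times> 'd, 'f \<times> 'g, 'd, 'g) colax" where
  "colax_snd D N = \<lparr>
     fobj = snd,
     farr = snd,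
     comult = (\<lambda>x y. Ident D (snd x \<otimes>\<^bsub>N\<^esub> snd y)),
     counit = Ident D (munit N)\<rparr>"

definition colax_bang :: "('c, 'f, unit, unit) colax" where
  "colax_bang = \<lparr>fobj = \<lambda>_. (), farr = \<lambda>_. (), comult = \<lambda>_ _. (), counit = ()\<rparr>"

text \<open>The structure maps relating two monoidal structures \<open>(I, \<otimes>)\<close> and \<open>(J, \<triangleleft>)\<close> on a category.\<close>

record ('o, 'a) duoidal =
  interchange :: "'o \<Rightarrow> 'o \<Rightarrow> 'o \<Rightarrow> 'o \<Rightarrow> 'a"
    \<comment> \<open>\<open>interchange p1 p2 q1 q2 : (p1 \<triangleleft> p2) \<otimes> (q1 \<triangleleft> q2) \<rightarrow> (p1 \<otimes> q1) \<triangleleft> (p2 \<otimes> q2)\<close>\<close>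
  tensor_counit :: 'a  \<comment> \<open>\<open>J \<otimes> J \<rightarrow> J\<close>\<close>
  unit_comult :: 'a    \<comment> \<open>\<open>I \<rightarrow> I \<triangleleft> I\<close>\<close>
  unit_counit :: 'a    \<comment> \<open>\<open>I \<rightarrow> J\<close>\<close>

definition tensor_colax ::
    "('o, 'a) monoidal \<Rightarrow> ('o, 'a) duoidal \<Rightarrow> ('o \<times> 'o, 'a \<times> 'a, 'o, 'a) colax" where
  "tensor_colax M X = \<lparr>
     fobj = fobj (mtensor M),
     farr = farr (mtensor M),
     comult = (\<lambda>(p1, q1) (p2, q2). interchange X p1 p2 q1 q2),
     counit = tensor_counit X\<rparr>"

definition unit_colax ::
    "('o, 'a) category \<Rightarrow> ('o, 'a) monoidal \<Rightarrow> ('o, 'a) duoidal \<Rightarrow> (unit, unit, 'o, 'a) colax" where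
  "unit_colax C M X = \<lparr>
     fobj = (\<lambda>_. munit M),
     farr = (\<lambda>_. Ident C (munit M)),
     comult = (\<lambda>_ _. unit_comult X),
     counit = unit_counit X\<rparr>"

text \<open>For colax monoidal functors \<open>F\<close> and \<open>G\<close> into \<open>C\<close>, the functor
  \<open>x \<mapsto> F x \<otimes> G x\<close> with its composite colax structure.\<close>

definition colax_tensor ::
    "('o, 'a) category \<Rightarrow> ('o, 'a) monoidal \<Rightarrow> ('o, 'a) duoidal \<Rightarrow>
     ('c, 'f, 'o, 'a) colax \<Rightarrow> ('c, 'f, 'o, 'a) colax \<Rightarrow> ('c, 'f, 'o, 'a) colax" where
  "colax_tensor C M X F G = colax_comp C (tensor_colax M X) (colax_pair F G)"

definition is_duoidal_category ::
    "('o, 'a) category \<Rightarrow> ('o, 'a) monoidal \<Rightarrow> ('o, 'a) monoidal \<Rightarrow> ('o, 'a) duoidal \<Rightarrow> bool" where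
  "is_duoidal_category C M N X \<longleftrightarrow>
     is_monoidal_category C M \<and>
     is_monoidal_category C N \<and>
     (let T = tensor_colax M X;
          U = unit_colax C M X;
          C3 = prod_cat C (prod_cat C C);
          N2 = prod_monoidal N N;
          N3 = prod_monoidal N N2;
          first = colax_fst C N;
          second = colax_comp C (colax_fst C N) (colax_snd (prod_cat C C) N2);
          third = colax_comp C (colax_snd C N) (colax_snd (prod_cat C C) N2)
      in is_colax_monoidal (prod_cat C C) N2 C N T \<and>
         is_colax_monoidal one_cat one_monoidal C N U \<and>
         is_monoidal_nat_trans C3 N3 C N
           (colax_tensor C M X (colax_tensor C M X first second) third)
           (colax_tensor C M X first (colax_tensor C M X second third))
           (\<lambda>(x, y, z). massoc M x y z) \<and>
         is_monoidal_nat_trans C N C N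
           (colax_tensor C M X (colax_comp C U colax_bang) (colax_id C N)) (colax_id C N) (mlunit M) \<and>
         is_monoidal_nat_trans C N C N
           (colax_tensor C M X (colax_id C N) (colax_comp C U colax_bang)) (colax_id C N) (mrunit M))"

definition is_normal_duoidal_category ::
    "('o, 'a) category \<Rightarrow> ('o, 'a) monoidal \<Rightarrow> ('o, 'a) monoidal \<Rightarrow> ('o, 'a) duoidal \<Rightarrow> bool" where
  "is_normal_duoidal_category C M N X \<longleftrightarrow>
     is_duoidal_category C M N X \<and> is_iso C (unit_counit X)"


section \<open>Polynomials in a category\<close>

record 'a poly_arr =
  src :: 'a
  tgt :: 'a
  on_pos :: 'a  \<comment> \<open>\<open>\<phi>\<^sub>1 : P \<rightarrow> Q\<close>\<close>
  on_dir :: 'a  \<comment> \<open>\<open>\<phi>\<^sup>\<sharp> : P \<times>\<^bsub>Q\<^esub> Q\<^sub>* \<rightarrow> P\<^sub>*\<close>\<close>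

locale polynomials =
  fixes E :: "('o, 'a) category"
begin

abbreviation cmp :: "'a \<Rightarrow> 'a \<Rightarrow> 'a" (infixr "\<cdot>" 70) where
  "g \<cdot> f \<equiv> Comp E g f"

text \<open>Chosen terminal object, binary products and pullbacks. All choices are made by Hilbert choice
  and are meaningful only when the respective limits exist.\<close>

definition is_terminal :: "'o \<Rightarrow> bool" where
  "is_terminal T \<longleftrightarrow> T \<in> Obj E \<and> (\<forall>X \<in> Obj E. \<exists>!h. h \<in> hom E X T)"

definition one :: 'o where
  "one = (SOME T. is_terminal T)"

definition bang :: "'o \<Rightarrow> 'a" where
  "bang X = (THE h. h \<in> hom E X one)"

definition is_product :: "'o \<Rightarrow> 'o \<Rightarrow> 'o \<times> 'a \<times> 'a \<Rightarrow> bool" where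
  "is_product A B = (\<lambda>(P, a, b).
     a \<in> hom E P A \<and> b \<in> hom E P B \<and>
     (\<forall>X. \<forall>u \<in> hom E X A. \<forall>v \<in> hom E X B.
        \<exists>!h. h \<in> hom E X P \<and> a \<cdot> h = u \<and> b \<cdot> h = v))"

definition product :: "'o \<Rightarrow> 'o \<Rightarrow> 'o \<times> 'a \<times> 'a" where
  "product A B = (SOME c. is_product A B c)"

definition prd :: "'o \<Rightarrow> 'o \<Rightarrow> 'o" where "prd A B = fst (product A B)"
definition pr1 :: "'o \<Rightarrow> 'o \<Rightarrow> 'a" where "pr1 A B = fst (snd (product A B))"
definition pr2 :: "'o \<Rightarrow> 'o \<Rightarrow> 'a" where "pr2 A B = snd (snd (product A B))"

definition tuple :: "'a \<Rightarrow> 'a \<Rightarrow> 'a" where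
  "tuple u v = (THE h. h \<in> hom E (Dom E u) (prd (Cod E u) (Cod E v)) \<and>
     pr1 (Cod E u) (Cod E v) \<cdot> h = u \<and> pr2 (Cod E u) (Cod E v) \<cdot> h = v)"

definition prd_map :: "'a \<Rightarrow> 'a \<Rightarrow> 'a" where
  "prd_map f g = tuple (f \<cdot> pr1 (Dom E f) (Dom E g)) (g \<cdot> pr2 (Dom E f) (Dom E g))"

definition is_pullback :: "'a \<Rightarrow> 'a \<Rightarrow> 'o \<times> 'a \<times> 'a \<Rightarrow> bool" where
  "is_pullback f g = (\<lambda>(P, a, b).
     a \<in> hom E P (Dom E f) \<and> b \<in> hom E P (Dom E g) \<and> f \<cdot> a = g \<cdot> b \<and>
     (\<forall>X. \<forall>u \<in> hom E X (Dom E f). \<forall>v \<in> hom E X (Dom E g). f \<cdot> u = g \<cdot> v \<longrightarrow>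
        (\<exists>!h. h \<in> hom E X P \<and> a \<cdot> h = u \<and> b \<cdot> h = v)))"

definition pullback :: "'a \<Rightarrow> 'a \<Rightarrow> 'o \<times> 'a \<times> 'a" where
  "pullback f g = (SOME c. is_pullback f g c)"

definition pb :: "'a \<Rightarrow> 'a \<Rightarrow> 'o" where "pb f g = fst (pullback f g)"
definition pb1 :: "'a \<Rightarrow> 'a \<Rightarrow> 'a" where "pb1 f g = fst (snd (pullback f g))"
definition pb2 :: "'a \<Rightarrow> 'a \<Rightarrow> 'a" where "pb2 f g = snd (snd (pullback f g))"

definition pb_pair :: "'a \<Rightarrow> 'a \<Rightarrow> 'a \<Rightarrow> 'a \<Rightarrow> 'a" where
  "pb_pair f g u v = (THE h. h \<in> hom E (Dom E u) (pb f g) \<and>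
     pb1 f g \<cdot> h = u \<and> pb2 f g \<cdot> h = v)"

text \<open>For \<open>f : B \<rightarrow> A\<close>, the functor \<open>\<Delta>\<^sub>f\<close> takes \<open>a : X \<rightarrow> A\<close> to the
  projection \<open>X \<times>\<^bsub>A\<^esub> B \<rightarrow> B\<close>.\<close>

definition Delta :: "'a \<Rightarrow> ('a, 'a \<times> 'a \<times> 'a, 'a, 'a \<times> 'a \<times> 'a) functr" where
  "Delta f = \<lparr>
     fobj = (\<lambda>a. pb2 a f),
     farr = (\<lambda>(a, b, h). (pb2 a f, pb2 b f, pb_pair b f (h \<cdot> pb1 a f) (pb2 a f)))\<rparr>"

definition exponentiable :: "'a \<Rightarrow> bool" where
  "exponentiable f \<longleftrightarrow> f \<in> Arr E \<and>
     (\<exists>G \<eta> \<epsilon>. is_adjunction (slice E (Cod E f)) (slice E (Dom E f)) (Delta f) G \<eta> \<epsilon>)"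

definition Pi_adj ::
    "'a \<Rightarrow> ('a, 'a \<times> 'a \<times> 'a, 'a, 'a \<times> 'a \<times> 'a) functr \<times>
       ('a \<Rightarrow> 'a \<times> 'a \<times> 'a) \<times> ('a \<Rightarrow> 'a \<times> 'a \<times> 'a)" where
  "Pi_adj f = (SOME (G, \<eta>, \<epsilon>).
     is_adjunction (slice E (Cod E f)) (slice E (Dom E f)) (Delta f) G \<eta> \<epsilon>)"

definition Pi :: "'a \<Rightarrow> ('a, 'a \<times> 'a \<times> 'a, 'a, 'a \<times> 'a \<times> 'a) functr" where
  "Pi f = fst (Pi_adj f)"

definition Pi_counit :: "'a \<Rightarrow> 'a \<Rightarrow> 'a \<times> 'a \<times> 'a" where
  "Pi_counit f = snd (snd (Pi_adj f))"

text \<open>A polynomial is an exponentiable arrow \<open>p : P\<^sub>* \<rightarrow> P\<close>, so that \<open>P\<^sub>* = Dom E p\<close> and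
  \<open>P = Cod E p\<close>. Since \<open>P \<times>\<^bsub>Q\<^esub> Q\<^sub>*\<close> is the chosen pullback, each morphism of polynomials (which
  is only determined up to the choice of pullback) has exactly one representative here.\<close>

definition is_poly_arr :: "'a poly_arr \<Rightarrow> bool" where
  "is_poly_arr \<phi> \<longleftrightarrow>
     exponentiable (src \<phi>) \<and> exponentiable (tgt \<phi>) \<and>
     on_pos \<phi> \<in> hom E (Cod E (src \<phi>)) (Cod E (tgt \<phi>)) \<and>
     on_dir \<phi> \<in> hom E (pb (on_pos \<phi>) (tgt \<phi>)) (Dom E (src \<phi>)) \<and>
     src \<phi> \<cdot> on_dir \<phi> = pb1 (on_pos \<phi>) (tgt \<phi>)"

text \<open>\<open>act_dir \<phi> x y\<close> is \<open>\<phi>\<^sup>\<sharp>(x, y)\<close> for generalized elements \<open>x\<close> of \<open>P\<close> and \<open>y\<close> of \<open>Q\<^sub>*\<close>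
  with \<open>y\<close> over \<open>\<phi>\<^sub>1 x\<close>.\<close>

definition act_dir :: "'a poly_arr \<Rightarrow> 'a \<Rightarrow> 'a \<Rightarrow> 'a" where
  "act_dir \<phi> x y = on_dir \<phi> \<cdot> pb_pair (on_pos \<phi>) (tgt \<phi>) x y"

definition poly_id :: "'a \<Rightarrow> 'a poly_arr" where
  "poly_id p = \<lparr>src = p, tgt = p, on_pos = Ident E (Cod E p),
     on_dir = pb2 (Ident E (Cod E p)) p\<rparr>"

definition poly_comp :: "'a poly_arr \<Rightarrow> 'a poly_arr \<Rightarrow> 'a poly_arr" where
  "poly_comp \<psi> \<phi> =
     (let c = on_pos \<psi> \<cdot> on_pos \<phi>; x = pb1 c (tgt \<psi>); z = pb2 c (tgt \<psi>)
      in \<lparr>src = src \<phi>, tgt = tgt \<psi>, on_pos = c,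
           on_dir = act_dir \<phi> x (act_dir \<psi> (on_pos \<phi> \<cdot> x) z)\<rparr>)"

definition Poly :: "('a, 'a poly_arr) category" where
  "Poly = \<lparr>
     Obj = {p. exponentiable p},
     Arr = {\<phi>. is_poly_arr \<phi>},
     Dom = src, Cod = tgt, Ident = poly_id, Comp = poly_comp\<rparr>"

definition y_poly :: 'a where
  "y_poly = Ident E one"


subsection \<open>The tensor product\<close>

definition tensor_arr :: "'a poly_arr \<Rightarrow> 'a poly_arr \<Rightarrow> 'a poly_arr" where
  "tensor_arr \<phi> \<psi> =
     (let c = prd_map (on_pos \<phi>) (on_pos \<psi>);
          P = Cod E (src \<phi>); P' = Cod E (src \<psi>);
          Q = Dom E (tgt \<phi>); Q' = Dom E (tgt \<psi>);
          t = prd_map (tgt \<phi>) (tgt \<psi>);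
          x = pb1 c t; y = pb2 c t;
          i = tuple (pb_pair (on_pos \<phi>) (tgt \<phi>) (pr1 P P' \<cdot> x) (pr1 Q Q' \<cdot> y))
                    (pb_pair (on_pos \<psi>) (tgt \<psi>) (pr2 P P' \<cdot> x) (pr2 Q Q' \<cdot> y))
      in \<lparr>src = prd_map (src \<phi>) (src \<psi>), tgt = t, on_pos = c,
           on_dir = prd_map (on_dir \<phi>) (on_dir \<psi>) \<cdot> i\<rparr>)"

definition prd_assoc :: "'o \<Rightarrow> 'o \<Rightarrow> 'o \<Rightarrow> 'a" where
  "prd_assoc A B C =
     tuple (pr1 A B \<cdot> pr1 (prd A B) C) (tuple (pr2 A B \<cdot> pr1 (prd A B) C) (pr2 (prd A B) C))"

definition prd_assoc_inv :: "'o \<Rightarrow> 'o \<Rightarrow> 'o \<Rightarrow> 'a" where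
  "prd_assoc_inv A B C =
     tuple (tuple (pr1 A (prd B C)) (pr1 B C \<cdot> pr2 A (prd B C))) (pr2 B C \<cdot> pr2 A (prd B C))"

definition tensor_assoc :: "'a \<Rightarrow> 'a \<Rightarrow> 'a \<Rightarrow> 'a poly_arr" where
  "tensor_assoc p q r =
     (let c = prd_assoc (Cod E p) (Cod E q) (Cod E r);
          t = prd_map p (prd_map q r)
      in \<lparr>src = prd_map (prd_map p q) r, tgt = t, on_pos = c,
           on_dir = prd_assoc_inv (Dom E p) (Dom E q) (Dom E r) \<cdot> pb2 c t\<rparr>)"

definition tensor_lunit :: "'a \<Rightarrow> 'a poly_arr" where
  "tensor_lunit p =
     (let c = pr2 one (Cod E p)
      in \<lparr>src = prd_map y_poly p, tgt = p, on_pos = c,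
           on_dir = tuple (bang (pb c p)) (pb2 c p)\<rparr>)"

definition tensor_runit :: "'a \<Rightarrow> 'a poly_arr" where
  "tensor_runit p =
     (let c = pr1 (Cod E p) one
      in \<lparr>src = prd_map p y_poly, tgt = p, on_pos = c,
           on_dir = tuple (pb2 c p) (bang (pb c p))\<rparr>)"

definition tensor_monoidal :: "('a, 'a poly_arr) monoidal" where
  "tensor_monoidal = \<lparr>
     munit = y_poly,
     mtensor = \<lparr>fobj = (\<lambda>(p, q). prd_map p q), farr = (\<lambda>(\<phi>, \<psi>). tensor_arr \<phi> \<psi>)\<rparr>,
     massoc = tensor_assoc, mlunit = tensor_lunit, mrunit = tensor_runit\<rparr>"


subsection \<open>The composition product\<close>

text \<open>\<open>base p q\<close> is the arrow \<open>\<Pi>\<^sub>p(Q \<times> P\<^sub>*) \<rightarrow> P\<close>, which on generalized elements is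
  \<open>(x, f) \<mapsto> x\<close>, and \<open>ev p q\<close> is the arrow \<open>\<Pi>\<^sub>p(Q \<times> P\<^sub>*) \<times>\<^bsub>P\<^esub> P\<^sub>* \<rightarrow> Q\<close>, which is
  \<open>((x, f), y) \<mapsto> f y\<close>.\<close>

definition base :: "'a \<Rightarrow> 'a \<Rightarrow> 'a" where
  "base p q = fobj (Pi p) (pr2 (Cod E q) (Dom E p))"

definition ev :: "'a \<Rightarrow> 'a \<Rightarrow> 'a" where
  "ev p q = (case Pi_counit p (pr2 (Cod E q) (Dom E p)) of
     (_, _, e) \<Rightarrow> pr1 (Cod E q) (Dom E p) \<cdot> e)"

definition comp_obj :: "'a \<Rightarrow> 'a \<Rightarrow> 'a" (infixr "\<triangleleft>" 75) where
  "p \<triangleleft> q = pb1 (base p q) p \<cdot> pb1 (ev p q) q"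

text \<open>The calculus of generalized elements of \<open>p \<triangleleft> q\<close>. A position is a pair \<open>(x, f)\<close> of
  \<open>x : X \<rightarrow> P\<close> and \<open>f : X \<times>\<^bsub>P\<^esub> P\<^sub>* \<rightarrow> Q\<close>; as an arrow \<open>X \<rightarrow> \<Pi>\<^sub>p(Q \<times> P\<^sub>*)\<close> it is
  \<open>position p q x f\<close>. For a position \<open>s = (x, f)\<close> and \<open>y\<close> in \<open>P\<^sub>*\<close> over \<open>x\<close>, the value \<open>f y\<close> is
  \<open>apply_at p q s y\<close>, and the direction \<open>(y, z)\<close> at \<open>s\<close> is \<open>direction p q s y z\<close>. The arrows
  \<open>dir1 p q\<close> and \<open>dir2 p q\<close> take the direction \<open>(y, z)\<close> at a position to \<open>y\<close> and \<open>z\<close>.\<close>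

definition apply_at :: "'a \<Rightarrow> 'a \<Rightarrow> 'a \<Rightarrow> 'a \<Rightarrow> 'a" where
  "apply_at p q s y = ev p q \<cdot> pb_pair (base p q) p s y"

definition position :: "'a \<Rightarrow> 'a \<Rightarrow> 'a \<Rightarrow> 'a \<Rightarrow> 'a" where
  "position p q x f = (THE s. s \<in> hom E (Dom E x) (Dom E (base p q)) \<and>
     base p q \<cdot> s = x \<and> apply_at p q (s \<cdot> pb1 x p) (pb2 x p) = f)"

definition direction :: "'a \<Rightarrow> 'a \<Rightarrow> 'a \<Rightarrow> 'a \<Rightarrow> 'a \<Rightarrow> 'a" where
  "direction p q s y z = pb_pair (ev p q) q (pb_pair (base p q) p s y) z"

definition dir1 :: "'a \<Rightarrow> 'a \<Rightarrow> 'a" where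
  "dir1 p q = pb2 (base p q) p \<cdot> pb1 (ev p q) q"

definition dir2 :: "'a \<Rightarrow> 'a \<Rightarrow> 'a" where
  "dir2 p q = pb2 (ev p q) q"

definition comp_arr :: "'a poly_arr \<Rightarrow> 'a poly_arr \<Rightarrow> 'a poly_arr" where
  "comp_arr \<phi> \<psi> =
     (let p = src \<phi>; p' = tgt \<phi>; q = src \<psi>; q' = tgt \<psi>;
          x = on_pos \<phi> \<cdot> base p q;
          s0 = pb1 x p'; y0 = pb2 x p';
          c = position p' q' x
                (on_pos \<psi> \<cdot> apply_at p q s0 (act_dir \<phi> (base p q \<cdot> s0) y0));
          s = pb1 c (p' \<triangleleft> q'); d = pb2 c (p' \<triangleleft> q');
          y = act_dir \<phi> (base p q \<cdot> s) (dir1 p' q' \<cdot> d);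
          z = act_dir \<psi> (apply_at p q s y) (dir2 p' q' \<cdot> d)
      in \<lparr>src = p \<triangleleft> q, tgt = p' \<triangleleft> q', on_pos = c, on_dir = direction p q s y z\<rparr>)"

text \<open>On positions, the associator sends \<open>((x, f), g)\<close> to \<open>(x, y \<mapsto> (f y, z \<mapsto> g (y, z)))\<close>; on
  directions, it sends \<open>(y, (z, w))\<close> to \<open>((y, z), w)\<close>.\<close>

definition comp_assoc :: "'a \<Rightarrow> 'a \<Rightarrow> 'a \<Rightarrow> 'a poly_arr" where
  "comp_assoc p q r =
     (let b = base (p \<triangleleft> q) r;
          x = base p q \<cdot> b;
          s0 = pb1 x p; y0 = pb2 x p;
          f = apply_at p q (b \<cdot> s0) y0;
          s1 = s0 \<cdot> pb1 f q; y1 = y0 \<cdot> pb1 f q; z1 = pb2 f q;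
          g = apply_at (p \<triangleleft> q) r s1 (direction p q (b \<cdot> s1) y1 z1);
          c = position p (q \<triangleleft> r) x (position q r f g);
          t = p \<triangleleft> (q \<triangleleft> r);
          s = pb1 c t; d = pb2 c t;
          y = dir1 p (q \<triangleleft> r) \<cdot> d;
          zw = dir2 p (q \<triangleleft> r) \<cdot> d;
          z = dir1 q r \<cdot> zw; w = dir2 q r \<cdot> zw
      in \<lparr>src = (p \<triangleleft> q) \<triangleleft> r, tgt = t, on_pos = c,
           on_dir = direction (p \<triangleleft> q) r s (direction p q (b \<cdot> s) y z) w\<rparr>)"

definition comp_lunit :: "'a \<Rightarrow> 'a poly_arr" where
  "comp_lunit p =
     (let S = Dom E (base y_poly p);
          c = apply_at y_poly p (Ident E S) (bang S)
      in \<lparr>src = y_poly \<triangleleft> p, tgt = p, on_pos = c,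
           on_dir = direction y_poly p (pb1 c p) (bang (pb c p)) (pb2 c p)\<rparr>)"

definition comp_runit :: "'a \<Rightarrow> 'a poly_arr" where
  "comp_runit p =
     (let c = base p y_poly
      in \<lparr>src = p \<triangleleft> y_poly, tgt = p, on_pos = c,
           on_dir = direction p y_poly (pb1 c p) (pb2 c p) (bang (pb c p))\<rparr>)"

definition comp_monoidal :: "('a, 'a poly_arr) monoidal" where
  "comp_monoidal = \<lparr>
     munit = y_poly,
     mtensor = \<lparr>fobj = (\<lambda>(p, q). p \<triangleleft> q), farr = (\<lambda>(\<phi>, \<psi>). comp_arr \<phi> \<psi>)\<rparr>,
     massoc = comp_assoc, mlunit = comp_lunit, mrunit = comp_runit\<rparr>"


subsection \<open>The duoidal structure maps\<close>

text \<open>On positions, the interchange map sends \<open>((x, f), (x', f'))\<close> to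
  \<open>((x, x'), (y, y') \<mapsto> (f y, f' y'))\<close>; on directions, it sends \<open>((y, y'), (z, z'))\<close> to
  \<open>((y, z), (y', z'))\<close>.\<close>

definition poly_interchange :: "'a \<Rightarrow> 'a \<Rightarrow> 'a \<Rightarrow> 'a \<Rightarrow> 'a poly_arr" where
  "poly_interchange p1 p2 q1 q2 =
     (let S = Dom E (base p1 p2); S' = Dom E (base q1 q2);
          p = prd_map p1 q1; q = prd_map p2 q2;
          x = prd_map (base p1 p2) (base q1 q2);
          s0 = pb1 x p; y0 = pb2 x p;
          f = tuple
                (apply_at p1 p2 (pr1 S S' \<cdot> s0) (pr1 (Dom E p1) (Dom E q1) \<cdot> y0))
                (apply_at q1 q2 (pr2 S S' \<cdot> s0) (pr2 (Dom E p1) (Dom E q1) \<cdot> y0));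
          c = position p q x f;
          s = pb1 c (p \<triangleleft> q); d = pb2 c (p \<triangleleft> q);
          y = dir1 p q \<cdot> d; z = dir2 p q \<cdot> d
      in \<lparr>src = prd_map (p1 \<triangleleft> p2) (q1 \<triangleleft> q2), tgt = p \<triangleleft> q, on_pos = c,
           on_dir = tuple
             (direction p1 p2 (pr1 S S' \<cdot> s)
                (pr1 (Dom E p1) (Dom E q1) \<cdot> y) (pr1 (Dom E p2) (Dom E q2) \<cdot> z))
             (direction q1 q2 (pr2 S S' \<cdot> s)
                (pr2 (Dom E p1) (Dom E q1) \<cdot> y) (pr2 (Dom E p2) (Dom E q2) \<cdot> z))\<rparr>)"

definition poly_unit_comult :: "'a poly_arr" where
  "poly_unit_comult =
     (let c = position y_poly y_poly y_poly (bang (pb y_poly y_poly))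
      in \<lparr>src = y_poly, tgt = y_poly \<triangleleft> y_poly, on_pos = c,
           on_dir = bang (pb c (y_poly \<triangleleft> y_poly))\<rparr>)"

definition poly_duoidal :: "('a, 'a poly_arr) duoidal" where
  "poly_duoidal = \<lparr>
     interchange = poly_interchange,
     tensor_counit = tensor_lunit y_poly,
     unit_comult = poly_unit_comult,
     unit_counit = poly_id y_poly\<rparr>"

end

end

theory Submission
  imports Defs
begin

text \<open>
  Everything is reduced to generalized elements. By the Yoneda lemma, \<open>p\<close> is exponentiable iff every
  functor of natural families of sections of an arrow \<open>z\<close> over the fibres of \<open>p\<close> is representable; in
  this form exponentiability is visibly stable under composition and pullback, so that \<open>p \<triangleleft> q\<close> and
  \<open>p \<otimes> q\<close> are polynomials. A morphism of polynomials is determined by its natural actions on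
  generalized positions and directions, and each structure map acts by an explicit formula. A
  position of \<open>p \<triangleleft> q\<close> is determined by its base and its values at all later stages, so every axiom
  becomes an equation between such formulas, which rewriting proves.
\<close>

text \<open>Pullbacks, products and the right adjoints \<open>Pi\<close> are Hilbert choices, so two
  arrows built from them can only be compared through universal properties. Generalized elements
  confine this to a few places: \<open>poly_arr_ext\<close> evaluates two morphisms at the generic
  position and the generic direction, and \<open>pos_ext\<close> is uniqueness of transposes for
  \<Delta> and \<Pi>. A family is an operation natural over all later stages instead of an arrow out
  of a pullback, so that dependent products can be substituted into each other without pasting
  chosen pullbacks. The shape of the rewrite rules follows: actions are computed on
  \<open>tuple\<close> and on \<open>direction\<close>, and quantifiers over positions of products
  and over directions are rewritten into quantifiers over components. A position of
  \<open>p \<triangleleft> q\<close> contains a function and has no such component form. It is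
  compared by extensionality instead, once for every level at which the codomain is nested to the
  right, and this nesting is the obstacle in the associator and the pentagon.\<close>

locale finitely_complete = polynomials E
  for E :: "('o, 'a) category" +
  assumes is_cat: "is_category E"
    and finite_limits: "has_finite_limits E"
begin

section \<open>Typing, identity and associativity laws of the base category\<close>

lemma Dom_in_Obj [simp]: "f \<in> Arr E \<Longrightarrow> Dom E f \<in> Obj E"
  and Cod_in_Obj [simp]: "f \<in> Arr E \<Longrightarrow> Cod E f \<in> Obj E"
  using is_cat by (auto simp: is_category_def)

lemma Ident_arr [simp]:
  assumes "x \<in> Obj E"
  shows "Ident E x \<in> Arr E" "Dom E (Ident E x) = x" "Cod E (Ident E x) = x"
  using is_cat assms by (auto simp: is_category_def hom_def)

lemma cmp_arr [simp]:
  assumes "f \<in> Arr E" "g \<in> Arr E" "Cod E f = Dom E g"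
  shows "g \<cdot> f \<in> Arr E" "Dom E (g \<cdot> f) = Dom E f" "Cod E (g \<cdot> f) = Cod E g"
  using is_cat assms unfolding is_category_def hom_def by auto

lemma cmp_Ident_right [simp]: "f \<in> Arr E \<Longrightarrow> Dom E f = x \<Longrightarrow> f \<cdot> Ident E x = f"
  and cmp_Ident_left [simp]: "f \<in> Arr E \<Longrightarrow> Cod E f = x \<Longrightarrow> Ident E x \<cdot> f = f"
  using is_cat by (auto simp: is_category_def)

lemma cmp_assoc [simp]:
  "f \<in> Arr E \<Longrightarrow> g \<in> Arr E \<Longrightarrow> h \<in> Arr E \<Longrightarrow> Cod E f = Dom E g \<Longrightarrow> Cod E g = Dom E h \<Longrightarrow>
    (h \<cdot> g) \<cdot> f = h \<cdot> (g \<cdot> f)"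
  using is_cat by (auto simp: is_category_def)

lemma homI [intro]: "f \<in> Arr E \<Longrightarrow> Dom E f = x \<Longrightarrow> Cod E f = y \<Longrightarrow> f \<in> hom E x y"
  by (auto simp: hom_def)

section \<open>Chosen limits\<close>

text \<open>Over the empty shape every object is the vertex of exactly one kind of cone, so a limit
  is a terminal object.\<close>

lemma ex_terminal: "\<exists>T. is_terminal T"
proof -
  let ?J = "\<lparr>Obj = {}, Arr = {}, Dom = \<lambda>x. x, Cod = \<lambda>x. x, Ident = \<lambda>x. x, Comp = \<lambda>g f. g\<rparr>
    :: (nat, nat) category"
  let ?F = "\<lparr>fobj = \<lambda>_. undefined, farr = \<lambda>_. undefined\<rparr> :: (nat, nat, 'o, 'a) functr"
  have "is_category ?J \<and> finite (Obj ?J) \<and> finite (Arr ?J) \<and> is_functor ?J E ?F"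
    by (simp add: is_category_def is_functor_def)
  then obtain X l where "is_limit ?J E ?F X l"
    using finite_limits unfolding has_finite_limits_def by metis
  then have "is_terminal X"
    by (simp add: is_limit_def is_cone_def is_terminal_def)
  then show ?thesis by blast
qed

text \<open>The limit over the cospan shape, with the leg at the corner discarded because the other
  two legs determine it.\<close>

lemma ex_pullback:
  assumes fg: "f \<in> Arr E" "g \<in> Arr E" "Cod E f = Cod E g"
  shows "\<exists>c. is_pullback f g c"
proof -
  \<comment> \<open>The cospan on numerals: the feet are 0 and 1, the corner is 2. The arrows 0, 1,
    2 are identities, 3 goes from 0 to 2 and 4 from 1 to 2. In a composite at most one factor is not
    an identity, and \<open>Comp\<close> returns that one.\<close>
  define J :: "(nat, nat) category" where
    "J = \<lparr>Obj = {0, 1, 2}, Arr = {0, 1, 2, 3, 4},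
      Dom = \<lambda>u. if u = 3 then 0 else if u = 4 then 1 else u, Cod = \<lambda>u. if u \<ge> 3 then 2 else u,
      Ident = \<lambda>x. x, Comp = \<lambda>v u. if u \<ge> 3 then u else v\<rparr>"
  define F :: "(nat, nat, 'o, 'a) functr" where
    "F = \<lparr>fobj = \<lambda>x. if x = 0 then Dom E f else if x = 1 then Dom E g else Cod E g,
      farr = \<lambda>u. if u = 0 then Ident E (Dom E f) else if u = 1 then Ident E (Dom E g)
        else if u = 2 then Ident E (Cod E g) else if u = 3 then f else g\<rparr>"
  have "is_category J"
    by (simp add: is_category_def J_def hom_def)
  moreover have "is_functor J E F"
    using fg by (simp add: is_functor_def J_def F_def hom_def)
  moreover have "finite (Obj J)" "finite (Arr J)"
    by (simp_all add: J_def)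
  ultimately obtain X l where lim: "is_limit J E F X l"
    using finite_limits unfolding has_finite_limits_def by metis
  then have cone: "is_cone J E F X l" by (simp add: is_limit_def)
  have l: "l 0 \<in> hom E X (Dom E f)" "l 1 \<in> hom E X (Dom E g)" "f \<cdot> l 0 = l 2" "g \<cdot> l 1 = l 2"
    using cone by (auto simp: is_cone_def J_def F_def)
  have "\<exists>!h. h \<in> hom E Y X \<and> l 0 \<cdot> h = u \<and> l 1 \<cdot> h = v"
    if uv: "u \<in> hom E Y (Dom E f)" "v \<in> hom E Y (Dom E g)" "f \<cdot> u = g \<cdot> v" for Y u v
  proof -
    \<comment> \<open>A commuting square is a cone whose leg at the corner is the common
      composite.\<close>
    define m where "m j = (if j = 0 then u else if j = 1 then v else g \<cdot> v)" for j :: nat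
    have "is_cone J E F Y m"
      using uv fg by (auto simp: is_cone_def J_def F_def m_def hom_def)
    then have ex: "\<exists>!h. h \<in> hom E Y X \<and> (\<forall>j \<in> Obj J. l j \<cdot> h = m j)"
      using lim by (simp add: is_limit_def)
    \<comment> \<open>The condition at the corner 2 is a consequence of the conditions at the two
      feet.\<close>
    have "(h \<in> hom E Y X \<and> (\<forall>j \<in> Obj J. l j \<cdot> h = m j)) \<longleftrightarrow>
        (h \<in> hom E Y X \<and> l 0 \<cdot> h = u \<and> l 1 \<cdot> h = v)" for h
    proof
      assume h: "h \<in> hom E Y X \<and> l 0 \<cdot> h = u \<and> l 1 \<cdot> h = v"
      have "l 2 \<cdot> h = g \<cdot> v"
        using h l(1,2) fg cmp_assoc[of h "l 1" g] unfolding l(4)[symmetric] by (auto simp: hom_def)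
      with h show "h \<in> hom E Y X \<and> (\<forall>j \<in> Obj J. l j \<cdot> h = m j)"
        by (auto simp: J_def m_def)
    qed (auto simp: J_def m_def)
    with ex show ?thesis by simp
  qed
  with l have "is_pullback f g (X, l 0, l 1)"
    by (simp add: is_pullback_def)
  then show ?thesis by blast
qed

section \<open>The chosen terminal object\<close>

lemma is_terminal_one: "is_terminal one"
  unfolding one_def using ex_terminal by (rule someI_ex)

lemma one_in_Obj [simp]: "one \<in> Obj E"
  using is_terminal_one by (simp add: is_terminal_def)

lemma bang_arr [simp]:
  assumes "X \<in> Obj E"
  shows "bang X \<in> Arr E" "Dom E (bang X) = X" "Cod E (bang X) = one"
proof -
  have "\<exists>!h. h \<in> hom E X one"
    using is_terminal_one assms by (simp add: is_terminal_def)
  then have "bang X \<in> hom E X one" unfolding bang_def by (rule theI')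
  then show "bang X \<in> Arr E" "Dom E (bang X) = X" "Cod E (bang X) = one" by (auto simp: hom_def)
qed

lemma bang_unique:
  assumes "f \<in> Arr E" "g \<in> Arr E" "Cod E f = one" "Cod E g = one" "Dom E f = Dom E g"
  shows "f = g"
proof -
  have "\<exists>!h. h \<in> hom E (Dom E f) one"
    using is_terminal_one assms by (simp add: is_terminal_def)
  moreover have "f \<in> hom E (Dom E f) one" "g \<in> hom E (Dom E f) one"
    using assms by auto
  ultimately show ?thesis by blast
qed

lemma eq_bang: "f \<in> Arr E \<Longrightarrow> Cod E f = one \<Longrightarrow> f = bang (Dom E f)"
  by (rule bang_unique) auto

lemma bang_cmp [simp]: "h \<in> Arr E \<Longrightarrow> Cod E h = X \<Longrightarrow> bang X \<cdot> h = bang (Dom E h)"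
  by (rule bang_unique) auto

section \<open>Chosen pullbacks and pairing into them\<close>

lemma is_pullback_pb:
  "f \<in> Arr E \<Longrightarrow> g \<in> Arr E \<Longrightarrow> Cod E f = Cod E g \<Longrightarrow> is_pullback f g (pb f g, pb1 f g, pb2 f g)"
  using someI_ex[OF ex_pullback] by (simp add: pb_def pb1_def pb2_def pullback_def)

lemma pb_arr [simp]:
  assumes "f \<in> Arr E" "g \<in> Arr E" "Cod E f = Cod E g"
  shows "pb1 f g \<in> Arr E" "Dom E (pb1 f g) = pb f g" "Cod E (pb1 f g) = Dom E f"
    "pb2 f g \<in> Arr E" "Dom E (pb2 f g) = pb f g" "Cod E (pb2 f g) = Dom E g" "pb f g \<in> Obj E"
proof -
  have *: "pb1 f g \<in> hom E (pb f g) (Dom E f)" "pb2 f g \<in> hom E (pb f g) (Dom E g)"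
    using is_pullback_pb[OF assms] by (auto simp: is_pullback_def)
  from * show "pb1 f g \<in> Arr E" "Dom E (pb1 f g) = pb f g" "Cod E (pb1 f g) = Dom E f"
    "pb2 f g \<in> Arr E" "Dom E (pb2 f g) = pb f g" "Cod E (pb2 f g) = Dom E g"
    by (auto simp: hom_def)
  then show "pb f g \<in> Obj E" using Dom_in_Obj[of "pb1 f g"] by simp
qed

lemma pb_commute:
  assumes "f \<in> Arr E" "g \<in> Arr E" "Cod E f = Cod E g"
  shows "g \<cdot> pb2 f g = f \<cdot> pb1 f g"
  using is_pullback_pb[OF assms] by (simp add: is_pullback_def)

lemma pb_pair_ex1:
  assumes "f \<in> Arr E" "g \<in> Arr E" "Cod E f = Cod E g"
    "u \<in> Arr E" "v \<in> Arr E" "Cod E u = Dom E f" "Cod E v = Dom E g" "f \<cdot> u = g \<cdot> v"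
  shows "\<exists>!h. h \<in> hom E (Dom E u) (pb f g) \<and> pb1 f g \<cdot> h = u \<and> pb2 f g \<cdot> h = v"
proof -
  have "Dom E v = Dom E u"
    using assms cmp_arr by metis
  with assms is_pullback_pb[OF assms(1-3)] show ?thesis
    by (auto simp: is_pullback_def hom_def)
qed

lemma pb_pair [simp]:
  assumes "f \<in> Arr E" "g \<in> Arr E" "Cod E f = Cod E g"
    "u \<in> Arr E" "v \<in> Arr E" "Cod E u = Dom E f" "Cod E v = Dom E g" "f \<cdot> u = g \<cdot> v"
  shows "pb_pair f g u v \<in> Arr E" "Dom E (pb_pair f g u v) = Dom E u"
    "Cod E (pb_pair f g u v) = pb f g"
    "pb1 f g \<cdot> pb_pair f g u v = u" "pb2 f g \<cdot> pb_pair f g u v = v"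
  using theI'[OF pb_pair_ex1[OF assms]] by (auto simp: pb_pair_def hom_def)

lemma pb_ext:
  assumes "f \<in> Arr E" "g \<in> Arr E" "Cod E f = Cod E g"
    "h \<in> Arr E" "k \<in> Arr E" "Cod E h = pb f g" "Cod E k = pb f g"
    "pb1 f g \<cdot> h = pb1 f g \<cdot> k" "pb2 f g \<cdot> h = pb2 f g \<cdot> k"
  shows "h = k"
proof -
  let ?u = "pb1 f g \<cdot> h" and ?v = "pb2 f g \<cdot> h"
  have "Dom E k = Dom E h"
    using assms cmp_arr(2)[of h "pb1 f g"] cmp_arr(2)[of k "pb1 f g"] by simp
  moreover have "f \<cdot> ?u = g \<cdot> ?v"
    using assms cmp_assoc[of h "pb1 f g" f] cmp_assoc[of h "pb2 f g" g] pb_commute[of f g] by simp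
  ultimately show ?thesis
    using pb_pair_ex1[of f g ?u ?v] assms by (auto simp: hom_def)
qed

lemma pb_pair_cmp [simp]:
  assumes "f \<in> Arr E" "g \<in> Arr E" "Cod E f = Cod E g"
    "u \<in> Arr E" "v \<in> Arr E" "Cod E u = Dom E f" "Cod E v = Dom E g" "f \<cdot> u = g \<cdot> v"
    "h \<in> Arr E" "Cod E h = Dom E u"
  shows "pb_pair f g u v \<cdot> h = pb_pair f g (u \<cdot> h) (v \<cdot> h)"
proof -
  have v: "Dom E v = Dom E u"
    using assms cmp_arr by metis
  have "f \<cdot> (u \<cdot> h) = g \<cdot> (v \<cdot> h)"
    using assms v cmp_assoc[of h u f] cmp_assoc[of h v g] by simp
  moreover have "pb1 f g \<cdot> (pb_pair f g u v \<cdot> h) = u \<cdot> h"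
    using assms by (subst cmp_assoc[symmetric]) simp_all
  moreover have "pb2 f g \<cdot> (pb_pair f g u v \<cdot> h) = v \<cdot> h"
    using assms by (subst cmp_assoc[symmetric]) simp_all
  ultimately show ?thesis
    using assms v by - (rule pb_ext[of f g], simp_all)
qed

lemma pb_pair_eta [simp]:
  assumes "f \<in> Arr E" "g \<in> Arr E" "Cod E f = Cod E g"
  shows "pb_pair f g (pb1 f g) (pb2 f g) = Ident E (pb f g)"
  using assms by - (rule pb_ext[of f g], simp_all add: pb_commute)

text \<open>A pullback over the terminal object is a product, because every square over it
  commutes.\<close>

lemma is_product_prd:
  assumes "A \<in> Obj E" "B \<in> Obj E"
  shows "is_product A B (prd A B, pr1 A B, pr2 A B)"
proof -
  obtain P a b where c: "is_pullback (bang A) (bang B) (P, a, b)"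
    using ex_pullback[of "bang A" "bang B"] assms by auto
  have "bang A \<cdot> u = bang B \<cdot> v" if "u \<in> hom E X A" "v \<in> hom E X B" for X u v
    using that assms by (auto simp: hom_def)
  with c assms have "is_product A B (P, a, b)"
    by (simp add: is_pullback_def is_product_def)
  then have "is_product A B (product A B)"
    unfolding product_def by (rule someI)
  then show ?thesis by (simp add: prd_def pr1_def pr2_def)
qed

lemma pr_arr [simp]:
  assumes "A \<in> Obj E" "B \<in> Obj E"
  shows "pr1 A B \<in> Arr E" "Dom E (pr1 A B) = prd A B" "Cod E (pr1 A B) = A"
    "pr2 A B \<in> Arr E" "Dom E (pr2 A B) = prd A B" "Cod E (pr2 A B) = B" "prd A B \<in> Obj E"
proof -
  have *: "pr1 A B \<in> hom E (prd A B) A" "pr2 A B \<in> hom E (prd A B) B"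
    using is_product_prd[OF assms] by (auto simp: is_product_def)
  from * show "pr1 A B \<in> Arr E" "Dom E (pr1 A B) = prd A B" "Cod E (pr1 A B) = A"
    "pr2 A B \<in> Arr E" "Dom E (pr2 A B) = prd A B" "Cod E (pr2 A B) = B"
    by (auto simp: hom_def)
  then show "prd A B \<in> Obj E" using Dom_in_Obj[of "pr1 A B"] by simp
qed

lemma tuple_ex1:
  assumes "u \<in> Arr E" "v \<in> Arr E" "Dom E u = Dom E v"
  shows "\<exists>!h. h \<in> hom E (Dom E u) (prd (Cod E u) (Cod E v)) \<and>
    pr1 (Cod E u) (Cod E v) \<cdot> h = u \<and> pr2 (Cod E u) (Cod E v) \<cdot> h = v"
proof -
  have "u \<in> hom E (Dom E u) (Cod E u)" "v \<in> hom E (Dom E u) (Cod E v)"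
    using assms by auto
  then show ?thesis
    using is_product_prd[of "Cod E u" "Cod E v"] assms unfolding is_product_def by simp
qed

lemma tuple [simp]:
  assumes "u \<in> Arr E" "v \<in> Arr E" "Dom E u = Dom E v"
  shows "tuple u v \<in> Arr E" "Dom E (tuple u v) = Dom E v"
    "Cod E (tuple u v) = prd (Cod E u) (Cod E v)"
  and pr1_tuple [simp]: "Cod E u = A \<Longrightarrow> Cod E v = B \<Longrightarrow> pr1 A B \<cdot> tuple u v = u"
  and pr2_tuple [simp]: "Cod E u = A \<Longrightarrow> Cod E v = B \<Longrightarrow> pr2 A B \<cdot> tuple u v = v"
  using theI'[OF tuple_ex1[OF assms]] assms by (auto simp: tuple_def hom_def)

lemma tuple_ext:
  assumes "A \<in> Obj E" "B \<in> Obj E"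
    "h \<in> Arr E" "k \<in> Arr E" "Cod E h = prd A B" "Cod E k = prd A B"
    "pr1 A B \<cdot> h = pr1 A B \<cdot> k" "pr2 A B \<cdot> h = pr2 A B \<cdot> k"
  shows "h = k"
proof -
  have "Dom E k = Dom E h"
    using assms cmp_arr(2)[of h "pr1 A B"] cmp_arr(2)[of k "pr1 A B"] by simp
  with tuple_ex1[of "pr1 A B \<cdot> h" "pr2 A B \<cdot> h"] assms show ?thesis
    by (auto simp: hom_def)
qed

lemma tuple_cmp [simp]:
  assumes "u \<in> Arr E" "v \<in> Arr E" "Dom E u = Dom E v" "h \<in> Arr E" "Cod E h = Dom E v"
  shows "tuple u v \<cdot> h = tuple (u \<cdot> h) (v \<cdot> h)"
proof (rule tuple_ext[of "Cod E u" "Cod E v"])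
  show "pr1 (Cod E u) (Cod E v) \<cdot> (tuple u v \<cdot> h) = pr1 (Cod E u) (Cod E v) \<cdot> tuple (u \<cdot> h) (v \<cdot> h)"
    using assms by (subst cmp_assoc[symmetric]) simp_all
  show "pr2 (Cod E u) (Cod E v) \<cdot> (tuple u v \<cdot> h) = pr2 (Cod E u) (Cod E v) \<cdot> tuple (u \<cdot> h) (v \<cdot> h)"
    using assms by (subst cmp_assoc[symmetric]) simp_all
qed (use assms in simp_all)

lemma tuple_eta:
  assumes "A \<in> Obj E" "B \<in> Obj E" "h \<in> Arr E" "Cod E h = prd A B"
  shows "tuple (pr1 A B \<cdot> h) (pr2 A B \<cdot> h) = h"
  using assms by - (rule tuple_ext[of A B], simp_all)

lemma tuple_pr [simp]:
  "A \<in> Obj E \<Longrightarrow> B \<in> Obj E \<Longrightarrow> tuple (pr1 A B) (pr2 A B) = Ident E (prd A B)"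
  using tuple_eta[of A B "Ident E (prd A B)"] by simp

lemma prd_map [simp]:
  assumes "f \<in> Arr E" "g \<in> Arr E"
  shows "prd_map f g \<in> Arr E" "Dom E (prd_map f g) = prd (Dom E f) (Dom E g)"
    "Cod E (prd_map f g) = prd (Cod E f) (Cod E g)"
  using assms by (simp_all add: prd_map_def)

lemma prd_map_tuple [simp]:
  assumes "f \<in> Arr E" "g \<in> Arr E" "u \<in> Arr E" "v \<in> Arr E" "Dom E u = Dom E v"
    "Cod E u = Dom E f" "Cod E v = Dom E g"
  shows "prd_map f g \<cdot> tuple u v = tuple (f \<cdot> u) (g \<cdot> v)"
  using assms by (simp add: prd_map_def)

lemma tuple_inject:
  assumes "u \<in> Arr E" "v \<in> Arr E" "Dom E u = Dom E v"
    "u' \<in> Arr E" "v' \<in> Arr E" "Dom E u' = Dom E v'" "Cod E u' = Cod E u" "Cod E v' = Cod E v"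
  shows "tuple u v = tuple u' v' \<longleftrightarrow> u = u' \<and> v = v'"
  using assms pr1_tuple pr2_tuple by metis

lemma tuple_cases:
  assumes "A \<in> Obj E" "B \<in> Obj E" "h \<in> Arr E" "Cod E h = prd A B"
  obtains u v where "h = tuple u v" "u \<in> Arr E" "v \<in> Arr E" "Cod E u = A" "Cod E v = B"
    "Dom E u = Dom E h" "Dom E v = Dom E h"
  using tuple_eta[OF assms] assms by (metis cmp_arr pr_arr)

end

section \<open>Adjunctions from universal arrows\<close>

lemma comp_in_hom:
  "is_category C \<Longrightarrow> f \<in> hom C x y \<Longrightarrow> g \<in> hom C y z \<Longrightarrow> g \<cdot>\<^bsub>C\<^esub> f \<in> hom C x z"
  by (auto simp: is_category_def hom_def)

lemma comp_assoc_hom: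
  "is_category C \<Longrightarrow> f \<in> hom C w x \<Longrightarrow> g \<in> hom C x y \<Longrightarrow> h \<in> hom C y z \<Longrightarrow>
    (h \<cdot>\<^bsub>C\<^esub> g) \<cdot>\<^bsub>C\<^esub> f = h \<cdot>\<^bsub>C\<^esub> (g \<cdot>\<^bsub>C\<^esub> f)"
  by (auto simp: is_category_def hom_def)

lemma Ident_hom: "is_category C \<Longrightarrow> x \<in> Obj C \<Longrightarrow> Ident C x \<in> hom C x x"
  by (auto simp: is_category_def)

lemma comp_Ident_hom:
  "is_category C \<Longrightarrow> f \<in> hom C x y \<Longrightarrow> f \<cdot>\<^bsub>C\<^esub> Ident C x = f"
  "is_category C \<Longrightarrow> f \<in> hom C x y \<Longrightarrow> Ident C y \<cdot>\<^bsub>C\<^esub> f = f"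
  by (auto simp: is_category_def hom_def)

lemma hom_Obj: "is_category C \<Longrightarrow> f \<in> hom C x y \<Longrightarrow> x \<in> Obj C \<and> y \<in> Obj C"
  by (auto simp: is_category_def hom_def)

lemma functor_Obj: "is_functor C D F \<Longrightarrow> x \<in> Obj C \<Longrightarrow> fobj F x \<in> Obj D"
  and functor_hom: "is_functor C D F \<Longrightarrow> f \<in> hom C x y \<Longrightarrow> farr F f \<in> hom D (fobj F x) (fobj F y)"
  and functor_comp: "is_functor C D F \<Longrightarrow> f \<in> hom C x y \<Longrightarrow> g \<in> hom C y z \<Longrightarrow>
    farr F (g \<cdot>\<^bsub>C\<^esub> f) = farr F g \<cdot>\<^bsub>D\<^esub> farr F f"
  and functor_Ident: "is_functor C D F \<Longrightarrow> x \<in> Obj C \<Longrightarrow> farr F (Ident C x) = Ident D (fobj F x)"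
  by (auto simp: is_functor_def hom_def)

text \<open>One half of the bijection of hom sets: naturality of the counit and the first triangle
  identity recover \<open>\<alpha>\<close> from its transpose.\<close>

lemma adjunction_transpose:
  assumes adj: "is_adjunction C D F G \<eta> \<epsilon>" and C: "is_category C" and D: "is_category D"
    and x: "x \<in> Obj C" and \<alpha>: "\<alpha> \<in> hom D (fobj F x) z"
  shows "farr G \<alpha> \<cdot>\<^bsub>C\<^esub> \<eta> x \<in> hom C x (fobj G z)"
    and "\<epsilon> z \<cdot>\<^bsub>D\<^esub> farr F (farr G \<alpha> \<cdot>\<^bsub>C\<^esub> \<eta> x) = \<alpha>"
proof -
  note defs = is_adjunction_def is_nat_trans_def comp_functor_def id_functor_def
  have F: "is_functor C D F" and G: "is_functor D C G" using adj by (auto simp: defs)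
  have Fx: "fobj F x \<in> Obj D" using F x by (rule functor_Obj)
  have \<eta>: "\<eta> x \<in> hom C x (fobj G (fobj F x))" using adj x by (auto simp: defs)
  have \<epsilon>F: "\<epsilon> (fobj F x) \<in> hom D (fobj F (fobj G (fobj F x))) (fobj F x)"
    using adj Fx by (auto simp: defs)
  have z: "z \<in> Obj D" using hom_Obj[OF D \<alpha>] by simp
  have \<epsilon>: "\<epsilon> z \<in> hom D (fobj F (fobj G z)) z" using adj z by (auto simp: defs)
  have G\<alpha>: "farr G \<alpha> \<in> hom C (fobj G (fobj F x)) (fobj G z)" by (rule functor_hom[OF G \<alpha>])
  show "farr G \<alpha> \<cdot>\<^bsub>C\<^esub> \<eta> x \<in> hom C x (fobj G z)" using C \<eta> G\<alpha> by (rule comp_in_hom)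
  have "\<epsilon> z \<cdot>\<^bsub>D\<^esub> farr F (farr G \<alpha> \<cdot>\<^bsub>C\<^esub> \<eta> x)
      = (\<epsilon> z \<cdot>\<^bsub>D\<^esub> farr F (farr G \<alpha>)) \<cdot>\<^bsub>D\<^esub> farr F (\<eta> x)"
    using functor_comp[OF F \<eta> G\<alpha>]
      comp_assoc_hom[OF D functor_hom[OF F \<eta>] functor_hom[OF F G\<alpha>] \<epsilon>] by simp
  also have "\<epsilon> z \<cdot>\<^bsub>D\<^esub> farr F (farr G \<alpha>) = \<alpha> \<cdot>\<^bsub>D\<^esub> \<epsilon> (fobj F x)"
    using adj \<alpha> by (auto simp: defs hom_def)
  also have "\<dots> \<cdot>\<^bsub>D\<^esub> farr F (\<eta> x) = \<alpha> \<cdot>\<^bsub>D\<^esub> (\<epsilon> (fobj F x) \<cdot>\<^bsub>D\<^esub> farr F (\<eta> x))"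
    by (rule comp_assoc_hom[OF D functor_hom[OF F \<eta>] \<epsilon>F \<alpha>])
  also have "\<dots> = \<alpha>"
    using adj x comp_Ident_hom(1)[OF D \<alpha>] by (auto simp: defs)
  finally show "\<epsilon> z \<cdot>\<^bsub>D\<^esub> farr F (farr G \<alpha> \<cdot>\<^bsub>C\<^esub> \<eta> x) = \<alpha>" .
qed

text \<open>The other half, from naturality of the unit and the second triangle identity. It is used
  for uniqueness: an arrow into \<open>fobj G z\<close> is determined by its transpose.\<close>

lemma adjunction_transpose_inverse:
  assumes adj: "is_adjunction C D F G \<eta> \<epsilon>" and C: "is_category C"
    and z: "z \<in> Obj D" and \<sigma>: "\<sigma> \<in> hom C x (fobj G z)"
  shows "farr G (\<epsilon> z \<cdot>\<^bsub>D\<^esub> farr F \<sigma>) \<cdot>\<^bsub>C\<^esub> \<eta> x = \<sigma>"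
proof -
  note defs = is_adjunction_def is_nat_trans_def comp_functor_def id_functor_def
  have F: "is_functor C D F" and G: "is_functor D C G" using adj by (auto simp: defs)
  have x: "x \<in> Obj C" using hom_Obj[OF C \<sigma>] by simp
  have \<eta>: "\<eta> x \<in> hom C x (fobj G (fobj F x))" using adj x by (auto simp: defs)
  have \<epsilon>: "\<epsilon> z \<in> hom D (fobj F (fobj G z)) z" using adj z by (auto simp: defs)
  have \<eta>G: "\<eta> (fobj G z) \<in> hom C (fobj G z) (fobj G (fobj F (fobj G z)))"
    using adj functor_Obj[OF G z] by (auto simp: defs)
  note F\<sigma> = functor_hom[OF F \<sigma>]
  have "farr G (\<epsilon> z \<cdot>\<^bsub>D\<^esub> farr F \<sigma>) \<cdot>\<^bsub>C\<^esub> \<eta> x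
      = farr G (\<epsilon> z) \<cdot>\<^bsub>C\<^esub> (farr G (farr F \<sigma>) \<cdot>\<^bsub>C\<^esub> \<eta> x)"
    using functor_comp[OF G F\<sigma> \<epsilon>]
      comp_assoc_hom[OF C \<eta> functor_hom[OF G F\<sigma>] functor_hom[OF G \<epsilon>]] by simp
  also have "farr G (farr F \<sigma>) \<cdot>\<^bsub>C\<^esub> \<eta> x = \<eta> (fobj G z) \<cdot>\<^bsub>C\<^esub> \<sigma>"
    using adj \<sigma> by (auto simp: defs hom_def)
  also have "farr G (\<epsilon> z) \<cdot>\<^bsub>C\<^esub> (\<eta> (fobj G z) \<cdot>\<^bsub>C\<^esub> \<sigma>)
      = (farr G (\<epsilon> z) \<cdot>\<^bsub>C\<^esub> \<eta> (fobj G z)) \<cdot>\<^bsub>C\<^esub> \<sigma>"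
    by (rule comp_assoc_hom[OF C \<sigma> \<eta>G functor_hom[OF G \<epsilon>], symmetric])
  also have "\<dots> = \<sigma>"
    using adj z comp_Ident_hom(2)[OF C \<sigma>] by (auto simp: defs)
  finally show ?thesis .
qed

text \<open>A universal arrow from \<open>F\<close> to each object already determines a right
  adjoint. Functoriality, the unit and the triangle identities all come from the uniqueness of
  factorizations.\<close>

lemma universal_arrows_adjunction:
  assumes C: "is_category C" and D: "is_category D" and F: "is_functor C D F"
    and g: "\<And>z. z \<in> Obj D \<Longrightarrow> g z \<in> Obj C"
    and \<epsilon>: "\<And>z. z \<in> Obj D \<Longrightarrow> \<epsilon> z \<in> hom D (fobj F (g z)) z"
    and univ: "\<And>x z \<alpha>. x \<in> Obj C \<Longrightarrow> z \<in> Obj D \<Longrightarrow> \<alpha> \<in> hom D (fobj F x) z \<Longrightarrow>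
      \<exists>!\<sigma>. \<sigma> \<in> hom C x (g z) \<and> \<epsilon> z \<cdot>\<^bsub>D\<^esub> farr F \<sigma> = \<alpha>"
  shows "\<exists>G \<eta>. is_adjunction C D F G \<eta> \<epsilon>"
proof -
  define T where "T x z \<alpha> = (THE \<sigma>. \<sigma> \<in> hom C x (g z) \<and> \<epsilon> z \<cdot>\<^bsub>D\<^esub> farr F \<sigma> = \<alpha>)" for x z \<alpha>
  have T: "T x z \<alpha> \<in> hom C x (g z)" "\<epsilon> z \<cdot>\<^bsub>D\<^esub> farr F (T x z \<alpha>) = \<alpha>"
    if "x \<in> Obj C" "z \<in> Obj D" "\<alpha> \<in> hom D (fobj F x) z" for x z \<alpha>
    using theI'[OF univ[OF that]] by (auto simp: T_def)
  \<comment> \<open>The cancellation property by which all remaining equations between arrows into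
    some \<open>g z\<close> are proved.\<close>
  have ext: "\<sigma> = \<tau>" if st: "\<sigma> \<in> hom C x (g z)" "\<tau> \<in> hom C x (g z)" "z \<in> Obj D"
    "\<epsilon> z \<cdot>\<^bsub>D\<^esub> farr F \<sigma> = \<epsilon> z \<cdot>\<^bsub>D\<^esub> farr F \<tau>" for x z \<sigma> \<tau>
  proof -
    have "x \<in> Obj C" using hom_Obj[OF C st(1)] by simp
    moreover have "\<epsilon> z \<cdot>\<^bsub>D\<^esub> farr F \<tau> \<in> hom D (fobj F x) z"
      by (rule comp_in_hom[OF D functor_hom[OF F st(2)] \<epsilon>[OF st(3)]])
    ultimately show ?thesis using univ[OF _ st(3)] st by blast
  qed
  \<comment> \<open>The forced choice: \<open>G\<close> sends \<open>k\<close> to the transpose of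
    \<open>k\<close> after the counit, and \<open>\<eta>\<close> is the transpose of an
    identity.\<close>
  define G where "G = \<lparr>fobj = g, farr = \<lambda>k. T (g (Dom D k)) (Cod D k) (k \<cdot>\<^bsub>D\<^esub> \<epsilon> (Dom D k))\<rparr>"
  define \<eta> where "\<eta> x = T x (fobj F x) (Ident D (fobj F x))" for x
  have Go [simp]: "fobj G = g" by (simp add: G_def)
  have Ga: "farr G k \<in> hom C (g z) (g w)" "\<epsilon> w \<cdot>\<^bsub>D\<^esub> farr F (farr G k) = k \<cdot>\<^bsub>D\<^esub> \<epsilon> z"
    if k: "k \<in> hom D z w" for z w k
  proof -
    have zw: "z \<in> Obj D" "w \<in> Obj D" using hom_Obj[OF D k] by auto
    have "k \<cdot>\<^bsub>D\<^esub> \<epsilon> z \<in> hom D (fobj F (g z)) w" by (rule comp_in_hom[OF D \<epsilon>[OF zw(1)] k])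
    from T[OF g[OF zw(1)] zw(2) this] k
    show "farr G k \<in> hom C (g z) (g w)" "\<epsilon> w \<cdot>\<^bsub>D\<^esub> farr F (farr G k) = k \<cdot>\<^bsub>D\<^esub> \<epsilon> z"
      by (auto simp: G_def hom_def)
  qed
  have Fo: "fobj F x \<in> Obj D" if "x \<in> Obj C" for x using F that by (rule functor_Obj)
  have \<eta>: "\<eta> x \<in> hom C x (g (fobj F x))" "\<epsilon> (fobj F x) \<cdot>\<^bsub>D\<^esub> farr F (\<eta> x) = Ident D (fobj F x)"
    if "x \<in> Obj C" for x
    unfolding \<eta>_def using T[OF that Fo[OF that] Ident_hom[OF D Fo[OF that]]] by auto
  \<comment> \<open>Composing with \<open>farr G k\<close> corresponds, after transposition, to
    composing with \<open>k\<close>.\<close>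
  have step: "\<epsilon> w \<cdot>\<^bsub>D\<^esub> farr F (farr G k \<cdot>\<^bsub>C\<^esub> \<sigma>) = k \<cdot>\<^bsub>D\<^esub> (\<epsilon> z \<cdot>\<^bsub>D\<^esub> farr F \<sigma>)"
    if k: "k \<in> hom D z w" and \<sigma>: "\<sigma> \<in> hom C x (g z)" for x z w k \<sigma>
  proof -
    have zw: "z \<in> Obj D" "w \<in> Obj D" using hom_Obj[OF D k] by auto
    note Gk = functor_hom[OF F Ga(1)[OF k]] and F\<sigma> = functor_hom[OF F \<sigma>]
    show ?thesis
      using functor_comp[OF F \<sigma> Ga(1)[OF k]] comp_assoc_hom[OF D F\<sigma> Gk \<epsilon>[OF zw(2)]]
        comp_assoc_hom[OF D F\<sigma> \<epsilon>[OF zw(1)] k] Ga(2)[OF k] by simp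
  qed
  have functor_G: "is_functor D C G"
    unfolding is_functor_def
  proof (intro conjI ballI impI)
    fix z assume z: "z \<in> Obj D"
    show "fobj G z \<in> Obj C" using g[OF z] by simp
    note I = Ident_hom[OF D z]
    show "farr G (Ident D z) = Ident C (fobj G z)"
      using Ga[OF I] Ident_hom[OF C g[OF z]] functor_Ident[OF F g[OF z]]
        comp_Ident_hom[OF D \<epsilon>[OF z]]
      by - (rule ext[OF _ _ z], auto)
  next
    fix k assume "k \<in> Arr D"
    then have "k \<in> hom D (Dom D k) (Cod D k)" by (simp add: hom_def)
    then show "farr G k \<in> hom C (fobj G (Dom D k)) (fobj G (Cod D k))"
      using Ga(1) by simp
  next
    fix k l assume kl: "k \<in> Arr D" "l \<in> Arr D" "Cod D k = Dom D l"
    then have k: "k \<in> hom D (Dom D k) (Dom D l)" and l: "l \<in> hom D (Dom D l) (Cod D l)"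
      by (simp_all add: hom_def)
    have z: "Dom D k \<in> Obj D" "Cod D l \<in> Obj D" using hom_Obj[OF D] k l by auto
    note lk = comp_in_hom[OF D k l]
    show "farr G (l \<cdot>\<^bsub>D\<^esub> k) = farr G l \<cdot>\<^bsub>C\<^esub> farr G k"
      using Ga(1)[OF lk] comp_in_hom[OF C Ga(1)[OF k] Ga(1)[OF l]] step[OF l Ga(1)[OF k]]
        Ga(2)[OF lk] Ga(2)[OF k] comp_assoc_hom[OF D \<epsilon>[OF z(1)] k l]
      by - (rule ext[OF _ _ z(2)], auto)
  qed
  have "farr G (farr F f) \<cdot>\<^bsub>C\<^esub> \<eta> (Dom C f) = \<eta> (Cod C f) \<cdot>\<^bsub>C\<^esub> f" if f: "f \<in> Arr C" for f
  proof -
    have f': "f \<in> hom C (Dom C f) (Cod C f)" using f by (simp add: hom_def)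
    then have o: "Dom C f \<in> Obj C" "Cod C f \<in> Obj C" using hom_Obj[OF C] by blast+
    note Ff = functor_hom[OF F f']
    note e1 = \<eta>(1)[OF o(1)] and e2 = \<eta>(1)[OF o(2)]
    have "\<epsilon> (fobj F (Cod C f)) \<cdot>\<^bsub>D\<^esub> farr F (\<eta> (Cod C f) \<cdot>\<^bsub>C\<^esub> f)
       = (\<epsilon> (fobj F (Cod C f)) \<cdot>\<^bsub>D\<^esub> farr F (\<eta> (Cod C f))) \<cdot>\<^bsub>D\<^esub> farr F f"
      using functor_comp[OF F f' e2]
        comp_assoc_hom[OF D Ff functor_hom[OF F e2] \<epsilon>[OF Fo[OF o(2)]]] by simp
    also have "\<dots> = farr F f"
      using \<eta>(2)[OF o(2)] comp_Ident_hom[OF D Ff] by simp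
    also have "\<dots> = \<epsilon> (fobj F (Cod C f)) \<cdot>\<^bsub>D\<^esub> farr F (farr G (farr F f) \<cdot>\<^bsub>C\<^esub> \<eta> (Dom C f))"
      using step[OF Ff e1] \<eta>(2)[OF o(1)] comp_Ident_hom[OF D Ff] by simp
    finally show ?thesis
      using ext[OF comp_in_hom[OF C e1 Ga(1)[OF Ff]] comp_in_hom[OF C f' e2] Fo[OF o(2)]]
      by simp
  qed
  moreover have "\<epsilon> (Cod D k) \<cdot>\<^bsub>D\<^esub> farr F (farr G k) = k \<cdot>\<^bsub>D\<^esub> \<epsilon> (Dom D k)" if "k \<in> Arr D" for k
    using Ga(2)[of k "Dom D k" "Cod D k"] that by (simp add: hom_def)
  moreover have "farr G (\<epsilon> z) \<cdot>\<^bsub>C\<^esub> \<eta> (g z) = Ident C (g z)" if z: "z \<in> Obj D" for z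
    using step[OF \<epsilon>[OF z] \<eta>(1)[OF g[OF z]]] \<eta>(2)[OF g[OF z]] functor_Ident[OF F g[OF z]]
      comp_in_hom[OF C \<eta>(1)[OF g[OF z]] Ga(1)[OF \<epsilon>[OF z]]] Ident_hom[OF C g[OF z]]
    by - (rule ext[OF _ _ z], auto)
  ultimately have "is_adjunction C D F G \<eta> \<epsilon>"
    using F functor_G \<eta> \<epsilon>
    by (simp add: is_adjunction_def is_nat_trans_def comp_functor_def id_functor_def)
  then show ?thesis by blast
qed

context finitely_complete
begin

section \<open>Slice categories and the pullback functor\<close>

lemma slice_simps [simp]:
  "Obj (slice E A) = {f \<in> Arr E. Cod E f = A}"
  "Dom (slice E A) (f, g, h) = f" "Cod (slice E A) (f, g, h) = g"
  "Ident (slice E A) f = (f, f, Ident E (Dom E f))"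
  "Comp (slice E A) (g', k, h') (f, g, h) = (f, k, h' \<cdot> h)"
  by (auto simp: slice_def)

lemma hom_slice:
  "u \<in> hom (slice E A) f g \<longleftrightarrow> (\<exists>h. u = (f, g, h) \<and> g \<in> Arr E \<and> Cod E g = A \<and> h \<in> Arr E \<and>
     Cod E h = Dom E g \<and> g \<cdot> h = f)"
  by (auto simp: slice_def hom_def)

text \<open>The domain of \<open>h\<close> is absent from \<open>hom_slice\<close> because it
  follows from \<open>g \<cdot> h = f\<close>; here it is restored.\<close>

lemma hom_slice_cases:
  assumes "u \<in> hom (slice E A) f g"
  obtains h where "u = (f, g, h)" "g \<in> Arr E" "Cod E g = A" "h \<in> Arr E"
    "Dom E h = Dom E f" "Cod E h = Dom E g" "g \<cdot> h = f"
proof -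
  obtain h where h: "u = (f, g, h)" "g \<in> Arr E" "Cod E g = A" "h \<in> Arr E" "Cod E h = Dom E g"
    "g \<cdot> h = f"
    using assms unfolding hom_slice by blast
  moreover from h have "Dom E h = Dom E f" using cmp_arr(2)[of h g] by simp
  ultimately show thesis using that by blast
qed

lemma slice_cases:
  assumes "u \<in> Arr (slice E A)"
  obtains g h where "u = (g \<cdot> h, g, h)" "g \<in> Arr E" "Cod E g = A" "h \<in> Arr E" "Cod E h = Dom E g"
  using assms by (auto simp: slice_def hom_def)

lemma is_category_slice: "is_category (slice E A)"
proof -
  have mem: "(g \<cdot> h, g, h) \<in> hom (slice E A) (g \<cdot> h) g" if "g \<in> Arr E" "Cod E g = A" "h \<in> Arr E"
    "Cod E h = Dom E g" for g h
    using that by (simp add: hom_slice)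
  show ?thesis
    unfolding is_category_def
  proof (intro conjI ballI impI)
    fix f assume "f \<in> Arr (slice E A)"
    then show "Dom (slice E A) f \<in> Obj (slice E A)" "Cod (slice E A) f \<in> Obj (slice E A)"
      "f \<cdot>\<^bsub>slice E A\<^esub> Ident (slice E A) (Dom (slice E A) f) = f"
      "Ident (slice E A) (Cod (slice E A) f) \<cdot>\<^bsub>slice E A\<^esub> f = f"
      by (elim slice_cases; simp)+
  next
    fix x assume "x \<in> Obj (slice E A)"
    then show "Ident (slice E A) x \<in> hom (slice E A) x x" by (simp add: hom_slice)
  next
    fix f g assume "f \<in> Arr (slice E A)" "g \<in> Arr (slice E A)"
      "Cod (slice E A) f = Dom (slice E A) g"
    then show "g \<cdot>\<^bsub>slice E A\<^esub> f \<in> hom (slice E A) (Dom (slice E A) f) (Cod (slice E A) g)"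
      by (elim slice_cases; simp add: hom_slice)
  next
    fix f g h assume "f \<in> Arr (slice E A)" "g \<in> Arr (slice E A)" "h \<in> Arr (slice E A)"
      "Cod (slice E A) f = Dom (slice E A) g" "Cod (slice E A) g = Dom (slice E A) h"
    then show "h \<cdot>\<^bsub>slice E A\<^esub> (g \<cdot>\<^bsub>slice E A\<^esub> f) = (h \<cdot>\<^bsub>slice E A\<^esub> g) \<cdot>\<^bsub>slice E A\<^esub> f"
      by (elim slice_cases; simp)
  qed
qed

lemma Delta_simps [simp]:
  "fobj (Delta f) a = pb2 a f"
  "farr (Delta f) (a, b, h) = (pb2 a f, pb2 b f, pb_pair b f (h \<cdot> pb1 a f) (pb2 a f))"
  by (simp_all add: Delta_def)

lemma is_functor_Delta:
  assumes p: "p \<in> Arr E"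
  shows "is_functor (slice E (Cod E p)) (slice E (Dom E p)) (Delta p)"
  unfolding is_functor_def
proof (intro conjI ballI impI)
  fix x assume "x \<in> Obj (slice E (Cod E p))"
  then show "fobj (Delta p) x \<in> Obj (slice E (Dom E p))"
    "farr (Delta p) (Ident (slice E (Cod E p)) x) = Ident (slice E (Dom E p)) (fobj (Delta p) x)"
    using p by simp_all
next
  fix f assume "f \<in> Arr (slice E (Cod E p))"
  then obtain b h where f: "f = (b \<cdot> h, b, h)" and h: "b \<in> Arr E" "Cod E b = Cod E p"
    "h \<in> Arr E" "Cod E h = Dom E b"
    by (rule slice_cases)
  have "b \<cdot> h \<cdot> pb1 (b \<cdot> h) p = p \<cdot> pb2 (b \<cdot> h) p"
    using h p pb_commute[of "b \<cdot> h" p] by simp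
  with h p show "farr (Delta p) f \<in> hom (slice E (Dom E p)) (fobj (Delta p) (Dom (slice E (Cod E p)) f))
      (fobj (Delta p) (Cod (slice E (Cod E p)) f))"
    by (simp add: f hom_slice)
next
  fix f g assume fg: "f \<in> Arr (slice E (Cod E p))" "g \<in> Arr (slice E (Cod E p))"
    "Cod (slice E (Cod E p)) f = Dom (slice E (Cod E p)) g"
  obtain b h where f: "f = (b \<cdot> h, b, h)" and h: "h \<in> Arr E" "Cod E h = Dom E b"
    using fg(1) by (rule slice_cases)
  obtain c k where g: "g = (c \<cdot> k, c, k)" and k: "c \<in> Arr E" "Cod E c = Cod E p"
    "k \<in> Arr E" "Cod E k = Dom E c"
    using fg(2) by (rule slice_cases)
  have b: "b = c \<cdot> k" using fg(3) f g by simp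
  have 1: "c \<cdot> k \<cdot> h \<cdot> pb1 (c \<cdot> k \<cdot> h) p = p \<cdot> pb2 (c \<cdot> k \<cdot> h) p"
    using h k b p pb_commute[of "c \<cdot> k \<cdot> h" p] by simp
  have 2: "c \<cdot> k \<cdot> pb1 (c \<cdot> k) p = p \<cdot> pb2 (c \<cdot> k) p"
    using k p pb_commute[of "c \<cdot> k" p] by simp
  show "farr (Delta p) (g \<cdot>\<^bsub>slice E (Cod E p)\<^esub> f) =
      farr (Delta p) g \<cdot>\<^bsub>slice E (Dom E p)\<^esub> farr (Delta p) f"
    using h k p 1 2 by (simp add: f g b)
qed

section \<open>Exponentiability in terms of generalized elements\<close>

text \<open>\<open>over p x y\<close> says that \<open>y\<close> is an element of the fibre of \<open>p\<close> over the generalized element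
  \<open>x\<close>. A family sends such elements, at all stages, naturally to elements of \<open>z\<close>.\<close>

definition over :: "'a \<Rightarrow> 'a \<Rightarrow> 'a \<Rightarrow> bool" where
  "over p x y \<longleftrightarrow> y \<in> Arr E \<and> Cod E y = Dom E p \<and> p \<cdot> y = x"

definition family :: "'a \<Rightarrow> 'a \<Rightarrow> 'a \<Rightarrow> ('a \<Rightarrow> 'a \<Rightarrow> 'a) \<Rightarrow> bool" where
  "family p z x F \<longleftrightarrow>
     (\<forall>h y. h \<in> Arr E \<and> Cod E h = Dom E x \<and> over p (x \<cdot> h) y \<longrightarrow> over z y (F h y)) \<and>
     (\<forall>h y k. h \<in> Arr E \<and> Cod E h = Dom E x \<and> over p (x \<cdot> h) y \<and> k \<in> Arr E \<and> Cod E k = Dom E h \<longrightarrow>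
        F (h \<cdot> k) (y \<cdot> k) = F h y \<cdot> k)"

text \<open>Representability of the functor of families: \<open>b\<close> is the structure arrow of
  the object \<Pi> of sections of \<open>z\<close> along \<open>p\<close>, and \<open>A\<close> is
  evaluation. The last two conjuncts are surjectivity and injectivity of the passage from arrows
  \<open>s\<close> with \<open>b \<cdot> s = x\<close> to families over \<open>x\<close>. No chosen
  pullback occurs, which makes the notion easy to transport.\<close>

definition dependent_product :: "'a \<Rightarrow> 'a \<Rightarrow> 'a \<Rightarrow> ('a \<Rightarrow> 'a \<Rightarrow> 'a) \<Rightarrow> bool" where
  "dependent_product p z b A \<longleftrightarrow>
     b \<in> Arr E \<and> Cod E b = Cod E p \<and>
     (\<forall>s y. s \<in> Arr E \<and> Cod E s = Dom E b \<and> over p (b \<cdot> s) y \<longrightarrow> over z y (A s y)) \<and>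
     (\<forall>s y k. s \<in> Arr E \<and> Cod E s = Dom E b \<and> over p (b \<cdot> s) y \<and> k \<in> Arr E \<and> Cod E k = Dom E s \<longrightarrow>
        A (s \<cdot> k) (y \<cdot> k) = A s y \<cdot> k) \<and>
     (\<forall>x F. x \<in> Arr E \<and> Cod E x = Cod E p \<and> family p z x F \<longrightarrow>
        (\<exists>s. s \<in> Arr E \<and> Cod E s = Dom E b \<and> b \<cdot> s = x \<and>
          (\<forall>h y. h \<in> Arr E \<and> Cod E h = Dom E x \<and> over p (x \<cdot> h) y \<longrightarrow> A (s \<cdot> h) y = F h y))) \<and>
     (\<forall>s s'. s \<in> Arr E \<and> Cod E s = Dom E b \<and> s' \<in> Arr E \<and> Cod E s' = Dom E b \<and> b \<cdot> s = b \<cdot> s' \<and>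
        (\<forall>h y. h \<in> Arr E \<and> Cod E h = Dom E s \<and> over p (b \<cdot> s \<cdot> h) y \<longrightarrow> A (s \<cdot> h) y = A (s' \<cdot> h) y) \<longrightarrow>
        s = s')"

lemma overD:
  assumes "over p x y" "p \<in> Arr E"
  shows "y \<in> Arr E" "Cod E y = Dom E p" "p \<cdot> y = x" "Dom E y = Dom E x"
  using assms by (auto simp: over_def)

lemma over_cmp:
  "over p x y \<Longrightarrow> p \<in> Arr E \<Longrightarrow> k \<in> Arr E \<Longrightarrow> Cod E k = Dom E x \<Longrightarrow> over p (x \<cdot> k) (y \<cdot> k)"
  by (auto simp: over_def)

lemma over_pb:
  "x \<in> Arr E \<Longrightarrow> p \<in> Arr E \<Longrightarrow> Cod E x = Cod E p \<Longrightarrow> over p (x \<cdot> pb1 x p) (pb2 x p)"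
  by (auto simp: over_def pb_commute)

lemma over_pb_pair:
  assumes "x \<in> Arr E" "p \<in> Arr E" "Cod E x = Cod E p" "h \<in> Arr E" "Cod E h = Dom E x"
    "over p (x \<cdot> h) y"
  shows "pb_pair x p h y \<in> Arr E" "Dom E (pb_pair x p h y) = Dom E h"
    "Cod E (pb_pair x p h y) = pb x p"
    "pb1 x p \<cdot> pb_pair x p h y = h" "pb2 x p \<cdot> pb_pair x p h y = y"
    "k \<in> Arr E \<Longrightarrow> Cod E k = Dom E h \<Longrightarrow> pb_pair x p h y \<cdot> k = pb_pair x p (h \<cdot> k) (y \<cdot> k)"
  using assms by (auto simp: over_def)

lemma familyD:
  assumes "family p z x F" "h \<in> Arr E" "Cod E h = Dom E x" "over p (x \<cdot> h) y"
  shows "over z y (F h y)"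
    and "k \<in> Arr E \<Longrightarrow> Cod E k = Dom E h \<Longrightarrow> F (h \<cdot> k) (y \<cdot> k) = F h y \<cdot> k"
  using assms unfolding family_def by blast+

lemma dependent_productD:
  assumes "dependent_product p z b A"
  shows "b \<in> Arr E" "Cod E b = Cod E p"
    "\<And>s y. s \<in> Arr E \<Longrightarrow> Cod E s = Dom E b \<Longrightarrow> over p (b \<cdot> s) y \<Longrightarrow> over z y (A s y)"
    "\<And>s y k. s \<in> Arr E \<Longrightarrow> Cod E s = Dom E b \<Longrightarrow> over p (b \<cdot> s) y \<Longrightarrow> k \<in> Arr E \<Longrightarrow>
       Cod E k = Dom E s \<Longrightarrow> A (s \<cdot> k) (y \<cdot> k) = A s y \<cdot> k"
  using assms unfolding dependent_product_def by blast+

lemma dependent_product_ex: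
  assumes "dependent_product p z b A" "x \<in> Arr E" "Cod E x = Cod E p" "family p z x F"
  obtains s where "s \<in> Arr E" "Cod E s = Dom E b" "b \<cdot> s = x"
    "\<And>h y. h \<in> Arr E \<Longrightarrow> Cod E h = Dom E x \<Longrightarrow> over p (x \<cdot> h) y \<Longrightarrow> A (s \<cdot> h) y = F h y"
proof -
  from assms(1) have "\<forall>x F. x \<in> Arr E \<and> Cod E x = Cod E p \<and> family p z x F \<longrightarrow>
      (\<exists>s. s \<in> Arr E \<and> Cod E s = Dom E b \<and> b \<cdot> s = x \<and>
        (\<forall>h y. h \<in> Arr E \<and> Cod E h = Dom E x \<and> over p (x \<cdot> h) y \<longrightarrow> A (s \<cdot> h) y = F h y))"
    unfolding dependent_product_def by (elim conjE)
  with assms(2-4) that show thesis by blast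
qed

lemma dependent_product_ext:
  assumes "dependent_product p z b A" "s \<in> Arr E" "Cod E s = Dom E b" "s' \<in> Arr E"
    "Cod E s' = Dom E b" "b \<cdot> s = b \<cdot> s'"
    "\<And>h y. h \<in> Arr E \<Longrightarrow> Cod E h = Dom E s \<Longrightarrow> over p (b \<cdot> s \<cdot> h) y \<Longrightarrow> A (s \<cdot> h) y = A (s' \<cdot> h) y"
  shows "s = s'"
proof -
  from assms(1) have "\<forall>s s'. s \<in> Arr E \<and> Cod E s = Dom E b \<and> s' \<in> Arr E \<and> Cod E s' = Dom E b \<and>
      b \<cdot> s = b \<cdot> s' \<and> (\<forall>h y. h \<in> Arr E \<and> Cod E h = Dom E s \<and> over p (b \<cdot> s \<cdot> h) y \<longrightarrow>
        A (s \<cdot> h) y = A (s' \<cdot> h) y) \<longrightarrow> s = s'"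
    unfolding dependent_product_def by (elim conjE)
  with assms(2-) show ?thesis by blast
qed

text \<open>Slice arrows out of \<open>\<Delta>\<^sub>p x\<close> are families over \<open>x\<close>, by the Yoneda lemma.\<close>

lemma adjunction_dependent_product:
  assumes p: "p \<in> Arr E" and z: "z \<in> Arr E" "Cod E z = Dom E p"
    and adj: "is_adjunction (slice E (Cod E p)) (slice E (Dom E p)) (Delta p) G \<eta> \<epsilon>"
  shows "dependent_product p z (fobj G z)
    (\<lambda>s y. snd (snd (\<epsilon> z)) \<cdot> pb_pair (fobj G z) p s y)"
proof -
  let ?C = "slice E (Cod E p)" and ?D = "slice E (Dom E p)"
  define b where "b = fobj G z"
  note C = is_category_slice[of "Cod E p"] and D = is_category_slice[of "Dom E p"]
  have zo: "z \<in> Obj ?D" using z by simp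
  have G: "is_functor ?D ?C G" using adj by (simp add: is_adjunction_def)
  have b [simp]: "b \<in> Arr E" "Cod E b = Cod E p" using functor_Obj[OF G zo] by (auto simp: b_def)
  have "\<epsilon> z \<in> hom ?D (fobj (Delta p) (fobj G z)) z"
    using adj zo unfolding is_adjunction_def is_nat_trans_def
    by (simp add: comp_functor_def id_functor_def)
  then obtain e where \<epsilon>: "\<epsilon> z = (pb2 b p, z, e)" and e: "e \<in> Arr E" "Dom E e = pb b p"
    "Cod E e = Dom E z" "z \<cdot> e = pb2 b p"
    using p b by (elim hom_slice_cases) (simp add: b_def[symmetric])
  define A where "A s y = e \<cdot> pb_pair b p s y" for s y
  \<comment> \<open>Transposing a slice arrow \<open>s\<close> amounts to evaluating it at the
    generic element of the fibre, \<open>pb2 x p\<close>, over the stage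
    \<open>pb1 x p\<close>.\<close>
  have T: "\<epsilon> z \<cdot>\<^bsub>?D\<^esub> farr (Delta p) (x, b, s) = (pb2 x p, z, A (s \<cdot> pb1 x p) (pb2 x p))" for x s
    by (simp add: \<epsilon> A_def)
  have sig: "(x, b, s) \<in> hom ?C x (fobj G z)"
    if "s \<in> Arr E" "Cod E s = Dom E b" "b \<cdot> s = x" for x s
    using that by (auto simp: hom_slice b_def[symmetric])
  have A: "over z y (A s y)" "k \<in> Arr E \<Longrightarrow> Cod E k = Dom E s \<Longrightarrow> A (s \<cdot> k) (y \<cdot> k) = A s y \<cdot> k"
    if s: "s \<in> Arr E" "Cod E s = Dom E b" "over p (b \<cdot> s) y" for s y k
  proof -
    note pp = over_pb_pair[OF b(1) p b(2) s]
    have "z \<cdot> e \<cdot> pb_pair b p s y = y"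
      using pp cmp_assoc[of "pb_pair b p s y" e z] e z by simp
    then show "over z y (A s y)" using pp e z by (simp add: over_def A_def)
    assume k: "k \<in> Arr E" "Cod E k = Dom E s"
    with pp e show "A (s \<cdot> k) (y \<cdot> k) = A s y \<cdot> k"
      by (simp add: A_def)
  qed
  have "dependent_product p z b A"
    unfolding dependent_product_def
  proof (intro conjI allI impI; (elim conjE)?)
    fix x F assume x: "x \<in> Arr E" "Cod E x = Cod E p" and F: "family p z x F"
    have o: "over p (x \<cdot> pb1 x p) (pb2 x p)" using over_pb x p by simp
    \<comment> \<open>The value at the generic element; by naturality it determines the whole
      family, as \<open>F_eq\<close> records.\<close>
    define f where "f = F (pb1 x p) (pb2 x p)"
    have f: "over z (pb2 x p) f" using familyD(1)[OF F _ _ o] p x by (simp add: f_def)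
    have F_eq: "F h y = f \<cdot> pb_pair x p h y" if h: "h \<in> Arr E" "Cod E h = Dom E x" "over p (x \<cdot> h) y"
      for h y
    proof -
      note pp = over_pb_pair[OF x(1) p x(2) h]
      show ?thesis
        using familyD(2)[OF F _ _ o, of "pb_pair x p h y"] x p pp by (simp add: f_def)
    qed
    let ?\<alpha> = "(pb2 x p, z, f)"
    have \<alpha>: "?\<alpha> \<in> hom ?D (fobj (Delta p) x) z"
      using overD[OF f z(1)] x p z by (simp add: hom_slice)
    note tr = adjunction_transpose[OF adj C D _ \<alpha>]
    have "farr G ?\<alpha> \<cdot>\<^bsub>?C\<^esub> \<eta> x \<in> hom ?C x b" using tr(1) x by (simp add: b_def)
    then obtain s where s: "farr G ?\<alpha> \<cdot>\<^bsub>?C\<^esub> \<eta> x = (x, b, s)" "s \<in> Arr E" "Cod E s = Dom E b"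
      "b \<cdot> s = x" "Dom E s = Dom E x"
      by (rule hom_slice_cases)
    have ft: "A (s \<cdot> pb1 x p) (pb2 x p) = f"
      using tr(2) x s(1) T[of x s] by simp
    have "A (s \<cdot> h) y = F h y" if h: "h \<in> Arr E" "Cod E h = Dom E x" "over p (x \<cdot> h) y" for h y
    proof -
      note pp = over_pb_pair[OF x(1) p x(2) h]
      have "over p (b \<cdot> s \<cdot> pb1 x p) (pb2 x p)"
        using o s x p cmp_assoc[of "pb1 x p" s b] by simp
      then have "A ((s \<cdot> pb1 x p) \<cdot> pb_pair x p h y) (pb2 x p \<cdot> pb_pair x p h y) = f \<cdot> pb_pair x p h y"
        using A(2)[of "s \<cdot> pb1 x p" "pb2 x p" "pb_pair x p h y"] s x p pp ft by simp
      then show ?thesis using F_eq[OF h] s x p pp by simp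
    qed
    with s show "\<exists>s. s \<in> Arr E \<and> Cod E s = Dom E b \<and> b \<cdot> s = x \<and>
      (\<forall>h y. h \<in> Arr E \<and> Cod E h = Dom E x \<and> over p (x \<cdot> h) y \<longrightarrow> A (s \<cdot> h) y = F h y)"
      by blast
  next
    fix s s' assume s: "s \<in> Arr E" "Cod E s = Dom E b" "s' \<in> Arr E" "Cod E s' = Dom E b"
      "b \<cdot> s = b \<cdot> s'" and h: "\<forall>h y. h \<in> Arr E \<and> Cod E h = Dom E s \<and> over p (b \<cdot> s \<cdot> h) y \<longrightarrow>
        A (s \<cdot> h) y = A (s' \<cdot> h) y"
    define x where "x = b \<cdot> s"
    have x: "x \<in> Arr E" "Cod E x = Cod E p" "Dom E x = Dom E s" "b \<cdot> s = x" "b \<cdot> s' = x"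
      using s(1,2) by (simp_all add: x_def s(5)[symmetric])
    have "over p (b \<cdot> s \<cdot> pb1 x p) (pb2 x p)"
      using over_pb[of x p] cmp_assoc[of "pb1 x p" s b] s p x by simp
    with h s p x have "A (s \<cdot> pb1 x p) (pb2 x p) = A (s' \<cdot> pb1 x p) (pb2 x p)"
      by simp
    \<comment> \<open>Agreement at the generic element is equality of transposes, and transposition
      is injective.\<close>
    then have "\<epsilon> z \<cdot>\<^bsub>?D\<^esub> farr (Delta p) (x, b, s) = \<epsilon> z \<cdot>\<^bsub>?D\<^esub> farr (Delta p) (x, b, s')"
      by (simp only: T)
    then have "(x, b, s) = (x, b, s')"
      using adjunction_transpose_inverse[OF adj C zo sig[OF s(1,2) x(4)]]
        adjunction_transpose_inverse[OF adj C zo sig[OF s(3,4) x(5)]] by simp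
    then show "s = s'" by simp
  qed (use A in auto)
  then show ?thesis by (simp add: b_def \<epsilon> A_def[abs_def])
qed

text \<open>The backward direction takes evaluation at the generic element as a universal arrow for
  \<open>Delta p\<close> at each \<open>z\<close>. Closure properties are then proved on the
  right-hand side, where no adjoint functor has to be constructed.\<close>

lemma exponentiable_iff:
  "exponentiable p \<longleftrightarrow>
     p \<in> Arr E \<and> (\<forall>z. z \<in> Arr E \<and> Cod E z = Dom E p \<longrightarrow> (\<exists>b A. dependent_product p z b A))"
proof
  assume "exponentiable p"
  then show "p \<in> Arr E \<and> (\<forall>z. z \<in> Arr E \<and> Cod E z = Dom E p \<longrightarrow> (\<exists>b A. dependent_product p z b A))"
    unfolding exponentiable_def using adjunction_dependent_product by blast
next
  assume "p \<in> Arr E \<and> (\<forall>z. z \<in> Arr E \<and> Cod E z = Dom E p \<longrightarrow> (\<exists>b A. dependent_product p z b A))"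
  then have p: "p \<in> Arr E" and "\<forall>z. z \<in> Arr E \<and> Cod E z = Dom E p \<longrightarrow> (\<exists>b A. dependent_product p z b A)"
    by auto
  then obtain b A where dp: "\<And>z. z \<in> Arr E \<Longrightarrow> Cod E z = Dom E p \<Longrightarrow> dependent_product p z (b z) (A z)"
    by metis
  let ?C = "slice E (Cod E p)" and ?D = "slice E (Dom E p)"
  \<comment> \<open>The prospective counit: evaluation at the generic element of the pullback of
    \<open>b z\<close> along \<open>p\<close>.\<close>
  define \<epsilon> where "\<epsilon> z = (pb2 (b z) p, z, A z (pb1 (b z) p) (pb2 (b z) p))" for z
  have "\<exists>G \<eta>. is_adjunction ?C ?D (Delta p) G \<eta> \<epsilon>"
  proof (rule universal_arrows_adjunction[where g = b])
    show "is_functor ?C ?D (Delta p)" using p by (rule is_functor_Delta)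
    fix z assume z: "z \<in> Obj ?D"
    then have dpz: "dependent_product p z (b z) (A z)" using dp by simp
    note dpD = dependent_productD[OF dpz]
    have z': "z \<in> Arr E" "Cod E z = Dom E p" using z by auto
    show "b z \<in> Obj ?C" using dpD by simp
    have o: "over p (b z \<cdot> pb1 (b z) p) (pb2 (b z) p)"
      using over_pb[OF dpD(1) p dpD(2)] .
    have oz: "over z (pb2 (b z) p) (A z (pb1 (b z) p) (pb2 (b z) p))"
      using dpD(3)[OF _ _ o] dpD(1,2) p by simp
    then show "\<epsilon> z \<in> hom ?D (fobj (Delta p) (b z)) z"
      using overD[OF oz] z dpD(1,2) p by (simp add: hom_slice \<epsilon>_def)
    have A_eq: "A z s y = A z (pb1 (b z) p) (pb2 (b z) p) \<cdot> pb_pair (b z) p s y"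
      if s: "s \<in> Arr E" "Cod E s = Dom E (b z)" "over p (b z \<cdot> s) y" for s y
      using dpD(4)[OF _ _ o, of "pb_pair (b z) p s y"] over_pb_pair[OF dpD(1) p dpD(2) s] p dpD(1,2)
      by simp
    fix x \<alpha> assume "x \<in> Obj ?C" and \<alpha>: "\<alpha> \<in> hom ?D (fobj (Delta p) x) z"
    then have x: "x \<in> Arr E" "Cod E x = Cod E p" by auto
    obtain f where f: "\<alpha> = (pb2 x p, z, f)" "f \<in> Arr E" "Dom E f = pb x p" "Cod E f = Dom E z"
      "z \<cdot> f = pb2 x p"
      using \<alpha> x p by (elim hom_slice_cases) simp
    have trans: "\<epsilon> z \<cdot>\<^bsub>?D\<^esub> farr (Delta p) (x, b z, s) = (pb2 x p, z, A z (s \<cdot> pb1 x p) (pb2 x p))"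
      if s: "s \<in> Arr E" "Cod E s = Dom E (b z)" "b z \<cdot> s = x" for s
    proof -
      have "over p (b z \<cdot> s \<cdot> pb1 x p) (pb2 x p)"
        using over_pb[OF x(1) p x(2)] s x p dpD(1,2) cmp_assoc[of "pb1 x p" s "b z"] by auto
      moreover have "Dom E s = Dom E x" using s dpD(1) by auto
      ultimately show ?thesis
        using A_eq[of "s \<cdot> pb1 x p" "pb2 x p"] s x p by (simp add: \<epsilon>_def)
    qed
    \<comment> \<open>An arrow out of the pullback becomes a family by precomposition with
      pairings.\<close>
    have fam: "family p z x (\<lambda>h y. f \<cdot> pb_pair x p h y)"
      unfolding family_def
    proof (intro conjI allI impI; elim conjE)
      fix h y assume h: "h \<in> Arr E" "Cod E h = Dom E x" "over p (x \<cdot> h) y"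
      note pp = over_pb_pair[OF x(1) p x(2) h]
      have "z \<cdot> f \<cdot> pb_pair x p h y = y"
        using pp f z cmp_assoc[of "pb_pair x p h y" f z] by simp
      then show "over z y (f \<cdot> pb_pair x p h y)" using pp f z by (simp add: over_def)
      fix k assume "k \<in> Arr E" "Cod E k = Dom E h"
      then show "f \<cdot> pb_pair x p (h \<cdot> k) (y \<cdot> k) = (f \<cdot> pb_pair x p h y) \<cdot> k"
        using pp f z by simp
    qed
    show "\<exists>!\<sigma>. \<sigma> \<in> hom ?C x (b z) \<and> \<epsilon> z \<cdot>\<^bsub>?D\<^esub> farr (Delta p) \<sigma> = \<alpha>"
    proof (rule ex_ex1I)
      obtain s where s: "s \<in> Arr E" "Cod E s = Dom E (b z)" "b z \<cdot> s = x"
        and sF: "\<And>h y. h \<in> Arr E \<Longrightarrow> Cod E h = Dom E x \<Longrightarrow> over p (x \<cdot> h) y \<Longrightarrow>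
          A z (s \<cdot> h) y = f \<cdot> pb_pair x p h y"
        using dependent_product_ex[OF dpz x fam] by blast
      have "A z (s \<cdot> pb1 x p) (pb2 x p) = f"
        using sF[OF _ _ over_pb[OF x(1) p x(2)]] x p f by simp
      moreover have "Dom E s = Dom E x" using s dpD(1) by auto
      ultimately have "(x, b z, s) \<in> hom ?C x (b z) \<and> \<epsilon> z \<cdot>\<^bsub>?D\<^esub> farr (Delta p) (x, b z, s) = \<alpha>"
        using trans[OF s] f s x dpD(1,2) by (simp add: hom_slice)
      then show "\<exists>\<sigma>. \<sigma> \<in> hom ?C x (b z) \<and> \<epsilon> z \<cdot>\<^bsub>?D\<^esub> farr (Delta p) \<sigma> = \<alpha>" by blast
    next
      fix \<sigma> \<tau> assume \<sigma>: "\<sigma> \<in> hom ?C x (b z) \<and> \<epsilon> z \<cdot>\<^bsub>?D\<^esub> farr (Delta p) \<sigma> = \<alpha>"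
        and \<tau>: "\<tau> \<in> hom ?C x (b z) \<and> \<epsilon> z \<cdot>\<^bsub>?D\<^esub> farr (Delta p) \<tau> = \<alpha>"
      obtain s where s: "\<sigma> = (x, b z, s)" "s \<in> Arr E" "Cod E s = Dom E (b z)" "b z \<cdot> s = x"
          "Dom E s = Dom E x"
        using \<sigma> by (elim conjE hom_slice_cases) simp
      obtain t where t: "\<tau> = (x, b z, t)" "t \<in> Arr E" "Cod E t = Dom E (b z)" "b z \<cdot> t = x"
          "Dom E t = Dom E x"
        using \<tau> by (elim conjE hom_slice_cases) simp
      have eq: "A z (s \<cdot> pb1 x p) (pb2 x p) = A z (t \<cdot> pb1 x p) (pb2 x p)"
        using \<sigma> \<tau> trans[OF s(2-4)] trans[OF t(2-4)] s(1) t(1) by simp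
      have o: "over p (x \<cdot> pb1 x p) (pb2 x p)" using over_pb[OF x(1) p x(2)] .
      \<comment> \<open>Values at all stages factor through the value at the generic element, where
        \<open>s\<close> and \<open>t\<close> agree by \<open>eq\<close>.\<close>
      have via: "A z (u \<cdot> h) y = A z (u \<cdot> pb1 x p) (pb2 x p) \<cdot> pb_pair x p h y"
        if u: "u \<in> Arr E" "Cod E u = Dom E (b z)" "b z \<cdot> u = x" "Dom E u = Dom E x"
        and h: "h \<in> Arr E" "Cod E h = Dom E x" "over p (x \<cdot> h) y" for u h y
      proof -
        have "over p (b z \<cdot> u \<cdot> pb1 x p) (pb2 x p)"
          using o u x p dpD(1,2) cmp_assoc[of "pb1 x p" u "b z"] by auto
        then have "A z ((u \<cdot> pb1 x p) \<cdot> pb_pair x p h y) (pb2 x p \<cdot> pb_pair x p h y) =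
            A z (u \<cdot> pb1 x p) (pb2 x p) \<cdot> pb_pair x p h y"
          using u x p over_pb_pair[OF x(1) p x(2) h] by (intro dpD(4)) simp_all
        then show ?thesis
          using u x p over_pb_pair[OF x(1) p x(2) h] by simp
      qed
      have "s = t"
      proof (rule dependent_product_ext[OF dpz s(2,3) t(2,3)])
        show "b z \<cdot> s = b z \<cdot> t" using s t by simp
        fix h y assume h: "h \<in> Arr E" "Cod E h = Dom E s" "over p (b z \<cdot> s \<cdot> h) y"
        moreover have "b z \<cdot> s \<cdot> h = x \<cdot> h"
          using h s dpD(1) cmp_assoc[of h s "b z"] by simp
        ultimately show "A z (s \<cdot> h) y = A z (t \<cdot> h) y"
          using via[OF s(2-5)] via[OF t(2-5)] eq s(5) by simp
      qed
      then show "\<sigma> = \<tau>" using s t by simp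
    qed
  qed (rule is_category_slice)+
  with p show "exponentiable p" unfolding exponentiable_def by blast
qed

section \<open>Introduction rules and closure properties of exponentiable arrows\<close>

lemma dependent_productI:
  assumes "b \<in> Arr E" "Cod E b = Cod E p"
    and "\<And>s y. s \<in> Arr E \<Longrightarrow> Cod E s = Dom E b \<Longrightarrow> over p (b \<cdot> s) y \<Longrightarrow> over z y (A s y)"
    and "\<And>s y k. s \<in> Arr E \<Longrightarrow> Cod E s = Dom E b \<Longrightarrow> over p (b \<cdot> s) y \<Longrightarrow> k \<in> Arr E \<Longrightarrow>
       Cod E k = Dom E s \<Longrightarrow> A (s \<cdot> k) (y \<cdot> k) = A s y \<cdot> k"
    and "\<And>x F. x \<in> Arr E \<Longrightarrow> Cod E x = Cod E p \<Longrightarrow> family p z x F \<Longrightarrow>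
      \<exists>s. s \<in> Arr E \<and> Cod E s = Dom E b \<and> b \<cdot> s = x \<and>
        (\<forall>h y. h \<in> Arr E \<and> Cod E h = Dom E x \<and> over p (x \<cdot> h) y \<longrightarrow> A (s \<cdot> h) y = F h y)"
    and "\<And>s s'. s \<in> Arr E \<Longrightarrow> Cod E s = Dom E b \<Longrightarrow> s' \<in> Arr E \<Longrightarrow> Cod E s' = Dom E b \<Longrightarrow>
      b \<cdot> s = b \<cdot> s' \<Longrightarrow>
      (\<And>h y. h \<in> Arr E \<Longrightarrow> Cod E h = Dom E s \<Longrightarrow> over p (b \<cdot> s \<cdot> h) y \<Longrightarrow> A (s \<cdot> h) y = A (s' \<cdot> h) y) \<Longrightarrow>
      s = s'"
  shows "dependent_product p z b A"
  unfolding dependent_product_def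
  using assms(1,2) by (intro conjI allI impI; (elim conjE)?) (blast intro: assms(3-6))+

lemma familyI:
  assumes "\<And>h y. h \<in> Arr E \<Longrightarrow> Cod E h = Dom E x \<Longrightarrow> over p (x \<cdot> h) y \<Longrightarrow> over z y (F h y)"
    and "\<And>h y k. h \<in> Arr E \<Longrightarrow> Cod E h = Dom E x \<Longrightarrow> over p (x \<cdot> h) y \<Longrightarrow> k \<in> Arr E \<Longrightarrow>
      Cod E k = Dom E h \<Longrightarrow> F (h \<cdot> k) (y \<cdot> k) = F h y \<cdot> k"
  shows "family p z x F"
  unfolding family_def using assms by blast

lemma exponentiableD: "exponentiable p \<Longrightarrow> p \<in> Arr E"
  by (simp add: exponentiable_def)

text \<open>The fibre of an identity over \<open>x\<close> has the single element \<open>x\<close>,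
  so a family is its value there. The dependent product of \<open>z\<close> is therefore
  \<open>z\<close> itself, with evaluation ignoring the element.\<close>

lemma exponentiable_Ident:
  assumes "X \<in> Obj E"
  shows "exponentiable (Ident E X)"
proof -
  have "dependent_product (Ident E X) z z (\<lambda>s y. s)" if z: "z \<in> Arr E" "Cod E z = X" for z
  proof (rule dependent_productI)
    fix x F assume x: "x \<in> Arr E" "Cod E x = Cod E (Ident E X)" and F: "family (Ident E X) z x F"
    have o: "over (Ident E X) (x \<cdot> k) (x \<cdot> k)" if "k \<in> Arr E" "Cod E k = Dom E x" for k
      using x assms that by (simp add: over_def)
    define s where "s = F (Ident E (Dom E x)) x"
    have s: "over z x s"
      using familyD(1)[OF F _ _ o[of "Ident E (Dom E x)"]] x by (simp add: s_def)
    have "s \<cdot> h = F h y" if h: "h \<in> Arr E" "Cod E h = Dom E x" "over (Ident E X) (x \<cdot> h) y" for h y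
    proof -
      have "y = x \<cdot> h" using h by (auto simp: over_def assms)
      then show ?thesis
        using familyD(2)[OF F _ _ o[of "Ident E (Dom E x)"], of h] x h by (simp add: s_def)
    qed
    with s show "\<exists>s. s \<in> Arr E \<and> Cod E s = Dom E z \<and> z \<cdot> s = x \<and>
      (\<forall>h y. h \<in> Arr E \<and> Cod E h = Dom E x \<and> over (Ident E X) (x \<cdot> h) y \<longrightarrow> s \<cdot> h = F h y)"
      by (auto simp: over_def)
  next
    fix s s' assume s: "s \<in> Arr E" "Cod E s = Dom E z" "s' \<in> Arr E" "Cod E s' = Dom E z"
      "z \<cdot> s = z \<cdot> s'"
      and h: "\<And>h y. h \<in> Arr E \<Longrightarrow> Cod E h = Dom E s \<Longrightarrow> over (Ident E X) (z \<cdot> s \<cdot> h) y \<Longrightarrow> s \<cdot> h = s' \<cdot> h"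
    have "Dom E s' = Dom E s" using s z by (metis cmp_arr(2))
    moreover have "over (Ident E X) (z \<cdot> s) (z \<cdot> s)" using s(1,2) z assms by (simp add: over_def)
    ultimately show "s = s'" using h[of "Ident E (Dom E s)" "z \<cdot> s"] s(1-4) by simp
  qed (use z assms in \<open>auto simp: over_def\<close>)
  with assms show ?thesis by (auto simp: exponentiable_iff)
qed

text \<open>\<Pi> along \<open>f \<cdot> g\<close> is \<Pi> along \<open>g\<close> followed by \<Pi>
  along \<open>f\<close>. An element \<open>c\<close> over \<open>f \<cdot> g\<close> is an element
  \<open>g \<cdot> c\<close> over \<open>f\<close> together with \<open>c\<close> over it, so
  evaluation takes place first at \<open>g \<cdot> c\<close> and then at \<open>c\<close>.\<close>

lemma exponentiable_cmp:
  assumes f: "exponentiable f" and g: "exponentiable g" and fg: "Cod E g = Dom E f"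
  shows "exponentiable (f \<cdot> g)"
proof -
  note fgA [simp] = exponentiableD[OF f] exponentiableD[OF g] fg
  have "\<exists>b A. dependent_product (f \<cdot> g) z b A" if z: "z \<in> Arr E" "Cod E z = Dom E g" for z
  proof -
    obtain b1 A1 where d1: "dependent_product g z b1 A1" using g z by (auto simp: exponentiable_iff)
    note b1 = dependent_productD[OF d1]
    obtain b2 A2 where d2: "dependent_product f b1 b2 A2"
      using f b1(1,2) by (auto simp: exponentiable_iff)
    note b2 = dependent_productD[OF d2]
    have o: "over f x (g \<cdot> c)" "over g (g \<cdot> c) c" if "over (f \<cdot> g) x c" for x c
      using that by (auto simp: over_def)
    have t: "A2 s (g \<cdot> c) \<in> Arr E" "Cod E (A2 s (g \<cdot> c)) = Dom E b1" "b1 \<cdot> A2 s (g \<cdot> c) = g \<cdot> c"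
      "Dom E (A2 s (g \<cdot> c)) = Dom E s" "over g (b1 \<cdot> A2 s (g \<cdot> c)) c"
      if "s \<in> Arr E" "Cod E s = Dom E b2" "over (f \<cdot> g) (b2 \<cdot> s) c" for s c
    proof -
      have 1: "over b1 (g \<cdot> c) (A2 s (g \<cdot> c))" using b2(3) o that by blast
      then show "A2 s (g \<cdot> c) \<in> Arr E" "Cod E (A2 s (g \<cdot> c)) = Dom E b1"
        "b1 \<cdot> A2 s (g \<cdot> c) = g \<cdot> c" by (auto simp: over_def)
      then show "over g (b1 \<cdot> A2 s (g \<cdot> c)) c" using o that by simp
      have "Dom E c = Dom E s" using overD(4)[OF that(3)] that b2(1) by simp
      moreover have "Dom E (g \<cdot> c) = Dom E c" using overD(1,2)[OF that(3)] by simp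
      ultimately show "Dom E (A2 s (g \<cdot> c)) = Dom E s" using overD(4)[OF 1 b1(1)] by simp
    qed
    have cmpo: "over (f \<cdot> g) (x \<cdot> k) (c \<cdot> k)" "g \<cdot> c \<cdot> k = (g \<cdot> c) \<cdot> k"
      if "over (f \<cdot> g) x c" "k \<in> Arr E" "Cod E k = Dom E x" for x c k
      using overD[OF that(1)] that by (auto simp: over_def)
    have "dependent_product (f \<cdot> g) z b2 (\<lambda>s c. A1 (A2 s (g \<cdot> c)) c)"
    proof (rule dependent_productI)
      fix s y assume s: "s \<in> Arr E" "Cod E s = Dom E b2" "over (f \<cdot> g) (b2 \<cdot> s) y"
      show "over z y (A1 (A2 s (g \<cdot> y)) y)"
        using b1(3)[OF t(1,2)[OF s] t(5)[OF s]] .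
      fix k assume k: "k \<in> Arr E" "Cod E k = Dom E s"
      have "Dom E (g \<cdot> y) = Dom E s" using t(3,4)[OF s] t(1,2)[OF s] b1(1) by (metis cmp_arr(2))
      have "A2 (s \<cdot> k) (g \<cdot> y \<cdot> k) = A2 s (g \<cdot> y) \<cdot> k"
        using b2(4)[OF s(1,2) o(1)[OF s(3)] k] cmpo(2)[OF s(3) k(1)] k s b2(1) by simp
      then show "A1 (A2 (s \<cdot> k) (g \<cdot> y \<cdot> k)) (y \<cdot> k) = A1 (A2 s (g \<cdot> y)) y \<cdot> k"
        using b1(4)[OF t(1,2)[OF s] t(5)[OF s] k(1)] k t(4)[OF s] by simp
    next
      fix x F assume x: "x \<in> Arr E" "Cod E x = Cod E (f \<cdot> g)" and F: "family (f \<cdot> g) z x F"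
      have xc: "Cod E x = Cod E f" using x by simp
      have over_fg: "over (f \<cdot> g) (x \<cdot> h \<cdot> k) c"
        if "h \<in> Arr E" "Cod E h = Dom E x" "over f (x \<cdot> h) y" "k \<in> Arr E" "Cod E k = Dom E h"
          "over g (y \<cdot> k) c" for h y k c
      proof -
        note y = overD[OF that(3) fgA(1)] and c = overD[OF that(6) fgA(2)]
        have "Dom E y = Dom E h" using y(4) that x by simp
        then have "f \<cdot> g \<cdot> c = (f \<cdot> y) \<cdot> k"
          using y(1,2) that c(3) by simp
        also have "\<dots> = x \<cdot> h \<cdot> k" using y(3) that x by simp
        finally show ?thesis using c by (simp add: over_def)
      qed
      have Dy: "Dom E y = Dom E h" if "h \<in> Arr E" "Cod E h = Dom E x" "over f (x \<cdot> h) y" for h y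
        using overD(4)[OF that(3)] that x by simp
      \<comment> \<open>For a fixed element \<open>y\<close> of the fibre of \<open>f\<close>, the
        family restricts to the fibre of \<open>g\<close> over \<open>y\<close>; the arrow
        \<open>t\<close> classifies this restriction.\<close>
      have "\<exists>t. t \<in> Arr E \<and> Cod E t = Dom E b1 \<and> b1 \<cdot> t = y \<and>
        (\<forall>k c. k \<in> Arr E \<longrightarrow> Cod E k = Dom E y \<longrightarrow> over g (y \<cdot> k) c \<longrightarrow> A1 (t \<cdot> k) c = F (h \<cdot> k) c)"
        if h: "h \<in> Arr E" "Cod E h = Dom E x" "over f (x \<cdot> h) y" for h y
      proof -
        note y = overD[OF h(3) fgA(1)]
        have fam: "family g z y (\<lambda>k c. F (h \<cdot> k) c)"
        proof (rule familyI)
          fix k c assume k: "k \<in> Arr E" "Cod E k = Dom E y" "over g (y \<cdot> k) c"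
          have o: "over (f \<cdot> g) (x \<cdot> h \<cdot> k) c" using over_fg[OF h k(1) _ k(3)] k(2) Dy[OF h] by simp
          show "over z c (F (h \<cdot> k) c)"
            using familyD(1)[OF F _ _ o] h k Dy[OF h] by simp
          fix l assume "l \<in> Arr E" "Cod E l = Dom E k"
          then show "F (h \<cdot> k \<cdot> l) (c \<cdot> l) = F (h \<cdot> k) c \<cdot> l"
            using familyD(2)[OF F _ _ o, of l] h k Dy[OF h] by simp
        qed
        have "Cod E y = Cod E g" using y by simp
        from dependent_product_ex[OF d1 y(1) this fam] show ?thesis by metis
      qed
      then obtain t where t': "\<And>h y. h \<in> Arr E \<Longrightarrow> Cod E h = Dom E x \<Longrightarrow> over f (x \<cdot> h) y \<Longrightarrow>
        t h y \<in> Arr E \<and> Cod E (t h y) = Dom E b1 \<and> b1 \<cdot> t h y = y \<and>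
        (\<forall>k c. k \<in> Arr E \<longrightarrow> Cod E k = Dom E y \<longrightarrow> over g (y \<cdot> k) c \<longrightarrow> A1 (t h y \<cdot> k) c = F (h \<cdot> k) c)"
        by metis
      \<comment> \<open>The classifying arrows were chosen separately for each \<open>h\<close> and
        \<open>y\<close>. Their naturality comes from uniqueness in the inner dependent
        product.\<close>
      have fam: "family f b1 x t"
      proof (rule familyI)
        fix h y assume h: "h \<in> Arr E" "Cod E h = Dom E x" "over f (x \<cdot> h) y"
        show "over b1 y (t h y)" using t'[OF h] by (simp add: over_def)
        note y = overD[OF h(3) fgA(1)]
        fix k assume k: "k \<in> Arr E" "Cod E k = Dom E h"
        have o: "over f (x \<cdot> h \<cdot> k) (y \<cdot> k)" using over_cmp[OF h(3) _ k(1)] h k x by simp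
        have hk: "h \<cdot> k \<in> Arr E" "Cod E (h \<cdot> k) = Dom E x" using h k by auto
        have Dt: "Dom E (t h y) = Dom E h"
          using t'[OF h] Dy[OF h] b1(1) cmp_arr(2)[of "t h y" b1] by simp
        show "t (h \<cdot> k) (y \<cdot> k) = t h y \<cdot> k"
        proof (rule dependent_product_ext[OF d1])
          show "t (h \<cdot> k) (y \<cdot> k) \<in> Arr E" "Cod E (t (h \<cdot> k) (y \<cdot> k)) = Dom E b1"
            using t'[OF hk o] by auto
          show "t h y \<cdot> k \<in> Arr E" "Cod E (t h y \<cdot> k) = Dom E b1"
            using t'[OF h] k Dt by auto
          have "b1 \<cdot> t h y \<cdot> k = (b1 \<cdot> t h y) \<cdot> k"
            using t'[OF h] k Dt b1(1) cmp_assoc[of k "t h y" b1] by simp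
          then show "b1 \<cdot> t (h \<cdot> k) (y \<cdot> k) = b1 \<cdot> t h y \<cdot> k"
            using t'[OF hk o] t'[OF h] by simp
          fix l c assume l: "l \<in> Arr E" "Cod E l = Dom E (t (h \<cdot> k) (y \<cdot> k))"
            "over g (b1 \<cdot> t (h \<cdot> k) (y \<cdot> k) \<cdot> l) c"
          have Dyk: "Dom E (y \<cdot> k) = Dom E k" using y(1) k Dy[OF h] by simp
          have Dt2: "Dom E (t (h \<cdot> k) (y \<cdot> k)) = Dom E k"
            using t'[OF hk o] Dyk b1(1) cmp_arr(2)[of "t (h \<cdot> k) (y \<cdot> k)" b1] by simp
          have "b1 \<cdot> t (h \<cdot> k) (y \<cdot> k) \<cdot> l = (y \<cdot> k) \<cdot> l"
            using t'[OF hk o] l b1(1) cmp_assoc[of l "t (h \<cdot> k) (y \<cdot> k)" b1] by simp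
          then have oc: "over g ((y \<cdot> k) \<cdot> l) c" using l(3) by simp
          have "A1 (t (h \<cdot> k) (y \<cdot> k) \<cdot> l) c = F ((h \<cdot> k) \<cdot> l) c"
            using t'[OF hk o] l(1,2) oc Dt2 Dyk by metis
          also have "\<dots> = F (h \<cdot> k \<cdot> l) c" using h k l(1,2) Dt2 by simp
          also have "\<dots> = A1 (t h y \<cdot> k \<cdot> l) c"
            using t'[OF h] oc k l(1,2) Dt2 y(1) Dy[OF h] by simp
          also have "\<dots> = A1 ((t h y \<cdot> k) \<cdot> l) c"
            using t'[OF h] k l(1,2) Dt Dt2 by simp
          finally show "A1 (t (h \<cdot> k) (y \<cdot> k) \<cdot> l) c = A1 ((t h y \<cdot> k) \<cdot> l) c" .
        qed
      qed
      obtain s where s: "s \<in> Arr E" "Cod E s = Dom E b2" "b2 \<cdot> s = x"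
        "\<And>h y. h \<in> Arr E \<Longrightarrow> Cod E h = Dom E x \<Longrightarrow> over f (x \<cdot> h) y \<Longrightarrow> A2 (s \<cdot> h) y = t h y"
        using dependent_product_ex[OF d2 x(1) xc fam] by blast
      have "A1 (A2 (s \<cdot> h) (g \<cdot> c)) c = F h c"
        if h: "h \<in> Arr E" "Cod E h = Dom E x" "over (f \<cdot> g) (x \<cdot> h) c" for h c
      proof -
        note o' = o[OF h(3)] and c = overD[OF o(2)[OF h(3)] fgA(2)]
        note t'' = t'[OF h(1,2) o'(1)]
        have D: "Dom E (g \<cdot> c) = Dom E h" using Dy[OF h(1,2) o'(1)] .
        have Dt: "Dom E (t h (g \<cdot> c)) = Dom E h"
          using t'' b1(1) cmp_arr(2)[of "t h (g \<cdot> c)" b1] D by simp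
        \<comment> \<open>The inner classification at the identity stage.\<close>
        have "A1 (t h (g \<cdot> c) \<cdot> Ident E (Dom E h)) c = F (h \<cdot> Ident E (Dom E h)) c"
        proof -
          have "(g \<cdot> c) \<cdot> Ident E (Dom E h) = g \<cdot> c"
            using c D by (intro cmp_Ident_right) auto
          then have oI: "over g ((g \<cdot> c) \<cdot> Ident E (Dom E h)) c" using o'(2) by simp
          from t'' have "\<forall>k d. k \<in> Arr E \<longrightarrow> Cod E k = Dom E (g \<cdot> c) \<longrightarrow> over g ((g \<cdot> c) \<cdot> k) d \<longrightarrow>
              A1 (t h (g \<cdot> c) \<cdot> k) d = F (h \<cdot> k) d"
            by blast
          from this[rule_format, OF _ _ oI] show ?thesis using D h(1) by simp
        qed
        then show ?thesis using s(4)[OF h(1,2) o'(1)] t'' Dt h(1) by simp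
      qed
      with s show "\<exists>s. s \<in> Arr E \<and> Cod E s = Dom E b2 \<and> b2 \<cdot> s = x \<and>
        (\<forall>h y. h \<in> Arr E \<and> Cod E h = Dom E x \<and> over (f \<cdot> g) (x \<cdot> h) y \<longrightarrow>
          A1 (A2 (s \<cdot> h) (g \<cdot> y)) y = F h y)"
        by blast
    next
      fix s s' assume s: "s \<in> Arr E" "Cod E s = Dom E b2" "s' \<in> Arr E" "Cod E s' = Dom E b2"
        "b2 \<cdot> s = b2 \<cdot> s'" and eq: "\<And>h c. h \<in> Arr E \<Longrightarrow> Cod E h = Dom E s \<Longrightarrow>
          over (f \<cdot> g) (b2 \<cdot> s \<cdot> h) c \<Longrightarrow> A1 (A2 (s \<cdot> h) (g \<cdot> c)) c = A1 (A2 (s' \<cdot> h) (g \<cdot> c)) c"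
      have Ds: "Dom E s' = Dom E s" using s b2(1) cmp_arr(2) by metis
      show "s = s'"
      proof (rule dependent_product_ext[OF d2 s])
        fix h y assume h: "h \<in> Arr E" "Cod E h = Dom E s" "over f (b2 \<cdot> s \<cdot> h) y"
        note y = overD[OF h(3) fgA(1)]
        have sh: "s \<cdot> h \<in> Arr E" "Cod E (s \<cdot> h) = Dom E b2" "Dom E (s \<cdot> h) = Dom E h"
          "s' \<cdot> h \<in> Arr E" "Cod E (s' \<cdot> h) = Dom E b2" "Dom E (s' \<cdot> h) = Dom E h"
          using s(1-4) h Ds by auto
        have "b2 \<cdot> s \<cdot> h = (b2 \<cdot> s) \<cdot> h" using s(1,2) h b2(1) by simp
        also have "\<dots> = b2 \<cdot> s' \<cdot> h" unfolding s(5) using s(3,4) h Ds b2(1) by simp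
        finally have bs: "b2 \<cdot> s' \<cdot> h = b2 \<cdot> s \<cdot> h" ..
        have Dyh: "Dom E y = Dom E h" using y(4) sh b2(1) by simp
        have o': "over f (b2 \<cdot> s' \<cdot> h) y" using h(3) bs by simp
        have u: "over b1 y (A2 (s \<cdot> h) y)" "over b1 y (A2 (s' \<cdot> h) y)"
          using b2(3) sh h(3) o' by blast+
        note u1 = overD[OF u(1) b1(1)] and u2 = overD[OF u(2) b1(1)]
        show "A2 (s \<cdot> h) y = A2 (s' \<cdot> h) y"
        proof (rule dependent_product_ext[OF d1 u1(1,2) u2(1,2)])
          show "b1 \<cdot> A2 (s \<cdot> h) y = b1 \<cdot> A2 (s' \<cdot> h) y" using u1 u2 by simp
          fix k c assume k: "k \<in> Arr E" "Cod E k = Dom E (A2 (s \<cdot> h) y)"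
            "over g (b1 \<cdot> A2 (s \<cdot> h) y \<cdot> k) c"
          have k2: "Cod E k = Dom E h" using k(2) u1(4) Dyh by simp
          have "b1 \<cdot> A2 (s \<cdot> h) y \<cdot> k = y \<cdot> k"
            using u1 k b1(1) cmp_assoc[of k "A2 (s \<cdot> h) y" b1] by simp
          then have gc: "over g (y \<cdot> k) c" using k(3) by simp
          note c = overD[OF gc fgA(2)]
          \<comment> \<open>At the later stage \<open>k\<close> the element \<open>y\<close> has
            become \<open>g \<cdot> c\<close>, so both inner values are of the form covered by
            \<open>eq\<close>.\<close>
          have e1: "A2 (s \<cdot> h) y \<cdot> k = A2 (s \<cdot> h \<cdot> k) (g \<cdot> c)"
            using b2(4)[OF sh(1,2) h(3) k(1)] k(1) k2 sh c s(1) h by simp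
          have e2: "A2 (s' \<cdot> h) y \<cdot> k = A2 (s' \<cdot> h \<cdot> k) (g \<cdot> c)"
            using b2(4)[OF sh(4,5) o' k(1)] k(1) k2 sh c s(3) h Ds by simp
          have "f \<cdot> g \<cdot> c = (f \<cdot> y) \<cdot> k" using c(3) y(1,2) k(1) k2 Dyh by simp
          also have "\<dots> = b2 \<cdot> s \<cdot> h \<cdot> k" using y(3) sh(1,2,3) s(1,2) h k(1) k2 b2(1) by simp
          finally have "over (f \<cdot> g) (b2 \<cdot> s \<cdot> h \<cdot> k) c" using c by (simp add: over_def)
          from eq[OF _ _ this] h k(1) k2 e1 e2
          show "A1 (A2 (s \<cdot> h) y \<cdot> k) c = A1 (A2 (s' \<cdot> h) y \<cdot> k) c" by simp
        qed
      qed
    qed (use b2(1,2) in simp_all)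
    then show ?thesis by blast
  qed
  then show ?thesis by (simp add: exponentiable_iff)
qed

text \<open>A family of elements of \<open>z\<close> over the fibres of \<open>p'\<close> at
  \<open>x\<close> is a family of elements of \<open>u' \<cdot> z\<close> over the fibres of
  \<open>p\<close> at \<open>u \<cdot> x\<close> whose images in \<open>B\<close> are the expected
  pairs. The dependent product of \<open>z\<close> along \<open>p'\<close> is thus a pullback of the
  one of \<open>u' \<cdot> z\<close> over the one of \<open>u'\<close>, both along \<open>p\<close>.
  An arbitrary pullback cone is allowed, since the squares needed for products of arrows are not the
  chosen ones.\<close>

lemma exponentiable_pullback:
  assumes p: "exponentiable p" and u: "u \<in> Arr E" "Cod E u = Cod E p"
    and pull: "is_pullback u p (B, p', u')"
  shows "exponentiable p'"
proof -
  note pA = exponentiableD[OF p]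
  have p': "p' \<in> Arr E" "Dom E p' = B" "Cod E p' = Dom E u"
    and u': "u' \<in> Arr E" "Dom E u' = B" "Cod E u' = Dom E p" and comm: "u \<cdot> p' = p \<cdot> u'"
    using pull by (auto simp: is_pullback_def hom_def)
  have univ: "\<exists>!h. h \<in> hom E X B \<and> p' \<cdot> h = a \<and> u' \<cdot> h = v"
    if "a \<in> hom E X (Dom E u)" "v \<in> hom E X (Dom E p)" "u \<cdot> a = p \<cdot> v" for X a v
    using pull that by (simp add: is_pullback_def)
  have B_ext: "h = k" if hk: "h \<in> Arr E" "Cod E h = B" "k \<in> Arr E" "Cod E k = B"
    "p' \<cdot> h = p' \<cdot> k" "u' \<cdot> h = u' \<cdot> k" for h k
  proof -
    have D: "Dom E k = Dom E h" using hk p' cmp_arr(2) by metis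
    have "u \<cdot> p' \<cdot> h = (u \<cdot> p') \<cdot> h" using u p' hk by simp
    also have "\<dots> = p \<cdot> u' \<cdot> h" unfolding comm using pA u' hk by simp
    finally have "\<exists>!l. l \<in> hom E (Dom E h) B \<and> p' \<cdot> l = p' \<cdot> h \<and> u' \<cdot> l = u' \<cdot> h"
      using p' u' hk(1,2) by (intro univ) (auto simp: hom_def)
    moreover have "h \<in> hom E (Dom E h) B" "k \<in> hom E (Dom E h) B" using hk D by auto
    ultimately show ?thesis using hk(5,6) by metis
  qed
  have "\<exists>h. h \<in> Arr E \<and> Dom E h = Dom E a \<and> Cod E h = B \<and> p' \<cdot> h = a \<and> u' \<cdot> h = y"
    if a: "a \<in> Arr E" "Cod E a = Dom E u" and y: "over p (u \<cdot> a) y" for a y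
  proof -
    note yD = overD[OF y pA]
    have "\<exists>!h. h \<in> hom E (Dom E a) B \<and> p' \<cdot> h = a \<and> u' \<cdot> h = y"
      using yD a u by (intro univ) auto
    then show ?thesis by (auto simp: hom_def)
  qed
  \<comment> \<open>\<open>pr a y\<close> is the element of \<open>B\<close> with components
    \<open>a\<close> and \<open>y\<close>. With composition by \<open>u'\<close> as inverse, it
    identifies the fibre of \<open>p\<close> over \<open>u \<cdot> a\<close> with the fibre of
    \<open>p'\<close> over \<open>a\<close>.\<close>
  then obtain pr where pr: "\<And>a y. a \<in> Arr E \<Longrightarrow> Cod E a = Dom E u \<Longrightarrow> over p (u \<cdot> a) y \<Longrightarrow>
    pr a y \<in> Arr E \<and> Dom E (pr a y) = Dom E a \<and> Cod E (pr a y) = B \<and> p' \<cdot> pr a y = a \<and> u' \<cdot> pr a y = y"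
    by metis
  have pr_over: "over p' a (pr a y)" if "a \<in> Arr E" "Cod E a = Dom E u" "over p (u \<cdot> a) y" for a y
    using pr[OF that] p' by (simp add: over_def)
  have over_u': "over p (u \<cdot> a) (u' \<cdot> y)" "pr a (u' \<cdot> y) = y"
    if a: "a \<in> Arr E" "Cod E a = Dom E u" and y: "over p' a y" for a y
  proof -
    note yD = overD[OF y p'(1)]
    have "p \<cdot> u' \<cdot> y = (p \<cdot> u') \<cdot> y" using pA u' p' yD by simp
    also have "\<dots> = u \<cdot> a" unfolding comm[symmetric] using u p' yD by simp
    finally show o: "over p (u \<cdot> a) (u' \<cdot> y)" using u' p' yD by (simp add: over_def)
    show "pr a (u' \<cdot> y) = y"
      using pr[OF a o] yD p' by - (rule B_ext, simp_all)
  qed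
  have pr_nat: "pr (a \<cdot> k) (y \<cdot> k) = pr a y \<cdot> k"
    if a: "a \<in> Arr E" "Cod E a = Dom E u" "over p (u \<cdot> a) y" and k: "k \<in> Arr E" "Cod E k = Dom E a"
    for a y k
  proof -
    have o: "over p (u \<cdot> a \<cdot> k) (y \<cdot> k)" using over_cmp[OF a(3) pA k(1)] a u k by simp
    have ak: "a \<cdot> k \<in> Arr E" "Cod E (a \<cdot> k) = Dom E u" using a k by auto
    have "p' \<cdot> pr a y \<cdot> k = a \<cdot> k" "u' \<cdot> pr a y \<cdot> k = y \<cdot> k"
      using pr[OF a] p' u' k cmp_assoc[of k "pr a y" p'] cmp_assoc[of k "pr a y" u'] by simp_all
    then show ?thesis
      using pr[OF ak o] pr[OF a] k by - (rule B_ext, simp_all)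
  qed
  have "\<exists>b A. dependent_product p' z b A" if z: "z \<in> Arr E" "Cod E z = Dom E p'" for z
  proof -
    have zB: "Cod E z = B" using z p' by simp
    \<comment> \<open>\<open>bT\<close> and, below, \<open>bS\<close> are the dependent products of
      \<open>u'\<close> and of \<open>u' \<cdot> z\<close> along \<open>p\<close>.\<close>
    obtain bT AT where dT: "dependent_product p u' bT AT"
      using p u' by (auto simp: exponentiable_iff)
    have "u' \<cdot> z \<in> Arr E" "Cod E (u' \<cdot> z) = Dom E p" using u' z zB by auto
    then obtain bS AS where dS: "dependent_product p (u' \<cdot> z) bS AS"
      using p unfolding exponentiable_iff by blast
    note T = dependent_productD[OF dT] and S = dependent_productD[OF dS]
    have ASD: "AS s y \<in> Arr E" "Cod E (AS s y) = Dom E z" "u' \<cdot> z \<cdot> AS s y = y" "Dom E (AS s y) = Dom E s"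
      if s: "s \<in> Arr E" "Cod E s = Dom E bS" "over p (bS \<cdot> s) y" for s y
    proof -
      have "u' \<cdot> z \<in> Arr E" "Dom E (u' \<cdot> z) = Dom E z" using u' z zB by auto
      note * = overD[OF S(3)[OF s] this(1)] this
      then show "AS s y \<in> Arr E" "Cod E (AS s y) = Dom E z" by auto
      then show "u' \<cdot> z \<cdot> AS s y = y" using * u' z zB by simp
      show "Dom E (AS s y) = Dom E s" using * overD(4)[OF s(3) pA] S(1) s by simp
    qed
    \<comment> \<open>\<open>m\<close> is \<Pi> along \<open>p\<close> applied to \<open>z\<close>,
      regarded as a slice arrow from \<open>u' \<cdot> z\<close> to \<open>u'\<close>.\<close>
    obtain m where m: "m \<in> Arr E" "Cod E m = Dom E bT" "bT \<cdot> m = bS"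
      and m_eq: "\<And>h y. h \<in> Arr E \<Longrightarrow> Cod E h = Dom E bS \<Longrightarrow> over p (bS \<cdot> h) y \<Longrightarrow>
        AT (m \<cdot> h) y = z \<cdot> AS h y"
    proof (rule dependent_product_ex[OF dT S(1,2)])
      show "family p u' bS (\<lambda>h y. z \<cdot> AS h y)"
      proof (rule familyI)
        fix h y assume h: "h \<in> Arr E" "Cod E h = Dom E bS" "over p (bS \<cdot> h) y"
        show "over u' y (z \<cdot> AS h y)" using ASD[OF h] z zB u' by (simp add: over_def)
        fix k assume k: "k \<in> Arr E" "Cod E k = Dom E h"
        show "z \<cdot> AS (h \<cdot> k) (y \<cdot> k) = (z \<cdot> AS h y) \<cdot> k"
          using S(4)[OF h k] ASD[OF h] k z by simp
      qed
    qed blast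
    have Dm: "Dom E m = Dom E bS" using m T(1) cmp_arr(2) by metis
    \<comment> \<open>\<open>n\<close> classifies the tautological family, which sends
      \<open>y\<close> at the stage \<open>h\<close> to the pair of \<open>h\<close> and
      \<open>y\<close> in \<open>B\<close>.\<close>
    obtain n where n: "n \<in> Arr E" "Cod E n = Dom E bT" "bT \<cdot> n = u"
      and n_eq: "\<And>h y. h \<in> Arr E \<Longrightarrow> Cod E h = Dom E u \<Longrightarrow> over p (u \<cdot> h) y \<Longrightarrow> AT (n \<cdot> h) y = pr h y"
    proof (rule dependent_product_ex[OF dT u])
      show "family p u' u pr"
        by (rule familyI) (use pr pr_nat u' in \<open>simp_all add: over_def\<close>)
    qed blast
    have Dn: "Dom E n = Dom E u" using n T(1) cmp_arr(2) by metis
    \<comment> \<open>In the pullback of \<open>m\<close> and \<open>n\<close> the images in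
      \<open>B\<close> of the values of a section are forced to be the tautological ones.\<close>
    define b where "b = pb2 m n"
    define A where "A s y = AS (pb1 m n \<cdot> s) (u' \<cdot> y)" for s y
    have mn: "Cod E m = Cod E n" using m n by simp
    have b: "b \<in> Arr E" "Cod E b = Cod E p'" "Dom E b = pb m n"
      using m(1) n(1) mn Dn p' by (simp_all add: b_def)
    have s1: "pb1 m n \<cdot> s \<in> Arr E" "Cod E (pb1 m n \<cdot> s) = Dom E bS" "Dom E (pb1 m n \<cdot> s) = Dom E s"
      "b \<cdot> s \<in> Arr E" "Cod E (b \<cdot> s) = Dom E u" "Dom E (b \<cdot> s) = Dom E s"
      "m \<cdot> pb1 m n \<cdot> s = n \<cdot> b \<cdot> s" "bS \<cdot> pb1 m n \<cdot> s = u \<cdot> b \<cdot> s"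
      if s: "s \<in> Arr E" "Cod E s = Dom E b" for s
    proof -
      show *: "pb1 m n \<cdot> s \<in> Arr E" "Cod E (pb1 m n \<cdot> s) = Dom E bS" "Dom E (pb1 m n \<cdot> s) = Dom E s"
        "b \<cdot> s \<in> Arr E" "Cod E (b \<cdot> s) = Dom E u" "Dom E (b \<cdot> s) = Dom E s"
        using s b m(1) n(1) mn Dm Dn p' by simp_all
      have "m \<cdot> pb1 m n \<cdot> s = (m \<cdot> pb1 m n) \<cdot> s" using m(1) n(1) mn s b by simp
      also have "\<dots> = n \<cdot> b \<cdot> s"
        using m(1) n(1) mn s b pb_commute[OF m(1) n(1) mn, symmetric] by (simp add: b_def)
      finally show mnb: "m \<cdot> pb1 m n \<cdot> s = n \<cdot> b \<cdot> s" .
      have "bS \<cdot> pb1 m n \<cdot> s = bT \<cdot> m \<cdot> pb1 m n \<cdot> s"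
        using cmp_assoc[of "pb1 m n \<cdot> s" m bT] m * T(1) Dm by simp
      also have "\<dots> = u \<cdot> b \<cdot> s"
        unfolding mnb using cmp_assoc[of "b \<cdot> s" n bT] n * T(1) Dn by simp
      finally show "bS \<cdot> pb1 m n \<cdot> s = u \<cdot> b \<cdot> s" .
    qed
    have so: "over p (bS \<cdot> pb1 m n \<cdot> s) (u' \<cdot> y)"
      if s: "s \<in> Arr E" "Cod E s = Dom E b" "over p' (b \<cdot> s) y" for s y
      using over_u'(1)[OF s1(4,5)[OF s(1,2)] s(3)] s1(8)[OF s(1,2)] by simp
    have "dependent_product p' z b A"
    proof (rule dependent_productI)
      fix s y assume s: "s \<in> Arr E" "Cod E s = Dom E b" "over p' (b \<cdot> s) y"
      note t = s1[OF s(1,2)] and o = so[OF s]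
      have "z \<cdot> A s y = AT (m \<cdot> pb1 m n \<cdot> s) (u' \<cdot> y)"
        using m_eq[OF t(1,2) o] by (simp add: A_def)
      also have "\<dots> = pr (b \<cdot> s) (u' \<cdot> y)"
        unfolding t(7) by (rule n_eq[OF t(4,5)]) (use o t(8) in simp)
      also have "\<dots> = y" by (rule over_u'(2)[OF t(4,5) s(3)])
      finally show "over z y (A s y)" using ASD[OF t(1,2) o] by (simp add: over_def A_def)
      fix k assume k: "k \<in> Arr E" "Cod E k = Dom E s"
      note yD = overD[OF s(3) p'(1)]
      show "A (s \<cdot> k) (y \<cdot> k) = A s y \<cdot> k"
        using S(4)[OF t(1,2) o k(1)] k t(3,6) s b yD u' p' m(1) n(1) mn by (simp add: A_def)
    next
      fix x F assume x: "x \<in> Arr E" "Cod E x = Cod E p'" and F: "family p' z x F"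
      have xu: "Cod E x = Dom E u" "u \<cdot> x \<in> Arr E" "Cod E (u \<cdot> x) = Cod E p" "Dom E (u \<cdot> x) = Dom E x"
        using x p' u by simp_all
      have po: "over p' (x \<cdot> h) (pr (x \<cdot> h) y)" "u \<cdot> x \<cdot> h = (u \<cdot> x) \<cdot> h"
        if h: "h \<in> Arr E" "Cod E h = Dom E x" "over p ((u \<cdot> x) \<cdot> h) y" for h y
        using pr_over[of "x \<cdot> h" y] h x xu u by simp_all
      have fam: "family p (u' \<cdot> z) (u \<cdot> x) (\<lambda>h y. F h (pr (x \<cdot> h) y))"
      proof (rule familyI)
        fix h y assume "h \<in> Arr E" "Cod E h = Dom E (u \<cdot> x)" and o: "over p ((u \<cdot> x) \<cdot> h) y"
        then have h: "h \<in> Arr E" "Cod E h = Dom E x" using xu by auto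
        have oz: "over z (pr (x \<cdot> h) y) (F h (pr (x \<cdot> h) y))"
          using familyD(1)[OF F h po(1)[OF h o]] .
        have prD: "u' \<cdot> pr (x \<cdot> h) y = y"
          using pr[of "x \<cdot> h" y] h o x xu u by simp
        show "over (u' \<cdot> z) y (F h (pr (x \<cdot> h) y))"
          using overD[OF oz z(1)] prD u' z zB by (simp add: over_def)
        fix k assume k: "k \<in> Arr E" "Cod E k = Dom E h"
        have "pr (x \<cdot> h \<cdot> k) (y \<cdot> k) = pr (x \<cdot> h) y \<cdot> k"
          using pr_nat[of "x \<cdot> h" y k] h k o x xu u by simp
        then show "F (h \<cdot> k) (pr (x \<cdot> h \<cdot> k) (y \<cdot> k)) = F h (pr (x \<cdot> h) y) \<cdot> k"
          using familyD(2)[OF F h po(1)[OF h o] k] by simp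
      qed
      obtain s0 where s0: "s0 \<in> Arr E" "Cod E s0 = Dom E bS" "bS \<cdot> s0 = u \<cdot> x"
        and s0F: "\<And>h y. h \<in> Arr E \<Longrightarrow> Cod E h = Dom E (u \<cdot> x) \<Longrightarrow> over p ((u \<cdot> x) \<cdot> h) y \<Longrightarrow>
          AS (s0 \<cdot> h) y = F h (pr (x \<cdot> h) y)"
        using dependent_product_ex[OF dS xu(2,3) fam] by blast
      have Ds0: "Dom E s0 = Dom E x" using s0 S(1) xu cmp_arr(2)[of s0 bS] by simp
      \<comment> \<open>\<open>F\<close> takes values in sections of \<open>z\<close>, so its values
        lie over the tautological elements of \<open>B\<close> and \<open>s0\<close> lifts to the
        pullback of \<open>m\<close> and \<open>n\<close>.\<close>
      have ms0: "m \<cdot> s0 = n \<cdot> x"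
      proof (rule dependent_product_ext[OF dT])
        show "m \<cdot> s0 \<in> Arr E" "Cod E (m \<cdot> s0) = Dom E bT" "n \<cdot> x \<in> Arr E" "Cod E (n \<cdot> x) = Dom E bT"
          using m n s0 x xu Dm Dn by simp_all
        have "bT \<cdot> m \<cdot> s0 = u \<cdot> x"
          using cmp_assoc[of s0 m bT] m s0 Dm T(1) by simp
        moreover have "bT \<cdot> n \<cdot> x = u \<cdot> x"
          using cmp_assoc[of x n bT] n x xu Dn T(1) by simp
        ultimately show "bT \<cdot> m \<cdot> s0 = bT \<cdot> n \<cdot> x" by simp
        fix h y assume h0: "h \<in> Arr E" "Cod E h = Dom E (m \<cdot> s0)" "over p (bT \<cdot> (m \<cdot> s0) \<cdot> h) y"
        then have h: "h \<in> Arr E" "Cod E h = Dom E x" using m s0 Dm Ds0 by auto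
        have "bT \<cdot> (m \<cdot> s0) \<cdot> h = (bT \<cdot> m \<cdot> s0) \<cdot> h"
          using h m s0 Dm Ds0 T(1) by simp
        also have "\<dots> = (u \<cdot> x) \<cdot> h" using \<open>bT \<cdot> m \<cdot> s0 = u \<cdot> x\<close> by simp
        finally have o: "over p ((u \<cdot> x) \<cdot> h) y" using h0(3) by simp
        have "bS \<cdot> s0 \<cdot> h = (u \<cdot> x) \<cdot> h"
          using cmp_assoc[of h s0 bS] h s0 Ds0 S(1) by simp
        then have "AT (m \<cdot> s0 \<cdot> h) y = z \<cdot> AS (s0 \<cdot> h) y"
          using m_eq[of "s0 \<cdot> h" y] h s0 Ds0 o by simp
        also have "\<dots> = z \<cdot> F h (pr (x \<cdot> h) y)" using s0F[of h y] h o xu by simp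
        also have "\<dots> = pr (x \<cdot> h) y"
          using overD(3)[OF familyD(1)[OF F h po(1)[OF h o]] z(1)] .
        also have "\<dots> = AT (n \<cdot> x \<cdot> h) y" using n_eq[of "x \<cdot> h" y] h x xu o u by simp
        finally show "AT ((m \<cdot> s0) \<cdot> h) y = AT ((n \<cdot> x) \<cdot> h) y"
          using h m n s0 x xu Dm Dn Ds0 by simp
      qed
      let ?s = "pb_pair m n s0 x"
      have s: "?s \<in> Arr E" "Cod E ?s = Dom E b" "Dom E ?s = Dom E x" "pb1 m n \<cdot> ?s = s0" "b \<cdot> ?s = x"
        using m(1) n(1) mn s0 x xu Dm Dn Ds0 ms0 b(3) by (simp_all add: b_def)
      have "A (?s \<cdot> h) y = F h y" if h: "h \<in> Arr E" "Cod E h = Dom E x" "over p' (x \<cdot> h) y" for h y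
      proof -
        have "pb1 m n \<cdot> ?s \<cdot> h = s0 \<cdot> h"
          using cmp_assoc[of h ?s "pb1 m n"] s b h m(1) n(1) mn by simp
        moreover have xh: "x \<cdot> h \<in> Arr E" "Cod E (x \<cdot> h) = Dom E u" using x xu h by simp_all
        moreover have "over p ((u \<cdot> x) \<cdot> h) (u' \<cdot> y)"
          using over_u'(1)[OF xh h(3)] u x xu h by simp
        ultimately show ?thesis
          using s0F[of h "u' \<cdot> y"] over_u'(2)[OF xh h(3)] h xu by (simp add: A_def)
      qed
      with s show "\<exists>s. s \<in> Arr E \<and> Cod E s = Dom E b \<and> b \<cdot> s = x \<and>
        (\<forall>h y. h \<in> Arr E \<and> Cod E h = Dom E x \<and> over p' (x \<cdot> h) y \<longrightarrow> A (s \<cdot> h) y = F h y)"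
        by blast
    next
      fix s s' assume s: "s \<in> Arr E" "Cod E s = Dom E b" "s' \<in> Arr E" "Cod E s' = Dom E b"
        "b \<cdot> s = b \<cdot> s'" and eq: "\<And>h y. h \<in> Arr E \<Longrightarrow> Cod E h = Dom E s \<Longrightarrow>
          over p' (b \<cdot> s \<cdot> h) y \<Longrightarrow> A (s \<cdot> h) y = A (s' \<cdot> h) y"
      note t = s1[OF s(1,2)] and t' = s1[OF s(3,4)]
      have Ds: "Dom E s' = Dom E s" using t(6) t'(6) s(5) by simp
      \<comment> \<open>One projection agrees by assumption; the other is compared by its values in
        the dependent product \<open>bS\<close>.\<close>
      have "pb1 m n \<cdot> s = pb1 m n \<cdot> s'"
      proof (rule dependent_product_ext[OF dS t(1,2) t'(1,2)])
        show "bS \<cdot> pb1 m n \<cdot> s = bS \<cdot> pb1 m n \<cdot> s'" using t(8) t'(8) s(5) by simp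
        fix h y assume h: "h \<in> Arr E" "Cod E h = Dom E (pb1 m n \<cdot> s)"
          and o: "over p (bS \<cdot> (pb1 m n \<cdot> s) \<cdot> h) y"
        then have hs: "Cod E h = Dom E s" using t by simp
        have "bS \<cdot> (pb1 m n \<cdot> s) \<cdot> h = (bS \<cdot> pb1 m n \<cdot> s) \<cdot> h"
          using cmp_assoc[of h "pb1 m n \<cdot> s" bS] h t S(1) by simp
        also have "\<dots> = u \<cdot> b \<cdot> s \<cdot> h"
          unfolding t(8) using h hs s(1,2) b u p' by simp
        finally have o1: "over p (u \<cdot> b \<cdot> s \<cdot> h) y" using o by simp
        have bsh: "b \<cdot> s \<cdot> h \<in> Arr E" "Cod E (b \<cdot> s \<cdot> h) = Dom E u" using h hs s(1,2) b p' by simp_all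
        show "AS ((pb1 m n \<cdot> s) \<cdot> h) y = AS ((pb1 m n \<cdot> s') \<cdot> h) y"
          using eq[OF h(1) hs pr_over[OF bsh o1]] pr[OF bsh o1] h(1) hs Ds s(1-4) b m(1) n(1) mn
          by (simp add: A_def)
      qed
      then show "s = s'"
        using s b m(1) n(1) mn unfolding b_def by - (rule pb_ext[of m n], simp_all)
    qed (use b in simp_all)
    then show ?thesis by blast
  qed
  with p'(1) show ?thesis by (simp add: exponentiable_iff)
qed

lemma exponentiable_pb1:
  assumes "exponentiable p" "u \<in> Arr E" "Cod E u = Cod E p"
  shows "exponentiable (pb1 u p)"
  using exponentiable_pullback[OF assms is_pullback_pb] exponentiableD[OF assms(1)] assms by simp

lemma is_pullbackI:
  assumes "a \<in> hom E P (Dom E f)" "b \<in> hom E P (Dom E g)" "f \<cdot> a = g \<cdot> b"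
    and "\<And>X u v. u \<in> hom E X (Dom E f) \<Longrightarrow> v \<in> hom E X (Dom E g) \<Longrightarrow> f \<cdot> u = g \<cdot> v \<Longrightarrow>
      \<exists>h. h \<in> hom E X P \<and> a \<cdot> h = u \<and> b \<cdot> h = v"
    and "\<And>h k. h \<in> Arr E \<Longrightarrow> k \<in> Arr E \<Longrightarrow> Cod E h = P \<Longrightarrow> Cod E k = P \<Longrightarrow> Dom E h = Dom E k \<Longrightarrow>
      a \<cdot> h = a \<cdot> k \<Longrightarrow> b \<cdot> h = b \<cdot> k \<Longrightarrow> h = k"
  shows "is_pullback f g (P, a, b)"
  unfolding is_pullback_def prod.case
proof (intro conjI allI ballI impI)
  fix X u v assume "u \<in> hom E X (Dom E f)" "v \<in> hom E X (Dom E g)" "f \<cdot> u = g \<cdot> v"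
  from assms(4)[OF this] show "\<exists>!h. h \<in> hom E X P \<and> a \<cdot> h = u \<and> b \<cdot> h = v"
    using assms(5) by (auto simp: hom_def)
qed (use assms in auto)

text \<open>A product of two morphisms factors into pullbacks of each of them along projections.\<close>

lemma exponentiable_prd_map:
  assumes p: "exponentiable p" and q: "exponentiable q"
  shows "exponentiable (prd_map p q)"
proof -
  note A [simp] = exponentiableD[OF p] exponentiableD[OF q]
  let ?f = "prd_map p (Ident E (Cod E q))" and ?g = "prd_map (Ident E (Dom E p)) q"
  have "is_pullback (pr1 (Cod E p) (Cod E q)) p
    (prd (Dom E p) (Cod E q), ?f, pr1 (Dom E p) (Cod E q))"
  proof (rule is_pullbackI)
    fix X u v assume u: "u \<in> hom E X (Dom E (pr1 (Cod E p) (Cod E q)))" and v: "v \<in> hom E X (Dom E p)"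
      and uv: "pr1 (Cod E p) (Cod E q) \<cdot> u = p \<cdot> v"
    have "?f \<cdot> tuple v (pr2 (Cod E p) (Cod E q) \<cdot> u) = u"
      using u v uv tuple_eta[of "Cod E p" "Cod E q" u] by (simp add: hom_def)
    with u v show "\<exists>h. h \<in> hom E X (prd (Dom E p) (Cod E q)) \<and> ?f \<cdot> h = u \<and> pr1 (Dom E p) (Cod E q) \<cdot> h = v"
      by (intro exI[of _ "tuple v (pr2 (Cod E p) (Cod E q) \<cdot> u)"]) (auto simp: hom_def)
  next
    fix h k assume hk: "h \<in> Arr E" "k \<in> Arr E" "Cod E h = prd (Dom E p) (Cod E q)"
      "Cod E k = prd (Dom E p) (Cod E q)" "Dom E h = Dom E k" "?f \<cdot> h = ?f \<cdot> k"
      "pr1 (Dom E p) (Cod E q) \<cdot> h = pr1 (Dom E p) (Cod E q) \<cdot> k"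
    have *: "pr2 (Cod E p) (Cod E q) \<cdot> ?f \<cdot> l = pr2 (Dom E p) (Cod E q) \<cdot> l"
      if "l \<in> Arr E" "Cod E l = prd (Dom E p) (Cod E q)" for l
      using that by (simp add: prd_map_def)
    show "h = k"
      using hk *[of h] *[of k] by - (rule tuple_ext[of "Dom E p" "Cod E q"], simp_all)
  qed (auto simp: prd_map_def)
  then have f: "exponentiable ?f" by (rule exponentiable_pullback[OF p, rotated 2]) simp_all
  have "is_pullback (pr2 (Dom E p) (Cod E q)) q
    (prd (Dom E p) (Dom E q), ?g, pr2 (Dom E p) (Dom E q))"
  proof (rule is_pullbackI)
    fix X u v assume u: "u \<in> hom E X (Dom E (pr2 (Dom E p) (Cod E q)))" and v: "v \<in> hom E X (Dom E q)"
      and uv: "pr2 (Dom E p) (Cod E q) \<cdot> u = q \<cdot> v"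
    have "?g \<cdot> tuple (pr1 (Dom E p) (Cod E q) \<cdot> u) v = u"
      using u v uv tuple_eta[of "Dom E p" "Cod E q" u] by (simp add: hom_def)
    with u v show "\<exists>h. h \<in> hom E X (prd (Dom E p) (Dom E q)) \<and> ?g \<cdot> h = u \<and> pr2 (Dom E p) (Dom E q) \<cdot> h = v"
      by (intro exI[of _ "tuple (pr1 (Dom E p) (Cod E q) \<cdot> u) v"]) (auto simp: hom_def)
  next
    fix h k assume hk: "h \<in> Arr E" "k \<in> Arr E" "Cod E h = prd (Dom E p) (Dom E q)"
      "Cod E k = prd (Dom E p) (Dom E q)" "Dom E h = Dom E k" "?g \<cdot> h = ?g \<cdot> k"
      "pr2 (Dom E p) (Dom E q) \<cdot> h = pr2 (Dom E p) (Dom E q) \<cdot> k"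
    have *: "pr1 (Dom E p) (Cod E q) \<cdot> ?g \<cdot> l = pr1 (Dom E p) (Dom E q) \<cdot> l"
      if "l \<in> Arr E" "Cod E l = prd (Dom E p) (Dom E q)" for l
      using that by (simp add: prd_map_def)
    show "h = k"
      using hk *[of h] *[of k] by - (rule tuple_ext[of "Dom E p" "Dom E q"], simp_all)
  qed (auto simp: prd_map_def)
  then have g: "exponentiable ?g" by (rule exponentiable_pullback[OF q, rotated 2]) simp_all
  have "prd_map p q = ?f \<cdot> ?g" by (simp add: prd_map_def)
  then show ?thesis using exponentiable_cmp[OF f g] by simp
qed

section \<open>Positions and directions\<close>

definition pos :: "'a \<Rightarrow> 'a \<Rightarrow> bool" where
  "pos p s \<longleftrightarrow> s \<in> Arr E \<and> Cod E s = Cod E p"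

text \<open>A composite under an opaque name, as is \<open>act_pos\<close> below. Rewriting with
  associativity would otherwise dissolve the terms on which the rules of the calculus match.\<close>

definition base_at :: "'a \<Rightarrow> 'a \<Rightarrow> 'a \<Rightarrow> 'a" where
  "base_at p q s = base p q \<cdot> s"

definition act_pos :: "'a poly_arr \<Rightarrow> 'a \<Rightarrow> 'a" where
  "act_pos \<phi> s = on_pos \<phi> \<cdot> s"

lemma posD: "pos p s \<Longrightarrow> s \<in> Arr E" "pos p s \<Longrightarrow> Cod E s = Cod E p"
  by (auto simp: pos_def)

lemma pos_cmp: "pos p s \<Longrightarrow> k \<in> Arr E \<Longrightarrow> Cod E k = Dom E s \<Longrightarrow> pos p (s \<cdot> k)"
  by (auto simp: pos_def)

lemma pos_Ident: "p \<in> Arr E \<Longrightarrow> pos p (Ident E (Cod E p))"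
  by (simp add: pos_def)

text \<open>The two outer components of the counit triple are forced; its third component is the
  arrow from which \<open>ev\<close> is built.\<close>

lemma counit_hom:
  assumes p: "p \<in> Arr E" and z: "z \<in> Arr E" "Cod E z = Dom E p"
    and adj: "is_adjunction (slice E (Cod E p)) (slice E (Dom E p)) (Delta p) G \<eta> \<epsilon>"
  obtains e where "\<epsilon> z = (pb2 (fobj G z) p, z, e)" "e \<in> Arr E" "Dom E e = pb (fobj G z) p"
    "Cod E e = Dom E z" "z \<cdot> e = pb2 (fobj G z) p"
proof -
  have zo: "z \<in> Obj (slice E (Dom E p))" using z by simp
  have "is_functor (slice E (Dom E p)) (slice E (Cod E p)) G" using adj by (simp add: is_adjunction_def)
  from functor_Obj[OF this zo] have b: "fobj G z \<in> Arr E" "Cod E (fobj G z) = Cod E p" by auto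
  have "\<epsilon> z \<in> hom (slice E (Dom E p)) (fobj (Delta p) (fobj G z)) z"
    using adj zo unfolding is_adjunction_def is_nat_trans_def
    by (simp add: comp_functor_def id_functor_def)
  then show thesis
    using b p by (elim hom_slice_cases) (rule that, simp_all)
qed

section \<open>The calculus of positions and directions of a composite of two polynomials\<close>

context
  fixes p q
  assumes p: "exponentiable p" and q: "exponentiable q"
begin

lemmas pA = exponentiableD[OF p] and qA = exponentiableD[OF q]

text \<open>The functor, unit and counit were selected jointly by one choice, so \<open>Pi p\<close>
  and \<open>Pi_counit p\<close> belong to the same adjunction.\<close>

lemma Pi_adjunction:
  "\<exists>\<eta>. is_adjunction (slice E (Cod E p)) (slice E (Dom E p)) (Delta p) (Pi p) \<eta> (Pi_counit p)"
proof -
  have "\<exists>t. case t of (G, \<eta>, \<epsilon>) \<Rightarrow>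
      is_adjunction (slice E (Cod E p)) (slice E (Dom E p)) (Delta p) G \<eta> \<epsilon>"
    using p by (auto simp: exponentiable_def)
  then have "case Pi_adj p of (G, \<eta>, \<epsilon>) \<Rightarrow>
      is_adjunction (slice E (Cod E p)) (slice E (Dom E p)) (Delta p) G \<eta> \<epsilon>"
    unfolding Pi_adj_def by (rule someI_ex)
  then show ?thesis by (auto simp: Pi_def Pi_counit_def split: prod.splits)
qed

text \<open>A section of the projection \<open>pr2 (Cod E q) (Dom E p)\<close> at \<open>y\<close>
  is a pair with second component \<open>y\<close>, so only the first component carries information,
  and \<open>apply_at\<close> extracts it. Families of sections thereby become functions from
  directions of \<open>p\<close> to positions of \<open>q\<close>.\<close>

lemma dependent_product_base:
  obtains A where "dependent_product p (pr2 (Cod E q) (Dom E p)) (base p q) A"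
    "\<And>s y. s \<in> Arr E \<Longrightarrow> Cod E s = Dom E (base p q) \<Longrightarrow> over p (base p q \<cdot> s) y \<Longrightarrow>
      A s y = tuple (apply_at p q s y) y"
    "ev p q \<in> Arr E" "Dom E (ev p q) = pb (base p q) p" "Cod E (ev p q) = Cod E q"
proof -
  let ?z = "pr2 (Cod E q) (Dom E p)"
  have z: "?z \<in> Arr E" "Cod E ?z = Dom E p" using pA qA by simp_all
  obtain \<eta> where adj: "is_adjunction (slice E (Cod E p)) (slice E (Dom E p)) (Delta p) (Pi p) \<eta> (Pi_counit p)"
    using Pi_adjunction by blast
  obtain e where e: "Pi_counit p ?z = (pb2 (base p q) p, ?z, e)" "e \<in> Arr E" "Dom E e = pb (base p q) p"
    "Cod E e = Dom E ?z"
    using counit_hom[OF pA z adj] unfolding base_def by metis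
  define A where "A s y = e \<cdot> pb_pair (base p q) p s y" for s y
  have dp: "dependent_product p ?z (base p q) A"
    using adjunction_dependent_product[OF pA z adj] e(1) by (simp add: A_def[abs_def] base_def)
  have ev: "ev p q = pr1 (Cod E q) (Dom E p) \<cdot> e" using e(1) by (simp add: ev_def)
  have "A s y = tuple (apply_at p q s y) y"
    if s: "s \<in> Arr E" "Cod E s = Dom E (base p q)" "over p (base p q \<cdot> s) y" for s y
  proof -
    note d = dependent_productD[OF dp]
    note A = overD[OF d(3)[OF s] z(1)]
    have "apply_at p q s y = pr1 (Cod E q) (Dom E p) \<cdot> A s y"
      using over_pb_pair[OF d(1) pA d(2) s] e pA qA d(1,2) by (simp add: apply_at_def ev A_def)
    then show ?thesis
      using tuple_eta[of "Cod E q" "Dom E p" "A s y"] A pA qA by simp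
  qed
  moreover have "ev p q \<in> Arr E" "Dom E (ev p q) = pb (base p q) p" "Cod E (ev p q) = Cod E q"
    using e pA qA by (simp_all add: ev)
  ultimately show thesis using that dp by blast
qed

lemma base_arr: "base p q \<in> Arr E" "Cod E (base p q) = Cod E p"
  and ev_arr: "ev p q \<in> Arr E" "Dom E (ev p q) = pb (base p q) p" "Cod E (ev p q) = Cod E q"
  using dependent_product_base dependent_productD(1,2) by metis+

lemma comp_obj_arr:
  "p \<triangleleft> q \<in> Arr E" "Cod E (p \<triangleleft> q) = Dom E (base p q)" "Dom E (p \<triangleleft> q) = pb (ev p q) q"
  using base_arr ev_arr pA qA by (simp_all add: comp_obj_def)

text \<open>\<open>p \<triangleleft> q\<close> is a pullback of \<open>q\<close> along
  \<open>ev p q\<close> followed by a pullback of \<open>p\<close> along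
  \<open>base p q\<close>.\<close>

lemma exponentiable_comp_obj: "exponentiable (p \<triangleleft> q)"
  unfolding comp_obj_def
  using base_arr ev_arr pA qA by (intro exponentiable_cmp exponentiable_pb1 p q) simp_all

lemma pos_comp_obj: "pos (p \<triangleleft> q) s \<longleftrightarrow> s \<in> Arr E \<and> Cod E s = Dom E (base p q)"
  by (simp add: pos_def comp_obj_arr)

lemma pos_base_at: "pos (p \<triangleleft> q) s \<Longrightarrow> pos p (base_at p q s)"
  and Dom_base_at: "pos (p \<triangleleft> q) s \<Longrightarrow> Dom E (base_at p q s) = Dom E s"
  and base_at_cmp: "pos (p \<triangleleft> q) s \<Longrightarrow> k \<in> Arr E \<Longrightarrow> Cod E k = Dom E s \<Longrightarrow>
    base_at p q s \<cdot> k = base_at p q (s \<cdot> k)"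
  using base_arr by (simp_all add: comp_obj_arr pos_def base_at_def)

lemma pos_apply_at: "pos (p \<triangleleft> q) s \<Longrightarrow> over p (base_at p q s) y \<Longrightarrow> pos q (apply_at p q s y)"
  and Dom_apply_at: "pos (p \<triangleleft> q) s \<Longrightarrow> over p (base_at p q s) y \<Longrightarrow> Dom E (apply_at p q s y) = Dom E s"
  and apply_at_cmp: "pos (p \<triangleleft> q) s \<Longrightarrow> over p (base_at p q s) y \<Longrightarrow> k \<in> Arr E \<Longrightarrow> Cod E k = Dom E s \<Longrightarrow>
    apply_at p q s y \<cdot> k = apply_at p q (s \<cdot> k) (y \<cdot> k)"
  using over_pb_pair[OF base_arr(1) pA base_arr(2), of s y] ev_arr
  by (simp_all add: comp_obj_arr pos_def base_at_def apply_at_def)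

text \<open>Function extensionality, from uniqueness in the dependent product. Values at the stage
  of \<open>s\<close> alone would not suffice, as the fibre may have too few elements there.\<close>

lemma pos_ext:
  assumes s: "pos (p \<triangleleft> q) s" and t: "pos (p \<triangleleft> q) t" and eq: "base_at p q s = base_at p q t"
    and app: "\<And>k y. k \<in> Arr E \<Longrightarrow> Cod E k = Dom E s \<Longrightarrow> over p (base_at p q (s \<cdot> k)) y \<Longrightarrow>
      apply_at p q (s \<cdot> k) y = apply_at p q (t \<cdot> k) y"
  shows "s = t"
proof -
  obtain A where dp: "dependent_product p (pr2 (Cod E q) (Dom E p)) (base p q) A"
    and A: "\<And>s y. s \<in> Arr E \<Longrightarrow> Cod E s = Dom E (base p q) \<Longrightarrow> over p (base p q \<cdot> s) y \<Longrightarrow>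
      A s y = tuple (apply_at p q s y) y"
    by (rule dependent_product_base) blast
  have st: "s \<in> Arr E" "Cod E s = Dom E (base p q)" "t \<in> Arr E" "Cod E t = Dom E (base p q)"
    using s t by (auto simp: pos_comp_obj)
  have D: "Dom E t = Dom E s" using eq Dom_base_at s t by metis
  show ?thesis
  proof (rule dependent_product_ext[OF dp st])
    show "base p q \<cdot> s = base p q \<cdot> t" using eq by (simp add: base_at_def)
    fix k y assume k: "k \<in> Arr E" "Cod E k = Dom E s" "over p (base p q \<cdot> s \<cdot> k) y"
    have "base p q \<cdot> t \<cdot> k = base p q \<cdot> s \<cdot> k"
      using eq base_at_cmp[OF s k(1,2)] base_at_cmp[OF t k(1)] k(2) D by (simp add: base_at_def)
    then show "A (s \<cdot> k) y = A (t \<cdot> k) y"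
      using app[OF k(1,2)] k st D by (simp add: A base_at_def)
  qed
qed

text \<open>A family of positions of \<open>q\<close> indexed by the directions at \<open>x\<close> is the same as an
  arrow out of the pullback, by evaluation at the generic direction.\<close>

lemma position_family:
  assumes x: "pos p x"
    and F: "\<And>h y. h \<in> Arr E \<Longrightarrow> Cod E h = Dom E x \<Longrightarrow> over p (x \<cdot> h) y \<Longrightarrow> pos q (F h y) \<and>
        Dom E (F h y) = Dom E h"
    and F_nat: "\<And>h y k. h \<in> Arr E \<Longrightarrow> Cod E h = Dom E x \<Longrightarrow> over p (x \<cdot> h) y \<Longrightarrow> k \<in> Arr E \<Longrightarrow>
        Cod E k = Dom E h \<Longrightarrow> F (h \<cdot> k) (y \<cdot> k) = F h y \<cdot> k"
    and f: "f = F (pb1 x p) (pb2 x p)"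
  shows "pos (p \<triangleleft> q) (position p q x f)" "base_at p q (position p q x f) = x"
    "Dom E (position p q x f) = Dom E x"
    "\<And>h y. h \<in> Arr E \<Longrightarrow> Cod E h = Dom E x \<Longrightarrow> over p (x \<cdot> h) y \<Longrightarrow>
      apply_at p q (position p q x f \<cdot> h) y = F h y"
proof -
  obtain A where dp: "dependent_product p (pr2 (Cod E q) (Dom E p)) (base p q) A"
    and A: "\<And>s y. s \<in> Arr E \<Longrightarrow> Cod E s = Dom E (base p q) \<Longrightarrow> over p (base p q \<cdot> s) y \<Longrightarrow>
      A s y = tuple (apply_at p q s y) y"
    by (rule dependent_product_base) blast
  have xA: "x \<in> Arr E" "Cod E x = Cod E p" using x by (auto simp: pos_def)
  have D: "Dom E y = Dom E h" if "h \<in> Arr E" "Cod E h = Dom E x" "over p (x \<cdot> h) y" for h y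
    using overD(4)[OF that(3) pA] that xA by simp
  \<comment> \<open>Pairing each value with \<open>y\<close> turns a function into \<open>q\<close>
    into a family of sections of the projection.\<close>
  have fam: "family p (pr2 (Cod E q) (Dom E p)) x (\<lambda>h y. tuple (F h y) y)"
  proof (rule familyI)
    fix h y assume h: "h \<in> Arr E" "Cod E h = Dom E x" "over p (x \<cdot> h) y"
    note y = overD[OF h(3) pA]
    show "over (pr2 (Cod E q) (Dom E p)) y (tuple (F h y) y)"
      using F[OF h] y D[OF h] pA qA by (simp add: over_def pos_def)
    fix k assume k: "k \<in> Arr E" "Cod E k = Dom E h"
    show "tuple (F (h \<cdot> k) (y \<cdot> k)) (y \<cdot> k) = tuple (F h y) y \<cdot> k"
      using F_nat[OF h k] F[OF h] y(1,2) D[OF h] k by (simp add: pos_def)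
  qed
  obtain s where s: "s \<in> Arr E" "Cod E s = Dom E (base p q)" "base p q \<cdot> s = x"
    and sF: "\<And>h y. h \<in> Arr E \<Longrightarrow> Cod E h = Dom E x \<Longrightarrow> over p (x \<cdot> h) y \<Longrightarrow> A (s \<cdot> h) y = tuple (F h y) y"
    using dependent_product_ex[OF dp xA fam] by blast
  have Ds: "Dom E s = Dom E x" using s base_arr cmp_arr(2)[of s "base p q"] by simp
  have bs: "base p q \<cdot> s \<cdot> h = x \<cdot> h" if "h \<in> Arr E" "Cod E h = Dom E x" for h
    using cmp_assoc[of h s "base p q"] that s Ds base_arr by simp
  have app: "apply_at p q (s \<cdot> h) y = F h y"
    if h: "h \<in> Arr E" "Cod E h = Dom E x" "over p (x \<cdot> h) y" for h y
  proof -
    have sh: "s \<cdot> h \<in> Arr E" "Cod E (s \<cdot> h) = Dom E (base p q)" "Dom E (s \<cdot> h) = Dom E h"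
      "over p (base p q \<cdot> s \<cdot> h) y"
      using s(1,2) h Ds bs by simp_all
    have "pos q (apply_at p q (s \<cdot> h) y)" "Dom E (apply_at p q (s \<cdot> h) y) = Dom E h"
      using pos_apply_at[of "s \<cdot> h" y] Dom_apply_at[of "s \<cdot> h" y] sh
      by (simp_all add: pos_comp_obj base_at_def)
    then show ?thesis
      using sF[OF h] A[OF sh(1,2,4)] F[OF h] overD[OF h(3) pA] D[OF h]
      by (simp add: tuple_inject pos_def)
  qed
  \<comment> \<open>The definition of \<open>position\<close> prescribes only the value at the
    generic direction; \<open>?P\<close> has to be shown to have a unique solution.\<close>
  let ?P = "\<lambda>s. s \<in> hom E (Dom E x) (Dom E (base p q)) \<and> base p q \<cdot> s = x \<and>
    apply_at p q (s \<cdot> pb1 x p) (pb2 x p) = f"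
  have gen: "over p (x \<cdot> pb1 x p) (pb2 x p)" using over_pb[OF xA(1) pA xA(2)] .
  have "?P s" using s Ds app[OF _ _ gen] xA pA f by auto
  \<comment> \<open>A solution has the right value at the generic direction, hence by naturality at
    all directions, and extensionality applies.\<close>
  moreover have "t = s" if t: "?P t" for t
  proof (rule pos_ext)
    have tA: "t \<in> Arr E" "Dom E t = Dom E x" "Cod E t = Dom E (base p q)" "base p q \<cdot> t = x"
      using t by (auto simp: hom_def)
    then show pt: "pos (p \<triangleleft> q) t" by (simp add: pos_comp_obj)
    show "pos (p \<triangleleft> q) s" using s by (simp add: pos_comp_obj)
    show "base_at p q t = base_at p q s" using tA s by (simp add: base_at_def)
    fix k y assume k: "k \<in> Arr E" "Cod E k = Dom E t" "over p (base_at p q (t \<cdot> k)) y"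
    have kx: "Cod E k = Dom E x" using k tA by simp
    have "base_at p q (t \<cdot> k) = x \<cdot> k" using base_at_cmp[OF pt k(1,2)] tA by (simp add: base_at_def)
    then have o: "over p (x \<cdot> k) y" using k by simp
    note pp = over_pb_pair[OF xA(1) pA xA(2) k(1) kx o]
    have "pos (p \<triangleleft> q) (t \<cdot> pb1 x p)" using pos_cmp[OF pt] xA pA tA by simp
    moreover have "base_at p q (t \<cdot> pb1 x p) = x \<cdot> pb1 x p"
      using base_at_cmp[OF pt, of "pb1 x p"] xA pA tA by (simp add: base_at_def)
    ultimately have "apply_at p q (t \<cdot> pb1 x p) (pb2 x p) \<cdot> pb_pair x p k y = apply_at p q (t \<cdot> k) y"
      using apply_at_cmp[of "t \<cdot> pb1 x p" "pb2 x p" "pb_pair x p k y"] gen pp tA xA pA by simp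
    moreover have "f \<cdot> pb_pair x p k y = F k y"
      using F_nat[OF _ _ gen, of "pb_pair x p k y"] pp xA pA f by simp
    ultimately show "apply_at p q (t \<cdot> k) y = apply_at p q (s \<cdot> k) y"
      using app[OF k(1) kx o] t by simp
  qed
  ultimately have P: "position p q x f = s" unfolding position_def by (rule the_equality)
  show "pos (p \<triangleleft> q) (position p q x f)" "base_at p q (position p q x f) = x"
    "Dom E (position p q x f) = Dom E x"
    using s Ds by (simp_all add: P pos_comp_obj base_at_def)
  show "\<And>h y. h \<in> Arr E \<Longrightarrow> Cod E h = Dom E x \<Longrightarrow> over p (x \<cdot> h) y \<Longrightarrow>
      apply_at p q (position p q x f \<cdot> h) y = F h y"
    using app by (simp add: P)
qed

lemma dir_arr: "dir1 p q \<in> Arr E" "Dom E (dir1 p q) = Dom E (p \<triangleleft> q)" "Cod E (dir1 p q) = Dom E p"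
  "dir2 p q \<in> Arr E" "Dom E (dir2 p q) = Dom E (p \<triangleleft> q)" "Cod E (dir2 p q) = Dom E q"
  using base_arr ev_arr pA qA by (simp_all add: dir1_def dir2_def comp_obj_arr)

text \<open>Rules of pairing for the iterated pullback that is the domain of
  \<open>p \<triangleleft> q\<close>: a direction is two nested uses of \<open>pb_pair\<close>, and
  each projection undoes one of them.\<close>

lemma
  assumes s: "pos (p \<triangleleft> q) s" and y: "over p (base_at p q s) y" and z: "over q (apply_at p q s y) z"
  shows over_direction: "over (p \<triangleleft> q) s (direction p q s y z)"
    and Dom_direction: "Dom E (direction p q s y z) = Dom E s"
    and dir1_direction: "dir1 p q \<cdot> direction p q s y z = y"
    and dir2_direction: "dir2 p q \<cdot> direction p q s y z = z"
    and direction_cmp: "k \<in> Arr E \<Longrightarrow> Cod E k = Dom E s \<Longrightarrow>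
      direction p q s y z \<cdot> k = direction p q (s \<cdot> k) (y \<cdot> k) (z \<cdot> k)"
proof -
  have sA: "s \<in> Arr E" "Cod E s = Dom E (base p q)" using s by (auto simp: pos_comp_obj)
  have y': "over p (base p q \<cdot> s) y" using y by (simp add: base_at_def)
  note pp = over_pb_pair[OF base_arr(1) pA base_arr(2) sA y']
  note zD = overD[OF z qA]
  have w: "ev p q \<cdot> pb_pair (base p q) p s y = q \<cdot> z" using zD by (simp add: apply_at_def)
  note p2 = pb_pair[OF ev_arr(1) qA ev_arr(3) pp(1) zD(1) _ zD(2) w]
  note arrs = base_arr ev_arr pA qA pp p2 sA
  show "over (p \<triangleleft> q) s (direction p q s y z)" "Dom E (direction p q s y z) = Dom E s"
    "dir1 p q \<cdot> direction p q s y z = y" "dir2 p q \<cdot> direction p q s y z = z"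
    using arrs by (simp_all add: over_def direction_def comp_obj_def dir1_def dir2_def)
  show "direction p q s y z \<cdot> k = direction p q (s \<cdot> k) (y \<cdot> k) (z \<cdot> k)"
    if "k \<in> Arr E" "Cod E k = Dom E s"
    using arrs that zD(1,2) w by (simp add: direction_def)
qed

text \<open>The converse of the preceding rules. They show that the typing of the second component
  depends on the first, as for dependent pairs.\<close>

lemma
  assumes s: "pos (p \<triangleleft> q) s" and d: "over (p \<triangleleft> q) s d"
  shows over_dir1: "over p (base_at p q s) (dir1 p q \<cdot> d)"
    and over_dir2: "over q (apply_at p q s (dir1 p q \<cdot> d)) (dir2 p q \<cdot> d)"
    and direction_eta: "direction p q s (dir1 p q \<cdot> d) (dir2 p q \<cdot> d) = d"
proof -
  have sA: "s \<in> Arr E" "Cod E s = Dom E (base p q)" using s by (auto simp: pos_comp_obj)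
  note dD = overD[OF d comp_obj_arr(1)]
  note arrs = base_arr ev_arr pA qA sA comp_obj_arr(3)
  let ?u = "pb1 (ev p q) q \<cdot> d"
  have u: "?u \<in> Arr E" "Cod E ?u = pb (base p q) p" "Dom E ?u = Dom E s" using dD arrs by simp_all
  have s_eq: "s = pb1 (base p q) p \<cdot> ?u" using dD arrs by (simp add: comp_obj_def)
  have y_eq: "dir1 p q \<cdot> d = pb2 (base p q) p \<cdot> ?u" using dD(1,2) arrs by (simp add: dir1_def)
  have yA: "dir1 p q \<cdot> d \<in> Arr E" "Cod E (dir1 p q \<cdot> d) = Dom E p"
    using dD(1,2) dir_arr by simp_all
  have "p \<cdot> dir1 p q \<cdot> d = (p \<cdot> pb2 (base p q) p) \<cdot> ?u" using y_eq u arrs by simp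
  also have "\<dots> = base p q \<cdot> s" unfolding s_eq using u arrs by (simp add: pb_commute)
  finally show o: "over p (base_at p q s) (dir1 p q \<cdot> d)" using yA by (simp add: over_def base_at_def)
  then have y': "over p (base p q \<cdot> s) (dir1 p q \<cdot> d)" by (simp add: base_at_def)
  note pp = over_pb_pair[OF base_arr(1) pA base_arr(2) sA y']
  \<comment> \<open>The first projection of \<open>d\<close> to \<open>pb (base p q) p\<close> is
    recovered from the position and the \<open>dir1\<close> component.\<close>
  have uu: "pb_pair (base p q) p s (dir1 p q \<cdot> d) = ?u"
  proof (rule pb_ext[of "base p q" p])
    show "pb1 (base p q) p \<cdot> pb_pair (base p q) p s (dir1 p q \<cdot> d) = pb1 (base p q) p \<cdot> ?u"
      unfolding pp(4) by (rule s_eq)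
    show "pb2 (base p q) p \<cdot> pb_pair (base p q) p s (dir1 p q \<cdot> d) = pb2 (base p q) p \<cdot> ?u"
      unfolding pp(5) by (rule y_eq)
  qed (use pp u base_arr pA in simp_all)
  have zA: "dir2 p q \<cdot> d \<in> Arr E" "Cod E (dir2 p q \<cdot> d) = Dom E q" "Dom E (dir2 p q \<cdot> d) = Dom E s"
    using dD(1,2,4) dir_arr by simp_all
  have "q \<cdot> dir2 p q \<cdot> d = (q \<cdot> pb2 (ev p q) q) \<cdot> d" using dD(1,2) arrs by (simp add: dir2_def)
  also have "\<dots> = ev p q \<cdot> ?u" using dD(1,2) arrs by (simp add: pb_commute)
  finally have w: "q \<cdot> dir2 p q \<cdot> d = ev p q \<cdot> ?u" .
  then show "over q (apply_at p q s (dir1 p q \<cdot> d)) (dir2 p q \<cdot> d)"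
    using zA by (simp add: over_def apply_at_def uu)
  show "direction p q s (dir1 p q \<cdot> d) (dir2 p q \<cdot> d) = d"
    unfolding direction_def uu
    using u zA w arrs dD(1,2) by - (rule pb_ext[of "ev p q" q], simp_all add: dir2_def)
qed

end

declare exponentiable_comp_obj [simp] exponentiable_prd_map [simp] pos_base_at [simp] Dom_base_at [simp]
  base_at_cmp [simp] pos_apply_at [simp] Dom_apply_at [simp] apply_at_cmp [simp] over_direction [simp]
  Dom_direction [simp] dir1_direction [simp] dir2_direction [simp] direction_cmp [simp]

lemma exponentiable_y_poly [simp]: "exponentiable y_poly"
  by (simp add: y_poly_def exponentiable_Ident)

lemma y_poly_arr: "y_poly \<in> Arr E" "Dom E y_poly = one" "Cod E y_poly = one"
  by (simp_all add: y_poly_def)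

section \<open>Morphisms of polynomials as natural actions\<close>

lemma is_poly_arr_src_tgt [simp]: "is_poly_arr \<phi> \<Longrightarrow> exponentiable (src \<phi>)" "is_poly_arr \<phi> \<Longrightarrow> exponentiable (tgt \<phi>)"
  by (simp_all add: is_poly_arr_def)

lemma is_poly_arr_arrs:
  assumes "is_poly_arr \<phi>"
  shows "src \<phi> \<in> Arr E" "tgt \<phi> \<in> Arr E" "on_pos \<phi> \<in> Arr E" "Dom E (on_pos \<phi>) = Cod E (src \<phi>)"
    "Cod E (on_pos \<phi>) = Cod E (tgt \<phi>)" "on_dir \<phi> \<in> Arr E"
    "Dom E (on_dir \<phi>) = pb (on_pos \<phi>) (tgt \<phi>)" "Cod E (on_dir \<phi>) = Dom E (src \<phi>)"
    "src \<phi> \<cdot> on_dir \<phi> = pb1 (on_pos \<phi>) (tgt \<phi>)"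
  using assms exponentiableD unfolding is_poly_arr_def hom_def by blast+

lemma
  assumes \<phi>: "is_poly_arr \<phi>" and s: "pos (src \<phi>) s"
  shows pos_act_pos [simp]: "tgt \<phi> = q \<Longrightarrow> pos q (act_pos \<phi> s)"
    and Dom_act_pos [simp]: "Dom E (act_pos \<phi> s) = Dom E s"
    and act_pos_cmp [simp]: "k \<in> Arr E \<Longrightarrow> Cod E k = Dom E s \<Longrightarrow> act_pos \<phi> s \<cdot> k = act_pos \<phi> (s \<cdot> k)"
  using is_poly_arr_arrs[OF \<phi>] s by (auto simp: pos_def act_pos_def)

text \<open>The defining equation of \<open>on_dir\<close> states that the action stays over the
  position \<open>s\<close>. The premises \<open>src \<phi> = p\<close> and \<open>t = s\<close> are
  equations instead of instances, so that the rule still matches after the source or the position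
  has been rewritten.\<close>

lemma
  assumes \<phi>: "is_poly_arr \<phi>" and s: "pos (src \<phi>) s" and d: "over (tgt \<phi>) (act_pos \<phi> s) d"
  shows over_act_dir [simp]: "src \<phi> = p \<Longrightarrow> t = s \<Longrightarrow> over p t (act_dir \<phi> s d)"
    and Dom_act_dir [simp]: "Dom E (act_dir \<phi> s d) = Dom E s"
    and act_dir_cmp [simp]: "k \<in> Arr E \<Longrightarrow> Cod E k = Dom E s \<Longrightarrow>
      act_dir \<phi> s d \<cdot> k = act_dir \<phi> (s \<cdot> k) (d \<cdot> k)"
proof -
  note \<phi>A = is_poly_arr_arrs[OF \<phi>]
  have s': "s \<in> Arr E" "Cod E s = Dom E (on_pos \<phi>)" using s \<phi>A by (auto simp: pos_def)
  have d': "over (tgt \<phi>) (on_pos \<phi> \<cdot> s) d" using d by (simp add: act_pos_def)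
  note pp = over_pb_pair[OF \<phi>A(3,2,5) s' d']
  have *: "src \<phi> \<cdot> act_dir \<phi> s d = s"
    using cmp_assoc[of "pb_pair (on_pos \<phi>) (tgt \<phi>) s d" "on_dir \<phi>" "src \<phi>"] pp \<phi>A
    by (simp add: act_dir_def)
  have A: "act_dir \<phi> s d \<in> Arr E" "Cod E (act_dir \<phi> s d) = Dom E (src \<phi>)"
    "Dom E (act_dir \<phi> s d) = Dom E s"
    using pp \<phi>A by (simp_all add: act_dir_def)
  from * A show "src \<phi> = p \<Longrightarrow> t = s \<Longrightarrow> over p t (act_dir \<phi> s d)" by (auto simp: over_def)
  show "Dom E (act_dir \<phi> s d) = Dom E s" by (rule A)
  show "k \<in> Arr E \<Longrightarrow> Cod E k = Dom E s \<Longrightarrow> act_dir \<phi> s d \<cdot> k = act_dir \<phi> (s \<cdot> k) (d \<cdot> k)"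
    using pp \<phi>A by (simp add: act_dir_def)
qed

text \<open>The Yoneda lemma: the identity is the generic position and recovers
  \<open>on_pos\<close>; the two projections of the pullback form the generic direction and recover
  \<open>on_dir\<close>.\<close>

lemma poly_arr_ext:
  assumes \<phi>: "is_poly_arr \<phi>" and \<psi>: "is_poly_arr \<psi>" and st: "src \<phi> = src \<psi>" "tgt \<phi> = tgt \<psi>"
    and ps: "\<And>s. pos (src \<psi>) s \<Longrightarrow> act_pos \<phi> s = act_pos \<psi> s"
    and dr: "\<And>s d. pos (src \<psi>) s \<Longrightarrow> over (tgt \<psi>) (act_pos \<psi> s) d \<Longrightarrow> act_dir \<phi> s d = act_dir \<psi> s d"
  shows "\<phi> = \<psi>"
proof -
  note A = is_poly_arr_arrs[OF \<phi>] and B = is_poly_arr_arrs[OF \<psi>]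
  have c: "on_pos \<phi> = on_pos \<psi>"
    using ps[OF pos_Ident[OF B(1)]] A B st by (simp add: act_pos_def)
  let ?x = "pb1 (on_pos \<psi>) (tgt \<psi>)" and ?y = "pb2 (on_pos \<psi>) (tgt \<psi>)"
  have "pos (src \<psi>) ?x" using B by (simp add: pos_def)
  moreover have "over (tgt \<psi>) (act_pos \<psi> ?x) ?y"
    using over_pb[of "on_pos \<psi>" "tgt \<psi>"] B by (simp add: act_pos_def)
  ultimately have "act_dir \<phi> ?x ?y = act_dir \<psi> ?x ?y" by (rule dr)
  then have "on_dir \<phi> = on_dir \<psi>" using A B c st by (simp add: act_dir_def)
  with c st show ?thesis by simp
qed

text \<open>The converse of \<open>poly_arr_ext\<close>: a natural action \<open>G\<close> on
  directions is represented by its value at the generic pair. By this rule the explicit formulas for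
  the structure maps are turned into computation rules for their actions.\<close>

lemma poly_arr_family:
  assumes p: "exponentiable p" and q: "exponentiable q"
    and c: "c \<in> Arr E" "Dom E c = Cod E p" "Cod E c = Cod E q"
    and G: "\<And>s d. pos p s \<Longrightarrow> over q (c \<cdot> s) d \<Longrightarrow> over p s (G s d)"
    and G_nat: "\<And>s d k. pos p s \<Longrightarrow> over q (c \<cdot> s) d \<Longrightarrow> k \<in> Arr E \<Longrightarrow> Cod E k = Dom E s \<Longrightarrow>
      G (s \<cdot> k) (d \<cdot> k) = G s d \<cdot> k"
    and \<phi>: "\<phi> = \<lparr>src = p, tgt = q, on_pos = c, on_dir = G (pb1 c q) (pb2 c q)\<rparr>"
  shows "is_poly_arr \<phi>" "src \<phi> = p" "tgt \<phi> = q" "act_pos \<phi> s = c \<cdot> s"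
    "pos p s \<Longrightarrow> over q (c \<cdot> s) d \<Longrightarrow> act_dir \<phi> s d = G s d"
proof -
  note pA = exponentiableD[OF p] and qA = exponentiableD[OF q]
  have x: "pos p (pb1 c q)" using c qA by (simp add: pos_def)
  have y: "over q (c \<cdot> pb1 c q) (pb2 c q)" using over_pb c qA by simp
  note g = overD[OF G[OF x y] pA]
  show "is_poly_arr \<phi>" "src \<phi> = p" "tgt \<phi> = q" "act_pos \<phi> s = c \<cdot> s"
    using p q c g qA by (simp_all add: \<phi> is_poly_arr_def hom_def act_pos_def)
  assume s: "pos p s" and d: "over q (c \<cdot> s) d"
  have s': "s \<in> Arr E" "Cod E s = Dom E c" using s c by (auto simp: pos_def)
  note pp = over_pb_pair[OF c(1) qA c(3) s' d]
  show "act_dir \<phi> s d = G s d"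
    using G_nat[OF x y pp(1)] pp c qA by (simp add: \<phi> act_dir_def)
qed

text \<open>The common pattern of \<open>comp_arr\<close>, \<open>comp_assoc\<close>,
  \<open>poly_interchange\<close> and \<open>poly_unit_comult\<close>, whose codomains are
  composites. A base \<open>X\<close>, values \<open>F\<close> and directions \<open>H\<close>,
  natural in the stage, are enough. The action on positions is described by its base and values,
  because a position itself is only given by a definite description.\<close>

lemma poly_arr_into_comp_family:
  assumes r: "exponentiable r" and p: "exponentiable p" and q: "exponentiable q"
    and x: "x \<in> Arr E" "Dom E x = Cod E r" "Cod E x = Cod E p"
    and X: "\<And>s. pos r s \<Longrightarrow> x \<cdot> s = X s"
    and F: "\<And>s y. pos r s \<Longrightarrow> over p (X s) y \<Longrightarrow> pos q (F s y) \<and> Dom E (F s y) = Dom E s"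
    and F_nat: "\<And>s y k. pos r s \<Longrightarrow> over p (X s) y \<Longrightarrow> k \<in> Arr E \<Longrightarrow> Cod E k = Dom E s \<Longrightarrow>
      F (s \<cdot> k) (y \<cdot> k) = F s y \<cdot> k"
    and H: "\<And>s y z. pos r s \<Longrightarrow> over p (X s) y \<Longrightarrow> over q (F s y) z \<Longrightarrow> over r s (H s y z)"
    and H_nat: "\<And>s y z k. pos r s \<Longrightarrow> over p (X s) y \<Longrightarrow> over q (F s y) z \<Longrightarrow> k \<in> Arr E \<Longrightarrow>
      Cod E k = Dom E s \<Longrightarrow> H (s \<cdot> k) (y \<cdot> k) (z \<cdot> k) = H s y z \<cdot> k"
    and c: "c = position p q x (F (pb1 x p) (pb2 x p))"
    and \<phi>: "\<phi> = \<lparr>src = r, tgt = p \<triangleleft> q, on_pos = c, on_dir = H (pb1 c (p \<triangleleft> q))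
        (dir1 p q \<cdot> pb2 c (p \<triangleleft> q)) (dir2 p q \<cdot> pb2 c (p \<triangleleft> q))\<rparr>"
  shows "is_poly_arr \<phi>" "src \<phi> = r" "tgt \<phi> = p \<triangleleft> q"
    "pos r s \<Longrightarrow> base_at p q (act_pos \<phi> s) = X s"
    "pos r s \<Longrightarrow> over p (X s) y \<Longrightarrow> apply_at p q (act_pos \<phi> s) y = F s y"
    "pos r s \<Longrightarrow> over p (X s) y \<Longrightarrow> over q (F s y) z \<Longrightarrow> t = act_pos \<phi> s \<Longrightarrow>
       act_dir \<phi> s (direction p q t y z) = H s y z"
proof -
  have px: "pos p x" using x by (simp add: pos_def)
  have r_pos: "pos r h" if "h \<in> Arr E" "Cod E h = Dom E x" for h
    using that x by (simp add: pos_def)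
  \<comment> \<open>\<open>c\<close> is the image of the generic position; all other positions are
    restrictions \<open>c \<cdot> s\<close> of it.\<close>
  have fam: "pos (p \<triangleleft> q) c" "base_at p q c = x" "Dom E c = Dom E x"
    "\<And>h y. h \<in> Arr E \<Longrightarrow> Cod E h = Dom E x \<Longrightarrow> over p (x \<cdot> h) y \<Longrightarrow> apply_at p q (c \<cdot> h) y = F h y"
    unfolding c by (rule position_family[OF p q px _ _ refl, of F]; use F F_nat X r_pos in force)+
  note cA = posD[OF fam(1)]
  have cs: "pos (p \<triangleleft> q) (c \<cdot> s)" "base_at p q (c \<cdot> s) = X s"
    "over p (X s) y \<Longrightarrow> apply_at p q (c \<cdot> s) y = F s y" if s: "pos r s" for s y
  proof -
    have s': "s \<in> Arr E" "Cod E s = Dom E c" using posD[OF s] x fam(3) by auto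
    show "pos (p \<triangleleft> q) (c \<cdot> s)" using pos_cmp[OF fam(1) s'] .
    show "base_at p q (c \<cdot> s) = X s"
      using base_at_cmp[OF p q fam(1) s'] fam(2) X[OF s] by simp
    show "over p (X s) y \<Longrightarrow> apply_at p q (c \<cdot> s) y = F s y"
      using fam(3) fam(4)[of s y] s' X[OF s] by simp
  qed
  \<comment> \<open>A direction of the composite enters only through its two components, which exist
    for every \<open>d\<close>, not only for a term built with \<open>direction\<close>.\<close>
  define G where "G s d = H s (dir1 p q \<cdot> d) (dir2 p q \<cdot> d)" for s d
  have dirs: "over p (X s) (dir1 p q \<cdot> d)" "over q (F s (dir1 p q \<cdot> d)) (dir2 p q \<cdot> d)"
    "d \<in> Arr E" "Cod E d = Dom E (p \<triangleleft> q)" "Dom E d = Dom E s"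
    if s: "pos r s" and d: "over (p \<triangleleft> q) (c \<cdot> s) d" for s d
  proof -
    show 1: "over p (X s) (dir1 p q \<cdot> d)" using over_dir1[OF p q cs(1)[OF s] d] cs(2)[OF s] by simp
    show "over q (F s (dir1 p q \<cdot> d)) (dir2 p q \<cdot> d)"
      using over_dir2[OF p q cs(1)[OF s] d] cs(3)[OF s 1] by simp
    show "d \<in> Arr E" "Cod E d = Dom E (p \<triangleleft> q)" "Dom E d = Dom E s"
      using overD[OF d comp_obj_arr(1)[OF p q]] posD[OF s] cA fam(3) x by simp_all
  qed
  have *: "exponentiable (p \<triangleleft> q)" "c \<in> Arr E" "Dom E c = Cod E r" "Cod E c = Cod E (p \<triangleleft> q)"
    using p q cA fam(3) x by simp_all
  have G: "over r s (G s d)" if "pos r s" "over (p \<triangleleft> q) (c \<cdot> s) d" for s d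
    unfolding G_def using H dirs[OF that] that(1) by blast
  have G_nat: "G (s \<cdot> k) (d \<cdot> k) = G s d \<cdot> k"
    if "pos r s" "over (p \<triangleleft> q) (c \<cdot> s) d" "k \<in> Arr E" "Cod E k = Dom E s" for s d k
    unfolding G_def using H_nat[OF that(1) dirs(1,2)[OF that(1,2)] that(3,4)] dirs(3-5)[OF that(1,2)]
      that(3,4) dir_arr[OF p q] by simp
  have \<phi>': "\<phi> = \<lparr>src = r, tgt = p \<triangleleft> q, on_pos = c, on_dir = G (pb1 c (p \<triangleleft> q)) (pb2 c (p \<triangleleft> q))\<rparr>"
    unfolding G_def by (rule \<phi>)
  have fam': "is_poly_arr \<phi>" "src \<phi> = r" "tgt \<phi> = p \<triangleleft> q" "\<And>s. act_pos \<phi> s = c \<cdot> s"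
    "\<And>s d. pos r s \<Longrightarrow> over (p \<triangleleft> q) (c \<cdot> s) d \<Longrightarrow> act_dir \<phi> s d = G s d"
    by (rule poly_arr_family[where G = G, OF r * _ _ \<phi>']; (rule G G_nat | assumption)+)+
  show "is_poly_arr \<phi>" "src \<phi> = r" "tgt \<phi> = p \<triangleleft> q" using fam'(1-3) by auto
  assume s: "pos r s"
  show "base_at p q (act_pos \<phi> s) = X s" using fam'(4) cs(2)[OF s] by simp
  assume y: "over p (X s) y"
  show "apply_at p q (act_pos \<phi> s) y = F s y" using fam'(4) cs(3)[OF s y] by simp
  assume z: "over q (F s y) z" and t: "t = act_pos \<phi> s"
  have yz: "over p (base_at p q (c \<cdot> s)) y" "over q (apply_at p q (c \<cdot> s) y) z"
    using y z cs(2,3)[OF s] by simp_all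
  note dd = over_direction[OF p q cs(1)[OF s] yz] dir1_direction[OF p q cs(1)[OF s] yz]
    dir2_direction[OF p q cs(1)[OF s] yz]
  show "act_dir \<phi> s (direction p q t y z) = H s y z"
    using fam'(5)[OF s dd(1)] fam'(4) G_def t dd(2,3) by simp
qed

section \<open>The category of polynomials and its isomorphisms\<close>

lemma src_tgt_poly_comp [simp]: "src (poly_comp \<psi> \<phi>) = src \<phi>" "tgt (poly_comp \<psi> \<phi>) = tgt \<psi>"
  by (simp_all add: poly_comp_def Let_def)

lemma src_tgt_poly_id [simp]: "src (poly_id p) = p" "tgt (poly_id p) = p"
  by (simp_all add: poly_id_def)

lemma
  assumes \<phi>: "is_poly_arr \<phi>" and \<psi>: "is_poly_arr \<psi>" and eq: "tgt \<phi> = src \<psi>"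
  shows is_poly_arr_poly_comp [simp]: "is_poly_arr (poly_comp \<psi> \<phi>)"
    and act_pos_poly_comp [simp]: "pos (src \<phi>) s \<Longrightarrow> act_pos (poly_comp \<psi> \<phi>) s = act_pos \<psi> (act_pos \<phi> s)"
    and act_dir_poly_comp [simp]: "pos (src \<phi>) s \<Longrightarrow> over (tgt \<psi>) (act_pos \<psi> (act_pos \<phi> s)) d \<Longrightarrow>
      act_dir (poly_comp \<psi> \<phi>) s d = act_dir \<phi> s (act_dir \<psi> (act_pos \<phi> s) d)"
proof -
  note A = is_poly_arr_arrs[OF \<phi>] is_poly_arr_arrs[OF \<psi>]
  let ?c = "on_pos \<psi> \<cdot> on_pos \<phi>"
  have cs: "?c \<cdot> s = act_pos \<psi> (act_pos \<phi> s)" if "pos (src \<phi>) s" for s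
    using that A eq by (simp add: pos_def act_pos_def)
  define G where "G s d = act_dir \<phi> s (act_dir \<psi> (on_pos \<phi> \<cdot> s) d)" for s d
  have G_eq: "G s d = act_dir \<phi> s (act_dir \<psi> (act_pos \<phi> s) d)" for s d
    by (simp add: G_def act_pos_def)
  have *: "exponentiable (src \<phi>)" "exponentiable (tgt \<psi>)" "?c \<in> Arr E" "Dom E ?c = Cod E (src \<phi>)"
    "Cod E ?c = Cod E (tgt \<psi>)" using \<phi> \<psi> A eq by simp_all
  have G: "over (src \<phi>) s (G s d)" "k \<in> Arr E \<Longrightarrow> Cod E k = Dom E s \<Longrightarrow> G (s \<cdot> k) (d \<cdot> k) = G s d \<cdot> k"
    if "pos (src \<phi>) s" "over (tgt \<psi>) (?c \<cdot> s) d" for s d k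
    using that \<phi> \<psi> eq by (simp_all add: G_eq cs)
  have eq: "poly_comp \<psi> \<phi> = \<lparr>src = src \<phi>, tgt = tgt \<psi>, on_pos = ?c,
      on_dir = G (pb1 ?c (tgt \<psi>)) (pb2 ?c (tgt \<psi>))\<rparr>"
    by (simp add: poly_comp_def Let_def G_def)
  have fam: "is_poly_arr (poly_comp \<psi> \<phi>)" "\<And>s. act_pos (poly_comp \<psi> \<phi>) s = ?c \<cdot> s"
    "\<And>s d. pos (src \<phi>) s \<Longrightarrow> over (tgt \<psi>) (?c \<cdot> s) d \<Longrightarrow> act_dir (poly_comp \<psi> \<phi>) s d = G s d"
    by (rule poly_arr_family[where G = G, OF * _ _ eq]; (rule G | assumption)+)+
  show "is_poly_arr (poly_comp \<psi> \<phi>)" by (rule fam)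
  assume s: "pos (src \<phi>) s"
  show "act_pos (poly_comp \<psi> \<phi>) s = act_pos \<psi> (act_pos \<phi> s)" using fam(2) cs[OF s] by simp
  assume d: "over (tgt \<psi>) (act_pos \<psi> (act_pos \<phi> s)) d"
  then show "act_dir (poly_comp \<psi> \<phi>) s d = act_dir \<phi> s (act_dir \<psi> (act_pos \<phi> s) d)"
    using fam(3)[of s d] s cs[OF s] by (simp add: G_eq)
qed

lemma
  assumes p: "exponentiable p"
  shows is_poly_arr_poly_id [simp]: "is_poly_arr (poly_id p)"
    and act_pos_poly_id [simp]: "pos p s \<Longrightarrow> act_pos (poly_id p) s = s"
    and act_dir_poly_id [simp]: "pos p s \<Longrightarrow> over p s d \<Longrightarrow> act_dir (poly_id p) s d = d"
proof -
  note pA = exponentiableD[OF p]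
  have I: "Ident E (Cod E p) \<cdot> s = s" if "pos p s" for s using that by (simp add: pos_def)
  have *: "Ident E (Cod E p) \<in> Arr E" "Dom E (Ident E (Cod E p)) = Cod E p"
    "Cod E (Ident E (Cod E p)) = Cod E p" using pA by simp_all
  have fam: "is_poly_arr (poly_id p)" "\<And>s. act_pos (poly_id p) s = Ident E (Cod E p) \<cdot> s"
    "\<And>s d. pos p s \<Longrightarrow> over p (Ident E (Cod E p) \<cdot> s) d \<Longrightarrow> act_dir (poly_id p) s d = d"
    by (rule poly_arr_family[where G = "\<lambda>s d. d", OF p p * _ _ poly_id_def]; simp add: I)+
  then show "is_poly_arr (poly_id p)" "pos p s \<Longrightarrow> act_pos (poly_id p) s = s"
    "pos p s \<Longrightarrow> over p s d \<Longrightarrow> act_dir (poly_id p) s d = d"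
    using I by simp_all
qed

lemma Poly_simps [simp]:
  "Obj Poly = {p. exponentiable p}" "Arr Poly = {\<phi>. is_poly_arr \<phi>}" "Dom Poly = src" "Cod Poly = tgt"
  "Ident Poly = poly_id" "Comp Poly = poly_comp"
  by (simp_all add: Poly_def)

lemma hom_Poly: "\<phi> \<in> hom Poly p q \<longleftrightarrow> is_poly_arr \<phi> \<and> src \<phi> = p \<and> tgt \<phi> = q"
  by (simp add: hom_def)

lemma is_category_Poly: "is_category Poly"
  unfolding is_category_def hom_Poly
proof (intro conjI ballI impI; (elim CollectE)?)
  fix f assume "f \<in> Arr Poly"
  then have f: "is_poly_arr f" by simp
  show "f \<cdot>\<^bsub>Poly\<^esub> Ident Poly (Dom Poly f) = f"
    using f by (simp, intro poly_arr_ext, simp_all)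
  show "Ident Poly (Cod Poly f) \<cdot>\<^bsub>Poly\<^esub> f = f"
    using f by (simp, intro poly_arr_ext, simp_all)
next
  fix f g h assume "f \<in> Arr Poly" "g \<in> Arr Poly" "h \<in> Arr Poly" "Cod Poly f = Dom Poly g"
    "Cod Poly g = Dom Poly h"
  then show "h \<cdot>\<^bsub>Poly\<^esub> (g \<cdot>\<^bsub>Poly\<^esub> f) = (h \<cdot>\<^bsub>Poly\<^esub> g) \<cdot>\<^bsub>Poly\<^esub> f"
    by (simp, intro poly_arr_ext, simp_all)
qed simp_all

text \<open>The inverse is read off at the generic position and the generic direction.\<close>

lemma is_iso_Poly:
  assumes \<phi>: "is_poly_arr \<phi>"
    and inj: "\<And>s t. pos (src \<phi>) s \<Longrightarrow> pos (src \<phi>) t \<Longrightarrow> act_pos \<phi> s = act_pos \<phi> t \<Longrightarrow> s = t"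
    and surj: "\<And>t. pos (tgt \<phi>) t \<Longrightarrow> \<exists>s. pos (src \<phi>) s \<and> act_pos \<phi> s = t"
    and dinj: "\<And>s d e. pos (src \<phi>) s \<Longrightarrow> over (tgt \<phi>) (act_pos \<phi> s) d \<Longrightarrow>
      over (tgt \<phi>) (act_pos \<phi> s) e \<Longrightarrow> act_dir \<phi> s d = act_dir \<phi> s e \<Longrightarrow> d = e"
    and dsurj: "\<And>s y. pos (src \<phi>) s \<Longrightarrow> over (src \<phi>) s y \<Longrightarrow>
      \<exists>d. over (tgt \<phi>) (act_pos \<phi> s) d \<and> act_dir \<phi> s d = y"
  shows "is_iso Poly \<phi>"
proof -
  let ?p = "src \<phi>" and ?q = "tgt \<phi>"
  note A = is_poly_arr_arrs[OF \<phi>]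
  \<comment> \<open>The preimage of the generic position. By naturality \<open>c \<cdot> t\<close>
    is the preimage of \<open>t\<close>, so \<open>c\<close> is the inverse on positions.\<close>
  obtain c where c: "pos ?p c" "act_pos \<phi> c = Ident E (Cod E ?q)"
    using surj[OF pos_Ident[OF A(2)]] by blast
  have cA: "c \<in> Arr E" "Cod E c = Cod E ?p" "Dom E c = Cod E ?q"
    using posD[OF c(1)] Dom_act_pos[OF \<phi> c(1)] c(2) A by simp_all
  have ct: "pos ?p (c \<cdot> t)" "act_pos \<phi> (c \<cdot> t) = t" if "pos ?q t" for t
    using posD[OF that] cA pos_cmp[OF c(1)] act_pos_cmp[OF \<phi> c(1), of t] c(2) by simp_all
  obtain e where e: "\<And>s y. pos ?p s \<Longrightarrow> over ?p s y \<Longrightarrow>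
      over ?q (act_pos \<phi> s) (e s y) \<and> act_dir \<phi> s (e s y) = y"
    using dsurj by metis
  define G where "G t y = e (c \<cdot> t) y" for t y
  have G: "over ?q t (G t y)" "act_dir \<phi> (c \<cdot> t) (G t y) = y"
    if "pos ?q t" "over ?p (c \<cdot> t) y" for t y
    using e[OF ct(1)[OF that(1)] that(2)] ct(2)[OF that(1)] by (auto simp: G_def)
  \<comment> \<open>The preimages of directions were chosen without regard to naturality;
    injectivity on directions enforces it.\<close>
  have G_nat: "G (t \<cdot> k) (y \<cdot> k) = G t y \<cdot> k"
    if t: "pos ?q t" "over ?p (c \<cdot> t) y" "k \<in> Arr E" "Cod E k = Dom E t" for t y k
  proof (rule dinj)
    note tA = posD[OF t(1)] and tk = pos_cmp[OF t(1,3,4)]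
    have D: "Dom E (c \<cdot> t) = Dom E t" using tA cA by simp
    have ctk: "c \<cdot> t \<cdot> k = (c \<cdot> t) \<cdot> k" using tA t cA by simp
    have yk: "over ?p (c \<cdot> t \<cdot> k) (y \<cdot> k)"
      unfolding ctk using over_cmp[OF t(2) A(1) t(3)] t(4) D by simp
    show "pos ?p (c \<cdot> t \<cdot> k)" by (rule ct(1)[OF tk])
    show "over ?q (act_pos \<phi> (c \<cdot> t \<cdot> k)) (G (t \<cdot> k) (y \<cdot> k))"
      using G(1)[OF tk yk] ct(2)[OF tk] by simp
    show "over ?q (act_pos \<phi> (c \<cdot> t \<cdot> k)) (G t y \<cdot> k)"
      using over_cmp[OF G(1)[OF t(1,2)] A(2) t(3,4)] ct(2)[OF tk] by simp
    have "act_dir \<phi> (c \<cdot> t \<cdot> k) (G t y \<cdot> k) = act_dir \<phi> (c \<cdot> t) (G t y) \<cdot> k"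
      unfolding ctk using ct[OF t(1)] G(1)[OF t(1,2)] t(3,4) D \<phi> by simp
    then show "act_dir \<phi> (c \<cdot> t \<cdot> k) (G (t \<cdot> k) (y \<cdot> k)) = act_dir \<phi> (c \<cdot> t \<cdot> k) (G t y \<cdot> k)"
      using G(2)[OF tk yk] G(2)[OF t(1,2)] by simp
  qed
  define \<psi> where "\<psi> = \<lparr>src = ?q, tgt = ?p, on_pos = c, on_dir = G (pb1 c ?p) (pb2 c ?p)\<rparr>"
  have \<psi>: "is_poly_arr \<psi>" "src \<psi> = ?q" "tgt \<psi> = ?p" "\<And>t. act_pos \<psi> t = c \<cdot> t"
    "\<And>t y. pos ?q t \<Longrightarrow> over ?p (c \<cdot> t) y \<Longrightarrow> act_dir \<psi> t y = G t y"
    by (rule poly_arr_family[where G = G,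
        OF is_poly_arr_src_tgt(2)[OF \<phi>] is_poly_arr_src_tgt(1)[OF \<phi>] cA(1,3,2) _ _ \<psi>_def];
        (rule G(1) G_nat | assumption)+)+
  have cphi: "c \<cdot> act_pos \<phi> s = s" if s: "pos ?p s" for s
    using inj[OF ct(1) s] ct(2) pos_act_pos[OF \<phi> s refl] by simp
  have "poly_comp \<psi> \<phi> = poly_id ?p"
  proof (rule poly_arr_ext)
    fix s d assume "pos (src (poly_id ?p)) s" "over (tgt (poly_id ?p)) (act_pos (poly_id ?p) s) d"
    then have s: "pos ?p s" "over ?p s d" using \<phi> by simp_all
    then show "act_dir (poly_comp \<psi> \<phi>) s d = act_dir (poly_id ?p) s d"
      using \<phi> \<psi> cphi[OF s(1)] G(2)[OF pos_act_pos[OF \<phi> s(1) refl], of d] by simp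
  qed (use \<phi> \<psi> cphi in simp_all)
  moreover have "poly_comp \<phi> \<psi> = poly_id ?q"
  proof (rule poly_arr_ext)
    fix t d assume "pos (src (poly_id ?q)) t" "over (tgt (poly_id ?q)) (act_pos (poly_id ?q) t) d"
    then have t: "pos ?q t" "over ?q t d" using \<phi> by simp_all
    let ?y = "act_dir \<phi> (c \<cdot> t) d"
    have y: "over ?p (c \<cdot> t) ?y" using \<phi> t ct[OF t(1)] by simp
    have "G t ?y = d"
      by (rule dinj[OF ct(1)[OF t(1)]]) (use G[OF t(1) y] ct(2)[OF t(1)] t(2) in simp_all)
    then show "act_dir (poly_comp \<phi> \<psi>) t d = act_dir (poly_id ?q) t d"
      using \<phi> \<psi> ct[OF t(1)] t y by simp
  qed (use \<phi> \<psi> ct in simp_all)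
  ultimately show ?thesis
    using \<phi> \<psi>(1-3) by (auto simp: is_iso_def hom_Poly)
qed

section \<open>The tensor product of morphisms and its coherence maps\<close>

lemma pos_tuple [simp]:
  assumes "exponentiable p" "exponentiable q" "pos p s" "pos q t" "Dom E s = Dom E t"
  shows "pos (prd_map p q) (tuple s t)"
  using assms exponentiableD by (auto simp: pos_def)

lemma over_tuple [simp]:
  assumes "exponentiable p" "exponentiable q" "pos p s" "pos q t" "Dom E s = Dom E t"
    "over p s y" "over q t z"
  shows "over (prd_map p q) (tuple s t) (tuple y z)"
  using assms exponentiableD overD[OF assms(6)] overD[OF assms(7)] by (simp add: over_def pos_def)

lemma Dom_tuple_pos [simp]: "pos p s \<Longrightarrow> pos q t \<Longrightarrow> Dom E s = Dom E t \<Longrightarrow> Dom E (tuple s t) = Dom E t"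
  by (simp add: pos_def)

lemma pos_prd_map_cases:
  assumes "exponentiable p" "exponentiable q" "pos (prd_map p q) u"
  obtains s t where "u = tuple s t" "pos p s" "pos q t" "Dom E s = Dom E t"
proof -
  note A = exponentiableD[OF assms(1)] exponentiableD[OF assms(2)]
  have u: "u \<in> Arr E" "Cod E u = prd (Cod E p) (Cod E q)" using assms(3) A by (auto simp: pos_def)
  show thesis
  proof (rule tuple_cases[OF _ _ u])
    fix s t assume st: "u = tuple s t" "s \<in> Arr E" "t \<in> Arr E" "Cod E s = Cod E p" "Cod E t = Cod E q"
      "Dom E s = Dom E u" "Dom E t = Dom E u"
    have "Dom E s = Dom E t" by (simp only: st(6,7))
    with st(1-5) show thesis using that unfolding pos_def by blast
  qed (use A in simp_all)
qed

lemma over_prd_map_cases: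
  assumes pq: "exponentiable p" "exponentiable q" and st: "pos p s" "pos q t" "Dom E s = Dom E t"
    and d: "over (prd_map p q) (tuple s t) d"
  obtains y z where "d = tuple y z" "over p s y" "over q t z"
proof -
  note A = exponentiableD[OF pq(1)] exponentiableD[OF pq(2)]
  note D = overD[OF d prd_map(1)[OF A]]
  have d': "d \<in> Arr E" "Cod E d = prd (Dom E p) (Dom E q)" using D A by simp_all
  show thesis
  proof (rule tuple_cases[OF _ _ d'])
    fix y z assume yz: "d = tuple y z" "y \<in> Arr E" "z \<in> Arr E" "Cod E y = Dom E p" "Cod E z = Dom E q"
      "Dom E y = Dom E d" "Dom E z = Dom E d"
    have Dyz: "Dom E y = Dom E z" by (simp only: yz(6,7))
    have "prd_map p q \<cdot> tuple y z = tuple s t" using D(3) by (simp only: yz(1))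
    then have "tuple (p \<cdot> y) (q \<cdot> z) = tuple s t" using yz(2-5) Dyz A by simp
    then have "p \<cdot> y = s" "q \<cdot> z = t"
      using st yz(2-5) Dyz A by (simp_all add: tuple_inject pos_def)
    then show thesis using that yz by (simp add: over_def)
  qed (use A in simp_all)
qed

text \<open>The fibre of an identity arrow over a point contains only that point.\<close>

lemma over_y_poly:
  assumes "pos y_poly s"
  shows "over y_poly s d \<longleftrightarrow> d = s"
  using assms y_poly_arr by (auto simp: over_def pos_def y_poly_def)

lemma pos_y_poly: "pos y_poly s \<Longrightarrow> s = bang (Dom E s)"
  using y_poly_arr eq_bang by (simp add: pos_def)

lemma pos_bang [simp]: "X \<in> Obj E \<Longrightarrow> pos y_poly (bang X)"
  using y_poly_arr by (simp add: pos_def)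

lemma over_bang [simp]: "X \<in> Obj E \<Longrightarrow> over y_poly (bang X) d \<longleftrightarrow> d = bang X"
  by (simp add: over_y_poly)

lemma pos_Dom_in_Obj [simp]: "pos p s \<Longrightarrow> Dom E s \<in> Obj E"
  by (simp add: pos_def)

lemma tensor_arr_src_tgt [simp]: "src (tensor_arr \<phi> \<psi>) = prd_map (src \<phi>) (src \<psi>)"
  "tgt (tensor_arr \<phi> \<psi>) = prd_map (tgt \<phi>) (tgt \<psi>)"
  by (simp_all add: tensor_arr_def Let_def)

lemma tuple_cmp_pos [simp]:
  "pos p s \<Longrightarrow> pos q t \<Longrightarrow> Dom E s = Dom E t \<Longrightarrow> k \<in> Arr E \<Longrightarrow> Cod E k = Dom E t \<Longrightarrow>
    tuple s t \<cdot> k = tuple (s \<cdot> k) (t \<cdot> k)"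
  by (simp add: pos_def)

lemma pos_pr:
  assumes "p \<in> Arr E" "q \<in> Arr E" "pos (prd_map p q) s"
  shows "pos p (pr1 (Cod E p) (Cod E q) \<cdot> s)" "Dom E (pr1 (Cod E p) (Cod E q) \<cdot> s) = Dom E s"
    "pos q (pr2 (Cod E p) (Cod E q) \<cdot> s)" "Dom E (pr2 (Cod E p) (Cod E q) \<cdot> s) = Dom E s"
  using assms by (simp_all add: pos_def)

lemma over_pr:
  assumes pq: "p \<in> Arr E" "q \<in> Arr E" and d: "over (prd_map p q) x d"
  shows "over p (pr1 (Cod E p) (Cod E q) \<cdot> x) (pr1 (Dom E p) (Dom E q) \<cdot> d)"
    "over q (pr2 (Cod E p) (Cod E q) \<cdot> x) (pr2 (Dom E p) (Dom E q) \<cdot> d)"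
proof -
  note D = overD[OF d prd_map(1)[OF pq]]
  have "pr1 (Cod E p) (Cod E q) \<cdot> x = p \<cdot> pr1 (Dom E p) (Dom E q) \<cdot> d"
    "pr2 (Cod E p) (Cod E q) \<cdot> x = q \<cdot> pr2 (Dom E p) (Dom E q) \<cdot> d"
    unfolding D(3)[symmetric] using D(1,2) pq by (simp_all add: prd_map_def)
  then show "over p (pr1 (Cod E p) (Cod E q) \<cdot> x) (pr1 (Dom E p) (Dom E q) \<cdot> d)"
    "over q (pr2 (Cod E p) (Cod E q) \<cdot> x) (pr2 (Dom E p) (Dom E q) \<cdot> d)"
    using D(1,2) pq by (simp_all add: over_def)
qed

lemma over_tupleI:
  assumes pq: "p \<in> Arr E" "q \<in> Arr E" and s: "pos (prd_map p q) s"
    and d: "over p (pr1 (Cod E p) (Cod E q) \<cdot> s) d" and e: "over q (pr2 (Cod E p) (Cod E q) \<cdot> s) e"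
  shows "over (prd_map p q) s (tuple d e)"
  using overD[OF d pq(1)] overD[OF e pq(2)] pos_pr[OF pq s] s pq
  by (simp add: over_def tuple_eta pos_def)

text \<open>The pairing inside \<open>tensor_arr\<close> is the comparison from a pullback of
  products to a product of pullbacks. Evaluated on tuples it disappears, and the action is
  componentwise.\<close>

lemma
  assumes \<phi>: "is_poly_arr \<phi>" and \<psi>: "is_poly_arr \<psi>"
  shows is_poly_arr_tensor [simp]: "is_poly_arr (tensor_arr \<phi> \<psi>)"
    and act_pos_tensor [simp]: "pos (src \<phi>) s \<Longrightarrow> pos (src \<psi>) t \<Longrightarrow> Dom E s = Dom E t \<Longrightarrow>
      act_pos (tensor_arr \<phi> \<psi>) (tuple s t) = tuple (act_pos \<phi> s) (act_pos \<psi> t)"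
    and act_dir_tensor [simp]: "pos (src \<phi>) s \<Longrightarrow> pos (src \<psi>) t \<Longrightarrow> Dom E s = Dom E t \<Longrightarrow>
      over (tgt \<phi>) (act_pos \<phi> s) d \<Longrightarrow> over (tgt \<psi>) (act_pos \<psi> t) e \<Longrightarrow>
      act_dir (tensor_arr \<phi> \<psi>) (tuple s t) (tuple d e) = tuple (act_dir \<phi> s d) (act_dir \<psi> t e)"
proof -
  note A = is_poly_arr_arrs[OF \<phi>] is_poly_arr_arrs[OF \<psi>]
  let ?p = "src \<phi>" and ?p' = "src \<psi>" and ?q = "tgt \<phi>" and ?q' = "tgt \<psi>"
  let ?c = "prd_map (on_pos \<phi>) (on_pos \<psi>)"
  \<comment> \<open>The action has to be given on arbitrary elements before it can be computed on
    tuples, so the components are first written as projections.\<close>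
  define a b where "a s = pr1 (Cod E ?p) (Cod E ?p') \<cdot> s" and "b s = pr2 (Cod E ?p) (Cod E ?p') \<cdot> s" for s
  define u v where "u d = pr1 (Dom E ?q) (Dom E ?q') \<cdot> d" and "v d = pr2 (Dom E ?q) (Dom E ?q') \<cdot> d" for d
  define G where "G s d = prd_map (on_dir \<phi>) (on_dir \<psi>) \<cdot>
      tuple (pb_pair (on_pos \<phi>) ?q (a s) (u d)) (pb_pair (on_pos \<psi>) ?q' (b s) (v d))" for s d
  have parts: "pos ?p (a s)" "pos ?p' (b s)" "Dom E (a s) = Dom E s" "Dom E (b s) = Dom E s"
    "over ?q (act_pos \<phi> (a s)) (u d)" "over ?q' (act_pos \<psi> (b s)) (v d)"
    "s \<in> Arr E" "Cod E s = prd (Cod E ?p) (Cod E ?p')"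
    "d \<in> Arr E" "Cod E d = prd (Dom E ?q) (Dom E ?q')" "Dom E d = Dom E s"
    if s: "pos (prd_map ?p ?p') s" and d: "over (prd_map ?q ?q') (?c \<cdot> s) d" for s d
  proof -
    show "pos ?p (a s)" "pos ?p' (b s)" "Dom E (a s) = Dom E s" "Dom E (b s) = Dom E s"
      unfolding a_def b_def using pos_pr[OF A(1) A(10) s] by simp_all
    show sA: "s \<in> Arr E" "Cod E s = prd (Cod E ?p) (Cod E ?p')" using s A by (simp_all add: pos_def)
    then show "over ?q (act_pos \<phi> (a s)) (u d)" "over ?q' (act_pos \<psi> (b s)) (v d)"
      using over_pr[OF A(2) A(11) d] A by (simp_all add: a_def b_def u_def v_def act_pos_def prd_map_def)
    show "d \<in> Arr E" "Cod E d = prd (Dom E ?q) (Dom E ?q')" "Dom E d = Dom E s"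
      using overD[OF d prd_map(1)[OF A(2) A(11)]] sA A by simp_all
  qed
  have G_eq: "G s d = tuple (act_dir \<phi> (a s) (u d)) (act_dir \<psi> (b s) (v d))"
    if sd: "pos (prd_map ?p ?p') s" "over (prd_map ?q ?q') (?c \<cdot> s) d" for s d
  proof -
    note pr = parts[OF sd]
    have s: "a s \<in> Arr E" "Cod E (a s) = Dom E (on_pos \<phi>)" "b s \<in> Arr E" "Cod E (b s) = Dom E (on_pos \<psi>)"
      using pr A by (simp_all add: pos_def)
    note d' = over_pb_pair[OF A(3,2,5) s(1,2) pr(5)[unfolded act_pos_def]]
    note e' = over_pb_pair[OF A(12,11,14) s(3,4) pr(6)[unfolded act_pos_def]]
    show ?thesis using d' e' A pr(3,4) by (simp add: G_def act_dir_def)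
  qed
  have *: "exponentiable (prd_map ?p ?p')" "exponentiable (prd_map ?q ?q')" "?c \<in> Arr E"
    "Dom E ?c = Cod E (prd_map ?p ?p')" "Cod E ?c = Cod E (prd_map ?q ?q')"
    using \<phi> \<psi> A by simp_all
  have G: "over (prd_map ?p ?p') s (G s d)"
    "k \<in> Arr E \<Longrightarrow> Cod E k = Dom E s \<Longrightarrow> G (s \<cdot> k) (d \<cdot> k) = G s d \<cdot> k"
    if sd: "pos (prd_map ?p ?p') s" "over (prd_map ?q ?q') (?c \<cdot> s) d" for s d k
  proof -
    note pr = parts[OF sd]
    have o: "over ?p (a s) (act_dir \<phi> (a s) (u d))" "over ?p' (b s) (act_dir \<psi> (b s) (v d))"
      using pr \<phi> \<psi> by simp_all
    show "over (prd_map ?p ?p') s (G s d)"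
      unfolding G_eq[OF sd] using over_tupleI[OF A(1) A(10) sd(1)] o by (simp add: a_def b_def)
    assume k: "k \<in> Arr E" "Cod E k = Dom E s"
    have "over (prd_map ?q ?q') (?c \<cdot> s \<cdot> k) (d \<cdot> k)"
      using over_cmp[OF sd(2) prd_map(1)[OF A(2) A(11)] k(1)] k pr(7,8) A by simp
    note kk = G_eq[OF pos_cmp[OF sd(1) k] this]
    have "a (s \<cdot> k) = a s \<cdot> k" "b (s \<cdot> k) = b s \<cdot> k" "u (d \<cdot> k) = u d \<cdot> k" "v (d \<cdot> k) = v d \<cdot> k"
      using pr(7-11) k A by (simp_all add: a_def b_def u_def v_def)
    then show "G (s \<cdot> k) (d \<cdot> k) = G s d \<cdot> k"
      unfolding kk G_eq[OF sd]
      using overD(1)[OF o(1) A(1)] overD(1)[OF o(2) A(10)] pr(1-6) k \<phi> \<psi> by simp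
  qed
  have eq: "tensor_arr \<phi> \<psi> = \<lparr>src = prd_map ?p ?p', tgt = prd_map ?q ?q', on_pos = ?c,
      on_dir = G (pb1 ?c (prd_map ?q ?q')) (pb2 ?c (prd_map ?q ?q'))\<rparr>"
    by (simp add: tensor_arr_def Let_def G_def a_def b_def u_def v_def)
  have fam: "is_poly_arr (tensor_arr \<phi> \<psi>)" "\<And>s. act_pos (tensor_arr \<phi> \<psi>) s = ?c \<cdot> s"
    "\<And>s d. pos (prd_map ?p ?p') s \<Longrightarrow> over (prd_map ?q ?q') (?c \<cdot> s) d \<Longrightarrow> act_dir (tensor_arr \<phi> \<psi>) s d = G s d"
    by (rule poly_arr_family[where G = G, OF * _ _ eq]; (rule G | assumption)+)+
  show "is_poly_arr (tensor_arr \<phi> \<psi>)" by (rule fam)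
  assume st: "pos ?p s" "pos ?p' t" "Dom E s = Dom E t"
  have stA: "s \<in> Arr E" "Cod E s = Cod E ?p" "t \<in> Arr E" "Cod E t = Cod E ?p'" using st by (auto simp: pos_def)
  show c: "act_pos (tensor_arr \<phi> \<psi>) (tuple s t) = tuple (act_pos \<phi> s) (act_pos \<psi> t)"
    using fam(2) stA st(3) A by (simp add: act_pos_def)
  assume d: "over ?q (act_pos \<phi> s) d" and e: "over ?q' (act_pos \<psi> t) e"
  have "over (prd_map ?q ?q') (?c \<cdot> tuple s t) (tuple d e)"
    using c st d e \<phi> \<psi> by (simp add: fam(2))
  then show "act_dir (tensor_arr \<phi> \<psi>) (tuple s t) (tuple d e) = tuple (act_dir \<phi> s d) (act_dir \<psi> t e)"
    using fam(3)[of "tuple s t" "tuple d e"] G_eq[of "tuple s t" "tuple d e"] st stA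
      overD[OF d A(2)] overD[OF e A(11)] \<phi> \<psi> by (simp add: a_def b_def u_def v_def)
qed

section \<open>The associator and unitors of the tensor product\<close>

lemma tensor_assoc_src_tgt [simp]: "src (tensor_assoc p q r) = prd_map (prd_map p q) r"
  "tgt (tensor_assoc p q r) = prd_map p (prd_map q r)"
  by (simp_all add: tensor_assoc_def Let_def)

lemma tensor_unit_src_tgt [simp]: "src (tensor_lunit p) = prd_map y_poly p" "tgt (tensor_lunit p) = p"
  "src (tensor_runit p) = prd_map p y_poly" "tgt (tensor_runit p) = p"
  by (simp_all add: tensor_lunit_def tensor_runit_def Let_def)

text \<open>Each coherence map of \<open>\<otimes>\<close> comes from an isomorphism in the arrow category of \<open>E\<close>.\<close>

lemma poly_arr_of_iso:
  assumes p: "exponentiable p" and q: "exponentiable q"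
    and c: "c \<in> Arr E" "Dom E c = Cod E p" "Cod E c = Cod E q"
    and c': "c' \<in> Arr E" "Dom E c' = Cod E q" "Cod E c' = Cod E p"
    and e: "e \<in> Arr E" "Dom E e = Dom E q" "Cod E e = Dom E p"
    and e': "e' \<in> Arr E" "Dom E e' = Dom E p" "Cod E e' = Dom E q"
    and inv: "c' \<cdot> c = Ident E (Cod E p)" "c \<cdot> c' = Ident E (Cod E q)"
      "e' \<cdot> e = Ident E (Dom E q)" "e \<cdot> e' = Ident E (Dom E p)"
    and sq: "p \<cdot> e = c' \<cdot> q"
    and \<phi>: "\<phi> = \<lparr>src = p, tgt = q, on_pos = c, on_dir = e \<cdot> pb2 c q\<rparr>"
  shows "is_poly_arr \<phi>" "act_pos \<phi> s = c \<cdot> s" "pos p s \<Longrightarrow> over q (c \<cdot> s) d \<Longrightarrow> act_dir \<phi> s d = e \<cdot> d"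
    and "is_iso Poly \<phi>"
proof -
  note A = exponentiableD[OF p] exponentiableD[OF q]
  \<comment> \<open>The square for the inverses: \<open>sq\<close> composed with \<open>c\<close> on
    one side and \<open>e'\<close> on the other.\<close>
  have qe: "q \<cdot> e' = c \<cdot> p"
  proof -
    have "c \<cdot> p = c \<cdot> (p \<cdot> e) \<cdot> e'" using c e e' A inv(4) by simp
    also have "\<dots> = (c \<cdot> c') \<cdot> q \<cdot> e'" unfolding sq using c c' e' A by simp
    finally show ?thesis using e' A inv(2) by simp
  qed
  have cc: "s \<in> Arr E \<Longrightarrow> Cod E s = Cod E p \<Longrightarrow> c' \<cdot> c \<cdot> s = s" "s \<in> Arr E \<Longrightarrow> Cod E s = Cod E q \<Longrightarrow> c \<cdot> c' \<cdot> s = s"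
    "s \<in> Arr E \<Longrightarrow> Cod E s = Dom E q \<Longrightarrow> e' \<cdot> e \<cdot> s = s" "s \<in> Arr E \<Longrightarrow> Cod E s = Dom E p \<Longrightarrow> e \<cdot> e' \<cdot> s = s" for s
    using cmp_assoc[of s c c'] cmp_assoc[of s c' c] cmp_assoc[of s e e'] cmp_assoc[of s e' e] c c' e e' inv
    by simp_all
  define G where "G s d = e \<cdot> d" for s d :: 'a
  have G: "over p s (G s d)" "k \<in> Arr E \<Longrightarrow> Cod E k = Dom E s \<Longrightarrow> G (s \<cdot> k) (d \<cdot> k) = G s d \<cdot> k"
    if s: "pos p s" and d: "over q (c \<cdot> s) d" for s d k
  proof -
    note dD = overD[OF d A(2)] and sD = posD[OF s]
    have "p \<cdot> e \<cdot> d = c' \<cdot> c \<cdot> s"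
      using cmp_assoc[of d e p] cmp_assoc[of d q c'] dD sD e c c' A sq by simp
    then show "over p s (G s d)" using cc(1)[OF sD] dD e by (simp add: over_def G_def)
    show "k \<in> Arr E \<Longrightarrow> Cod E k = Dom E s \<Longrightarrow> G (s \<cdot> k) (d \<cdot> k) = G s d \<cdot> k"
      using dD sD c e by (simp add: G_def)
  qed
  have \<phi>': "\<phi> = \<lparr>src = p, tgt = q, on_pos = c, on_dir = G (pb1 c q) (pb2 c q)\<rparr>" by (simp add: \<phi> G_def)
  have act: "is_poly_arr \<phi>" "\<And>s. act_pos \<phi> s = c \<cdot> s"
    "\<And>s d. pos p s \<Longrightarrow> over q (c \<cdot> s) d \<Longrightarrow> act_dir \<phi> s d = G s d"
    by (rule poly_arr_family[where G = G, OF p q c _ _ \<phi>']; (rule G | assumption)+)+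
  then show "is_poly_arr \<phi>" "act_pos \<phi> s = c \<cdot> s" "pos p s \<Longrightarrow> over q (c \<cdot> s) d \<Longrightarrow> act_dir \<phi> s d = e \<cdot> d"
    by (simp_all add: G_def)
  have st: "src \<phi> = p" "tgt \<phi> = q" by (simp_all add: \<phi>)
  show "is_iso Poly \<phi>"
  proof (rule is_iso_Poly[OF act(1)]; unfold st act(2))
    show "s = t" if "pos p s" "pos p t" "c \<cdot> s = c \<cdot> t" for s t
      using cc(1)[OF posD[OF that(1)]] cc(1)[OF posD[OF that(2)]] that(3) by metis
    show "\<exists>s. pos p s \<and> c \<cdot> s = t" if "pos q t" for t
      using cc(2)[OF posD[OF that]] posD[OF that] c' by (intro exI[of _ "c' \<cdot> t"]) (simp add: pos_def)
    show "d = d'" if s: "pos p s" and d: "over q (c \<cdot> s) d" "over q (c \<cdot> s) d'" and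
      eq: "act_dir \<phi> s d = act_dir \<phi> s d'" for s d d'
      using eq act(3)[OF s d(1)] act(3)[OF s d(2)] cc(3)[OF overD(1,2)[OF d(1) A(2)]]
        cc(3)[OF overD(1,2)[OF d(2) A(2)]] unfolding G_def by metis
    show "\<exists>d. over q (c \<cdot> s) d \<and> act_dir \<phi> s d = y" if s: "pos p s" and y: "over p s y" for s y
    proof -
      note yD = overD[OF y A(1)]
      have "over q (c \<cdot> s) (e' \<cdot> y)"
        using cmp_assoc[of y e' q] cmp_assoc[of y p c] yD e' c A qe by (simp add: over_def)
      then show ?thesis
        using act(3)[OF s] cc(4)[OF yD(1,2)] by (intro exI[of _ "e' \<cdot> y"]) (simp add: G_def)
    qed
  qed
qed

lemma prd_assoc_arr:
  assumes "X \<in> Obj E" "Y \<in> Obj E" "Z \<in> Obj E"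
  shows "prd_assoc X Y Z \<in> Arr E" "Dom E (prd_assoc X Y Z) = prd (prd X Y) Z"
    "Cod E (prd_assoc X Y Z) = prd X (prd Y Z)" "prd_assoc_inv X Y Z \<in> Arr E"
    "Dom E (prd_assoc_inv X Y Z) = prd X (prd Y Z)" "Cod E (prd_assoc_inv X Y Z) = prd (prd X Y) Z"
    "prd_assoc_inv X Y Z \<cdot> prd_assoc X Y Z = Ident E (prd (prd X Y) Z)"
    "prd_assoc X Y Z \<cdot> prd_assoc_inv X Y Z = Ident E (prd X (prd Y Z))"
  using assms tuple_eta[of X Y "pr1 (prd X Y) Z"] tuple_eta[of Y Z "pr2 X (prd Y Z)"]
  by (simp_all add: prd_assoc_def prd_assoc_inv_def)

lemma
  assumes p: "exponentiable p" and q: "exponentiable q" and r: "exponentiable r"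
  shows is_poly_arr_tensor_assoc [simp]: "is_poly_arr (tensor_assoc p q r)"
    and act_pos_tensor_assoc [simp]: "pos p s \<Longrightarrow> pos q t \<Longrightarrow> pos r u \<Longrightarrow> Dom E s = Dom E t \<Longrightarrow> Dom E t = Dom E u \<Longrightarrow>
      act_pos (tensor_assoc p q r) (tuple (tuple s t) u) = tuple s (tuple t u)"
    and act_dir_tensor_assoc [simp]: "pos p s \<Longrightarrow> pos q t \<Longrightarrow> pos r u \<Longrightarrow> Dom E s = Dom E t \<Longrightarrow> Dom E t = Dom E u \<Longrightarrow>
      over p s d \<Longrightarrow> over q t e \<Longrightarrow> over r u f \<Longrightarrow>
      act_dir (tensor_assoc p q r) (tuple (tuple s t) u) (tuple d (tuple e f)) = tuple (tuple d e) f"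
    and is_iso_tensor_assoc: "is_iso Poly (tensor_assoc p q r)"
proof -
  note A = exponentiableD[OF p] exponentiableD[OF q] exponentiableD[OF r]
  let ?c = "prd_assoc (Cod E p) (Cod E q) (Cod E r)" and ?c' = "prd_assoc_inv (Cod E p) (Cod E q) (Cod E r)"
  \<comment> \<open>Directions run from the codomain back to the domain, so the inverse associator
    appears here.\<close>
  let ?e = "prd_assoc_inv (Dom E p) (Dom E q) (Dom E r)"
  have "prd_map (prd_map p q) r \<cdot> ?e = ?c' \<cdot> prd_map p (prd_map q r)"
    using A by (simp add: prd_assoc_inv_def prd_map_def)
  note iso = poly_arr_of_iso[of "prd_map (prd_map p q) r" "prd_map p (prd_map q r)" ?c ?c' ?e
      "prd_assoc (Dom E p) (Dom E q) (Dom E r)" "tensor_assoc p q r", OF _ _ _ _ _ _ _ _ _ _ _ _ _ _ _ _ _ _ this]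
  have iso: "is_poly_arr (tensor_assoc p q r)" "\<And>s. act_pos (tensor_assoc p q r) s = ?c \<cdot> s"
    "\<And>s d. pos (prd_map (prd_map p q) r) s \<Longrightarrow> over (prd_map p (prd_map q r)) (?c \<cdot> s) d \<Longrightarrow>
      act_dir (tensor_assoc p q r) s d = ?e \<cdot> d" "is_iso Poly (tensor_assoc p q r)"
    by (rule iso; use p q r A in \<open>simp add: prd_assoc_arr tensor_assoc_def Let_def\<close>)+
  show "is_poly_arr (tensor_assoc p q r)" "is_iso Poly (tensor_assoc p q r)" by (rule iso)+
  assume st: "pos p s" "pos q t" "pos r u" "Dom E s = Dom E t" "Dom E t = Dom E u"
  show c: "act_pos (tensor_assoc p q r) (tuple (tuple s t) u) = tuple s (tuple t u)"
    using st A by (simp add: iso(2) prd_assoc_def pos_def)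
  assume d: "over p s d" "over q t e" "over r u f"
  have "?e \<cdot> tuple d (tuple e f) = tuple (tuple d e) f"
    using overD[OF d(1) A(1)] overD[OF d(2) A(2)] overD[OF d(3) A(3)] st(4,5) A by (simp add: prd_assoc_inv_def)
  then show "act_dir (tensor_assoc p q r) (tuple (tuple s t) u) (tuple d (tuple e f)) = tuple (tuple d e) f"
    using iso(3)[of "tuple (tuple s t) u" "tuple d (tuple e f)"] c st d p q r by (simp add: iso(2))
qed

lemma
  assumes p: "exponentiable p"
  shows is_poly_arr_tensor_lunit [simp]: "is_poly_arr (tensor_lunit p)"
    and act_pos_tensor_lunit [simp]: "pos y_poly t \<Longrightarrow> pos p s \<Longrightarrow> Dom E t = Dom E s \<Longrightarrow>
      act_pos (tensor_lunit p) (tuple t s) = s"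
    and act_dir_tensor_lunit [simp]: "pos y_poly t \<Longrightarrow> pos p s \<Longrightarrow> Dom E t = Dom E s \<Longrightarrow>
      over p s d \<Longrightarrow> act_dir (tensor_lunit p) (tuple t s) d = tuple t d"
    and is_iso_tensor_lunit: "is_iso Poly (tensor_lunit p)"
proof -
  note A = exponentiableD[OF p] y_poly_arr
  \<comment> \<open>The inverse of the projection away from a terminal factor, used both on
    positions and on directions.\<close>
  let ?i = "\<lambda>X. tuple (bang X) (Ident E X)"
  have inv: "?i X \<cdot> pr2 one X = Ident E (prd one X)" if "X \<in> Obj E" for X
    using that bang_unique[of "pr1 one X" "bang (prd one X)"] by (simp flip: tuple_pr)
  have iso: "is_poly_arr (tensor_lunit p)" "\<And>s. act_pos (tensor_lunit p) s = pr2 one (Cod E p) \<cdot> s"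
    "\<And>s d. pos (prd_map y_poly p) s \<Longrightarrow> over p (pr2 one (Cod E p) \<cdot> s) d \<Longrightarrow>
      act_dir (tensor_lunit p) s d = ?i (Dom E p) \<cdot> d" "is_iso Poly (tensor_lunit p)"
    by (rule poly_arr_of_iso[where p = "prd_map y_poly p" and q = p and c = "pr2 one (Cod E p)" and
          c' = "?i (Cod E p)" and e = "?i (Dom E p)" and e' = "pr2 one (Dom E p)"];
        use p A inv exponentiable_y_poly[unfolded y_poly_def] in \<open>simp add: tensor_lunit_def Let_def y_poly_def\<close>)+
  show "is_poly_arr (tensor_lunit p)" "is_iso Poly (tensor_lunit p)" by (rule iso)+
  assume st: "pos y_poly t" "pos p s" "Dom E t = Dom E s"
  show c: "act_pos (tensor_lunit p) (tuple t s) = s" using st A by (simp add: iso(2) pos_def)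
  assume d: "over p s d"
  then have "?i (Dom E p) \<cdot> d = tuple t d"
    using overD[OF d A(1)] pos_y_poly[OF st(1)] st(3) A by simp
  then show "act_dir (tensor_lunit p) (tuple t s) d = tuple t d"
    using iso(3)[of "tuple t s" d] c st d p by (simp add: iso(2))
qed

lemma
  assumes p: "exponentiable p"
  shows is_poly_arr_tensor_runit [simp]: "is_poly_arr (tensor_runit p)"
    and act_pos_tensor_runit [simp]: "pos p s \<Longrightarrow> pos y_poly t \<Longrightarrow> Dom E s = Dom E t \<Longrightarrow>
      act_pos (tensor_runit p) (tuple s t) = s"
    and act_dir_tensor_runit [simp]: "pos p s \<Longrightarrow> pos y_poly t \<Longrightarrow> Dom E s = Dom E t \<Longrightarrow>
      over p s d \<Longrightarrow> act_dir (tensor_runit p) (tuple s t) d = tuple d t"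
    and is_iso_tensor_runit: "is_iso Poly (tensor_runit p)"
proof -
  note A = exponentiableD[OF p] y_poly_arr
  let ?i = "\<lambda>X. tuple (Ident E X) (bang X)"
  have inv: "?i X \<cdot> pr1 X one = Ident E (prd X one)" if "X \<in> Obj E" for X
    using that bang_unique[of "pr2 X one" "bang (prd X one)"] by (simp flip: tuple_pr)
  have iso: "is_poly_arr (tensor_runit p)" "\<And>s. act_pos (tensor_runit p) s = pr1 (Cod E p) one \<cdot> s"
    "\<And>s d. pos (prd_map p y_poly) s \<Longrightarrow> over p (pr1 (Cod E p) one \<cdot> s) d \<Longrightarrow>
      act_dir (tensor_runit p) s d = ?i (Dom E p) \<cdot> d" "is_iso Poly (tensor_runit p)"
    by (rule poly_arr_of_iso[where p = "prd_map p y_poly" and q = p and c = "pr1 (Cod E p) one" and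
          c' = "?i (Cod E p)" and e = "?i (Dom E p)" and e' = "pr1 (Dom E p) one"];
        use p A inv exponentiable_y_poly[unfolded y_poly_def] in \<open>simp add: tensor_runit_def Let_def y_poly_def\<close>)+
  show "is_poly_arr (tensor_runit p)" "is_iso Poly (tensor_runit p)" by (rule iso)+
  assume st: "pos p s" "pos y_poly t" "Dom E s = Dom E t"
  show c: "act_pos (tensor_runit p) (tuple s t) = s" using st A by (simp add: iso(2) pos_def)
  assume d: "over p s d"
  then have "?i (Dom E p) \<cdot> d = tuple d t"
    using overD[OF d A(1)] pos_y_poly[OF st(2)] st(3) A by simp
  then show "act_dir (tensor_runit p) (tuple s t) d = tuple d t"
    using iso(3)[of "tuple s t" d] c st d p by (simp add: iso(2))
qed

section \<open>The composition product of morphisms and its coherence maps\<close>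

lemma comp_obj_cases:
  assumes "exponentiable p" "exponentiable q" "pos (p \<triangleleft> q) s" "over (p \<triangleleft> q) s d"
  obtains y z where "d = direction p q s y z" "over p (base_at p q s) y" "over q (apply_at p q s y) z"
  using over_dir1[OF assms] over_dir2[OF assms] direction_eta[OF assms] by metis

lemma direction_inject:
  assumes "exponentiable p" "exponentiable q" "pos (p \<triangleleft> q) s"
    "over p (base_at p q s) y" "over q (apply_at p q s y) z"
    "over p (base_at p q s) y'" "over q (apply_at p q s y') z'"
  shows "direction p q s y z = direction p q s y' z' \<longleftrightarrow> y = y' \<and> z = z'"
  using dir1_direction[OF assms(1-5)] dir2_direction[OF assms(1-5)]
    dir1_direction[OF assms(1-3,6,7)] dir2_direction[OF assms(1-3,6,7)] by metis

lemma comp_arr_src_tgt [simp]: "src (comp_arr \<phi> \<psi>) = src \<phi> \<triangleleft> src \<psi>" "tgt (comp_arr \<phi> \<psi>) = tgt \<phi> \<triangleleft> tgt \<psi>"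
  by (simp_all add: comp_arr_def Let_def)

text \<open>The map sends \<open>(x, f)\<close> to the image of \<open>x\<close> under
  \<open>\<phi>\<close>, and to the function that pulls a direction back along
  \<open>\<phi>\<close>, applies \<open>f\<close> and pushes the result along \<open>\<psi>\<close>.
  Codomains and the target position are variables with equational premises, since either may already
  have been rewritten when a rule is tried.\<close>

lemma
  assumes \<phi>: "is_poly_arr \<phi>" and \<psi>: "is_poly_arr \<psi>"
  shows is_poly_arr_comp_arr [simp]: "is_poly_arr (comp_arr \<phi> \<psi>)"
    and base_at_comp_arr [simp]: "p' = tgt \<phi> \<Longrightarrow> q' = tgt \<psi> \<Longrightarrow> pos (src \<phi> \<triangleleft> src \<psi>) s \<Longrightarrow>
      base_at p' q' (act_pos (comp_arr \<phi> \<psi>) s) = act_pos \<phi> (base_at (src \<phi>) (src \<psi>) s)"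
    and apply_at_comp_arr [simp]: "p' = tgt \<phi> \<Longrightarrow> q' = tgt \<psi> \<Longrightarrow> pos (src \<phi> \<triangleleft> src \<psi>) s \<Longrightarrow>
      over (tgt \<phi>) (act_pos \<phi> (base_at (src \<phi>) (src \<psi>) s)) y \<Longrightarrow>
      apply_at p' q' (act_pos (comp_arr \<phi> \<psi>) s) y =
        act_pos \<psi> (apply_at (src \<phi>) (src \<psi>) s (act_dir \<phi> (base_at (src \<phi>) (src \<psi>) s) y))"
    and act_dir_comp_arr [simp]: "p' = tgt \<phi> \<Longrightarrow> q' = tgt \<psi> \<Longrightarrow> t = act_pos (comp_arr \<phi> \<psi>) s \<Longrightarrow>
      pos (src \<phi> \<triangleleft> src \<psi>) s \<Longrightarrow> over (tgt \<phi>) (act_pos \<phi> (base_at (src \<phi>) (src \<psi>) s)) y \<Longrightarrow>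
      over (tgt \<psi>) (act_pos \<psi> (apply_at (src \<phi>) (src \<psi>) s (act_dir \<phi> (base_at (src \<phi>) (src \<psi>) s) y))) z \<Longrightarrow>
      act_dir (comp_arr \<phi> \<psi>) s (direction p' q' t y z) =
        direction (src \<phi>) (src \<psi>) s (act_dir \<phi> (base_at (src \<phi>) (src \<psi>) s) y)
          (act_dir \<psi> (apply_at (src \<phi>) (src \<psi>) s (act_dir \<phi> (base_at (src \<phi>) (src \<psi>) s) y)) z)"
proof -
  let ?p = "src \<phi>" and ?q = "src \<psi>"
  define x where "x = on_pos \<phi> \<cdot> base ?p ?q"
  define X where "X s = act_pos \<phi> (base_at ?p ?q s)" for s
  define F where "F s y = on_pos \<psi> \<cdot> apply_at ?p ?q s (act_dir \<phi> (base ?p ?q \<cdot> s) y)" for s y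
  define H where "H s y z = direction ?p ?q s (act_dir \<phi> (base ?p ?q \<cdot> s) y)
    (act_dir \<psi> (apply_at ?p ?q s (act_dir \<phi> (base ?p ?q \<cdot> s) y)) z)" for s y z
  \<comment> \<open>\<open>F\<close> and \<open>H\<close> are defined in the literal form of
    \<open>comp_arr\<close>; these equations put them into the form that the calculus
    rewrites.\<close>
  have F_eq: "F s y = act_pos \<psi> (apply_at ?p ?q s (act_dir \<phi> (base_at ?p ?q s) y))" for s y
    by (simp add: F_def act_pos_def base_at_def)
  have H_eq: "H s y z = direction ?p ?q s (act_dir \<phi> (base_at ?p ?q s) y)
    (act_dir \<psi> (apply_at ?p ?q s (act_dir \<phi> (base_at ?p ?q s) y)) z)" for s y z
    by (simp add: H_def base_at_def)
  note e [simp] = is_poly_arr_src_tgt[OF \<phi>] is_poly_arr_src_tgt[OF \<psi>] \<phi> \<psi>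
  note A = is_poly_arr_arrs[OF \<phi>] base_arr[OF e(1,3)] comp_obj_arr[OF e(1,3)]
  have xA: "x \<in> Arr E" "Dom E x = Cod E (?p \<triangleleft> ?q)" "Cod E x = Cod E (tgt \<phi>)"
    using A by (simp_all add: x_def)
  have X: "x \<cdot> s = X s" if "pos (?p \<triangleleft> ?q) s" for s
    using that A by (simp add: x_def X_def act_pos_def base_at_def pos_def)
  have F: "pos (tgt \<psi>) (F s y) \<and> Dom E (F s y) = Dom E s"
    "k \<in> Arr E \<Longrightarrow> Cod E k = Dom E s \<Longrightarrow> F (s \<cdot> k) (y \<cdot> k) = F s y \<cdot> k"
    if "pos (?p \<triangleleft> ?q) s" "over (tgt \<phi>) (X s) y" for s y k
    using that by (simp_all add: F_eq X_def)
  have H: "over (?p \<triangleleft> ?q) s (H s y z)"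
    "k \<in> Arr E \<Longrightarrow> Cod E k = Dom E s \<Longrightarrow> H (s \<cdot> k) (y \<cdot> k) (z \<cdot> k) = H s y z \<cdot> k"
    if "pos (?p \<triangleleft> ?q) s" "over (tgt \<phi>) (X s) y" "over (tgt \<psi>) (F s y) z" for s y z k
    using that by (simp_all add: F_eq X_def H_eq)
  define c where "c = position (tgt \<phi>) (tgt \<psi>) x (F (pb1 x (tgt \<phi>)) (pb2 x (tgt \<phi>)))"
  have eq: "comp_arr \<phi> \<psi> = \<lparr>src = ?p \<triangleleft> ?q, tgt = tgt \<phi> \<triangleleft> tgt \<psi>, on_pos = c,
      on_dir = H (pb1 c (tgt \<phi> \<triangleleft> tgt \<psi>)) (dir1 (tgt \<phi>) (tgt \<psi>) \<cdot> pb2 c (tgt \<phi> \<triangleleft> tgt \<psi>))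
        (dir2 (tgt \<phi>) (tgt \<psi>) \<cdot> pb2 c (tgt \<phi> \<triangleleft> tgt \<psi>))\<rparr>"
    by (simp add: comp_arr_def Let_def c_def F_def H_def x_def)
  have r: "exponentiable (?p \<triangleleft> ?q)" by simp
  have fam: "is_poly_arr (comp_arr \<phi> \<psi>)"
    "\<And>s. pos (?p \<triangleleft> ?q) s \<Longrightarrow> base_at (tgt \<phi>) (tgt \<psi>) (act_pos (comp_arr \<phi> \<psi>) s) = X s"
    "\<And>s y. pos (?p \<triangleleft> ?q) s \<Longrightarrow> over (tgt \<phi>) (X s) y \<Longrightarrow>
      apply_at (tgt \<phi>) (tgt \<psi>) (act_pos (comp_arr \<phi> \<psi>) s) y = F s y"
    "\<And>s y z t. pos (?p \<triangleleft> ?q) s \<Longrightarrow> over (tgt \<phi>) (X s) y \<Longrightarrow> over (tgt \<psi>) (F s y) z \<Longrightarrow>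
      t = act_pos (comp_arr \<phi> \<psi>) s \<Longrightarrow>
       act_dir (comp_arr \<phi> \<psi>) s (direction (tgt \<phi>) (tgt \<psi>) t y z) = H s y z"
    by (rule poly_arr_into_comp_family[where X = X and F = F and H = H, OF r e(2,4) xA _ _ _ _ _ c_def eq];
        (rule X F H | assumption)+)+
  show "is_poly_arr (comp_arr \<phi> \<psi>)" by (rule fam)
  assume p': "p' = tgt \<phi>" and q': "q' = tgt \<psi>" and s: "pos (?p \<triangleleft> ?q) s"
  show "base_at p' q' (act_pos (comp_arr \<phi> \<psi>) s) = act_pos \<phi> (base_at ?p ?q s)"
    using fam(2)[OF s] by (simp add: p' q' X_def)
  assume y: "over (tgt \<phi>) (act_pos \<phi> (base_at ?p ?q s)) y"
  show "apply_at p' q' (act_pos (comp_arr \<phi> \<psi>) s) y =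
        act_pos \<psi> (apply_at ?p ?q s (act_dir \<phi> (base_at ?p ?q s) y))"
    using fam(3)[OF s, of y] y by (simp add: p' q' X_def F_eq)
  assume "t = act_pos (comp_arr \<phi> \<psi>) s"
    "over (tgt \<psi>) (act_pos \<psi> (apply_at ?p ?q s (act_dir \<phi> (base_at ?p ?q s) y))) z"
  then show "act_dir (comp_arr \<phi> \<psi>) s (direction p' q' t y z) =
        direction ?p ?q s (act_dir \<phi> (base_at ?p ?q s) y)
          (act_dir \<psi> (apply_at ?p ?q s (act_dir \<phi> (base_at ?p ?q s) y)) z)"
    using fam(4)[OF s, of y z t] y by (simp add: p' q' X_def F_eq H_eq)
qed

section \<open>The associator of the composition product\<close>

lemma comp_assoc_src_tgt [simp]: "src (comp_assoc p q r) = (p \<triangleleft> q) \<triangleleft> r"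
  "tgt (comp_assoc p q r) = p \<triangleleft> (q \<triangleleft> r)"
  by (simp_all add: comp_assoc_def Let_def)

text \<open>The codomain is nested, so each value of the image is itself a position of
  \<open>q \<triangleleft> r\<close> built by \<open>position\<close>. Its base, its values and its
  naturality have to be established before the outer map can be described. The rules compute only
  the innermost data, which are all that extensionality asks for.\<close>

lemma
  assumes p: "exponentiable p" and q: "exponentiable q" and r: "exponentiable r"
  shows is_poly_arr_comp_assoc [simp]: "is_poly_arr (comp_assoc p q r)"
    and base_at_comp_assoc [simp]: "pos ((p \<triangleleft> q) \<triangleleft> r) s \<Longrightarrow>
      base_at p (q \<triangleleft> r) (act_pos (comp_assoc p q r) s) = base_at p q (base_at (p \<triangleleft> q) r s)"
    and base_at_apply_at_comp_assoc [simp]: "pos ((p \<triangleleft> q) \<triangleleft> r) s \<Longrightarrow>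
      over p (base_at p q (base_at (p \<triangleleft> q) r s)) y \<Longrightarrow>
      base_at q r (apply_at p (q \<triangleleft> r) (act_pos (comp_assoc p q r) s) y) =
        apply_at p q (base_at (p \<triangleleft> q) r s) y"
    and apply_at_apply_at_comp_assoc [simp]: "pos ((p \<triangleleft> q) \<triangleleft> r) s \<Longrightarrow>
      over p (base_at p q (base_at (p \<triangleleft> q) r s)) y \<Longrightarrow>
      over q (apply_at p q (base_at (p \<triangleleft> q) r s) y) z \<Longrightarrow>
      apply_at q r (apply_at p (q \<triangleleft> r) (act_pos (comp_assoc p q r) s) y) z =
        apply_at (p \<triangleleft> q) r s (direction p q (base_at (p \<triangleleft> q) r s) y z)"
    and act_dir_comp_assoc [simp]: "pos ((p \<triangleleft> q) \<triangleleft> r) s \<Longrightarrow>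
      over p (base_at p q (base_at (p \<triangleleft> q) r s)) y \<Longrightarrow>
      over q (apply_at p q (base_at (p \<triangleleft> q) r s) y) z \<Longrightarrow>
      over r (apply_at (p \<triangleleft> q) r s (direction p q (base_at (p \<triangleleft> q) r s) y z)) w \<Longrightarrow>
      t = act_pos (comp_assoc p q r) s \<Longrightarrow>
      u = apply_at p (q \<triangleleft> r) (act_pos (comp_assoc p q r) s) y \<Longrightarrow>
      act_dir (comp_assoc p q r) s (direction p (q \<triangleleft> r) t y (direction q r u z w)) =
        direction (p \<triangleleft> q) r s (direction p q (base_at (p \<triangleleft> q) r s) y z) w"
proof -
  let ?R = "(p \<triangleleft> q) \<triangleleft> r"
  note [simp] = p q r
  have pq: "exponentiable (p \<triangleleft> q)" and qr: "exponentiable (q \<triangleleft> r)" and R: "exponentiable ?R" by simp_all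
  define b where "b = base (p \<triangleleft> q) r"
  have b_at: "b \<cdot> s = base_at (p \<triangleleft> q) r s" for s by (simp add: b_def base_at_def)
  define x where "x = base p q \<cdot> b"
  define X where "X s = base_at p q (base_at (p \<triangleleft> q) r s)" for s
  define f where "f s y = apply_at p q (b \<cdot> s) y" for s y
  \<comment> \<open>The extra argument \<open>h\<close> shifts the stage: the inner position needs
    values at all stages after that of \<open>s\<close>, not just at its own.\<close>
  define g where "g s y h z = apply_at (p \<triangleleft> q) r (s \<cdot> h) (direction p q (b \<cdot> s \<cdot> h) (y \<cdot> h) z)"
    for s y h z
  define F where "F s y = position q r (f s y) (g s y (pb1 (f s y) q) (pb2 (f s y) q))" for s y
  define H where "H s y zw = direction (p \<triangleleft> q) r s (direction p q (b \<cdot> s) y (dir1 q r \<cdot> zw)) (dir2 q r \<cdot> zw)"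
    for s y zw
  note A = base_arr[OF p q] base_arr[OF pq r] comp_obj_arr[OF p q] comp_obj_arr[OF pq r]
  have xA: "x \<in> Arr E" "Dom E x = Cod E ?R" "Cod E x = Cod E p"
    using A by (simp_all add: x_def b_def)
  have X: "x \<cdot> s = X s" if "pos ?R s" for s
    using that A by (simp add: x_def X_def b_def base_at_def pos_def)
  have f: "f s y = apply_at p q (base_at (p \<triangleleft> q) r s) y" for s y
    by (simp add: f_def b_at)
  have fD: "pos q (f s y)" "Dom E (f s y) = Dom E s"
    "k \<in> Arr E \<Longrightarrow> Cod E k = Dom E s \<Longrightarrow> f s y \<cdot> k = f (s \<cdot> k) (y \<cdot> k)"
    if "pos ?R s" "over p (X s) y" for s y k
    using that by (simp_all add: f X_def)
  have shift: "pos ?R (s \<cdot> k)" "X s \<cdot> k = X (s \<cdot> k)" "over p (X (s \<cdot> k)) (y \<cdot> k)"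
    "s \<in> Arr E" "y \<in> Arr E" "Dom E y = Dom E s" "Dom E (s \<cdot> k) = Dom E k"
    if "pos ?R s" "over p (X s) y" "k \<in> Arr E" "Cod E k = Dom E s" for s y k
  proof -
    have D: "Dom E (X s) = Dom E s" using that(1) by (simp add: X_def)
    show "pos ?R (s \<cdot> k)" using pos_cmp that by blast
    show *: "X s \<cdot> k = X (s \<cdot> k)" using that(1,3,4) by (simp add: X_def)
    show "over p (X (s \<cdot> k)) (y \<cdot> k)"
      using over_cmp[OF that(2) exponentiableD[OF p] that(3)] that(4) D * by simp
    show "s \<in> Arr E" "y \<in> Arr E" "Dom E y = Dom E s"
      using posD[OF that(1)] overD[OF that(2) exponentiableD[OF p]] D by simp_all
    then show "Dom E (s \<cdot> k) = Dom E k" using that by simp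
  qed
  \<comment> \<open>The inner position is valid, with base \<open>f s y\<close> and values given by
    \<open>g\<close>.\<close>
  have Fl: "pos (q \<triangleleft> r) (F s y)" "base_at q r (F s y) = f s y" "Dom E (F s y) = Dom E s"
    "\<And>h z. h \<in> Arr E \<Longrightarrow> Cod E h = Dom E s \<Longrightarrow> over q (f s y \<cdot> h) z \<Longrightarrow>
      apply_at q r (F s y \<cdot> h) z = g s y h z"
    if s: "pos ?R s" "over p (X s) y" for s y
  proof -
    have g1: "pos r (g s y h z) \<and> Dom E (g s y h z) = Dom E h"
      if h: "h \<in> Arr E" "Cod E h = Dom E (f s y)" "over q (f s y \<cdot> h) z" for h z
    proof -
      have k: "Cod E h = Dom E s" using h fD[OF s] by simp
      note sh = shift[OF s h(1) k]
      have "over q (f (s \<cdot> h) (y \<cdot> h)) z" using h fD(3)[OF s h(1) k] by simp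
      then show ?thesis using sh by (simp add: g_def f b_at X_def)
    qed
    have g2: "g s y (h \<cdot> k) (z \<cdot> k) = g s y h z \<cdot> k"
      if h: "h \<in> Arr E" "Cod E h = Dom E (f s y)" "over q (f s y \<cdot> h) z"
        and k: "k \<in> Arr E" "Cod E k = Dom E h" for h z k
    proof -
      have h': "Cod E h = Dom E s" using h fD[OF s] by simp
      note sh = shift[OF s h(1) h']
      have "over q (f (s \<cdot> h) (y \<cdot> h)) z" using h fD(3)[OF s h(1) h'] by simp
      then show ?thesis using sh k h(1) h' by (simp add: g_def f b_at X_def)
    qed
    have F_def': "F s y = position q r (f s y) (g s y (pb1 (f s y) q) (pb2 (f s y) q))"
      by (rule F_def)
    note pf = position_family[OF q r fD(1)[OF s], where F = "g s y"]
    show "pos (q \<triangleleft> r) (F s y)" unfolding F_def' by (rule pf(1); (rule g1 g2 refl | assumption)+)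
    show "base_at q r (F s y) = f s y" unfolding F_def' by (rule pf(2); (rule g1 g2 refl | assumption)+)
    have "Dom E (F s y) = Dom E (f s y)" unfolding F_def' by (rule pf(3); (rule g1 g2 refl | assumption)+)
    then show "Dom E (F s y) = Dom E s" using fD[OF s] by simp
    fix h z assume h: "h \<in> Arr E" "Cod E h = Dom E s" "over q (f s y \<cdot> h) z"
    have h': "Cod E h = Dom E (f s y)" using h fD[OF s] by simp
    show "apply_at q r (F s y \<cdot> h) z = g s y h z" unfolding F_def'
      by (rule pf(4)[OF _ _ _ h(1) h' h(3)]; (rule g1 g2 refl | assumption)+)
  qed
  \<comment> \<open>Evaluation without a change of stage is the case where \<open>h\<close> is an
    identity.\<close>
  have app: "apply_at q r (F s y) z = apply_at (p \<triangleleft> q) r s (direction p q (base_at (p \<triangleleft> q) r s) y z)"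
    if s: "pos ?R s" "over p (X s) y" "over q (f s y) z" for s y z
  proof -
    have sI: "Ident E (Dom E s) \<in> Arr E" "Cod E (Ident E (Dom E s)) = Dom E s"
      using s(1) by (simp_all add: pos_def)
    note sh = shift[OF s(1,2) sI]
    have "F s y \<cdot> Ident E (Dom E s) = F s y" "f s y \<cdot> Ident E (Dom E s) = f s y"
      using Fl(1,3)[OF s(1,2)] fD[OF s(1,2)] by (simp_all add: pos_def)
    then show ?thesis
      using Fl(4)[OF s(1,2) sI, of z] s(3) sh(4-6) by (simp add: g_def b_at)
  qed
  have F: "pos (q \<triangleleft> r) (F s y) \<and> Dom E (F s y) = Dom E s" if "pos ?R s" "over p (X s) y" for s y
    using Fl[OF that] by simp
  \<comment> \<open>The inner positions at two stages are described independently of each other;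
    only extensionality relates them.\<close>
  have F_nat: "F (s \<cdot> k) (y \<cdot> k) = F s y \<cdot> k"
    if s: "pos ?R s" "over p (X s) y" and k: "k \<in> Arr E" "Cod E k = Dom E s" for s y k
  proof (rule pos_ext[OF q r])
    note sh = shift[OF s k]
    note Fk = Fl[OF sh(1,3)] and Fs = Fl[OF s]
    show "pos (q \<triangleleft> r) (F (s \<cdot> k) (y \<cdot> k))" by (rule Fk)
    show "pos (q \<triangleleft> r) (F s y \<cdot> k)" using pos_cmp[OF Fs(1) k(1)] k Fs(3) by simp
    show "base_at q r (F (s \<cdot> k) (y \<cdot> k)) = base_at q r (F s y \<cdot> k)"
      using Fk(2) Fs base_at_cmp[OF q r Fs(1) k(1)] k fD(3)[OF s k] by simp
    fix h z assume h: "h \<in> Arr E" "Cod E h = Dom E (F (s \<cdot> k) (y \<cdot> k))"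
      and z: "over q (base_at q r (F (s \<cdot> k) (y \<cdot> k) \<cdot> h)) z"
    have hk: "Cod E h = Dom E k" using h Fk(3) sh by simp
    have "base_at q r (F (s \<cdot> k) (y \<cdot> k) \<cdot> h) = f (s \<cdot> k) (y \<cdot> k) \<cdot> h"
      using base_at_cmp[OF q r Fk(1) h] Fk(2) by simp
    then have z': "over q (f (s \<cdot> k) (y \<cdot> k) \<cdot> h) z" using z by simp
    have hs: "Cod E h = Dom E (s \<cdot> k)" using hk sh by simp
    have e1: "apply_at q r (F (s \<cdot> k) (y \<cdot> k) \<cdot> h) z = g (s \<cdot> k) (y \<cdot> k) h z"
      using Fk(4)[OF h(1) hs z'] .
    have kh: "k \<cdot> h \<in> Arr E" "Cod E (k \<cdot> h) = Dom E s" using k h hk by simp_all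
    have "f s y \<cdot> k \<cdot> h = f (s \<cdot> k) (y \<cdot> k) \<cdot> h"
      using fD(1,2)[OF s] fD(3)[OF s k] k h(1) hk cmp_assoc[of h k "f s y"] by (simp add: pos_def)
    then have z'': "over q (f s y \<cdot> k \<cdot> h) z" using z' by simp
    have e2: "apply_at q r (F s y \<cdot> k \<cdot> h) z = g s y (k \<cdot> h) z" using Fs(4)[OF kh z''] .
    have "(F s y \<cdot> k) \<cdot> h = F s y \<cdot> k \<cdot> h" using posD[OF Fs(1)] Fs(3) k h(1) hk by simp
    moreover have "g (s \<cdot> k) (y \<cdot> k) h z = g s y (k \<cdot> h) z"
      using sh(4-6) k h(1) hk by (simp add: g_def)
    ultimately show "apply_at q r (F (s \<cdot> k) (y \<cdot> k) \<cdot> h) z = apply_at q r ((F s y \<cdot> k) \<cdot> h) z"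
      using e1 e2 by simp
  qed
  have zwD: "over q (f s y) (dir1 q r \<cdot> zw)"
    "over r (apply_at (p \<triangleleft> q) r s (direction p q (base_at (p \<triangleleft> q) r s) y (dir1 q r \<cdot> zw))) (dir2 q r \<cdot> zw)"
    "zw \<in> Arr E" "Cod E zw = Dom E (q \<triangleleft> r)" "Dom E zw = Dom E s"
    if s: "pos ?R s" "over p (X s) y" and zw: "over (q \<triangleleft> r) (F s y) zw" for s y zw
  proof -
    show 1: "over q (f s y) (dir1 q r \<cdot> zw)"
      using over_dir1[OF q r Fl(1)[OF s] zw] Fl(2)[OF s] by simp
    show "over r (apply_at (p \<triangleleft> q) r s (direction p q (base_at (p \<triangleleft> q) r s) y (dir1 q r \<cdot> zw))) (dir2 q r \<cdot> zw)"
      using over_dir2[OF q r Fl(1)[OF s] zw] app[OF s 1] by simp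
    show "zw \<in> Arr E" "Cod E zw = Dom E (q \<triangleleft> r)" "Dom E zw = Dom E s"
      using overD[OF zw exponentiableD[OF qr]] Fl(3)[OF s] by simp_all
  qed
  have H: "over ?R s (H s y zw)"
    "k \<in> Arr E \<Longrightarrow> Cod E k = Dom E s \<Longrightarrow> H (s \<cdot> k) (y \<cdot> k) (zw \<cdot> k) = H s y zw \<cdot> k"
    if s: "pos ?R s" "over p (X s) y" and zw: "over (q \<triangleleft> r) (F s y) zw" for s y zw k
    using s zwD[OF s zw] dir_arr[OF q r] by (simp_all add: H_def f b_at X_def)
  define c where "c = position p (q \<triangleleft> r) x (F (pb1 x p) (pb2 x p))"
  have eq: "comp_assoc p q r = \<lparr>src = ?R, tgt = p \<triangleleft> (q \<triangleleft> r), on_pos = c,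
      on_dir = H (pb1 c (p \<triangleleft> (q \<triangleleft> r))) (dir1 p (q \<triangleleft> r) \<cdot> pb2 c (p \<triangleleft> (q \<triangleleft> r)))
        (dir2 p (q \<triangleleft> r) \<cdot> pb2 c (p \<triangleleft> (q \<triangleleft> r)))\<rparr>"
    unfolding comp_assoc_def Let_def c_def F_def H_def x_def f_def g_def b_def by (rule refl)
  have fam: "is_poly_arr (comp_assoc p q r)"
    "\<And>s. pos ?R s \<Longrightarrow> base_at p (q \<triangleleft> r) (act_pos (comp_assoc p q r) s) = X s"
    "\<And>s y. pos ?R s \<Longrightarrow> over p (X s) y \<Longrightarrow> apply_at p (q \<triangleleft> r) (act_pos (comp_assoc p q r) s) y = F s y"
    "\<And>s y z t. pos ?R s \<Longrightarrow> over p (X s) y \<Longrightarrow> over (q \<triangleleft> r) (F s y) z \<Longrightarrow>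
      t = act_pos (comp_assoc p q r) s \<Longrightarrow>
       act_dir (comp_assoc p q r) s (direction p (q \<triangleleft> r) t y z) = H s y z"
    by (rule poly_arr_into_comp_family[where X = X and F = F and H = H, OF R p qr xA _ _ _ _ _ c_def eq];
        (rule X F F_nat H | assumption)+)+
  show "is_poly_arr (comp_assoc p q r)" by (rule fam)
  assume s: "pos ?R s"
  show "base_at p (q \<triangleleft> r) (act_pos (comp_assoc p q r) s) = base_at p q (base_at (p \<triangleleft> q) r s)"
    using fam(2)[OF s] by (simp add: X_def)
  assume "over p (base_at p q (base_at (p \<triangleleft> q) r s)) y"
  then have y: "over p (X s) y" by (simp add: X_def)
  show "base_at q r (apply_at p (q \<triangleleft> r) (act_pos (comp_assoc p q r) s) y) =
        apply_at p q (base_at (p \<triangleleft> q) r s) y"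
    using fam(3)[OF s y] Fl(2)[OF s y] f by simp
  assume "over q (apply_at p q (base_at (p \<triangleleft> q) r s) y) z"
  then have z: "over q (f s y) z" by (simp add: f)
  show "apply_at q r (apply_at p (q \<triangleleft> r) (act_pos (comp_assoc p q r) s) y) z =
        apply_at (p \<triangleleft> q) r s (direction p q (base_at (p \<triangleleft> q) r s) y z)"
    using fam(3)[OF s y] app[OF s y z] by simp
  assume w: "over r (apply_at (p \<triangleleft> q) r s (direction p q (base_at (p \<triangleleft> q) r s) y z)) w"
    and t: "t = act_pos (comp_assoc p q r) s" and "u = apply_at p (q \<triangleleft> r) (act_pos (comp_assoc p q r) s) y"
  then have u: "u = F s y" using fam(3)[OF s y] by simp
  have zu: "over q (base_at q r (F s y)) z" using z Fl(2)[OF s y] by simp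
  have wu: "over r (apply_at q r (F s y) z) w" using w app[OF s y z] by simp
  show "act_dir (comp_assoc p q r) s (direction p (q \<triangleleft> r) t y (direction q r u z w)) =
        direction (p \<triangleleft> q) r s (direction p q (base_at (p \<triangleleft> q) r s) y z) w"
    using fam(4)[OF s y over_direction[OF q r Fl(1)[OF s y] zu wu] t]
      dir1_direction[OF q r Fl(1)[OF s y] zu wu] dir2_direction[OF q r Fl(1)[OF s y] zu wu]
    by (simp add: u H_def b_at)
qed

section \<open>The unitors of the composition product\<close>

lemma base_at_y_poly [simp]:
  assumes "exponentiable q" "pos (y_poly \<triangleleft> q) s"
  shows "base_at y_poly q s = bang (Dom E s)"
  using pos_y_poly[OF pos_base_at[OF exponentiable_y_poly assms]]
    Dom_base_at[OF exponentiable_y_poly assms] by simp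

lemma apply_at_y_poly [simp]:
  assumes "exponentiable p" "pos (p \<triangleleft> y_poly) s" "over p (base_at p y_poly s) y"
  shows "apply_at p y_poly s y = bang (Dom E s)"
  using pos_y_poly[OF pos_apply_at[OF assms(1) exponentiable_y_poly assms(2,3)]]
    Dom_apply_at[OF assms(1) exponentiable_y_poly assms(2,3)] by simp

lemma comp_unit_src_tgt [simp]: "src (comp_lunit p) = y_poly \<triangleleft> p" "tgt (comp_lunit p) = p"
  "src (comp_runit p) = p \<triangleleft> y_poly" "tgt (comp_runit p) = p"
  by (simp_all add: comp_lunit_def comp_runit_def Let_def)

lemma
  assumes p: "exponentiable p"
  shows is_poly_arr_comp_lunit [simp]: "is_poly_arr (comp_lunit p)"
    and act_pos_comp_lunit [simp]: "pos (y_poly \<triangleleft> p) s \<Longrightarrow>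
      act_pos (comp_lunit p) s = apply_at y_poly p s (bang (Dom E s))"
    and act_dir_comp_lunit [simp]: "pos (y_poly \<triangleleft> p) s \<Longrightarrow> over p (apply_at y_poly p s (bang (Dom E s))) d \<Longrightarrow>
      act_dir (comp_lunit p) s d = direction y_poly p s (bang (Dom E s)) d"
proof -
  note yp = exponentiable_y_poly p
  note A = base_arr[OF yp] comp_obj_arr[OF yp] exponentiableD[OF p]
  let ?S = "Dom E (base y_poly p)"
  define c where "c = apply_at y_poly p (Ident E ?S) (bang ?S)"
  define G :: "'a \<Rightarrow> 'a \<Rightarrow> 'a" where "G s d = direction y_poly p s (bang (Dom E s)) d" for s d
  \<comment> \<open>The generic position of \<open>y_poly \<triangleleft> p\<close> and the only
    direction over its base; the value there is the arrow on positions.\<close>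
  have I: "pos (y_poly \<triangleleft> p) (Ident E ?S)" "over y_poly (base_at y_poly p (Ident E ?S)) (bang ?S)"
    using A p by (simp_all add: pos_def)
  have cA: "c \<in> Arr E" "Dom E c = Cod E (y_poly \<triangleleft> p)" "Cod E c = Cod E p"
    using pos_apply_at[OF yp I] Dom_apply_at[OF yp I] A by (simp_all add: c_def pos_def)
  have c: "c \<cdot> s = apply_at y_poly p s (bang (Dom E s))" if "pos (y_poly \<triangleleft> p) s" for s
    using apply_at_cmp[OF yp I, of s] posD[OF that] A by (simp add: c_def)
  have G: "over (y_poly \<triangleleft> p) s (G s d)"
    "k \<in> Arr E \<Longrightarrow> Cod E k = Dom E s \<Longrightarrow> G (s \<cdot> k) (d \<cdot> k) = G s d \<cdot> k"
    if "pos (y_poly \<triangleleft> p) s" "over p (c \<cdot> s) d" for s d k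
    using that p posD[OF that(1)] by (simp_all add: G_def c)
  have *: "exponentiable (y_poly \<triangleleft> p)" using p by simp
  have eq: "comp_lunit p = \<lparr>src = y_poly \<triangleleft> p, tgt = p, on_pos = c, on_dir = G (pb1 c p) (pb2 c p)\<rparr>"
    using cA A by (simp add: comp_lunit_def Let_def c_def[symmetric] G_def)
  have fam: "is_poly_arr (comp_lunit p)" "\<And>s. act_pos (comp_lunit p) s = c \<cdot> s"
    "\<And>s d. pos (y_poly \<triangleleft> p) s \<Longrightarrow> over p (c \<cdot> s) d \<Longrightarrow> act_dir (comp_lunit p) s d = G s d"
    by (rule poly_arr_family[where G = G, OF * p cA _ _ eq]; (rule G | assumption)+)+
  show "is_poly_arr (comp_lunit p)"
    "pos (y_poly \<triangleleft> p) s \<Longrightarrow> act_pos (comp_lunit p) s = apply_at y_poly p s (bang (Dom E s))"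
    "pos (y_poly \<triangleleft> p) s \<Longrightarrow> over p (apply_at y_poly p s (bang (Dom E s))) d \<Longrightarrow>
      act_dir (comp_lunit p) s d = direction y_poly p s (bang (Dom E s)) d"
    using fam c by (simp_all add: G_def)
qed

lemma
  assumes p: "exponentiable p"
  shows is_poly_arr_comp_runit [simp]: "is_poly_arr (comp_runit p)"
    and act_pos_comp_runit [simp]: "pos (p \<triangleleft> y_poly) s \<Longrightarrow>
      act_pos (comp_runit p) s = base_at p y_poly s"
    and act_dir_comp_runit [simp]: "pos (p \<triangleleft> y_poly) s \<Longrightarrow> over p (base_at p y_poly s) d \<Longrightarrow>
      act_dir (comp_runit p) s d = direction p y_poly s d (bang (Dom E s))"
proof -
  note yp = p exponentiable_y_poly
  note A = base_arr[OF yp] comp_obj_arr[OF yp] exponentiableD[OF p]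
  let ?c = "base p y_poly"
  define G :: "'a \<Rightarrow> 'a \<Rightarrow> 'a" where "G s d = direction p y_poly s d (bang (Dom E s))" for s d
  have cA: "?c \<in> Arr E" "Dom E ?c = Cod E (p \<triangleleft> y_poly)" "Cod E ?c = Cod E p"
    using A by simp_all
  have c: "?c \<cdot> s = base_at p y_poly s" for s by (simp add: base_at_def)
  have G: "over (p \<triangleleft> y_poly) s (G s d)"
    "k \<in> Arr E \<Longrightarrow> Cod E k = Dom E s \<Longrightarrow> G (s \<cdot> k) (d \<cdot> k) = G s d \<cdot> k"
    if "pos (p \<triangleleft> y_poly) s" "over p (?c \<cdot> s) d" for s d k
    using that p posD[OF that(1)] by (simp_all add: G_def c)
  have *: "exponentiable (p \<triangleleft> y_poly)" using p by simp
  have eq: "comp_runit p = \<lparr>src = p \<triangleleft> y_poly, tgt = p, on_pos = ?c, on_dir = G (pb1 ?c p) (pb2 ?c p)\<rparr>"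
    using cA A by (simp add: comp_runit_def Let_def G_def)
  have fam: "is_poly_arr (comp_runit p)" "\<And>s. act_pos (comp_runit p) s = ?c \<cdot> s"
    "\<And>s d. pos (p \<triangleleft> y_poly) s \<Longrightarrow> over p (?c \<cdot> s) d \<Longrightarrow> act_dir (comp_runit p) s d = G s d"
    by (rule poly_arr_family[where G = G, OF * p cA _ _ eq]; (rule G | assumption)+)+
  show "is_poly_arr (comp_runit p)"
    "pos (p \<triangleleft> y_poly) s \<Longrightarrow> act_pos (comp_runit p) s = base_at p y_poly s"
    "pos (p \<triangleleft> y_poly) s \<Longrightarrow> over p (base_at p y_poly s) d \<Longrightarrow>
      act_dir (comp_runit p) s d = direction p y_poly s d (bang (Dom E s))"
    using fam c by (simp_all add: G_def)
qed

section \<open>The interchange maps\<close>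

lemma over_tuple_pr:
  assumes "exponentiable p" "exponentiable q" "pos p s" "pos q t" "Dom E s = Dom E t"
    "over (prd_map p q) (tuple s t) d"
  shows "over p s (pr1 (Dom E p) (Dom E q) \<cdot> d)" "over q t (pr2 (Dom E p) (Dom E q) \<cdot> d)"
    "d \<in> Arr E" "Cod E d = prd (Dom E p) (Dom E q)" "Dom E d = Dom E t"
proof -
  note A = exponentiableD[OF assms(1)] exponentiableD[OF assms(2)]
  show "over p s (pr1 (Dom E p) (Dom E q) \<cdot> d)" "over q t (pr2 (Dom E p) (Dom E q) \<cdot> d)"
    "d \<in> Arr E" "Cod E d = prd (Dom E p) (Dom E q)" "Dom E d = Dom E t"
    using over_pr[OF A assms(6)] overD[OF assms(6) prd_map(1)[OF A]] assms(3-5) A by (simp_all add: pos_def)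
qed

lemma interchange_src_tgt [simp]:
  "src (poly_interchange p1 p2 q1 q2) = prd_map (p1 \<triangleleft> p2) (q1 \<triangleleft> q2)"
  "tgt (poly_interchange p1 p2 q1 q2) = prd_map p1 q1 \<triangleleft> prd_map p2 q2"
  by (simp_all add: poly_interchange_def Let_def)

text \<open>Both factors are paired level by level, and the direction map exchanges the two middle
  components. Only functions of the form \<open>(y, y') \<mapsto> (f y, f' y')\<close> arise as
  images, which is why the interchange is in general not invertible.\<close>

lemma
  assumes p1: "exponentiable p1" and p2: "exponentiable p2" and q1: "exponentiable q1" and q2: "exponentiable q2"
  shows is_poly_arr_interchange [simp]: "is_poly_arr (poly_interchange p1 p2 q1 q2)"
    and base_at_interchange [simp]: "pos (p1 \<triangleleft> p2) s \<Longrightarrow> pos (q1 \<triangleleft> q2) t \<Longrightarrow> Dom E s = Dom E t \<Longrightarrow>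
      base_at (prd_map p1 q1) (prd_map p2 q2) (act_pos (poly_interchange p1 p2 q1 q2) (tuple s t)) =
        tuple (base_at p1 p2 s) (base_at q1 q2 t)"
    and apply_at_interchange [simp]: "pos (p1 \<triangleleft> p2) s \<Longrightarrow> pos (q1 \<triangleleft> q2) t \<Longrightarrow> Dom E s = Dom E t \<Longrightarrow>
      over p1 (base_at p1 p2 s) y \<Longrightarrow> over q1 (base_at q1 q2 t) z \<Longrightarrow>
      apply_at (prd_map p1 q1) (prd_map p2 q2) (act_pos (poly_interchange p1 p2 q1 q2) (tuple s t)) (tuple y z) =
        tuple (apply_at p1 p2 s y) (apply_at q1 q2 t z)"
    and act_dir_interchange [simp]: "pos (p1 \<triangleleft> p2) s \<Longrightarrow> pos (q1 \<triangleleft> q2) t \<Longrightarrow> Dom E s = Dom E t \<Longrightarrow>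
      over p1 (base_at p1 p2 s) y \<Longrightarrow> over q1 (base_at q1 q2 t) z \<Longrightarrow>
      over p2 (apply_at p1 p2 s y) w \<Longrightarrow> over q2 (apply_at q1 q2 t z) w' \<Longrightarrow>
      m = act_pos (poly_interchange p1 p2 q1 q2) (tuple s t) \<Longrightarrow>
      act_dir (poly_interchange p1 p2 q1 q2) (tuple s t)
        (direction (prd_map p1 q1) (prd_map p2 q2) m (tuple y z) (tuple w w')) =
        tuple (direction p1 p2 s y w) (direction q1 q2 t z w')"
proof -
  note [simp] = p1 p2 q1 q2
  let ?S = "Dom E (base p1 p2)" and ?S' = "Dom E (base q1 q2)"
  let ?p = "prd_map p1 q1" and ?q = "prd_map p2 q2" and ?R = "prd_map (p1 \<triangleleft> p2) (q1 \<triangleleft> q2)"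
  note A = base_arr[OF p1 p2] base_arr[OF q1 q2] comp_obj_arr[OF p1 p2] comp_obj_arr[OF q1 q2]
    exponentiableD[OF p1] exponentiableD[OF p2] exponentiableD[OF q1] exponentiableD[OF q2]
  \<comment> \<open>Projections of a position, of a first direction (\<open>f\<close>,
    \<open>g\<close>) and of a second direction (\<open>u\<close>, \<open>v\<close>), needed because
    the formulas must make sense for elements not yet written as tuples.\<close>
  define a b where "a s = pr1 ?S ?S' \<cdot> s" and "b s = pr2 ?S ?S' \<cdot> s" for s
  define f g where "f y = pr1 (Dom E p1) (Dom E q1) \<cdot> y" and "g y = pr2 (Dom E p1) (Dom E q1) \<cdot> y" for y
  define u v where "u z = pr1 (Dom E p2) (Dom E q2) \<cdot> z" and "v z = pr2 (Dom E p2) (Dom E q2) \<cdot> z" for z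
  note proj = a_def b_def f_def g_def u_def v_def
  define x where "x = prd_map (base p1 p2) (base q1 q2)"
  define X where "X s = tuple (base_at p1 p2 (a s)) (base_at q1 q2 (b s))" for s
  define F where "F s y = tuple (apply_at p1 p2 (a s) (f y)) (apply_at q1 q2 (b s) (g y))" for s y
  define H where "H s y z = tuple (direction p1 p2 (a s) (f y) (u z)) (direction q1 q2 (b s) (g y) (v z))"
    for s y z
  have xA: "x \<in> Arr E" "Dom E x = Cod E ?R" "Cod E x = Cod E ?p"
    using A by (simp_all add: x_def)
  have ab: "pos (p1 \<triangleleft> p2) (a s)" "pos (q1 \<triangleleft> q2) (b s)" "Dom E (a s) = Dom E s" "Dom E (b s) = Dom E s"
    "s \<in> Arr E" "Cod E s = prd ?S ?S'" if s: "pos ?R s" for s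
    using pos_pr[OF _ _ s] s A by (simp_all add: a_def b_def pos_def)
  have X: "x \<cdot> s = X s" if s: "pos ?R s" for s
    using ab[OF s] A by (simp add: x_def X_def a_def b_def base_at_def prd_map_def)
  have fg: "over p1 (base_at p1 p2 (a s)) (f y)" "over q1 (base_at q1 q2 (b s)) (g y)"
    "y \<in> Arr E" "Cod E y = prd (Dom E p1) (Dom E q1)" "Dom E y = Dom E s"
    if s: "pos ?R s" and y: "over ?p (X s) y" for s y
    unfolding f_def g_def
    using over_tuple_pr[OF p1 q1 pos_base_at[OF p1 p2 ab(1)[OF s]] pos_base_at[OF q1 q2 ab(2)[OF s]] _
        y[unfolded X_def]] ab[OF s] by simp_all
  have uv: "over p2 (apply_at p1 p2 (a s) (f y)) (u z)" "over q2 (apply_at q1 q2 (b s) (g y)) (v z)"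
    "z \<in> Arr E" "Cod E z = prd (Dom E p2) (Dom E q2)" "Dom E z = Dom E s"
    if s: "pos ?R s" and y: "over ?p (X s) y" and z: "over ?q (F s y) z" for s y z
    unfolding u_def v_def
    using over_tuple_pr[OF p2 q2 pos_apply_at[OF p1 p2 ab(1)[OF s] fg(1)[OF s y]]
        pos_apply_at[OF q1 q2 ab(2)[OF s] fg(2)[OF s y]] _ z[unfolded F_def]] ab[OF s] fg(1,2)[OF s y] by simp_all
  have cmp: "a (s \<cdot> k) = a s \<cdot> k" "b (s \<cdot> k) = b s \<cdot> k"
    if "pos ?R s" "k \<in> Arr E" "Cod E k = Dom E s" for s k
    using that ab[OF that(1)] A by (simp_all add: proj)
  have cmp_fg: "f (y \<cdot> k) = f y \<cdot> k" "g (y \<cdot> k) = g y \<cdot> k"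
    if "y \<in> Arr E" "Cod E y = prd (Dom E p1) (Dom E q1)" "k \<in> Arr E" "Cod E k = Dom E y" for y k
    using that A by (simp_all add: proj)
  have cmp_uv: "u (z \<cdot> k) = u z \<cdot> k" "v (z \<cdot> k) = v z \<cdot> k"
    if "z \<in> Arr E" "Cod E z = prd (Dom E p2) (Dom E q2)" "k \<in> Arr E" "Cod E k = Dom E z" for z k
    using that A by (simp_all add: proj)
  have F: "pos ?q (F s y) \<and> Dom E (F s y) = Dom E s"
    "k \<in> Arr E \<Longrightarrow> Cod E k = Dom E s \<Longrightarrow> F (s \<cdot> k) (y \<cdot> k) = F s y \<cdot> k"
    if sy: "pos ?R s" "over ?p (X s) y" for s y k
  proof -
    note t = ab[OF sy(1)] fg[OF sy]
    note ap = pos_apply_at[OF p1 p2 t(1,7)] pos_apply_at[OF q1 q2 t(2,8)]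
    show "pos ?q (F s y) \<and> Dom E (F s y) = Dom E s" using t Dom_tuple_pos[OF ap] by (simp add: F_def)
    show "k \<in> Arr E \<Longrightarrow> Cod E k = Dom E s \<Longrightarrow> F (s \<cdot> k) (y \<cdot> k) = F s y \<cdot> k"
      using t tuple_cmp_pos[OF ap] by (simp add: F_def cmp[OF sy(1)] cmp_fg)
  qed
  have H: "over ?R s (H s y z)"
    "k \<in> Arr E \<Longrightarrow> Cod E k = Dom E s \<Longrightarrow> H (s \<cdot> k) (y \<cdot> k) (z \<cdot> k) = H s y z \<cdot> k"
    if syz: "pos ?R s" "over ?p (X s) y" "over ?q (F s y) z" for s y z k
  proof -
    note t = ab[OF syz(1)] fg[OF syz(1,2)] uv[OF syz]
    show "over ?R s (H s y z)"
      using over_tupleI[OF _ _ syz(1)] t A by (simp add: H_def a_def b_def)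
    show "k \<in> Arr E \<Longrightarrow> Cod E k = Dom E s \<Longrightarrow> H (s \<cdot> k) (y \<cdot> k) (z \<cdot> k) = H s y z \<cdot> k"
      using t overD(1)[OF over_direction[OF p1 p2 t(1,7) t(12)] A(5)]
        overD(1)[OF over_direction[OF q1 q2 t(2,8) t(13)] A(8)]
      by (simp add: H_def cmp[OF syz(1)] cmp_fg cmp_uv)
  qed
  define c where "c = position ?p ?q x (F (pb1 x ?p) (pb2 x ?p))"
  have eq: "poly_interchange p1 p2 q1 q2 = \<lparr>src = ?R, tgt = ?p \<triangleleft> ?q, on_pos = c,
      on_dir = H (pb1 c (?p \<triangleleft> ?q)) (dir1 ?p ?q \<cdot> pb2 c (?p \<triangleleft> ?q)) (dir2 ?p ?q \<cdot> pb2 c (?p \<triangleleft> ?q))\<rparr>"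
    unfolding poly_interchange_def Let_def c_def F_def H_def x_def proj by (rule refl)
  have R: "exponentiable ?R" "exponentiable ?p" "exponentiable ?q" by simp_all
  have fam: "is_poly_arr (poly_interchange p1 p2 q1 q2)"
    "\<And>s. pos ?R s \<Longrightarrow> base_at ?p ?q (act_pos (poly_interchange p1 p2 q1 q2) s) = X s"
    "\<And>s y. pos ?R s \<Longrightarrow> over ?p (X s) y \<Longrightarrow> apply_at ?p ?q (act_pos (poly_interchange p1 p2 q1 q2) s) y = F s y"
    "\<And>s y z t. pos ?R s \<Longrightarrow> over ?p (X s) y \<Longrightarrow> over ?q (F s y) z \<Longrightarrow>
      t = act_pos (poly_interchange p1 p2 q1 q2) s \<Longrightarrow>
       act_dir (poly_interchange p1 p2 q1 q2) s (direction ?p ?q t y z) = H s y z"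
    by (rule poly_arr_into_comp_family[where X = X and F = F and H = H, OF R xA _ _ _ _ _ c_def eq];
        (rule X F H | assumption)+)+
  show "is_poly_arr (poly_interchange p1 p2 q1 q2)" by (rule fam)
  assume st: "pos (p1 \<triangleleft> p2) s" "pos (q1 \<triangleleft> q2) t" "Dom E s = Dom E t"
  have st': "pos ?R (tuple s t)" "a (tuple s t) = s" "b (tuple s t) = t"
    using st A by (simp_all add: a_def b_def pos_def)
  show "base_at ?p ?q (act_pos (poly_interchange p1 p2 q1 q2) (tuple s t)) =
        tuple (base_at p1 p2 s) (base_at q1 q2 t)"
    using fam(2)[OF st'(1)] st' by (simp add: X_def)
  assume yz: "over p1 (base_at p1 p2 s) y" "over q1 (base_at q1 q2 t) z"
  have yz': "over ?p (X (tuple s t)) (tuple y z)" "f (tuple y z) = y" "g (tuple y z) = z"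
    using st st' yz overD[OF yz(1)] overD[OF yz(2)] A by (simp_all add: X_def f_def g_def)
  show "apply_at ?p ?q (act_pos (poly_interchange p1 p2 q1 q2) (tuple s t)) (tuple y z) =
        tuple (apply_at p1 p2 s y) (apply_at q1 q2 t z)"
    using fam(3)[OF st'(1) yz'(1)] st' yz' by (simp add: F_def)
  assume w: "over p2 (apply_at p1 p2 s y) w" "over q2 (apply_at q1 q2 t z) w'"
    and m: "m = act_pos (poly_interchange p1 p2 q1 q2) (tuple s t)"
  have w': "over ?q (F (tuple s t) (tuple y z)) (tuple w w')" "u (tuple w w') = w" "v (tuple w w') = w'"
    using st st' yz yz' w overD[OF w(1)] overD[OF w(2)] A by (simp_all add: F_def u_def v_def)
  show "act_dir (poly_interchange p1 p2 q1 q2) (tuple s t)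
        (direction ?p ?q m (tuple y z) (tuple w w')) = tuple (direction p1 p2 s y w) (direction q1 q2 t z w')"
    using fam(4)[OF st'(1) yz'(1) w'(1) m] st' yz' w' by (simp add: H_def)
qed

lemma unit_comult_src_tgt [simp]: "src poly_unit_comult = y_poly" "tgt poly_unit_comult = y_poly \<triangleleft> y_poly"
  by (simp_all add: poly_unit_comult_def Let_def)

text \<open>Base, values and directions all belong to \<open>y_poly\<close> and are therefore arrows
  to the terminal object. A rule for positions is not stated, because \<open>base_at_y_poly\<close>
  and \<open>apply_at_y_poly\<close> already compute them.\<close>

lemma
  shows is_poly_arr_unit_comult [simp]: "is_poly_arr poly_unit_comult"
    and act_dir_unit_comult [simp]: "pos y_poly s \<Longrightarrow> over y_poly (bang (Dom E s)) y \<Longrightarrow>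
      over y_poly (bang (Dom E s)) z \<Longrightarrow> t = act_pos poly_unit_comult s \<Longrightarrow>
      act_dir poly_unit_comult s (direction y_poly y_poly t y z) = bang (Dom E s)"
proof -
  note y = exponentiable_y_poly
  define X :: "'a \<Rightarrow> 'a" where "X s = bang (Dom E s)" for s
  define F :: "'a \<Rightarrow> 'a \<Rightarrow> 'a" where "F s y = bang (Dom E s)" for s y
  define H :: "'a \<Rightarrow> 'a \<Rightarrow> 'a \<Rightarrow> 'a" where "H s y z = bang (Dom E s)" for s y z
  have yA: "y_poly \<in> Arr E" "Dom E y_poly = Cod E y_poly" "Cod E y_poly = Cod E y_poly"
    using y_poly_arr by simp_all
  have X: "y_poly \<cdot> s = X s" if "pos y_poly s" for s
    using pos_y_poly[OF that] that y_poly_arr by (simp add: X_def y_poly_def pos_def)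
  have F: "pos y_poly (F s y) \<and> Dom E (F s y) = Dom E s"
    "k \<in> Arr E \<Longrightarrow> Cod E k = Dom E s \<Longrightarrow> F (s \<cdot> k) (y \<cdot> k) = F s y \<cdot> k"
    if "pos y_poly s" "over y_poly (X s) y" for s y k
    using that posD[OF that(1)] by (simp_all add: F_def)
  have H: "over y_poly s (H s y z)"
    "k \<in> Arr E \<Longrightarrow> Cod E k = Dom E s \<Longrightarrow> H (s \<cdot> k) (y \<cdot> k) (z \<cdot> k) = H s y z \<cdot> k"
    if "pos y_poly s" "over y_poly (X s) y" "over y_poly (F s y) z" for s y z k
  proof -
    show "over y_poly s (H s y z)"
      using that pos_y_poly[OF that(1)] by (simp add: H_def over_y_poly)
    show "k \<in> Arr E \<Longrightarrow> Cod E k = Dom E s \<Longrightarrow> H (s \<cdot> k) (y \<cdot> k) (z \<cdot> k) = H s y z \<cdot> k"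
      using posD[OF that(1)] by (simp add: H_def)
  qed
  define c where "c = position y_poly y_poly y_poly (F (pb1 y_poly y_poly) (pb2 y_poly y_poly))"
  have py: "pos y_poly y_poly" using yA by (simp add: pos_def)
  have posy: "pos y_poly h" if "h \<in> Arr E" "Cod E h = Dom E y_poly" for h
    using that yA by (simp add: pos_def)
  have Fy: "pos y_poly (F h z) \<and> Dom E (F h z) = Dom E h"
      "k \<in> Arr E \<Longrightarrow> Cod E k = Dom E h \<Longrightarrow> F (h \<cdot> k) (z \<cdot> k) = F h z \<cdot> k"
    if "h \<in> Arr E" "Cod E h = Dom E y_poly" "over y_poly (y_poly \<cdot> h) z" for h z k
    using F[OF posy[OF that(1,2)]] that(3) X[OF posy[OF that(1,2)]] by simp_all
  have "pos (y_poly \<triangleleft> y_poly) c"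
    unfolding c_def by (rule position_family(1)[OF y y py, where F = F]; (rule Fy refl | assumption)+)
  note cA = posD[OF this]
  have eq: "poly_unit_comult = \<lparr>src = y_poly, tgt = y_poly \<triangleleft> y_poly, on_pos = c,
      on_dir = H (pb1 c (y_poly \<triangleleft> y_poly)) (dir1 y_poly y_poly \<cdot> pb2 c (y_poly \<triangleleft> y_poly))
        (dir2 y_poly y_poly \<cdot> pb2 c (y_poly \<triangleleft> y_poly))\<rparr>"
    using cA comp_obj_arr[OF y y] y_poly_arr
    by (simp add: poly_unit_comult_def Let_def H_def c_def F_def)
  have fam: "is_poly_arr poly_unit_comult"
    "\<And>s z w t. pos y_poly s \<Longrightarrow> over y_poly (X s) z \<Longrightarrow> over y_poly (F s z) w \<Longrightarrow>
      t = act_pos poly_unit_comult s \<Longrightarrow>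
       act_dir poly_unit_comult s (direction y_poly y_poly t z w) = H s z w"
    by (rule poly_arr_into_comp_family[where X = X and F = F and H = H, OF y y y yA _ _ _ _ _ c_def eq];
        (rule X F H | assumption)+)+
  show "is_poly_arr poly_unit_comult" by (rule fam)
  assume "pos y_poly s" "over y_poly (bang (Dom E s)) y" "over y_poly (bang (Dom E s)) z"
    "t = act_pos poly_unit_comult s"
  then show "act_dir poly_unit_comult s (direction y_poly y_poly t y z) = bang (Dom E s)"
    using fam(2)[of s y z t] by (simp add: X_def F_def H_def)
qed

section \<open>Equality of morphisms of polynomials\<close>

declare posD(1) [simp]

lemma calculus_arr [simp]:
  "exponentiable p \<Longrightarrow> exponentiable q \<Longrightarrow> pos (p \<triangleleft> q) s \<Longrightarrow> base_at p q s \<in> Arr E"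
  "exponentiable p \<Longrightarrow> exponentiable q \<Longrightarrow> pos (p \<triangleleft> q) s \<Longrightarrow> over p (base_at p q s) y \<Longrightarrow> apply_at p q s y \<in> Arr E"
  "is_poly_arr \<phi> \<Longrightarrow> pos (src \<phi>) s \<Longrightarrow> act_pos \<phi> s \<in> Arr E"
  using posD(1)[OF pos_base_at] posD(1)[OF pos_apply_at] posD(1)[OF pos_act_pos[OF _ _ refl]] by blast+

section \<open>Splitting quantifiers into components, and extensionality for morphisms\<close>

lemma pos_y_poly_iff: "pos y_poly s \<longleftrightarrow> (\<exists>X \<in> Obj E. s = bang X)"
  using pos_y_poly by (metis pos_Dom_in_Obj pos_bang)

text \<open>With the next two rules, this brings every quantified element into the form on which
  actions are computed. The guards are nested implications, so that the typing of the components is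
  assumed while the body is simplified.\<close>

lemma all_pos_prd_map [simp]:
  assumes "exponentiable p" "exponentiable q"
  shows "(\<forall>u. pos (prd_map p q) u \<longrightarrow> P u) \<longleftrightarrow>
    (\<forall>s. pos p s \<longrightarrow> (\<forall>t. pos q t \<longrightarrow> Dom E s = Dom E t \<longrightarrow> P (tuple s t)))"
  using pos_prd_map_cases[OF assms] pos_tuple[OF assms] by metis

lemma all_over_prd_map [simp]:
  assumes "exponentiable p" "exponentiable q" "pos p s" "pos q t" "Dom E s = Dom E t"
  shows "(\<forall>d. over (prd_map p q) (tuple s t) d \<longrightarrow> P d) \<longleftrightarrow>
    (\<forall>y. over p s y \<longrightarrow> (\<forall>z. over q t z \<longrightarrow> P (tuple y z)))"
  using over_prd_map_cases[OF assms] over_tuple[OF assms] by metis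

lemma all_over_comp_obj [simp]:
  assumes "exponentiable p" "exponentiable q" "pos (p \<triangleleft> q) s"
  shows "(\<forall>d. over (p \<triangleleft> q) s d \<longrightarrow> P d) \<longleftrightarrow>
    (\<forall>y. over p (base_at p q s) y \<longrightarrow> (\<forall>z. over q (apply_at p q s y) z \<longrightarrow> P (direction p q s y z)))"
  using comp_obj_cases[OF assms] over_direction[OF assms] by metis

text \<open>\<open>poly_arr_ext\<close> with the quantifiers in the object logic, where the
  splitting rules can act on them.\<close>

lemma poly_arr_eqI:
  assumes "is_poly_arr \<phi>" "is_poly_arr \<psi>" "src \<phi> = src \<psi>" "tgt \<phi> = tgt \<psi>"
    "\<forall>s. pos (src \<psi>) s \<longrightarrow> act_pos \<phi> s = act_pos \<psi> s"
    "\<forall>s. pos (src \<psi>) s \<longrightarrow> (\<forall>d. over (tgt \<psi>) (act_pos \<psi> s) d \<longrightarrow> act_dir \<phi> s d = act_dir \<psi> s d)"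
  shows "\<phi> = \<psi>"
  using assms by (intro poly_arr_ext) blast+

text \<open>Values are compared only at the stage of \<open>s\<close>: since \<open>s\<close> ranges
  over all positions, a later stage is the instance \<open>s \<cdot> k\<close>. The comparison of
  directions may assume that the positions agree, because \<open>direction\<close> depends on the
  position and a rule for one side must match a term over the other.\<close>

lemma poly_arr_into_comp_eqI:
  assumes \<phi>: "is_poly_arr \<phi>" and \<psi>: "is_poly_arr \<psi>" and src: "src \<phi> = src \<psi>"
    and tgt: "tgt \<phi> = p \<triangleleft> q" "tgt \<psi> = p \<triangleleft> q" and pq: "exponentiable p" "exponentiable q"
    and base: "\<forall>s. pos (src \<psi>) s \<longrightarrow> base_at p q (act_pos \<phi> s) = base_at p q (act_pos \<psi> s)"
    and app: "\<forall>s. pos (src \<psi>) s \<longrightarrow> (\<forall>y. over p (base_at p q (act_pos \<psi> s)) y \<longrightarrow>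
      apply_at p q (act_pos \<phi> s) y = apply_at p q (act_pos \<psi> s) y)"
    and dir: "\<forall>s. pos (src \<psi>) s \<longrightarrow> act_pos \<phi> s = act_pos \<psi> s \<longrightarrow>
      (\<forall>d. over (p \<triangleleft> q) (act_pos \<psi> s) d \<longrightarrow> act_dir \<phi> s d = act_dir \<psi> s d)"
  shows "\<phi> = \<psi>"
proof (rule poly_arr_eqI[OF \<phi> \<psi> src])
  have "act_pos \<phi> s = act_pos \<psi> s" if s: "pos (src \<psi>) s" for s
  proof (rule pos_ext[OF pq])
    show "pos (p \<triangleleft> q) (act_pos \<phi> s)" "pos (p \<triangleleft> q) (act_pos \<psi> s)"
      using \<phi> \<psi> src tgt s by simp_all
    show "base_at p q (act_pos \<phi> s) = base_at p q (act_pos \<psi> s)" using base s by blast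
    fix k y assume k: "k \<in> Arr E" "Cod E k = Dom E (act_pos \<phi> s)"
      and y: "over p (base_at p q (act_pos \<phi> s \<cdot> k)) y"
    have k': "Cod E k = Dom E s" using k \<phi> s src by simp
    have sk: "pos (src \<psi>) (s \<cdot> k)" using pos_cmp[OF s k(1) k'] .
    have "act_pos \<phi> s \<cdot> k = act_pos \<phi> (s \<cdot> k)" "act_pos \<psi> s \<cdot> k = act_pos \<psi> (s \<cdot> k)"
      using \<phi> \<psi> s src k(1) k' by simp_all
    then show "apply_at p q (act_pos \<phi> s \<cdot> k) y = apply_at p q (act_pos \<psi> s \<cdot> k) y"
      using app base sk y by metis
  qed
  then show "\<forall>s. pos (src \<psi>) s \<longrightarrow> act_pos \<phi> s = act_pos \<psi> s"
    "\<forall>s. pos (src \<psi>) s \<longrightarrow> (\<forall>d. over (tgt \<psi>) (act_pos \<psi> s) d \<longrightarrow> act_dir \<phi> s d = act_dir \<psi> s d)"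
    using dir tgt by auto
qed (simp add: tgt)

text \<open>Provides the premise on values in \<open>poly_arr_into_comp_eqI\<close> when the second
  factor is again a composite. The values are then positions, to which extensionality is applied
  once more; naturality moves the later stages into \<open>s\<close> and \<open>y\<close>.\<close>

lemma apply_at_eqI:
  assumes \<phi>: "is_poly_arr \<phi>" and \<psi>: "is_poly_arr \<psi>" and src: "src \<phi> = src \<psi>"
    and tgt: "tgt \<phi> = p \<triangleleft> (q1 \<triangleleft> q2)" "tgt \<psi> = p \<triangleleft> (q1 \<triangleleft> q2)"
    and pq: "exponentiable p" "exponentiable q1" "exponentiable q2"
    and base: "\<forall>s. pos (src \<psi>) s \<longrightarrow> base_at p (q1 \<triangleleft> q2) (act_pos \<phi> s) = base_at p (q1 \<triangleleft> q2) (act_pos \<psi> s)"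
    and base2: "\<forall>s. pos (src \<psi>) s \<longrightarrow> (\<forall>y. over p (base_at p (q1 \<triangleleft> q2) (act_pos \<psi> s)) y \<longrightarrow>
      base_at q1 q2 (apply_at p (q1 \<triangleleft> q2) (act_pos \<phi> s) y) = base_at q1 q2 (apply_at p (q1 \<triangleleft> q2) (act_pos \<psi> s) y))"
    and app: "\<forall>s. pos (src \<psi>) s \<longrightarrow> (\<forall>y. over p (base_at p (q1 \<triangleleft> q2) (act_pos \<psi> s)) y \<longrightarrow>
      (\<forall>z. over q1 (base_at q1 q2 (apply_at p (q1 \<triangleleft> q2) (act_pos \<psi> s) y)) z \<longrightarrow>
        apply_at q1 q2 (apply_at p (q1 \<triangleleft> q2) (act_pos \<phi> s) y) z =
        apply_at q1 q2 (apply_at p (q1 \<triangleleft> q2) (act_pos \<psi> s) y) z))"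
  shows "\<forall>s. pos (src \<psi>) s \<longrightarrow> (\<forall>y. over p (base_at p (q1 \<triangleleft> q2) (act_pos \<psi> s)) y \<longrightarrow>
      apply_at p (q1 \<triangleleft> q2) (act_pos \<phi> s) y = apply_at p (q1 \<triangleleft> q2) (act_pos \<psi> s) y)"
proof (intro allI impI)
  fix s y assume s: "pos (src \<psi>) s" and y: "over p (base_at p (q1 \<triangleleft> q2) (act_pos \<psi> s)) y"
  have q: "exponentiable (q1 \<triangleleft> q2)" using pq by simp
  have s': "pos (p \<triangleleft> (q1 \<triangleleft> q2)) (act_pos \<phi> s)" "pos (p \<triangleleft> (q1 \<triangleleft> q2)) (act_pos \<psi> s)"
    using \<phi> \<psi> src tgt s by simp_all
  have y': "over p (base_at p (q1 \<triangleleft> q2) (act_pos \<phi> s)) y" using y base s by simp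
  have D: "Dom E (act_pos \<phi> s) = Dom E s" "Dom E (act_pos \<psi> s) = Dom E s" using \<phi> \<psi> src s by simp_all
  show "apply_at p (q1 \<triangleleft> q2) (act_pos \<phi> s) y = apply_at p (q1 \<triangleleft> q2) (act_pos \<psi> s) y" (is "?l = ?r")
  proof (rule pos_ext[OF pq(2,3)])
    show "pos (q1 \<triangleleft> q2) ?l" "pos (q1 \<triangleleft> q2) ?r" using s' y y' pq by simp_all
    show "base_at q1 q2 ?l = base_at q1 q2 ?r" using base2 s y by blast
    fix k z assume k: "k \<in> Arr E" "Cod E k = Dom E ?l" and z: "over q1 (base_at q1 q2 (?l \<cdot> k)) z"
    have k': "Cod E k = Dom E s" using k Dom_apply_at[OF pq(1) q s'(1) y'] D by simp
    have sk: "pos (src \<psi>) (s \<cdot> k)" using pos_cmp[OF s k(1) k'] .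
    have "act_pos \<phi> s \<cdot> k = act_pos \<phi> (s \<cdot> k)" "act_pos \<psi> s \<cdot> k = act_pos \<psi> (s \<cdot> k)"
      using \<phi> \<psi> s src k(1) k' by simp_all
    then have lr: "?l \<cdot> k = apply_at p (q1 \<triangleleft> q2) (act_pos \<phi> (s \<cdot> k)) (y \<cdot> k)"
      "?r \<cdot> k = apply_at p (q1 \<triangleleft> q2) (act_pos \<psi> (s \<cdot> k)) (y \<cdot> k)"
      and yk: "over p (base_at p (q1 \<triangleleft> q2) (act_pos \<psi> (s \<cdot> k))) (y \<cdot> k)"
      using apply_at_cmp[OF pq(1) q s'(1) y' k(1)] apply_at_cmp[OF pq(1) q s'(2) y k(1)]
        over_cmp[OF y exponentiableD[OF pq(1)] k(1)] base_at_cmp[OF pq(1) q s'(2) k(1)]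
        Dom_base_at[OF pq(1) q s'(2)] k' D by simp_all
    show "apply_at q1 q2 (?l \<cdot> k) z = apply_at q1 q2 (?r \<cdot> k) z"
      unfolding lr using app sk yk base2 z lr by metis
  qed
qed

text \<open>One level deeper: the conclusion is the last premise of \<open>apply_at_eqI\<close> for
  a second factor \<open>p \<triangleleft> (q1 \<triangleleft> q2)\<close>. This is the depth of the
  codomain in the pentagon.\<close>

lemma apply_at_apply_at_eqI:
  assumes \<phi>: "is_poly_arr \<phi>" and \<psi>: "is_poly_arr \<psi>" and src: "src \<phi> = src \<psi>"
    and tgt: "tgt \<phi> = w \<triangleleft> (p \<triangleleft> (q1 \<triangleleft> q2))" "tgt \<psi> = w \<triangleleft> (p \<triangleleft> (q1 \<triangleleft> q2))"
    and pq: "exponentiable w" "exponentiable p" "exponentiable q1" "exponentiable q2"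
    and base: "\<forall>s. pos (src \<psi>) s \<longrightarrow>
      base_at w (p \<triangleleft> (q1 \<triangleleft> q2)) (act_pos \<phi> s) = base_at w (p \<triangleleft> (q1 \<triangleleft> q2)) (act_pos \<psi> s)"
    and base2: "\<forall>s. pos (src \<psi>) s \<longrightarrow> (\<forall>x. over w (base_at w (p \<triangleleft> (q1 \<triangleleft> q2)) (act_pos \<psi> s)) x \<longrightarrow>
      base_at p (q1 \<triangleleft> q2) (apply_at w (p \<triangleleft> (q1 \<triangleleft> q2)) (act_pos \<phi> s) x) =
      base_at p (q1 \<triangleleft> q2) (apply_at w (p \<triangleleft> (q1 \<triangleleft> q2)) (act_pos \<psi> s) x))"
    and base3: "\<forall>s. pos (src \<psi>) s \<longrightarrow> (\<forall>x. over w (base_at w (p \<triangleleft> (q1 \<triangleleft> q2)) (act_pos \<psi> s)) x \<longrightarrow>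
      (\<forall>y. over p (base_at p (q1 \<triangleleft> q2) (apply_at w (p \<triangleleft> (q1 \<triangleleft> q2)) (act_pos \<psi> s) x)) y \<longrightarrow>
      base_at q1 q2 (apply_at p (q1 \<triangleleft> q2) (apply_at w (p \<triangleleft> (q1 \<triangleleft> q2)) (act_pos \<phi> s) x) y) =
      base_at q1 q2 (apply_at p (q1 \<triangleleft> q2) (apply_at w (p \<triangleleft> (q1 \<triangleleft> q2)) (act_pos \<psi> s) x) y)))"
    and app: "\<forall>s. pos (src \<psi>) s \<longrightarrow> (\<forall>x. over w (base_at w (p \<triangleleft> (q1 \<triangleleft> q2)) (act_pos \<psi> s)) x \<longrightarrow>
      (\<forall>y. over p (base_at p (q1 \<triangleleft> q2) (apply_at w (p \<triangleleft> (q1 \<triangleleft> q2)) (act_pos \<psi> s) x)) y \<longrightarrow>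
      (\<forall>z. over q1 (base_at q1 q2 (apply_at p (q1 \<triangleleft> q2) (apply_at w (p \<triangleleft> (q1 \<triangleleft> q2)) (act_pos \<psi> s) x) y)) z \<longrightarrow>
        apply_at q1 q2 (apply_at p (q1 \<triangleleft> q2) (apply_at w (p \<triangleleft> (q1 \<triangleleft> q2)) (act_pos \<phi> s) x) y) z =
        apply_at q1 q2 (apply_at p (q1 \<triangleleft> q2) (apply_at w (p \<triangleleft> (q1 \<triangleleft> q2)) (act_pos \<psi> s) x) y) z)))"
  shows "\<forall>s. pos (src \<psi>) s \<longrightarrow> (\<forall>x. over w (base_at w (p \<triangleleft> (q1 \<triangleleft> q2)) (act_pos \<psi> s)) x \<longrightarrow>
      (\<forall>y. over p (base_at p (q1 \<triangleleft> q2) (apply_at w (p \<triangleleft> (q1 \<triangleleft> q2)) (act_pos \<psi> s) x)) y \<longrightarrow>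
      apply_at p (q1 \<triangleleft> q2) (apply_at w (p \<triangleleft> (q1 \<triangleleft> q2)) (act_pos \<phi> s) x) y =
      apply_at p (q1 \<triangleleft> q2) (apply_at w (p \<triangleleft> (q1 \<triangleleft> q2)) (act_pos \<psi> s) x) y))"
proof (intro allI impI)
  let ?q = "q1 \<triangleleft> q2" let ?r = "p \<triangleleft> ?q"
  fix s x y assume s: "pos (src \<psi>) s" and x: "over w (base_at w ?r (act_pos \<psi> s)) x"
    and y: "over p (base_at p ?q (apply_at w ?r (act_pos \<psi> s) x)) y"
  have q: "exponentiable ?q" and r: "exponentiable ?r" using pq by simp_all
  have s': "pos (w \<triangleleft> ?r) (act_pos \<phi> s)" "pos (w \<triangleleft> ?r) (act_pos \<psi> s)"
    using \<phi> \<psi> src tgt s by simp_all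
  have x': "over w (base_at w ?r (act_pos \<phi> s)) x" using x base s by simp
  have y': "over p (base_at p ?q (apply_at w ?r (act_pos \<phi> s) x)) y" using y base2 s x by simp
  note a' = pos_apply_at[OF pq(1) r s'(1) x'] pos_apply_at[OF pq(1) r s'(2) x]
  have D: "Dom E (act_pos \<phi> s) = Dom E s" "Dom E (act_pos \<psi> s) = Dom E s" using \<phi> \<psi> src s by simp_all
  note Da = Dom_apply_at[OF pq(1) r s'(1) x'] Dom_apply_at[OF pq(1) r s'(2) x]
  show "apply_at p ?q (apply_at w ?r (act_pos \<phi> s) x) y = apply_at p ?q (apply_at w ?r (act_pos \<psi> s) x) y"
    (is "?L = ?R")
  proof (rule pos_ext[OF pq(3,4)])
    show "pos ?q ?L" "pos ?q ?R" using a' y y' pq by simp_all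
    show "base_at q1 q2 ?L = base_at q1 q2 ?R" using base3 s x y by blast
    fix k z assume k: "k \<in> Arr E" "Cod E k = Dom E ?L" and z: "over q1 (base_at q1 q2 (?L \<cdot> k)) z"
    have k': "Cod E k = Dom E s" using k Dom_apply_at[OF pq(2) q a'(1) y'] Da D by simp
    have sk: "pos (src \<psi>) (s \<cdot> k)" using pos_cmp[OF s k(1) k'] .
    have c1: "act_pos \<phi> s \<cdot> k = act_pos \<phi> (s \<cdot> k)" "act_pos \<psi> s \<cdot> k = act_pos \<psi> (s \<cdot> k)"
      using \<phi> \<psi> s src k(1) k' by simp_all
    then have c2: "apply_at w ?r (act_pos \<phi> s) x \<cdot> k = apply_at w ?r (act_pos \<phi> (s \<cdot> k)) (x \<cdot> k)"
      "apply_at w ?r (act_pos \<psi> s) x \<cdot> k = apply_at w ?r (act_pos \<psi> (s \<cdot> k)) (x \<cdot> k)"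
      and xk: "over w (base_at w ?r (act_pos \<psi> (s \<cdot> k))) (x \<cdot> k)"
      using apply_at_cmp[OF pq(1) r s'(1) x' k(1)] apply_at_cmp[OF pq(1) r s'(2) x k(1)]
        over_cmp[OF x exponentiableD[OF pq(1)] k(1)] base_at_cmp[OF pq(1) r s'(2) k(1)]
        Dom_base_at[OF pq(1) r s'(2)] k' D by simp_all
    then have lr: "?L \<cdot> k = apply_at p ?q (apply_at w ?r (act_pos \<phi> (s \<cdot> k)) (x \<cdot> k)) (y \<cdot> k)"
      "?R \<cdot> k = apply_at p ?q (apply_at w ?r (act_pos \<psi> (s \<cdot> k)) (x \<cdot> k)) (y \<cdot> k)"
      and yk: "over p (base_at p ?q (apply_at w ?r (act_pos \<psi> (s \<cdot> k)) (x \<cdot> k))) (y \<cdot> k)"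
      using apply_at_cmp[OF pq(2) q a'(1) y' k(1)] apply_at_cmp[OF pq(2) q a'(2) y k(1)]
        over_cmp[OF y exponentiableD[OF pq(2)] k(1)] base_at_cmp[OF pq(2) q a'(2) k(1)]
        Dom_base_at[OF pq(2) q a'(2)] k' D Da by simp_all
    show "apply_at q1 q2 (?L \<cdot> k) z = apply_at q1 q2 (?R \<cdot> k) z"
      unfolding lr using app sk xk yk base3 z lr by metis
  qed
qed

end

lemma prod_cat_simps [simp]:
  "Obj (prod_cat C D) = Obj C \<times> Obj D" "Arr (prod_cat C D) = Arr C \<times> Arr D"
  "Dom (prod_cat C D) (f, g) = (Dom C f, Dom D g)" "Cod (prod_cat C D) (f, g) = (Cod C f, Cod D g)"
  "Ident (prod_cat C D) (x, y) = (Ident C x, Ident D y)"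
  "Comp (prod_cat C D) (f', g') (f, g) = (f' \<cdot>\<^bsub>C\<^esub> f, g' \<cdot>\<^bsub>D\<^esub> g)"
  by (simp_all add: prod_cat_def)

context finitely_complete
begin

section \<open>The monoidal structures\<close>

lemma tensor_monoidal_simps [simp]:
  "munit tensor_monoidal = y_poly" "fobj (mtensor tensor_monoidal) (p, q) = prd_map p q"
  "farr (mtensor tensor_monoidal) (\<phi>, \<psi>) = tensor_arr \<phi> \<psi>" "massoc tensor_monoidal = tensor_assoc"
  "mlunit tensor_monoidal = tensor_lunit" "mrunit tensor_monoidal = tensor_runit"
  by (simp_all add: tensor_monoidal_def)

lemma comp_monoidal_simps [simp]:
  "munit comp_monoidal = y_poly" "fobj (mtensor comp_monoidal) (p, q) = p \<triangleleft> q"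
  "farr (mtensor comp_monoidal) (\<phi>, \<psi>) = comp_arr \<phi> \<psi>" "massoc comp_monoidal = comp_assoc"
  "mlunit comp_monoidal = comp_lunit" "mrunit comp_monoidal = comp_runit"
  by (simp_all add: comp_monoidal_def)

lemma is_functor_tensor: "is_functor (prod_cat Poly Poly) Poly (mtensor tensor_monoidal)"
proof -
  have "tensor_arr (poly_id p) (poly_id q) = poly_id (prd_map p q)"
    if "exponentiable p" "exponentiable q" for p q
    using that by - (rule poly_arr_eqI, simp_all)
  moreover have "tensor_arr (poly_comp \<phi>' \<phi>) (poly_comp \<psi>' \<psi>) =
      poly_comp (tensor_arr \<phi>' \<psi>') (tensor_arr \<phi> \<psi>)"
    if "is_poly_arr \<phi>" "is_poly_arr \<psi>" "is_poly_arr \<phi>'" "is_poly_arr \<psi>'"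
      "tgt \<phi> = src \<phi>'" "tgt \<psi> = src \<psi>'" for \<phi> \<psi> \<phi>' \<psi>'
    using that by - (rule poly_arr_eqI, simp_all)
  ultimately show ?thesis by (auto simp: is_functor_def hom_Poly)
qed

lemma is_functor_comp: "is_functor (prod_cat Poly Poly) Poly (mtensor comp_monoidal)"
proof -
  have "comp_arr (poly_id p) (poly_id q) = poly_id (p \<triangleleft> q)"
    if "exponentiable p" "exponentiable q" for p q
    using that by - (rule poly_arr_into_comp_eqI[where p = p and q = q], simp_all)
  moreover have "comp_arr (poly_comp \<phi>' \<phi>) (poly_comp \<psi>' \<psi>) =
      poly_comp (comp_arr \<phi>' \<psi>') (comp_arr \<phi> \<psi>)"
    if "is_poly_arr \<phi>" "is_poly_arr \<psi>" "is_poly_arr \<phi>'" "is_poly_arr \<psi>'"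
      "tgt \<phi> = src \<phi>'" "tgt \<psi> = src \<psi>'" for \<phi> \<psi> \<phi>' \<psi>'
    using that by - (rule poly_arr_into_comp_eqI[where p = "tgt \<phi>'" and q = "tgt \<psi>'"], simp_all)
  ultimately show ?thesis by (auto simp: is_functor_def hom_Poly)
qed

text \<open>On tuples both sides are the same regrouping. In the unit laws
  \<open>over_y_poly\<close> identifies the direction in the unit factor with the position
  there.\<close>

lemma tensor_coherence:
  shows "is_poly_arr \<phi> \<Longrightarrow> is_poly_arr \<psi> \<Longrightarrow> is_poly_arr \<chi> \<Longrightarrow>
      poly_comp (tensor_assoc (tgt \<phi>) (tgt \<psi>) (tgt \<chi>)) (tensor_arr (tensor_arr \<phi> \<psi>) \<chi>) =
      poly_comp (tensor_arr \<phi> (tensor_arr \<psi> \<chi>)) (tensor_assoc (src \<phi>) (src \<psi>) (src \<chi>))"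
    and "is_poly_arr \<phi> \<Longrightarrow> poly_comp (tensor_lunit (tgt \<phi>)) (tensor_arr (poly_id y_poly) \<phi>) =
      poly_comp \<phi> (tensor_lunit (src \<phi>))"
    and "is_poly_arr \<phi> \<Longrightarrow> poly_comp (tensor_runit (tgt \<phi>)) (tensor_arr \<phi> (poly_id y_poly)) =
      poly_comp \<phi> (tensor_runit (src \<phi>))"
    and "exponentiable p \<Longrightarrow> exponentiable q \<Longrightarrow> exponentiable r \<Longrightarrow> exponentiable t \<Longrightarrow>
      poly_comp (tensor_assoc p q (prd_map r t)) (tensor_assoc (prd_map p q) r t) =
      poly_comp (tensor_arr (poly_id p) (tensor_assoc q r t))
        (poly_comp (tensor_assoc p (prd_map q r) t) (tensor_arr (tensor_assoc p q r) (poly_id t)))"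
    and "exponentiable p \<Longrightarrow> exponentiable q \<Longrightarrow>
      poly_comp (tensor_arr (poly_id p) (tensor_lunit q)) (tensor_assoc p y_poly q) =
      tensor_arr (tensor_runit p) (poly_id q)"
  by (rule poly_arr_eqI; simp add: over_y_poly)+

text \<open>The number of extensionality steps for positions follows the nesting of the codomain:
  none for naturality of the unitors, one for the triangle, two for naturality of the associator,
  three for the pentagon.\<close>

lemma comp_coherence:
  shows "is_poly_arr \<phi> \<Longrightarrow> is_poly_arr \<psi> \<Longrightarrow> is_poly_arr \<chi> \<Longrightarrow>
      poly_comp (comp_assoc (tgt \<phi>) (tgt \<psi>) (tgt \<chi>)) (comp_arr (comp_arr \<phi> \<psi>) \<chi>) =
      poly_comp (comp_arr \<phi> (comp_arr \<psi> \<chi>)) (comp_assoc (src \<phi>) (src \<psi>) (src \<chi>))"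
    and "is_poly_arr \<phi> \<Longrightarrow> poly_comp (comp_lunit (tgt \<phi>)) (comp_arr (poly_id y_poly) \<phi>) =
      poly_comp \<phi> (comp_lunit (src \<phi>))"
    and "is_poly_arr \<phi> \<Longrightarrow> poly_comp (comp_runit (tgt \<phi>)) (comp_arr \<phi> (poly_id y_poly)) =
      poly_comp \<phi> (comp_runit (src \<phi>))"
    and "exponentiable p \<Longrightarrow> exponentiable q \<Longrightarrow> exponentiable r \<Longrightarrow> exponentiable t \<Longrightarrow>
      poly_comp (comp_assoc p q (r \<triangleleft> t)) (comp_assoc (p \<triangleleft> q) r t) =
      poly_comp (comp_arr (poly_id p) (comp_assoc q r t))
        (poly_comp (comp_assoc p (q \<triangleleft> r) t) (comp_arr (comp_assoc p q r) (poly_id t)))"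
    and "exponentiable p \<Longrightarrow> exponentiable q \<Longrightarrow>
      poly_comp (comp_arr (poly_id p) (comp_lunit q)) (comp_assoc p y_poly q) =
      comp_arr (comp_runit p) (poly_id q)"
proof -
  show "poly_comp (comp_assoc (tgt \<phi>) (tgt \<psi>) (tgt \<chi>)) (comp_arr (comp_arr \<phi> \<psi>) \<chi>) =
      poly_comp (comp_arr \<phi> (comp_arr \<psi> \<chi>)) (comp_assoc (src \<phi>) (src \<psi>) (src \<chi>))"
    if "is_poly_arr \<phi>" "is_poly_arr \<psi>" "is_poly_arr \<chi>"
    using that
    by - ((rule poly_arr_into_comp_eqI[where p = "tgt \<phi>" and q = "tgt \<psi> \<triangleleft> tgt \<chi>"]; (simp; fail)?),
      (rule apply_at_eqI; simp))
  show "is_poly_arr \<phi> \<Longrightarrow> poly_comp (comp_lunit (tgt \<phi>)) (comp_arr (poly_id y_poly) \<phi>) =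
      poly_comp \<phi> (comp_lunit (src \<phi>))"
    by (rule poly_arr_eqI; simp)
  show "is_poly_arr \<phi> \<Longrightarrow> poly_comp (comp_runit (tgt \<phi>)) (comp_arr \<phi> (poly_id y_poly)) =
      poly_comp \<phi> (comp_runit (src \<phi>))"
    by (rule poly_arr_eqI; simp)
  show "poly_comp (comp_assoc p q (r \<triangleleft> t)) (comp_assoc (p \<triangleleft> q) r t) =
      poly_comp (comp_arr (poly_id p) (comp_assoc q r t))
        (poly_comp (comp_assoc p (q \<triangleleft> r) t) (comp_arr (comp_assoc p q r) (poly_id t)))"
    if "exponentiable p" "exponentiable q" "exponentiable r" "exponentiable t"
    using that
    apply -
    apply (rule poly_arr_into_comp_eqI[where p = p and q = "q \<triangleleft> (r \<triangleleft> t)"]; (simp; fail)?)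
    subgoal by (rule apply_at_eqI; (simp; fail)?) (rule apply_at_apply_at_eqI; simp)
    subgoal premises prems
    proof (intro allI impI)
      let ?\<phi> = "poly_comp (comp_assoc p q (r \<triangleleft> t)) (comp_assoc (p \<triangleleft> q) r t)"
      let ?\<psi> = "poly_comp (comp_arr (poly_id p) (comp_assoc q r t))
        (poly_comp (comp_assoc p (q \<triangleleft> r) t) (comp_arr (comp_assoc p q r) (poly_id t)))"
      fix s d assume s: "pos (src ?\<psi>) s" and eq: "act_pos ?\<phi> s = act_pos ?\<psi> s"
        and d: "over (p \<triangleleft> (q \<triangleleft> (r \<triangleleft> t))) (act_pos ?\<psi> s) d"
      have s': "pos (((p \<triangleleft> q) \<triangleleft> r) \<triangleleft> t) s" using s by simp
      let ?b = "base_at (p \<triangleleft> q) r (base_at ((p \<triangleleft> q) \<triangleleft> r) t s)"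
      txt \<open>On positions the two sides have different normal forms at this depth, so their equality
        has to be supplied to the simplifier before the directions can be compared.\<close>
      have eq3: "apply_at (p \<triangleleft> q) (r \<triangleleft> t) (act_pos (comp_assoc (p \<triangleleft> q) r t) s) (direction p q ?b y z) =
        apply_at q (r \<triangleleft> t) (apply_at p (q \<triangleleft> (r \<triangleleft> t)) (act_pos ?\<psi> s) y) z"
        if "over p (base_at p q ?b) y" "over q (apply_at p q ?b y) z" for y z
        using arg_cong[OF eq, of "\<lambda>T. apply_at q (r \<triangleleft> t) (apply_at p (q \<triangleleft> (r \<triangleleft> t)) T y) z"]
          that s' prems by simp
      have "\<forall>d. over (p \<triangleleft> (q \<triangleleft> (r \<triangleleft> t))) (act_pos ?\<psi> s) d \<longrightarrow> act_dir ?\<phi> s d = act_dir ?\<psi> s d"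
        using prems s' eq by (simp add: eq3)
      then show "act_dir ?\<phi> s d = act_dir ?\<psi> s d" using d by blast
    qed
    done
  show "exponentiable p \<Longrightarrow> exponentiable q \<Longrightarrow>
      poly_comp (comp_arr (poly_id p) (comp_lunit q)) (comp_assoc p y_poly q) =
      comp_arr (comp_runit p) (poly_id q)"
    by (rule poly_arr_into_comp_eqI[where p = p and q = q]; simp)
qed

text \<open>A function on the one-element fibre of \<open>y_poly\<close> is the same as its value,
  and a direction is determined by its second component.\<close>

lemma is_iso_comp_lunit:
  assumes p: "exponentiable p"
  shows "is_iso Poly (comp_lunit p)"
proof (rule is_iso_Poly)
  note [simp] = p
  note yp = exponentiable_y_poly p
  show "is_poly_arr (comp_lunit p)" by simp
  show "s = t" if "pos (src (comp_lunit p)) s" "pos (src (comp_lunit p)) t"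
    and eq: "act_pos (comp_lunit p) s = act_pos (comp_lunit p) t" for s t
  proof -
    have s: "pos (y_poly \<triangleleft> p) s" and t: "pos (y_poly \<triangleleft> p) t" using that by simp_all
    have D: "Dom E t = Dom E s"
      using Dom_act_pos[of "comp_lunit p" s] Dom_act_pos[of "comp_lunit p" t] eq s t by simp
    have eq': "apply_at y_poly p s (bang (Dom E s)) = apply_at y_poly p t (bang (Dom E s))"
      using eq s t D by simp
    show ?thesis
    proof (rule pos_ext[OF yp s t])
      show "base_at y_poly p s = base_at y_poly p t" using s t D by simp
      fix k y assume k: "k \<in> Arr E" "Cod E k = Dom E s" and y: "over y_poly (base_at y_poly p (s \<cdot> k)) y"
      have "y = bang (Dom E k)" using y k s pos_cmp[OF s k] by simp
      then show "apply_at y_poly p (s \<cdot> k) y = apply_at y_poly p (t \<cdot> k) y"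
        using arg_cong[OF eq', of "\<lambda>u. u \<cdot> k"] k s t D by simp
    qed
  qed
  show "\<exists>s. pos (src (comp_lunit p)) s \<and> act_pos (comp_lunit p) s = t"
    if "pos (tgt (comp_lunit p)) t" for t
  proof -
    have t: "pos p t" using that by simp
    \<comment> \<open>The preimage of \<open>t\<close> is the family with constant value
      \<open>t\<close>, restricted to each stage.\<close>
    let ?x = "bang (Dom E t)" and ?F = "\<lambda>h y. t \<cdot> h"
    have x: "pos y_poly ?x" using t by simp
    have F: "pos p (t \<cdot> h) \<and> Dom E (t \<cdot> h) = Dom E h" "k \<in> Arr E \<Longrightarrow> Cod E k = Dom E h \<Longrightarrow> t \<cdot> h \<cdot> k = (t \<cdot> h) \<cdot> k"
      if "h \<in> Arr E" "Cod E h = Dom E ?x" for h k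
      using that t pos_cmp[OF t, of h] by simp_all
    note pf = position_family[OF yp x, where F = ?F]
    define s where "s = position y_poly p ?x (t \<cdot> pb1 ?x y_poly)"
    have s: "pos (y_poly \<triangleleft> p) s" unfolding s_def by (rule pf(1); (rule F refl | assumption)+)
    have Ds: "Dom E s = Dom E ?x" unfolding s_def by (rule pf(3); (rule F refl | assumption)+)
    have "apply_at y_poly p (s \<cdot> h) y = t \<cdot> h"
      if h: "h \<in> Arr E" "Cod E h = Dom E ?x" "over y_poly (?x \<cdot> h) y" for h y
      unfolding s_def by (rule pf(4)[OF _ _ _ h]; (rule F refl | assumption)+)
    from this[of "Ident E (Dom E s)" "bang (Dom E s)"] s Ds t show ?thesis
      by (intro exI[of _ s]) simp
  qed
  fix s assume "pos (src (comp_lunit p)) s"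
  then have s: "pos (y_poly \<triangleleft> p) s" by simp
  show "d = e" if "over (tgt (comp_lunit p)) (act_pos (comp_lunit p) s) d"
    "over (tgt (comp_lunit p)) (act_pos (comp_lunit p) s) e"
    "act_dir (comp_lunit p) s d = act_dir (comp_lunit p) s e" for d e
    using that s direction_inject[OF yp s, of "bang (Dom E s)" d "bang (Dom E s)" e] by simp
  show "\<exists>d. over (tgt (comp_lunit p)) (act_pos (comp_lunit p) s) d \<and> act_dir (comp_lunit p) s d = y"
    if y: "over (src (comp_lunit p)) s y" for y
  proof -
    obtain u v where "y = direction y_poly p s u v" "over y_poly (base_at y_poly p s) u"
      "over p (apply_at y_poly p s u) v"
      using comp_obj_cases[OF yp s y[unfolded comp_unit_src_tgt]] by blast
    then show ?thesis using s by (intro exI[of _ v]) simp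
  qed
qed

text \<open>Values in \<open>y_poly\<close> carry no information, so a position is determined by its
  base and a direction by its first component.\<close>

lemma is_iso_comp_runit:
  assumes p: "exponentiable p"
  shows "is_iso Poly (comp_runit p)"
proof (rule is_iso_Poly)
  note [simp] = p
  note yp = p exponentiable_y_poly
  show "is_poly_arr (comp_runit p)" by simp
  show "s = t" if "pos (src (comp_runit p)) s" "pos (src (comp_runit p)) t"
    and eq: "act_pos (comp_runit p) s = act_pos (comp_runit p) t" for s t
  proof -
    have s: "pos (p \<triangleleft> y_poly) s" and t: "pos (p \<triangleleft> y_poly) t" using that by simp_all
    have D: "Dom E t = Dom E s"
      using Dom_act_pos[of "comp_runit p" s] Dom_act_pos[of "comp_runit p" t] eq s t by simp
    have eq': "base_at p y_poly s = base_at p y_poly t" using eq s t by simp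
    show ?thesis
    proof (rule pos_ext[OF yp s t eq'])
      fix k y assume k: "k \<in> Arr E" "Cod E k = Dom E s" and y: "over p (base_at p y_poly (s \<cdot> k)) y"
      have "base_at p y_poly (t \<cdot> k) = base_at p y_poly (s \<cdot> k)"
        using base_at_cmp[OF yp s k] base_at_cmp[OF yp t k(1)] k D eq' by simp
      then show "apply_at p y_poly (s \<cdot> k) y = apply_at p y_poly (t \<cdot> k) y"
        using y k s t D pos_cmp[OF s k] pos_cmp[OF t k(1)] by simp
    qed
  qed
  show "\<exists>s. pos (src (comp_runit p)) s \<and> act_pos (comp_runit p) s = t"
    if "pos (tgt (comp_runit p)) t" for t
  proof -
    have t: "pos p t" using that by simp
    \<comment> \<open>The only possible family of positions of \<open>y_poly\<close>; over the base
      \<open>t\<close> it gives the preimage.\<close>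
    let ?F = "\<lambda>h (y :: 'a). bang (Dom E h)"
    have F: "pos y_poly (bang (Dom E h)) \<and> Dom E (bang (Dom E h)) = Dom E h"
      "k \<in> Arr E \<Longrightarrow> Cod E k = Dom E h \<Longrightarrow> bang (Dom E (h \<cdot> k)) = bang (Dom E h) \<cdot> k"
      if "h \<in> Arr E" for h k
      using that by simp_all
    note pf = position_family[OF yp t, where F = ?F]
    define s where "s = position p y_poly t (bang (Dom E (pb1 t p)))"
    have "pos (p \<triangleleft> y_poly) s" unfolding s_def by (rule pf(1); (rule F refl | assumption)+)
    moreover have "base_at p y_poly s = t" unfolding s_def by (rule pf(2); (rule F refl | assumption)+)
    ultimately show ?thesis by (intro exI[of _ s]) simp
  qed
  fix s assume "pos (src (comp_runit p)) s"
  then have s: "pos (p \<triangleleft> y_poly) s" by simp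
  show "d = e" if "over (tgt (comp_runit p)) (act_pos (comp_runit p) s) d"
    "over (tgt (comp_runit p)) (act_pos (comp_runit p) s) e"
    "act_dir (comp_runit p) s d = act_dir (comp_runit p) s e" for d e
    using that s direction_inject[OF yp s, of d "bang (Dom E s)" e "bang (Dom E s)"] by simp
  show "\<exists>d. over (tgt (comp_runit p)) (act_pos (comp_runit p) s) d \<and> act_dir (comp_runit p) s d = y"
    if y: "over (src (comp_runit p)) s y" for y
  proof -
    obtain u v where "y = direction p y_poly s u v" "over p (base_at p y_poly s) u"
      "over y_poly (apply_at p y_poly s u) v"
      using comp_obj_cases[OF yp s y[unfolded comp_unit_src_tgt]] by blast
    then show ?thesis using s by (intro exI[of _ u]) simp
  qed
qed

text \<open>Currying and its inverse. A position of
  \<open>p \<triangleleft> (q \<triangleleft> r)\<close> assigns to \<open>y\<close> a base and a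
  function of \<open>z\<close>. The bases assemble to a position of
  \<open>p \<triangleleft> q\<close>, and the functions to one function of the pair of
  \<open>y\<close> and \<open>z\<close>.\<close>

lemma is_iso_comp_assoc:
  assumes p: "exponentiable p" and q: "exponentiable q" and r: "exponentiable r"
  shows "is_iso Poly (comp_assoc p q r)"
proof (rule is_iso_Poly)
  note [simp] = p q r
  have pq: "exponentiable (p \<triangleleft> q)" and qr: "exponentiable (q \<triangleleft> r)" by simp_all
  let ?\<alpha> = "comp_assoc p q r" and ?R = "(p \<triangleleft> q) \<triangleleft> r" and ?L = "p \<triangleleft> (q \<triangleleft> r)"
  show "is_poly_arr ?\<alpha>" by simp
  show "s = t" if "pos (src ?\<alpha>) s" "pos (src ?\<alpha>) t" and eq: "act_pos ?\<alpha> s = act_pos ?\<alpha> t" for s t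
  proof -
    have s: "pos ?R s" and t: "pos ?R t" using that by simp_all
    have D: "Dom E t = Dom E s"
      using Dom_act_pos[of ?\<alpha> s] Dom_act_pos[of ?\<alpha> t] eq s t by simp
    \<comment> \<open>The assumed equality restricts to later stages, where extensionality needs
      it.\<close>
    have eqk: "act_pos ?\<alpha> (s \<cdot> k) = act_pos ?\<alpha> (t \<cdot> k)" "pos ?R (s \<cdot> k)" "pos ?R (t \<cdot> k)"
      if "k \<in> Arr E" "Cod E k = Dom E s" for k
      using that s t D arg_cong[OF eq, of "\<lambda>u. u \<cdot> k"] pos_cmp[OF s that] pos_cmp[OF t that(1)] by simp_all
    have bb: "base_at p q (base_at (p \<triangleleft> q) r s) = base_at p q (base_at (p \<triangleleft> q) r t)"
      if eq: "act_pos ?\<alpha> s = act_pos ?\<alpha> t" and s: "pos ?R s" and t: "pos ?R t" for s t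
      using arg_cong[OF eq, of "base_at p (q \<triangleleft> r)"] s t by simp
    \<comment> \<open>Stated for arbitrary positions, since it is applied to the restrictions
      \<open>s \<cdot> k\<close> and \<open>t \<cdot> k\<close>.\<close>
    have ab: "apply_at p q (base_at (p \<triangleleft> q) r s) y = apply_at p q (base_at (p \<triangleleft> q) r t) y"
      if eq: "act_pos ?\<alpha> s = act_pos ?\<alpha> t" and s: "pos ?R s" and t: "pos ?R t"
        and y: "over p (base_at p q (base_at (p \<triangleleft> q) r s)) y" for s t y
      using arg_cong[OF eq, of "\<lambda>u. base_at q r (apply_at p (q \<triangleleft> r) u y)"] s t y bb[OF eq s t] by simp
    have base: "base_at (p \<triangleleft> q) r s = base_at (p \<triangleleft> q) r t"
    proof (rule pos_ext[OF p q])
      show "pos (p \<triangleleft> q) (base_at (p \<triangleleft> q) r s)" "pos (p \<triangleleft> q) (base_at (p \<triangleleft> q) r t)" using s t by simp_all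
      show "base_at p q (base_at (p \<triangleleft> q) r s) = base_at p q (base_at (p \<triangleleft> q) r t)"
        by (rule bb[OF eq s t])
      fix k y assume k: "k \<in> Arr E" "Cod E k = Dom E (base_at (p \<triangleleft> q) r s)"
        and y: "over p (base_at p q (base_at (p \<triangleleft> q) r s \<cdot> k)) y"
      have k': "Cod E k = Dom E s" using k s by simp
      show "apply_at p q (base_at (p \<triangleleft> q) r s \<cdot> k) y = apply_at p q (base_at (p \<triangleleft> q) r t \<cdot> k) y"
        using ab[OF eqk[OF k(1) k']] y k(1) k' s t D by simp
    qed
    show ?thesis
    proof (rule pos_ext[OF pq r s t base])
      fix k d assume k: "k \<in> Arr E" "Cod E k = Dom E s" and d: "over (p \<triangleleft> q) (base_at (p \<triangleleft> q) r (s \<cdot> k)) d"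
      note e = eqk[OF k]
      have b: "base_at (p \<triangleleft> q) r (t \<cdot> k) = base_at (p \<triangleleft> q) r (s \<cdot> k)"
        using base_at_cmp[OF pq r s k] base_at_cmp[OF pq r t k(1)] base k D by simp
      obtain y z where d': "d = direction p q (base_at (p \<triangleleft> q) r (s \<cdot> k)) y z"
        "over p (base_at p q (base_at (p \<triangleleft> q) r (s \<cdot> k))) y"
        "over q (apply_at p q (base_at (p \<triangleleft> q) r (s \<cdot> k)) y) z"
        using comp_obj_cases[OF p q _ d] e(2) by auto
      show "apply_at (p \<triangleleft> q) r (s \<cdot> k) d = apply_at (p \<triangleleft> q) r (t \<cdot> k) d"
        using arg_cong[OF e(1), of "\<lambda>u. apply_at q r (apply_at p (q \<triangleleft> r) u y) z"] e(2,3) d' b by simp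
    qed
  qed
  show "\<exists>s. pos (src ?\<alpha>) s \<and> act_pos ?\<alpha> s = t" if "pos (tgt ?\<alpha>) t" for t
  proof -
    have t: "pos ?L t" using that by simp
    let ?x = "base_at p (q \<triangleleft> r) t"
    have th: "pos ?L (t \<cdot> h)" "?x \<cdot> h = base_at p (q \<triangleleft> r) (t \<cdot> h)" "Dom E (t \<cdot> h) = Dom E h"
      if "h \<in> Arr E" "Cod E h = Dom E t" for h
      using that t pos_cmp[OF t that] by simp_all
    \<comment> \<open>The first layer of the preimage: \<open>y\<close> is sent to the base of the
      value of \<open>t\<close> at \<open>y\<close>.\<close>
    define F where "F h y = base_at q r (apply_at p (q \<triangleleft> r) (t \<cdot> h) y)" for h y
    have F: "pos q (F h y) \<and> Dom E (F h y) = Dom E h"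
      "k \<in> Arr E \<Longrightarrow> Cod E k = Dom E h \<Longrightarrow> F (h \<cdot> k) (y \<cdot> k) = F h y \<cdot> k"
      if h: "h \<in> Arr E" "Cod E h = Dom E ?x" "over p (?x \<cdot> h) y" for h y k
    proof -
      have h': "Cod E h = Dom E t" using h t by simp
      note th = th[OF h(1) h']
      have y: "over p (base_at p (q \<triangleleft> r) (t \<cdot> h)) y" using h(3) th by simp
      show "pos q (F h y) \<and> Dom E (F h y) = Dom E h" using th y by (simp add: F_def)
      assume k: "k \<in> Arr E" "Cod E k = Dom E h"
      have "t \<cdot> h \<cdot> k = (t \<cdot> h) \<cdot> k" using t h(1) h' k by simp
      then show "F (h \<cdot> k) (y \<cdot> k) = F h y \<cdot> k" using th y k by (simp add: F_def)
    qed
    have x: "pos p ?x" using t by simp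
    note pf = position_family[OF p q x, where F = F]
    define s1 where "s1 = position p q ?x (F (pb1 ?x p) (pb2 ?x p))"
    have s1: "pos (p \<triangleleft> q) s1" unfolding s1_def by (rule pf(1); (rule F refl | assumption)+)
    have bs1: "base_at p q s1 = ?x" unfolding s1_def by (rule pf(2); (rule F refl | assumption)+)
    have "Dom E s1 = Dom E ?x" unfolding s1_def by (rule pf(3); (rule F refl | assumption)+)
    then have Ds1: "Dom E s1 = Dom E t" using t by simp
    have as1: "apply_at p q (s1 \<cdot> h) y = F h y"
      if h: "h \<in> Arr E" "Cod E h = Dom E ?x" "over p (?x \<cdot> h) y" for h y
      unfolding s1_def by (rule pf(4)[OF _ _ _ h]; (rule F refl | assumption)+)
    have s1h: "pos (p \<triangleleft> q) (s1 \<cdot> h)" "base_at p q (s1 \<cdot> h) = base_at p (q \<triangleleft> r) (t \<cdot> h)"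
      "over p (base_at p (q \<triangleleft> r) (t \<cdot> h)) y \<Longrightarrow>
        apply_at p q (s1 \<cdot> h) y = base_at q r (apply_at p (q \<triangleleft> r) (t \<cdot> h) y)"
      if h: "h \<in> Arr E" "Cod E h = Dom E t" for h y
    proof -
      note th = th[OF h]
      show "pos (p \<triangleleft> q) (s1 \<cdot> h)" using pos_cmp[OF s1 h(1)] h Ds1 by simp
      show "base_at p q (s1 \<cdot> h) = base_at p (q \<triangleleft> r) (t \<cdot> h)"
        using base_at_cmp[OF p q s1 h(1)] bs1 h Ds1 th by simp
      show "apply_at p q (s1 \<cdot> h) y = base_at q r (apply_at p (q \<triangleleft> r) (t \<cdot> h) y)"
        if "over p (base_at p (q \<triangleleft> r) (t \<cdot> h)) y"
        using as1[of h y] h th that t by (simp add: F_def)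
    qed
    \<comment> \<open>Uncurrying: at a direction with components \<open>y\<close> and
      \<open>z\<close>, evaluate \<open>t\<close> at \<open>y\<close> and the result at
      \<open>z\<close>.\<close>
    define G where "G h d = apply_at q r (apply_at p (q \<triangleleft> r) (t \<cdot> h) (dir1 p q \<cdot> d)) (dir2 p q \<cdot> d)" for h d
    have Gd: "over p (base_at p (q \<triangleleft> r) (t \<cdot> h)) (dir1 p q \<cdot> d)"
      "over q (base_at q r (apply_at p (q \<triangleleft> r) (t \<cdot> h) (dir1 p q \<cdot> d))) (dir2 p q \<cdot> d)"
      "d \<in> Arr E" "Cod E d = Dom E (p \<triangleleft> q)" "Dom E d = Dom E h"
      if h: "h \<in> Arr E" "Cod E h = Dom E t" "over (p \<triangleleft> q) (s1 \<cdot> h) d" for h d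
    proof -
      note s1h = s1h[OF h(1,2)]
      show y: "over p (base_at p (q \<triangleleft> r) (t \<cdot> h)) (dir1 p q \<cdot> d)"
        using over_dir1[OF p q s1h(1) h(3)] s1h(2) by simp
      show "over q (base_at q r (apply_at p (q \<triangleleft> r) (t \<cdot> h) (dir1 p q \<cdot> d))) (dir2 p q \<cdot> d)"
        using over_dir2[OF p q s1h(1) h(3)] s1h(3)[OF y] by simp
      show "d \<in> Arr E" "Cod E d = Dom E (p \<triangleleft> q)" "Dom E d = Dom E h"
        using overD[OF h(3) exponentiableD[OF pq]] s1 Ds1 h(1,2) by simp_all
    qed
    have G: "pos r (G h d) \<and> Dom E (G h d) = Dom E h"
      "k \<in> Arr E \<Longrightarrow> Cod E k = Dom E h \<Longrightarrow> G (h \<cdot> k) (d \<cdot> k) = G h d \<cdot> k"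
      if h: "h \<in> Arr E" "Cod E h = Dom E s1" "over (p \<triangleleft> q) (s1 \<cdot> h) d" for h d k
    proof -
      have h': "Cod E h = Dom E t" using h Ds1 by simp
      note g = Gd[OF h(1) h' h(3)] and th = th[OF h(1) h']
      show "pos r (G h d) \<and> Dom E (G h d) = Dom E h" using g th by (simp add: G_def)
      assume k: "k \<in> Arr E" "Cod E k = Dom E h"
      have "t \<cdot> h \<cdot> k = (t \<cdot> h) \<cdot> k" using t h(1) h' k by simp
      then show "G (h \<cdot> k) (d \<cdot> k) = G h d \<cdot> k"
        using g th k dir_arr[OF p q] by (simp add: G_def)
    qed
    note pg = position_family[OF pq r s1, where F = G]
    define s where "s = position (p \<triangleleft> q) r s1 (G (pb1 s1 (p \<triangleleft> q)) (pb2 s1 (p \<triangleleft> q)))"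
    have s: "pos ?R s" unfolding s_def by (rule pg(1); (rule G refl | assumption)+)
    have bs: "base_at (p \<triangleleft> q) r s = s1" unfolding s_def by (rule pg(2); (rule G refl | assumption)+)
    have "Dom E s = Dom E s1" unfolding s_def by (rule pg(3); (rule G refl | assumption)+)
    then have Ds: "Dom E s = Dom E t" using Ds1 by simp
    have as: "apply_at (p \<triangleleft> q) r (s \<cdot> h) d = G h d"
      if h: "h \<in> Arr E" "Cod E h = Dom E s1" "over (p \<triangleleft> q) (s1 \<cdot> h) d" for h d
      unfolding s_def by (rule pg(4)[OF _ _ _ h]; (rule G refl | assumption)+)
    have sh: "pos ?R (s \<cdot> h)" "base_at (p \<triangleleft> q) r (s \<cdot> h) = s1 \<cdot> h" "Dom E (s \<cdot> h) = Dom E h"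
      if "h \<in> Arr E" "Cod E h = Dom E t" for h
      using pos_cmp[OF s that(1)] base_at_cmp[OF pq r s that(1)] that Ds bs s by simp_all
    \<comment> \<open>The codomain is nested, so extensionality is used twice, with stages
      \<open>k\<close> and then \<open>k \<cdot> l\<close>.\<close>
    have "act_pos ?\<alpha> s = t"
    proof (rule pos_ext[OF p qr])
      show "pos ?L (act_pos ?\<alpha> s)" using s by simp
      show "pos ?L t" by (rule t)
      show "base_at p (q \<triangleleft> r) (act_pos ?\<alpha> s) = base_at p (q \<triangleleft> r) t" using s bs bs1 by simp
      fix k y assume "k \<in> Arr E" "Cod E k = Dom E (act_pos ?\<alpha> s)"
        and y0: "over p (base_at p (q \<triangleleft> r) (act_pos ?\<alpha> s \<cdot> k)) y"
      then have k: "k \<in> Arr E" "Cod E k = Dom E t" using s Ds by simp_all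
      have ak: "act_pos ?\<alpha> s \<cdot> k = act_pos ?\<alpha> (s \<cdot> k)" using s k Ds by simp
      note sk = sh[OF k] and tk = th[OF k] and s1k = s1h[OF k]
      have y: "over p (base_at p (q \<triangleleft> r) (t \<cdot> k)) y" using y0 ak sk s1k(2) by simp
      have y1: "over p (base_at p q (base_at (p \<triangleleft> q) r (s \<cdot> k))) y" using y sk s1k(2) by simp
      show "apply_at p (q \<triangleleft> r) (act_pos ?\<alpha> s \<cdot> k) y = apply_at p (q \<triangleleft> r) (t \<cdot> k) y"
        unfolding ak
      proof (rule pos_ext[OF q r])
        show "pos (q \<triangleleft> r) (apply_at p (q \<triangleleft> r) (act_pos ?\<alpha> (s \<cdot> k)) y)" using sk(1) y1 by simp
        show "pos (q \<triangleleft> r) (apply_at p (q \<triangleleft> r) (t \<cdot> k) y)" using tk(1) y by simp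
        show "base_at q r (apply_at p (q \<triangleleft> r) (act_pos ?\<alpha> (s \<cdot> k)) y) = base_at q r (apply_at p (q \<triangleleft> r) (t \<cdot> k) y)"
          using sk(1,2) y1 s1k(3)[OF y] by simp
        fix l z assume l0: "l \<in> Arr E" "Cod E l = Dom E (apply_at p (q \<triangleleft> r) (act_pos ?\<alpha> (s \<cdot> k)) y)"
          and z0: "over q (base_at q r (apply_at p (q \<triangleleft> r) (act_pos ?\<alpha> (s \<cdot> k)) y \<cdot> l)) z"
        have l: "l \<in> Arr E" "Cod E l = Dom E k" using l0 sk(1,3) y1 by simp_all
        have kl: "k \<cdot> l \<in> Arr E" "Cod E (k \<cdot> l) = Dom E t" using k l by simp_all
        note skl = sh[OF kl] and tkl = th[OF kl] and s1kl = s1h[OF kl]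
        have as': "(s \<cdot> k) \<cdot> l = s \<cdot> k \<cdot> l" "(t \<cdot> k) \<cdot> l = t \<cdot> k \<cdot> l" using s t k l Ds by simp_all
        have yl: "over p (base_at p (q \<triangleleft> r) (t \<cdot> k \<cdot> l)) (y \<cdot> l)"
          using over_cmp[OF y exponentiableD[OF p] l(1)] tk l as' by simp
        have yl1: "over p (base_at p q (base_at (p \<triangleleft> q) r (s \<cdot> k \<cdot> l))) (y \<cdot> l)" using yl skl s1kl(2) by simp
        have c1: "apply_at p (q \<triangleleft> r) (act_pos ?\<alpha> (s \<cdot> k)) y \<cdot> l = apply_at p (q \<triangleleft> r) (act_pos ?\<alpha> (s \<cdot> k \<cdot> l)) (y \<cdot> l)"
          using sk(1,3) y1 l as' by simp
        have c2: "apply_at p (q \<triangleleft> r) (t \<cdot> k) y \<cdot> l = apply_at p (q \<triangleleft> r) (t \<cdot> k \<cdot> l) (y \<cdot> l)"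
          using tk(1,3) y l as' by simp
        have z: "over q (base_at q r (apply_at p (q \<triangleleft> r) (t \<cdot> k \<cdot> l) (y \<cdot> l))) z"
          using z0 c1 skl(1,2) yl1 s1kl(3)[OF yl] by simp
        have z1: "over q (apply_at p q (s1 \<cdot> k \<cdot> l) (y \<cdot> l)) z" using z s1kl(3)[OF yl] by simp
        have yl2: "over p (base_at p q (s1 \<cdot> k \<cdot> l)) (y \<cdot> l)" using yl s1kl(2) by simp
        note dd = over_direction[OF p q s1kl(1) yl2 z1] dir1_direction[OF p q s1kl(1) yl2 z1]
          dir2_direction[OF p q s1kl(1) yl2 z1]
        have "apply_at q r (apply_at p (q \<triangleleft> r) (act_pos ?\<alpha> (s \<cdot> k \<cdot> l)) (y \<cdot> l)) z =
            apply_at (p \<triangleleft> q) r (s \<cdot> k \<cdot> l) (direction p q (s1 \<cdot> k \<cdot> l) (y \<cdot> l) z)"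
          using skl(1,2) yl1 z1 by simp
        also have "\<dots> = G (k \<cdot> l) (direction p q (s1 \<cdot> k \<cdot> l) (y \<cdot> l) z)"
          using as[OF kl(1) _ dd(1)] kl Ds1 by simp
        also have "\<dots> = apply_at q r (apply_at p (q \<triangleleft> r) (t \<cdot> k \<cdot> l) (y \<cdot> l)) z"
          by (simp add: G_def dd(2,3))
        finally show "apply_at q r (apply_at p (q \<triangleleft> r) (act_pos ?\<alpha> (s \<cdot> k)) y \<cdot> l) z =
            apply_at q r (apply_at p (q \<triangleleft> r) (t \<cdot> k) y \<cdot> l) z"
          unfolding c1 c2 .
      qed
    qed
    then show ?thesis using s by auto
  qed
  fix s assume "pos (src ?\<alpha>) s"
  then have s: "pos ?R s" by simp
  let ?b = "base_at (p \<triangleleft> q) r s"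
  have dcases: thesis if d: "over (tgt ?\<alpha>) (act_pos ?\<alpha> s) d" and *: "\<And>y z w. d = direction p (q \<triangleleft> r) (act_pos ?\<alpha> s) y
      (direction q r (apply_at p (q \<triangleleft> r) (act_pos ?\<alpha> s) y) z w) \<Longrightarrow> over p (base_at p q ?b) y \<Longrightarrow>
      over q (apply_at p q ?b y) z \<Longrightarrow> over r (apply_at (p \<triangleleft> q) r s (direction p q ?b y z)) w \<Longrightarrow> thesis" for d thesis
  proof -
    \<comment> \<open>The quantifier over \<open>d\<close> is present so that
      \<open>all_over_comp_obj\<close> can split it, twice, into three components; the witnesses are
      then immediate.\<close>
    have "\<forall>d. over ?L (act_pos ?\<alpha> s) d \<longrightarrow> (\<exists>y z w. d = direction p (q \<triangleleft> r) (act_pos ?\<alpha> s) y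
      (direction q r (apply_at p (q \<triangleleft> r) (act_pos ?\<alpha> s) y) z w) \<and> over p (base_at p q ?b) y \<and>
      over q (apply_at p q ?b y) z \<and> over r (apply_at (p \<triangleleft> q) r s (direction p q ?b y z)) w)"
      using s by simp blast
    with d * show thesis by fastforce
  qed
  have inj: "y = y' \<and> z = z' \<and> w = w'"
    if yz: "over p (base_at p q ?b) y" "over q (apply_at p q ?b y) z" "over r (apply_at (p \<triangleleft> q) r s (direction p q ?b y z)) w"
      "over p (base_at p q ?b) y'" "over q (apply_at p q ?b y') z'" "over r (apply_at (p \<triangleleft> q) r s (direction p q ?b y' z')) w'"
      and eq: "direction (p \<triangleleft> q) r s (direction p q ?b y z) w = direction (p \<triangleleft> q) r s (direction p q ?b y' z') w'"
    for y z w y' z' w'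
  proof -
    have b: "pos (p \<triangleleft> q) ?b" using s by simp
    have "direction p q ?b y z = direction p q ?b y' z' \<and> w = w'"
      using direction_inject[OF pq r s over_direction[OF p q b yz(1,2)] yz(3) over_direction[OF p q b yz(4,5)] yz(6)] eq
      by simp
    then show ?thesis using direction_inject[OF p q b yz(1,2,4,5)] by simp
  qed
  show "d = e" if d: "over (tgt ?\<alpha>) (act_pos ?\<alpha> s) d" and e: "over (tgt ?\<alpha>) (act_pos ?\<alpha> s) e"
    and eq: "act_dir ?\<alpha> s d = act_dir ?\<alpha> s e" for d e
  proof (rule dcases[OF d], rule dcases[OF e])
    fix y z w y' z' w'
    assume d': "d = direction p (q \<triangleleft> r) (act_pos ?\<alpha> s) y (direction q r (apply_at p (q \<triangleleft> r) (act_pos ?\<alpha> s) y) z w)"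
      and e': "e = direction p (q \<triangleleft> r) (act_pos ?\<alpha> s) y' (direction q r (apply_at p (q \<triangleleft> r) (act_pos ?\<alpha> s) y') z' w')"
      and yz: "over p (base_at p q ?b) y" "over q (apply_at p q ?b y) z" "over r (apply_at (p \<triangleleft> q) r s (direction p q ?b y z)) w"
      "over p (base_at p q ?b) y'" "over q (apply_at p q ?b y') z'" "over r (apply_at (p \<triangleleft> q) r s (direction p q ?b y' z')) w'"
    have "y = y' \<and> z = z' \<and> w = w'"
      by (rule inj[OF yz]) (use eq d' e' yz s in simp)
    then show "d = e" using d' e' by simp
  qed
  show "\<exists>d. over (tgt ?\<alpha>) (act_pos ?\<alpha> s) d \<and> act_dir ?\<alpha> s d = y" if y: "over (src ?\<alpha>) s y" for y
  proof -
    \<comment> \<open>The same splitting for directions grouped to the left. The preimage is the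
      regrouped direction.\<close>
    have "\<forall>d. over ?R s d \<longrightarrow> (\<exists>y z w. d = direction (p \<triangleleft> q) r s (direction p q ?b y z) w \<and>
      over p (base_at p q ?b) y \<and> over q (apply_at p q ?b y) z \<and>
      over r (apply_at (p \<triangleleft> q) r s (direction p q ?b y z)) w)"
      using s by simp blast
    then obtain u v w where "y = direction (p \<triangleleft> q) r s (direction p q ?b u v) w"
      "over p (base_at p q ?b) u" "over q (apply_at p q ?b u) v"
      "over r (apply_at (p \<triangleleft> q) r s (direction p q ?b u v)) w"
      using y by fastforce
    then show ?thesis
      using s by (intro exI[of _ "direction p (q \<triangleleft> r) (act_pos ?\<alpha> s) u
        (direction q r (apply_at p (q \<triangleleft> r) (act_pos ?\<alpha> s) u) v w)"]) simp
  qed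
qed

theorem is_monoidal_tensor: "is_monoidal_category Poly tensor_monoidal"
  unfolding is_monoidal_category_def
  using is_category_Poly is_functor_tensor
  by (simp add: hom_Poly is_iso_tensor_assoc is_iso_tensor_lunit is_iso_tensor_runit tensor_coherence)

theorem is_monoidal_comp: "is_monoidal_category Poly comp_monoidal"
  unfolding is_monoidal_category_def
  using is_category_Poly is_functor_comp
  by (simp add: hom_Poly is_iso_comp_assoc is_iso_comp_lunit is_iso_comp_runit comp_coherence)

section \<open>The duoidal structure\<close>

text \<open>Rewriting \<open>s\<close> to \<open>bang (Dom E s)\<close> would not terminate;
  eliminating the quantifier performs this replacement once.\<close>

lemma all_pos_y_poly: "(\<forall>s. pos y_poly s \<longrightarrow> P s) \<longleftrightarrow> (\<forall>X \<in> Obj E. P (bang X))"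
  by (auto simp: pos_y_poly_iff)

lemma interchange_natural:
  assumes "is_poly_arr \<phi>" "is_poly_arr \<psi>" "is_poly_arr \<phi>'" "is_poly_arr \<psi>'"
  shows "poly_comp (poly_interchange (tgt \<phi>) (tgt \<psi>) (tgt \<phi>') (tgt \<psi>'))
      (tensor_arr (comp_arr \<phi> \<psi>) (comp_arr \<phi>' \<psi>')) =
    poly_comp (comp_arr (tensor_arr \<phi> \<phi>') (tensor_arr \<psi> \<psi>'))
      (poly_interchange (src \<phi>) (src \<psi>) (src \<phi>') (src \<psi>'))"
  using assms by - (rule poly_arr_into_comp_eqI[where p = "prd_map (tgt \<phi>) (tgt \<phi>')"
    and q = "prd_map (tgt \<psi>) (tgt \<psi>')"]; simp)

text \<open>The coassociativity axiom for the colax structure of \<open>\<otimes>\<close>. Both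
  sides pair the functions of the two factors at each of the three levels.\<close>

lemma interchange_assoc:
  assumes "exponentiable x" "exponentiable y" "exponentiable z" "exponentiable x'" "exponentiable y'" "exponentiable z'"
  shows "poly_comp (comp_assoc (prd_map x x') (prd_map y y') (prd_map z z'))
      (poly_comp (comp_arr (poly_interchange x y x' y') (poly_id (prd_map z z')))
        (poly_interchange (x \<triangleleft> y) z (x' \<triangleleft> y') z')) =
    poly_comp (comp_arr (poly_id (prd_map x x')) (poly_interchange y z y' z'))
      (poly_comp (poly_interchange x (y \<triangleleft> z) x' (y' \<triangleleft> z'))
        (tensor_arr (comp_assoc x y z) (comp_assoc x' y' z')))"
  using assms
  by - ((rule poly_arr_into_comp_eqI[where p = "prd_map x x'" and q = "prd_map y y' \<triangleleft> prd_map z z'"]; (simp; fail)?), (rule apply_at_eqI; simp))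

text \<open>The counit axioms for the colax structure of \<open>\<otimes>\<close>; the counit is
  \<open>tensor_lunit y_poly\<close>.\<close>

lemma interchange_unit:
  assumes "exponentiable x" "exponentiable x'"
  shows "poly_comp (comp_lunit (prd_map x x'))
      (poly_comp (comp_arr (tensor_lunit y_poly) (poly_id (prd_map x x'))) (poly_interchange y_poly x y_poly x')) =
      tensor_arr (comp_lunit x) (comp_lunit x')"
    and "poly_comp (comp_runit (prd_map x x'))
      (poly_comp (comp_arr (poly_id (prd_map x x')) (tensor_lunit y_poly)) (poly_interchange x y_poly x' y_poly)) =
      tensor_arr (comp_runit x) (comp_runit x')"
  using assms by - (rule poly_arr_eqI; simp)+

text \<open>A colax structure on the functor that picks out the unit is a comonoid structure on
  \<open>y_poly\<close> for \<open>\<triangleleft>\<close>. Its axioms hold because all elements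
  involved are arrows to the terminal object.\<close>

lemma unit_comult_coherence:
  "poly_comp (comp_assoc y_poly y_poly y_poly)
     (poly_comp (comp_arr poly_unit_comult (poly_id y_poly)) poly_unit_comult) =
   poly_comp (comp_arr (poly_id y_poly) poly_unit_comult) poly_unit_comult"
  "poly_comp (comp_lunit y_poly) poly_unit_comult = poly_id y_poly"
  "poly_comp (comp_runit y_poly) poly_unit_comult = poly_id y_poly"
  subgoal
    by (rule poly_arr_into_comp_eqI[where p = y_poly and q = "y_poly \<triangleleft> y_poly"]; (simp; fail)?) (rule apply_at_eqI; simp)
  by (rule poly_arr_eqI; simp add: all_pos_y_poly)+

text \<open>Compatibility of the associator of \<open>\<otimes>\<close> with the comultiplications:
  pairing the functions of three factors commutes with regrouping them.\<close>

lemma tensor_assoc_interchange: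
  assumes "exponentiable p" "exponentiable q" "exponentiable r" "exponentiable p'" "exponentiable q'" "exponentiable r'"
  shows "poly_comp (comp_arr (tensor_assoc p q r) (tensor_assoc p' q' r'))
      (poly_comp (poly_interchange (prd_map p q) (prd_map p' q') r r')
        (tensor_arr (poly_interchange p p' q q') (poly_id (r \<triangleleft> r')))) =
    poly_comp (poly_comp (poly_interchange p p' (prd_map q r) (prd_map q' r'))
      (tensor_arr (poly_id (p \<triangleleft> p')) (poly_interchange q q' r r')))
      (tensor_assoc (p \<triangleleft> p') (q \<triangleleft> q') (r \<triangleleft> r'))"
  using assms by - (rule poly_arr_into_comp_eqI[where p = "prd_map p (prd_map q r)" and q = "prd_map p' (prd_map q' r')"]; simp)

text \<open>Compatibility of the associator with the counits.\<close>

lemma tensor_assoc_counit: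
  "poly_comp (poly_comp (tensor_lunit y_poly) (tensor_arr (poly_id y_poly) (tensor_lunit y_poly)))
    (tensor_assoc y_poly y_poly y_poly) =
   poly_comp (tensor_lunit y_poly) (tensor_arr (tensor_lunit y_poly) (poly_id y_poly))"
  by (rule poly_arr_eqI; simp add: all_pos_y_poly)

text \<open>Compatibility of the unitors with the comultiplications: a trivial factor is paired on
  and then projected away at both levels.\<close>

lemma tensor_unit_interchange:
  assumes "exponentiable p" "exponentiable q"
  shows "poly_comp (comp_arr (tensor_lunit p) (tensor_lunit q))
      (poly_comp (poly_interchange y_poly y_poly p q) (tensor_arr poly_unit_comult (poly_id (p \<triangleleft> q)))) =
      tensor_lunit (p \<triangleleft> q)"
    and "poly_comp (comp_arr (tensor_runit p) (tensor_runit q))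
      (poly_comp (poly_interchange p q y_poly y_poly) (tensor_arr (poly_id (p \<triangleleft> q)) poly_unit_comult)) =
      tensor_runit (p \<triangleleft> q)"
  using assms by - (rule poly_arr_into_comp_eqI[where p = p and q = q]; simp add: all_pos_y_poly)+

text \<open>The counit of \<open>\<otimes>\<close> is given by the left unitor, whereas the counit
  condition for the right unitor produces the right one.\<close>

lemma tensor_runit_y_poly: "tensor_runit y_poly = tensor_lunit y_poly"
  by (rule poly_arr_eqI; simp add: all_pos_y_poly)

section \<open>Assembling the normal duoidal structure\<close>

lemma poly_comp_id_left [simp]: "is_poly_arr \<phi> \<Longrightarrow> tgt \<phi> = q \<Longrightarrow> poly_comp (poly_id q) \<phi> = \<phi>"
  and poly_comp_id_right [simp]: "is_poly_arr \<phi> \<Longrightarrow> src \<phi> = p \<Longrightarrow> poly_comp \<phi> (poly_id p) = \<phi>"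
  using is_category_Poly by (auto simp: is_category_def)

lemma tensor_arr_id [simp]:
  "exponentiable p \<Longrightarrow> exponentiable q \<Longrightarrow> tensor_arr (poly_id p) (poly_id q) = poly_id (prd_map p q)"
  and comp_arr_id [simp]:
  "exponentiable p \<Longrightarrow> exponentiable q \<Longrightarrow> comp_arr (poly_id p) (poly_id q) = poly_id (p \<triangleleft> q)"
  using is_functor_tensor is_functor_comp by (auto simp: is_functor_def)

lemmas colax_defs = tensor_colax_def unit_colax_def colax_tensor_def colax_comp_def colax_pair_def
  colax_id_def colax_fst_def colax_snd_def colax_bang_def prod_monoidal_def one_monoidal_def
  one_cat_def poly_duoidal_def

lemma is_colax_tensor:
  "is_colax_monoidal (prod_cat Poly Poly) (prod_monoidal comp_monoidal comp_monoidal) Poly comp_monoidal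
    (tensor_colax tensor_monoidal poly_duoidal)"
proof -
  \<comment> \<open>Passing to the colax record leaves the functor part \<open>mtensor\<close>
    unchanged.\<close>
  have "is_functor (prod_cat Poly Poly) Poly (tensor_colax tensor_monoidal poly_duoidal)"
    using is_functor_tensor by (simp add: is_functor_def tensor_colax_def)
  then show ?thesis
    unfolding is_colax_monoidal_def
    by (auto simp: colax_defs hom_Poly interchange_natural interchange_assoc interchange_unit)
qed

lemma is_colax_unit:
  "is_colax_monoidal one_cat one_monoidal Poly comp_monoidal (unit_colax Poly tensor_monoidal poly_duoidal)"
  unfolding is_colax_monoidal_def is_functor_def
  by (simp add: colax_defs hom_Poly unit_comult_coherence)

lemma tensor_assoc_monoidal:
  "is_monoidal_nat_trans (prod_cat Poly (prod_cat Poly Poly))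
     (prod_monoidal comp_monoidal (prod_monoidal comp_monoidal comp_monoidal)) Poly comp_monoidal
     (colax_tensor Poly tensor_monoidal poly_duoidal
       (colax_tensor Poly tensor_monoidal poly_duoidal (colax_fst Poly comp_monoidal)
         (colax_comp Poly (colax_fst Poly comp_monoidal)
           (colax_snd (prod_cat Poly Poly) (prod_monoidal comp_monoidal comp_monoidal))))
       (colax_comp Poly (colax_snd Poly comp_monoidal)
         (colax_snd (prod_cat Poly Poly) (prod_monoidal comp_monoidal comp_monoidal))))
     (colax_tensor Poly tensor_monoidal poly_duoidal (colax_fst Poly comp_monoidal)
       (colax_tensor Poly tensor_monoidal poly_duoidal
         (colax_comp Poly (colax_fst Poly comp_monoidal)
           (colax_snd (prod_cat Poly Poly) (prod_monoidal comp_monoidal comp_monoidal)))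
         (colax_comp Poly (colax_snd Poly comp_monoidal)
           (colax_snd (prod_cat Poly Poly) (prod_monoidal comp_monoidal comp_monoidal)))))
     (\<lambda>(x, y, z). massoc tensor_monoidal x y z)"
  unfolding is_monoidal_nat_trans_def is_nat_trans_def
  by (auto simp: colax_defs hom_Poly tensor_coherence tensor_assoc_interchange tensor_assoc_counit)

lemma tensor_lunit_monoidal:
  "is_monoidal_nat_trans Poly comp_monoidal Poly comp_monoidal
     (colax_tensor Poly tensor_monoidal poly_duoidal
       (colax_comp Poly (unit_colax Poly tensor_monoidal poly_duoidal) colax_bang) (colax_id Poly comp_monoidal))
     (colax_id Poly comp_monoidal) (mlunit tensor_monoidal)"
  unfolding is_monoidal_nat_trans_def is_nat_trans_def
  by (auto simp: colax_defs hom_Poly tensor_coherence tensor_unit_interchange)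

lemma tensor_runit_monoidal:
  "is_monoidal_nat_trans Poly comp_monoidal Poly comp_monoidal
     (colax_tensor Poly tensor_monoidal poly_duoidal (colax_id Poly comp_monoidal)
       (colax_comp Poly (unit_colax Poly tensor_monoidal poly_duoidal) colax_bang))
     (colax_id Poly comp_monoidal) (mrunit tensor_monoidal)"
  unfolding is_monoidal_nat_trans_def is_nat_trans_def
  by (auto simp: colax_defs hom_Poly tensor_coherence tensor_unit_interchange tensor_runit_y_poly)

text \<open>Both monoidal structures have the unit \<open>y_poly\<close>, so normality is
  invertibility of an identity.\<close>

lemma is_iso_poly_id: "exponentiable p \<Longrightarrow> is_iso Poly (poly_id p)"
  unfolding is_iso_def hom_Poly by (auto intro!: bexI[of _ "poly_id p"] simp: hom_Poly)

theorem is_normal_duoidal_Poly: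
  "is_normal_duoidal_category Poly tensor_monoidal comp_monoidal poly_duoidal"
  unfolding is_normal_duoidal_category_def is_duoidal_category_def Let_def
  using is_monoidal_tensor is_monoidal_comp is_colax_tensor is_colax_unit tensor_assoc_monoidal
    tensor_lunit_monoidal tensor_runit_monoidal is_iso_poly_id[OF exponentiable_y_poly]
  by (simp add: poly_duoidal_def)

end

theorem theorem4p5:
  fixes E :: "('o, 'a) category"
  assumes "is_category E"
    and "has_finite_limits E"
  shows "is_functor (prod_cat (polynomials.Poly E) (polynomials.Poly E)) (polynomials.Poly E)
           (mtensor (polynomials.tensor_monoidal E)) \<and>
         is_monoidal_category (polynomials.Poly E) (polynomials.tensor_monoidal E) \<and>
         is_normal_duoidal_category (polynomials.Poly E)
           (polynomials.tensor_monoidal E) (polynomials.comp_monoidal E)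
           (polynomials.poly_duoidal E)"
proof -
  interpret finitely_complete E using assms by unfold_locales
  show ?thesis using is_functor_tensor is_monoidal_tensor is_normal_duoidal_Poly by blast
qed

end
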